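(* Let $\mathbf{k}$ be a non-Archimedean local field which is not of characteristic $2$ and is not an extension of $\mathbb{Q}_2$, and let $n\ge 1$ be an integer. Then the unitary operator $$F= q^{2n}\int_{X_n\times X_n}\Psi\big(\phi(a_1)t_2-\phi(a_2)t_1\big)\,\lambda_{[g_1]^{-1}}\otimes\lambda_{[g_2]^{-1}}\,d[g_1]\,d[g_2],\qquad [g_j]=(a_j,[t_j]),$$ viewed as an element of $W^*(X_n\times X_n)=W^*(X_n)\,\bar\otimes\, W^*(X_n)$, satisfies the $2$-cocycle relation $$(1\otimes F)\,(\mathrm{Id}\otimes\hat\Delta)(F)=(F\otimes 1)\,(\hat\Delta\otimes\mathrm{Id})(F).$$
   Context: Notation: $\mathcal{O}_{\mathbf{k}}$ is the ring of integers of $\mathbf{k}$, $\varpi$ is a generator of its maximal ideal, $q$ is the cardinality of the residue field $\mathcal{O}_{\mathbf{k}}/\varpi\mathcal{O}_{\mathbf{k}}$, and $|\cdot|_{\mathbf{k}}$ is the absolute value normalized by $|\varpi|_{\mathbf{k}}=q^{-1}$. The Haar measure $dt$ on $\mathbf{k}$ is normalized by $\mathrm{Vol}(\mathcal{O}_{\mathbf{k}})=1$. $\Psi$ is a fixed unitary character of the additive group $\mathbf{k}$ that is trivial on $\mathcal{O}_{\mathbf{k}}$ but not on $\varpi^{-1}\mathcal{O}_{\mathbf{k}}$. $U_n:=1+\varpi^n\mathcal{O}_{\mathbf{k}}$ is the multiplicative group of higher principal units, with Haar measure the restriction of $dt$. $\Gamma_n:=\mathbf{k}/\varpi^{-n}\mathcal{O}_{\mathbf{k}}$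 is a discrete abelian group; $[t]$ denotes the class of $t\in\mathbf{k}$. $X_n:=U_n\ltimes\Gamma_n$ is the group with underlying set $U_n\times\Gamma_n$ and law $$(a,[t])\cdot(a',[t'])=(aa',[a'^{-1}t+t']).$$ Its Haar measure $d[g]$ (with $[g]=(a,[t])$) is the product of the Haar measure of $U_n$ and the counting measure of $\Gamma_n$; $X_n$ is unimodular. $\phi:U_n\to\varpi^n\mathcal{O}_{\mathbf{k}}$ is $\phi(a)=a-a^{-1}$. $\lambda$ is the left regular representation of $X_n$: $\lambda_{[g]}f([g'])=f([g]^{-1}[g'])$. $W^*(G)$ denotes the group von Neumann algebra of $G$, generated by the left translations on $L^2(G)$. $\hat\Delta:W^*(X_n)\to W^*(X_n)\bar\otimes W^*(X_n)$ is the coproduct, the normal $*$-homomorphism determined by $\hat\Delta(\lambda_{[g]})=\lambda_{[g]}\otimes\lambda_{[g]}$. The formula for $F$ means: for $f$ in the space $\mathcal{D}(X_n\times X_n)$ of locally constant compactly supported functions, $$Ff([g_1'],[g_2'])=q^{2n}\int_{X_n\times X_n}\Psi\big(\phi(a_1)t_2-\phi(a_2)t_1\big)\,f\big([g_1][g_1'],[g_2][g_2']\big)\,d[g_1]\,d[g_2],$$ and this operator extends (uniquely) to a unitary operator on $L^2(X_n\times X_n)$, still denoted $F$, which belongs to $W^*(X_n\times X_n)$. *)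

theory Defs
  imports
    "HOL-Analysis.Analysis"
    "HOL-Algebra.Group"
    "HOL-Computational_Algebra.Computational_Algebra"
begin

section \<open>Non-Archimedean local fields\<close>

definition val_dist :: "('k::field \<Rightarrow> real) \<Rightarrow> 'k \<Rightarrow> 'k \<Rightarrow> real" where
  "val_dist v x y = v (x - y)"

definition val_topology :: "('k::field \<Rightarrow> real) \<Rightarrow> 'k topology" where
  "val_topology v = Metric_space.mtopology UNIV (val_dist v)"

definition integers_of :: "('k::field \<Rightarrow> real) \<Rightarrow> 'k set" where
  "integers_of v = {x. v x \<le> 1}"

text \<open>The fractional ideal \<open>\<pi>\<^sup>k \<O>\<close> for an integer exponent \<open>k\<close>.\<close>

definition frac_ideal :: "('k::field \<Rightarrow> real) \<Rightarrow> 'k \<Rightarrow> int \<Rightarrow> 'k set" where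
  "frac_ideal v \<pi> k = (\<lambda>x. \<pi> powi k * x) ` integers_of v"

definition residue_field :: "('k::field \<Rightarrow> real) \<Rightarrow> 'k \<Rightarrow> 'k set set" where
  "residue_field v \<pi> = integers_of v //
     {(x, y). x \<in> integers_of v \<and> y \<in> integers_of v \<and> x - y \<in> frac_ideal v \<pi> 1}"

definition residue_card :: "('k::field \<Rightarrow> real) \<Rightarrow> 'k \<Rightarrow> nat" where
  "residue_card v \<pi> = card (residue_field v \<pi>)"

text \<open>
  A field, complete with respect to a discrete non-Archimedean absolute value, with finite
  residue field; \<open>\<pi>\<close> is a uniformizer and \<open>v\<close> is the normalized absolute value.
\<close>

locale nonarch_local_field =
  fixes v :: "'k::field \<Rightarrow> real" and \<pi> :: 'k
  assumes val_nonneg: "0 \<le> v x"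
    and val_eq_0_iff: "v x = 0 \<longleftrightarrow> x = 0"
    and val_mult: "v (x * y) = v x * v y"
    and val_ultrametric: "v (x + y) \<le> max (v x) (v y)"
    and val_complete: "Metric_space.mcomplete UNIV (val_dist v)"
    and uniformizer_nonzero: "\<pi> \<noteq> 0"
    and uniformizer_generates: "{x. v x < 1} = frac_ideal v \<pi> 1"
    and residue_field_finite: "finite (residue_field v \<pi>)"
    and val_normalized: "v \<pi> = 1 / real (residue_card v \<pi>)"

text \<open>The 2-adic absolute value on the rationals, normalized by \<open>|2| = 1/2\<close>.\<close>

definition rat_abs2 :: "rat \<Rightarrow> real" where
  "rat_abs2 x = (if x = 0 then 0 else
     2 powi (int (multiplicity 2 (snd (quotient_of x))) - int (multiplicity 2 (fst (quotient_of x)))))"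

text \<open>
  \<open>\<rat>\<^sub>2\<close> is the completion of \<open>\<rat>\<close> for the 2-adic absolute value. The valued field \<open>('k, v)\<close> is an
  extension of \<open>\<rat>\<^sub>2\<close> if it has a subfield \<open>K\<close> which is such a completion: \<open>K\<close> is complete and
  contains a dense copy of \<open>\<rat>\<close> on which \<open>v\<close> is equivalent to the 2-adic absolute value. A power
  \<open>c\<close> is needed because \<open>v\<close> is normalized on \<open>'k\<close> and not on \<open>\<rat>\<^sub>2\<close>.
\<close>

definition extension_of_Q2 :: "('k::field \<Rightarrow> real) \<Rightarrow> bool" where
  "extension_of_Q2 v \<longleftrightarrow>
     (\<exists>K (\<iota> :: rat \<Rightarrow> 'k) c.
        0 \<in> K \<and> 1 \<in> K \<and> (\<forall>x\<in>K. \<forall>y\<in>K. x - y \<in> K \<and> x * y \<in> K) \<and> (\<forall>x\<in>K. inverse x \<in> K) \<and>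
        \<iota> 1 = 1 \<and> (\<forall>x y. \<iota> (x + y) = \<iota> x + \<iota> y) \<and> (\<forall>x y. \<iota> (x * y) = \<iota> x * \<iota> y) \<and>
        range \<iota> \<subseteq> K \<and> K \<subseteq> val_topology v closure_of range \<iota> \<and>
        Metric_space.mcomplete K (val_dist v) \<and>
        c > 0 \<and> (\<forall>x. v (\<iota> x) = rat_abs2 x powr c))"

definition haar_measure :: "('k::field \<Rightarrow> real) \<Rightarrow> 'k measure \<Rightarrow> bool" where
  "haar_measure v \<mu> \<longleftrightarrow>
     sets \<mu> = sets (sigma UNIV {A. openin (val_topology v) A}) \<and>
     (\<forall>x. \<forall>A\<in>sets \<mu>. emeasure \<mu> ((+) x ` A) = emeasure \<mu> A) \<and>
     emeasure \<mu> (integers_of v) = 1"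

definition unitary_character :: "('k::field \<Rightarrow> real) \<Rightarrow> ('k \<Rightarrow> complex) \<Rightarrow> bool" where
  "unitary_character v \<Psi> \<longleftrightarrow>
     continuous_map (val_topology v) euclidean \<Psi> \<and>
     (\<forall>x. cmod (\<Psi> x) = 1) \<and> (\<forall>x y. \<Psi> (x + y) = \<Psi> x * \<Psi> y)"


section \<open>The groups \<open>X\<^sub>n\<close>\<close>

definition principal_units :: "('k::field \<Rightarrow> real) \<Rightarrow> 'k \<Rightarrow> nat \<Rightarrow> 'k set" where
  "principal_units v \<pi> n = (+) 1 ` frac_ideal v \<pi> (int n)"

definition Gamma_rel :: "('k::field \<Rightarrow> real) \<Rightarrow> 'k \<Rightarrow> nat \<Rightarrow> ('k \<times> 'k) set" where
  "Gamma_rel v \<pi> n = {(s, t). s - t \<in> frac_ideal v \<pi> (- int n)}"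

definition Gamma_quot :: "('k::field \<Rightarrow> real) \<Rightarrow> 'k \<Rightarrow> nat \<Rightarrow> 'k set set" where
  "Gamma_quot v \<pi> n = UNIV // Gamma_rel v \<pi> n"

definition Gamma_cls :: "('k::field \<Rightarrow> real) \<Rightarrow> 'k \<Rightarrow> nat \<Rightarrow> 'k \<Rightarrow> 'k set" where
  "Gamma_cls v \<pi> n t = Gamma_rel v \<pi> n `` {t}"

definition X_group :: "('k::field \<Rightarrow> real) \<Rightarrow> 'k \<Rightarrow> nat \<Rightarrow> ('k \<times> 'k set) monoid" where
  "X_group v \<pi> n =
     \<lparr> carrier = principal_units v \<pi> n \<times> Gamma_quot v \<pi> n,
       mult = (\<lambda>(a, C) (a', C').
         (a * a', \<Union>t\<in>C. \<Union>t'\<in>C'. Gamma_cls v \<pi> n (inverse a' * t + t'))),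
       one = (1, Gamma_cls v \<pi> n 0) \<rparr>"

definition X_measure :: "('k::field \<Rightarrow> real) \<Rightarrow> 'k \<Rightarrow> 'k measure \<Rightarrow> nat \<Rightarrow> ('k \<times> 'k set) measure" where
  "X_measure v \<pi> \<mu> n =
     restrict_space \<mu> (principal_units v \<pi> n) \<Otimes>\<^sub>M count_space (Gamma_quot v \<pi> n)"

definition X_topology :: "('k::field \<Rightarrow> real) \<Rightarrow> 'k \<Rightarrow> nat \<Rightarrow> ('k \<times> 'k set) topology" where
  "X_topology v \<pi> n =
     prod_topology (subtopology (val_topology v) (principal_units v \<pi> n))
       (discrete_topology (Gamma_quot v \<pi> n))"

definition phi :: "'k::field \<Rightarrow> 'k" where
  "phi a = a - inverse a"

text \<open>
  The integrand \<open>\<Psi>(\<phi>(a\<^sub>1)t\<^sub>2 - \<phi>(a\<^sub>2)t\<^sub>1)\<close> does not depend on the representatives \<open>t\<^sub>1\<close> and \<open>t\<^sub>2\<close>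
  (see \<open>twist_kernel_class\<close> below), so the set of its values is a singleton.
\<close>

definition twist_kernel ::
  "('k::field \<Rightarrow> complex) \<Rightarrow> ('k \<times> 'k set) \<times> ('k \<times> 'k set) \<Rightarrow> complex" where
  "twist_kernel \<Psi> = (\<lambda>((a1, C1), (a2, C2)).
     the_elem ((\<lambda>(t1, t2). \<Psi> (phi a1 * t2 - phi a2 * t1)) ` (C1 \<times> C2)))"


section \<open>Operators on \<open>L\<^sup>2\<close>\<close>

text \<open>
  Elements of \<open>L\<^sup>2(M)\<close> are represented by square-integrable functions, and an operator by a map
  between such functions; equality in \<open>L\<^sup>2(M)\<close> is equality almost everywhere, and \<open>op_eq\<close> is the
  corresponding equality of operators. A linear bounded map in the sense of \<open>bounded_ops\<close> sends
  almost everywhere equal functions to almost everywhere equal functions.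
\<close>

definition L2 :: "'x measure \<Rightarrow> ('x \<Rightarrow> complex) set" where
  "L2 M = {f \<in> borel_measurable M. integrable M (\<lambda>x. (cmod (f x))\<^sup>2)}"

definition L2_inner :: "'x measure \<Rightarrow> ('x \<Rightarrow> complex) \<Rightarrow> ('x \<Rightarrow> complex) \<Rightarrow> complex" where
  "L2_inner M f g = (\<integral>x. f x * cnj (g x) \<partial>M)"

definition L2_norm :: "'x measure \<Rightarrow> ('x \<Rightarrow> complex) \<Rightarrow> real" where
  "L2_norm M f = sqrt (\<integral>x. (cmod (f x))\<^sup>2 \<partial>M)"

type_synonym 'x op = "('x \<Rightarrow> complex) \<Rightarrow> 'x \<Rightarrow> complex"

definition bounded_ops :: "'x measure \<Rightarrow> 'x op set" where
  "bounded_ops M = {T.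
     (\<forall>f\<in>L2 M. T f \<in> L2 M) \<and>
     (\<forall>f\<in>L2 M. \<forall>g\<in>L2 M. AE x in M. T (\<lambda>y. f y + g y) x = T f x + T g x) \<and>
     (\<forall>c. \<forall>f\<in>L2 M. AE x in M. T (\<lambda>y. c * f y) x = c * T f x) \<and>
     (\<exists>K. \<forall>f\<in>L2 M. L2_norm M (T f) \<le> K * L2_norm M f)}"

definition op_eq :: "'x measure \<Rightarrow> 'x op \<Rightarrow> 'x op \<Rightarrow> bool" where
  "op_eq M S T \<longleftrightarrow> (\<forall>f\<in>L2 M. AE x in M. S f x = T f x)"

definition op_add :: "'x op \<Rightarrow> 'x op \<Rightarrow> 'x op" where
  "op_add S T = (\<lambda>f x. S f x + T f x)"

definition op_scale :: "complex \<Rightarrow> 'x op \<Rightarrow> 'x op" where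
  "op_scale c T = (\<lambda>f x. c * T f x)"

definition is_adjoint :: "'x measure \<Rightarrow> 'x op \<Rightarrow> 'x op \<Rightarrow> bool" where
  "is_adjoint M T S \<longleftrightarrow> (\<forall>f\<in>L2 M. \<forall>g\<in>L2 M. L2_inner M (T f) g = L2_inner M f (S g))"

definition unitary_op :: "'x measure \<Rightarrow> 'x op \<Rightarrow> bool" where
  "unitary_op M T \<longleftrightarrow> T \<in> bounded_ops M \<and>
     (\<exists>S\<in>bounded_ops M. is_adjoint M T S \<and> op_eq M (S \<circ> T) id \<and> op_eq M (T \<circ> S) id)"

text \<open>
  The \<open>\<sigma>\<close>-weak (ultraweak) topology: the initial topology of the functionals
  \<open>T \<mapsto> \<Sum>i. \<langle>T \<xi>\<^sub>i, \<eta>\<^sub>i\<rangle>\<close> with square-summable sequences of vectors \<open>\<xi>\<close> and \<open>\<eta>\<close>.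
\<close>

definition l2_sequence :: "'x measure \<Rightarrow> (nat \<Rightarrow> 'x \<Rightarrow> complex) \<Rightarrow> bool" where
  "l2_sequence M \<xi> \<longleftrightarrow> (\<forall>i. \<xi> i \<in> L2 M) \<and> summable (\<lambda>i. (L2_norm M (\<xi> i))\<^sup>2)"

definition sigma_weak_topology :: "'x measure \<Rightarrow> 'x op topology" where
  "sigma_weak_topology M = topology_generated_by
     {{T \<in> bounded_ops M. (\<Sum>i. L2_inner M (T (\<xi> i)) (\<eta> i)) \<in> U} |\<xi> \<eta> U.
        l2_sequence M \<xi> \<and> l2_sequence M \<eta> \<and> open U}"

text \<open>
  A von Neumann algebra is a unital \<open>*\<close>-algebra of bounded operators which is closed in the
  \<open>\<sigma>\<close>-weak (equivalently, weak or strong operator) topology. Closedness makes it invariant under \<open>op_eq\<close>, which is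
  indistinguishability in this topology.
\<close>

definition von_neumann_algebra :: "'x measure \<Rightarrow> 'x op set \<Rightarrow> bool" where
  "von_neumann_algebra M A \<longleftrightarrow>
     A \<subseteq> bounded_ops M \<and> id \<in> A \<and>
     (\<forall>S\<in>A. \<forall>T\<in>A. op_add S T \<in> A \<and> S \<circ> T \<in> A) \<and>
     (\<forall>c. \<forall>T\<in>A. op_scale c T \<in> A) \<and>
     (\<forall>T\<in>A. \<forall>S\<in>bounded_ops M. is_adjoint M T S \<longrightarrow> S \<in> A) \<and>
     closedin (sigma_weak_topology M) A"

definition vn_generated :: "'x measure \<Rightarrow> 'x op set \<Rightarrow> 'x op set" where
  "vn_generated M B = \<Inter>{A. von_neumann_algebra M A \<and> B \<subseteq> A}"

definition normal_star_hom ::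
  "'x measure \<Rightarrow> 'x op set \<Rightarrow> 'y measure \<Rightarrow> 'y op set \<Rightarrow> ('x op \<Rightarrow> 'y op) \<Rightarrow> bool" where
  "normal_star_hom M A N B \<Theta> \<longleftrightarrow>
     (\<forall>T\<in>A. \<Theta> T \<in> B) \<and>
     (\<forall>S\<in>A. \<forall>T\<in>A. op_eq N (\<Theta> (op_add S T)) (op_add (\<Theta> S) (\<Theta> T))) \<and>
     (\<forall>c. \<forall>T\<in>A. op_eq N (\<Theta> (op_scale c T)) (op_scale c (\<Theta> T))) \<and>
     (\<forall>S\<in>A. \<forall>T\<in>A. op_eq N (\<Theta> (S \<circ> T)) (\<Theta> S \<circ> \<Theta> T)) \<and>
     (\<forall>S\<in>A. \<forall>T\<in>A. is_adjoint M T S \<longrightarrow> is_adjoint N (\<Theta> T) (\<Theta> S)) \<and>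
     continuous_map (subtopology (sigma_weak_topology M) A)
       (subtopology (sigma_weak_topology N) B) \<Theta>"

text \<open>
  \<open>S \<otimes> T\<close> is the bounded operator determined (up to \<open>op_eq\<close>) by
  \<open>(S \<otimes> T)(f \<otimes> g) = S f \<otimes> T g\<close>.
\<close>

definition op_tensor :: "'x measure \<Rightarrow> 'y measure \<Rightarrow> 'x op \<Rightarrow> 'y op \<Rightarrow> ('x \<times> 'y) op" where
  "op_tensor M N S T = (SOME R. R \<in> bounded_ops (M \<Otimes>\<^sub>M N) \<and>
     (\<forall>f\<in>L2 M. \<forall>g\<in>L2 N. AE z in M \<Otimes>\<^sub>M N.
        R (\<lambda>(x, y). f x * g y) z = S f (fst z) * T g (snd z)))"

definition vn_tensor ::
  "'x measure \<Rightarrow> 'x op set \<Rightarrow> 'y measure \<Rightarrow> 'y op set \<Rightarrow> ('x \<times> 'y) op set" where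
  "vn_tensor M A N B = vn_generated (M \<Otimes>\<^sub>M N) {op_tensor M N S T |S T. S \<in> A \<and> T \<in> B}"

text \<open>
  \<open>\<Phi>\<close> is \<open>\<Theta>\<^sub>1 \<otimes> \<Theta>\<^sub>2\<close>, for normal \<open>*\<close>-homomorphisms \<open>\<Theta>\<^sub>i\<close> from the von Neumann algebra \<open>A\<^sub>i\<close>
  on \<open>L\<^sup>2(M\<^sub>i)\<close> to \<open>B\<^sub>i\<close> on \<open>L\<^sup>2(N\<^sub>i)\<close>.
\<close>

definition is_hom_tensor ::
  "'x measure \<Rightarrow> 'x op set \<Rightarrow> 'y measure \<Rightarrow> 'y op set \<Rightarrow> ('x op \<Rightarrow> 'y op) \<Rightarrow>
   'z measure \<Rightarrow> 'z op set \<Rightarrow> 'w measure \<Rightarrow> 'w op set \<Rightarrow> ('z op \<Rightarrow> 'w op) \<Rightarrow>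
   (('x \<times> 'z) op \<Rightarrow> ('y \<times> 'w) op) \<Rightarrow> bool" where
  "is_hom_tensor M1 A1 N1 B1 \<Theta>1 M2 A2 N2 B2 \<Theta>2 \<Phi> \<longleftrightarrow>
     normal_star_hom (M1 \<Otimes>\<^sub>M M2) (vn_tensor M1 A1 M2 A2) (N1 \<Otimes>\<^sub>M N2) (vn_tensor N1 B1 N2 B2) \<Phi> \<and>
     (\<forall>S\<in>A1. \<forall>T\<in>A2.
        op_eq (N1 \<Otimes>\<^sub>M N2) (\<Phi> (op_tensor M1 M2 S T)) (op_tensor N1 N2 (\<Theta>1 S) (\<Theta>2 T)))"

text \<open>Transport of operators along \<open>(X \<times> Y) \<times> Z \<cong> X \<times> (Y \<times> Z)\<close>.\<close>

definition op_assoc :: "(('x \<times> 'y) \<times> 'z) op \<Rightarrow> ('x \<times> ('y \<times> 'z)) op" where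
  "op_assoc R = (\<lambda>f (x, y, z). R (\<lambda>((x', y'), z'). f (x', y', z')) ((x, y), z))"


section \<open>Group von Neumann algebras\<close>

text \<open>In this section \<open>M\<close> stands for a Haar measure of the locally compact group \<open>G\<close>.\<close>

definition left_regular :: "('g, 'm) monoid_scheme \<Rightarrow> 'g \<Rightarrow> 'g op" where
  "left_regular G g = (\<lambda>f x. f (inv\<^bsub>G\<^esub> g \<otimes>\<^bsub>G\<^esub> x))"

definition group_vn :: "('g, 'm) monoid_scheme \<Rightarrow> 'g measure \<Rightarrow> 'g op set" where
  "group_vn G M = vn_generated M (left_regular G ` carrier G)"

definition is_coproduct ::
  "('g, 'm) monoid_scheme \<Rightarrow> 'g measure \<Rightarrow> ('g op \<Rightarrow> ('g \<times> 'g) op) \<Rightarrow> bool" where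
  "is_coproduct G M \<Delta> \<longleftrightarrow>
     normal_star_hom M (group_vn G M) (M \<Otimes>\<^sub>M M) (vn_tensor M (group_vn G M) M (group_vn G M)) \<Delta> \<and>
     (\<forall>g\<in>carrier G. op_eq (M \<Otimes>\<^sub>M M) (\<Delta> (left_regular G g))
        (op_tensor M M (left_regular G g) (left_regular G g)))"

text \<open>
  Locally constant functions with compact support; values outside of the space are irrelevant.
\<close>

definition test_functions :: "'x topology \<Rightarrow> ('x \<Rightarrow> complex) set" where
  "test_functions T = {f.
     (\<forall>x\<in>topspace T. \<exists>U. openin T U \<and> x \<in> U \<and> (\<forall>y\<in>U. f y = f x)) \<and>
     (\<exists>K. compactin T K \<and> (\<forall>x\<in>topspace T - K. f x = 0))}"

text \<open>The unitary operator \<open>F\<close> in \<open>W\<^sup>*(X\<^sub>n \<times> X\<^sub>n)\<close> extending the integral formula.\<close>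

definition is_twist ::
  "('k::field \<Rightarrow> real) \<Rightarrow> 'k \<Rightarrow> 'k measure \<Rightarrow> ('k \<Rightarrow> complex) \<Rightarrow> nat \<Rightarrow>
   (('k \<times> 'k set) \<times> ('k \<times> 'k set)) op \<Rightarrow> bool" where
  "is_twist v \<pi> \<mu> \<Psi> n F \<longleftrightarrow>
     (let X = X_group v \<pi> n; M = X_measure v \<pi> \<mu> n; T = X_topology v \<pi> n in
      unitary_op (M \<Otimes>\<^sub>M M) F \<and> F \<in> group_vn (X \<times>\<times> X) (M \<Otimes>\<^sub>M M) \<and>
      (\<forall>f\<in>test_functions (prod_topology T T). AE g' in M \<Otimes>\<^sub>M M.
         F f g' = of_nat (residue_card v \<pi>) ^ (2 * n) *
           (\<integral>g. twist_kernel \<Psi> g * f (fst g \<otimes>\<^bsub>X\<^esub> fst g', snd g \<otimes>\<^bsub>X\<^esub> snd g') \<partial>(M \<Otimes>\<^sub>M M))))"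


section \<open>Independence of representatives\<close>

context nonarch_local_field
begin

lemma val_1: "v 1 = 1"
proof -
  have "v 1 * v 1 = v 1" "v 1 \<noteq> 0" using val_mult[of 1 1] val_eq_0_iff[of 1] by auto
  then show ?thesis by simp
qed

lemma val_minus: "v (- x) = v x"
proof -
  have "v (-1) * v (-1) = 1" using val_mult[of "-1" "-1"] val_1 by simp
  then have "(v (-1))\<^sup>2 = 1" by (simp add: power2_eq_square)
  then have "v (-1) = 1" using val_nonneg[of "-1"] by (auto simp: power2_eq_1_iff)
  then show ?thesis using val_mult[of "-1" x] by simp
qed

lemma val_diff: "v (x - y) \<le> max (v x) (v y)"
  using val_ultrametric[of x "- y"] by (simp add: val_minus)

lemma val_power_int: "v (\<pi> powi k) = v \<pi> powi k"
proof -
  have inv: "v (inverse x) = inverse (v x)" if "x \<noteq> 0" for x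
    using val_mult[of x "inverse x"] that val_1 val_eq_0_iff[of x]
    by (simp add: field_simps)
  have pow: "v (x ^ m) = v x ^ m" for x m
    by (induction m) (auto simp: val_1 val_mult)
  show ?thesis using inv[of "\<pi>"] uniformizer_nonzero by (auto simp: power_int_def pow)
qed

lemma frac_ideal_eq: "frac_ideal v \<pi> k = {x. v x \<le> v \<pi> powi k}"
proof -
  have pos: "v \<pi> powi k > 0"
    using uniformizer_nonzero val_nonneg[of \<pi>] val_eq_0_iff[of \<pi>] by (simp add: order_less_le)
  have nz: "\<pi> powi k \<noteq> 0" using uniformizer_nonzero by simp
  show ?thesis
  proof (rule subset_antisym; rule subsetI)
    fix x assume "x \<in> frac_ideal v \<pi> k"
    then show "x \<in> {x. v x \<le> v \<pi> powi k}"
      using pos by (auto simp: frac_ideal_def integers_of_def val_mult val_power_int)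
  next
    fix x assume "x \<in> {x. v x \<le> v \<pi> powi k}"
    then have x: "v x \<le> v \<pi> powi k" by simp
    define y where "y = x / \<pi> powi k"
    have xy: "x = \<pi> powi k * y" using nz by (simp add: y_def)
    then have "v \<pi> powi k * v y \<le> v \<pi> powi k * 1" using x by (simp add: val_mult val_power_int)
    then have "v y \<le> 1" using pos by (simp only: mult_le_cancel_left_pos)
    then show "x \<in> frac_ideal v \<pi> k" using xy by (auto simp: frac_ideal_def integers_of_def)
  qed
qed

lemma val_uniformizer_less_1: "v \<pi> < 1"
  using uniformizer_generates uniformizer_nonzero
  by (auto simp: frac_ideal_eq set_eq_iff)

lemma val_principal_unit:
  assumes "n \<ge> 1" "a \<in> principal_units v \<pi> n"
  shows "v a = 1"
proof -
  obtain y where y: "a = 1 + y" "v y \<le> v \<pi> ^ n"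
    using assms by (auto simp: principal_units_def frac_ideal_eq)
  have "v \<pi> ^ n \<le> v \<pi> ^ 1"
    using assms val_nonneg val_uniformizer_less_1 by (intro power_decreasing) auto
  then have "v y < 1" using y val_uniformizer_less_1 by simp
  moreover have "v a \<le> max 1 (v y)" using val_ultrametric[of 1 y] y val_1 by simp
  moreover have "1 \<le> max (v a) (v y)" using val_diff[of a y] y val_1 by simp
  ultimately show ?thesis by (auto simp: max_def split: if_splits)
qed

lemma equiv_Gamma_rel: "equiv UNIV (Gamma_rel v \<pi> n)"
proof (rule equivI)
  have pos: "v \<pi> powi (- int n) \<ge> 0" using val_nonneg by simp
  show "refl (Gamma_rel v \<pi> n)"
    using pos val_eq_0_iff[of 0] by (auto simp: refl_on_def Gamma_rel_def frac_ideal_eq)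
  show "sym (Gamma_rel v \<pi> n)"
  proof (rule symI)
    fix x y assume "(x, y) \<in> Gamma_rel v \<pi> n"
    then show "(y, x) \<in> Gamma_rel v \<pi> n"
      using val_minus[of "x - y"] by (simp add: Gamma_rel_def frac_ideal_eq)
  qed
  show "trans (Gamma_rel v \<pi> n)"
  proof (rule transI)
    fix x y z assume "(x, y) \<in> Gamma_rel v \<pi> n" "(y, z) \<in> Gamma_rel v \<pi> n"
    then show "(x, z) \<in> Gamma_rel v \<pi> n"
      using val_ultrametric[of "x - y" "y - z"] by (auto simp: Gamma_rel_def frac_ideal_eq)
  qed
qed auto

lemma X_mult_class:
  assumes "n \<ge> 1" "a' \<in> principal_units v \<pi> n"
  shows "(a, Gamma_cls v \<pi> n t) \<otimes>\<^bsub>X_group v \<pi> n\<^esub> (a', Gamma_cls v \<pi> n t') =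
           (a * a', Gamma_cls v \<pi> n (inverse a' * t + t'))"
proof -
  have va: "v (inverse a') = 1"
    using val_principal_unit[OF assms] val_mult[of a' "inverse a'"] val_1 val_eq_0_iff[of a']
    by (cases "a' = 0") auto
  have "congruent2 (Gamma_rel v \<pi> n) (Gamma_rel v \<pi> n)
          (\<lambda>t t'. Gamma_cls v \<pi> n (inverse a' * t + t'))"
  proof (rule congruent2I')
    fix s1 s2 t1 t2
    assume *: "(s1, s2) \<in> Gamma_rel v \<pi> n" "(t1, t2) \<in> Gamma_rel v \<pi> n"
    have eq: "inverse a' * s1 + t1 - (inverse a' * s2 + t2) = inverse a' * (s1 - s2) + (t1 - t2)"
      by (simp add: algebra_simps)
    have "(inverse a' * s1 + t1, inverse a' * s2 + t2) \<in> Gamma_rel v \<pi> n"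
      using * val_ultrametric[of "inverse a' * (s1 - s2)" "t1 - t2"]
      by (auto simp: Gamma_rel_def frac_ideal_eq eq val_mult va)
    then show "Gamma_cls v \<pi> n (inverse a' * s1 + t1) = Gamma_cls v \<pi> n (inverse a' * s2 + t2)"
      unfolding Gamma_cls_def by (rule equiv_class_eq[OF equiv_Gamma_rel])
  qed
  from UN_equiv_class2[OF equiv_Gamma_rel equiv_Gamma_rel this]
  show ?thesis by (simp add: X_group_def Gamma_cls_def)
qed

lemma twist_kernel_class:
  assumes "n \<ge> 1" "a1 \<in> principal_units v \<pi> n" "a2 \<in> principal_units v \<pi> n"
    and "unitary_character v \<Psi>" "\<forall>x\<in>integers_of v. \<Psi> x = 1"
  shows "twist_kernel \<Psi> ((a1, Gamma_cls v \<pi> n t1), (a2, Gamma_cls v \<pi> n t2)) =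
           \<Psi> (phi a1 * t2 - phi a2 * t1)"
proof -
  have pos: "v \<pi> > 0" using uniformizer_nonzero val_nonneg[of \<pi>] val_eq_0_iff[of \<pi>]
    by (simp add: order_less_le)
  have phi: "v (phi a) \<le> v \<pi> powi (int n)" if a: "a \<in> principal_units v \<pi> n" for a
  proof -
    have va: "v a = 1" by (rule val_principal_unit[OF assms(1) a])
    then have nz: "a \<noteq> 0" using val_eq_0_iff[of a] by auto
    obtain y where y: "a = 1 + y" "v y \<le> v \<pi> ^ n"
      using a by (auto simp: principal_units_def frac_ideal_eq)
    have "a * phi a = a * a - 1" using nz by (simp add: phi_def right_diff_distrib)
    also have "\<dots> = y * (a + 1)" using y by (simp add: algebra_simps)
    finally have "v (phi a) = v y * v (a + 1)" using va by (metis mult_1 val_mult)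
    moreover have "v (a + 1) \<le> 1" using val_ultrametric[of a 1] va val_1 by simp
    ultimately have "v (phi a) \<le> v y" using val_nonneg by (simp add: mult_left_le)
    then show ?thesis using y by simp
  qed
  have int: "v (phi a * d) \<le> 1" if "a \<in> principal_units v \<pi> n" "v d \<le> v \<pi> powi (- int n)" for a d
  proof -
    have "v (phi a * d) \<le> v \<pi> powi (int n) * v \<pi> powi (- int n)"
      unfolding val_mult using phi[OF that(1)] that(2) val_nonneg by (intro mult_mono) auto
    also have "\<dots> = 1" using pos by (simp add: power_int_minus)
    finally show ?thesis .
  qed
  have "\<Psi> (phi a1 * s2 - phi a2 * s1) = \<Psi> (phi a1 * t2 - phi a2 * t1)"
    if s: "s1 \<in> Gamma_cls v \<pi> n t1" "s2 \<in> Gamma_cls v \<pi> n t2" for s1 s2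
  proof -
    have d: "v (t1 - s1) \<le> v \<pi> powi (- int n)" "v (t2 - s2) \<le> v \<pi> powi (- int n)"
      using s by (auto simp: Gamma_cls_def Gamma_rel_def frac_ideal_eq)
    have "v (phi a1 * (t2 - s2) - phi a2 * (t1 - s1)) \<le> 1"
      using val_diff[of "phi a1 * (t2 - s2)" "phi a2 * (t1 - s1)"]
        int[OF assms(2) d(2)] int[OF assms(3) d(1)] by simp
    then have "\<Psi> (phi a1 * (t2 - s2) - phi a2 * (t1 - s1)) = 1"
      using assms(5) by (simp add: integers_of_def)
    moreover have "phi a1 * t2 - phi a2 * t1 =
        (phi a1 * (t2 - s2) - phi a2 * (t1 - s1)) + (phi a1 * s2 - phi a2 * s1)"
      by (simp add: algebra_simps)
    ultimately show ?thesis using assms(4) by (simp add: unitary_character_def)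
  qed
  moreover have "t \<in> Gamma_cls v \<pi> n t" for t
    unfolding Gamma_cls_def by (rule equiv_class_self[OF equiv_Gamma_rel]) simp
  ultimately have "(\<lambda>(s1, s2). \<Psi> (phi a1 * s2 - phi a2 * s1)) `
      (Gamma_cls v \<pi> n t1 \<times> Gamma_cls v \<pi> n t2) = {\<Psi> (phi a1 * t2 - phi a2 * t1)}"
    (is "?f ` ?C = {?z}")
  proof -
    assume const: "\<And>s1 s2. s1 \<in> Gamma_cls v \<pi> n t1 \<Longrightarrow> s2 \<in> Gamma_cls v \<pi> n t2 \<Longrightarrow>
        \<Psi> (phi a1 * s2 - phi a2 * s1) = ?z" and self: "\<And>t. t \<in> Gamma_cls v \<pi> n t"
    have "?f x \<in> {?z}" if "x \<in> ?C" for x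
    proof (cases x)
      case (Pair s1 s2)
      then show ?thesis using that const[of s1 s2] by simp
    qed
    then have "?f ` ?C \<subseteq> {?z}" by (rule image_subsetI)
    moreover have "?z \<in> ?f ` ?C" using self by (intro image_eqI[of _ _ "(t1, t2)"]) simp_all
    ultimately show "?f ` ?C = {?z}" by (intro subset_antisym) simp_all
  qed
  then show ?thesis by (simp add: twist_kernel_def)
qed

end

end

theory Submission imports Defs begin

text \<open>
  On indicators of products of small balls \<open>F\<close> is given by an explicit kernel (\<open>kappa\<close>), because
  integrating \<open>\<Psi>(\<phi>(a)t)\<close> over a ball of radius \<open>|\<pi>|\<^sup>N\<close> cuts \<open>t\<close> off at \<open>|t| \<le> |\<pi>|\<^sup>-\<^sup>N\<close>; here \<open>\<phi>\<close> is
  an isometry since 2 is a unit. On \<open>\<lambda>\<^sub>g \<otimes> \<lambda>\<^sub>h\<close> the maps \<open>id \<otimes> \<Delta>\<close> and \<open>\<Delta> \<otimes> id\<close> are explicit, and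
  normality carries their matrix coefficients over to \<open>F\<close>, which is a \<open>\<sigma>\<close>-weak limit of linear
  combinations of such operators. Evaluated on products of three balls, the relation then becomes an
  identity between finite sums of characters, which follows from \<open>\<phi>(ab) = \<phi>(a)/b + a\<phi>(b)\<close>.
\<close>

section \<open>Square-integrable functions\<close>

text \<open>Two obstacles shape the argument. The integral formula describes F only on test
  functions, while \<open>id_\<Delta>\<close> and \<open>\<Delta>_id\<close> are known only on
  elementary tensors and through their continuity, so neither description can be inserted into the
  other. Moreover a coefficient of lambda_g (x) lambda_h (x) lambda_h contains h twice and is not
  visibly a coefficient of lambda_g (x) lambda_h, whereas only an identity between a coefficient of
  T and one of its image, linear and continuous in T, survives the passage to the limit F. On balls
  the doubling can be undone: a point in the translate of one ball reveals the ball containing the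
  translating element, and this already fixes the translate of the other ball. Right translations
  preserve balls of every radius, left translations only if the class of the translating element is
  bounded in terms of the radius. The cut-off in \<open>kappa\<close> therefore serves twice: it
  makes the sums finite, and it keeps the second application of F on indicators of balls. Operators
  act on functions instead of classes, so algebraic laws hold almost everywhere only.\<close>

lemma L2_measurable [measurable_dest]: "f \<in> L2 M \<Longrightarrow> f \<in> borel_measurable M"
  by (simp add: L2_def)

lemma L2_integrable_sq: "f \<in> L2 M \<Longrightarrow> integrable M (\<lambda>x. (cmod (f x))\<^sup>2)"
  by (simp add: L2_def)

lemma L2_bound:
  assumes "f \<in> borel_measurable M" "integrable M h" "AE x in M. (cmod (f x))\<^sup>2 \<le> h x"
  shows "f \<in> L2 M"
proof -
  have "integrable M (\<lambda>x. (cmod (f x))\<^sup>2)"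
    by (rule Bochner_Integration.integrable_bound[OF assms(2)])
       (use assms in \<open>auto elim!: eventually_mono\<close>)
  then show ?thesis using assms(1) by (simp add: L2_def)
qed

lemma borel_measurable_cnj [measurable (raw)]:
  "f \<in> borel_measurable M \<Longrightarrow> (\<lambda>x. cnj (f x)) \<in> borel_measurable M"
  by (rule borel_measurable_continuous_on[of cnj]) (auto intro!: continuous_intros)

lemma L2_zero [simp]: "(\<lambda>x. 0) \<in> L2 M"
  by (simp add: L2_def)

lemma L2_scale [intro]: "f \<in> L2 M \<Longrightarrow> (\<lambda>x. c * f x) \<in> L2 M"
  by (auto simp: L2_def norm_mult power_mult_distrib)

lemma cmod_add_sq_le: "(cmod (a + b))\<^sup>2 \<le> 2 * (cmod a)\<^sup>2 + 2 * (cmod b)\<^sup>2"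
proof -
  have "(cmod (a + b))\<^sup>2 \<le> (cmod a + cmod b)\<^sup>2"
    by (intro power_mono norm_triangle_ineq) simp
  also have "\<dots> \<le> 2 * (cmod a)\<^sup>2 + 2 * (cmod b)\<^sup>2"
    using zero_le_power2[of "cmod a - cmod b"] by (simp add: power2_eq_square algebra_simps)
  finally show ?thesis .
qed

lemma L2_add [intro]:
  assumes "f \<in> L2 M" "g \<in> L2 M" shows "(\<lambda>x. f x + g x) \<in> L2 M"
proof (rule L2_bound)
  show "integrable M (\<lambda>x. 2 * (cmod (f x))\<^sup>2 + 2 * (cmod (g x))\<^sup>2)"
    using assms by (auto simp: L2_def)
qed (use assms in \<open>auto simp: cmod_add_sq_le L2_def\<close>)

lemma L2_minus [intro]: "f \<in> L2 M \<Longrightarrow> (\<lambda>x. - f x) \<in> L2 M"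
  using L2_scale[of f M "-1"] by simp

lemma L2_diff [intro]:
  assumes "f \<in> L2 M" "g \<in> L2 M" shows "(\<lambda>x. f x - g x) \<in> L2 M"
  using L2_add[OF assms(1) L2_minus[OF assms(2)]] by simp

lemma L2_sum [intro]:
  assumes "\<And>i. i \<in> I \<Longrightarrow> f i \<in> L2 M" shows "(\<lambda>x. \<Sum>i\<in>I. f i x) \<in> L2 M"
  using assms by (induction I rule: infinite_finite_induct) auto

lemma L2_cong_AE:
  assumes "f \<in> L2 M" "g \<in> borel_measurable M" "AE x in M. f x = g x"
  shows "g \<in> L2 M"
  by (rule L2_bound[OF assms(2) L2_integrable_sq[OF assms(1)]]) (use assms(3) in auto)

lemma L2_indicator:
  assumes "A \<in> sets M" "emeasure M A < \<infinity>"
  shows "(\<lambda>x. indicator A x) \<in> L2 M"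
proof -
  have eq: "(\<lambda>x. (cmod (indicator A x :: complex))\<^sup>2) = (indicator A :: _ \<Rightarrow> real)"
    by (auto simp: indicator_def)
  have "integrable M (indicator A :: _ \<Rightarrow> real)" using assms by simp
  then show ?thesis using assms(1) unfolding L2_def eq[symmetric] by simp
qed

lemma L2_norm_nonneg [simp]: "0 \<le> L2_norm M f"
  by (simp add: L2_norm_def)

lemma L2_norm_sq: "(L2_norm M f)\<^sup>2 = (\<integral>x. (cmod (f x))\<^sup>2 \<partial>M)"
  by (simp add: L2_norm_def)

lemma L2_norm_cong_AE:
  assumes "AE x in M. f x = g x" "f \<in> borel_measurable M" "g \<in> borel_measurable M"
  shows "L2_norm M f = L2_norm M g"
  unfolding L2_norm_def by (rule arg_cong[where f=sqrt], rule integral_cong_AE) (use assms in auto)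

lemma L2_norm_scale: "L2_norm M (\<lambda>x. c * f x) = cmod c * L2_norm M f"
  by (simp add: L2_norm_def norm_mult power_mult_distrib real_sqrt_mult)

lemma L2_norm_minus_commute: "L2_norm M (\<lambda>x. f x - g x) = L2_norm M (\<lambda>x. g x - f x)"
  by (simp add: L2_norm_def norm_minus_commute)

lemma L2_norm_zero [simp]: "L2_norm M (\<lambda>x. 0) = 0"
  by (simp add: L2_norm_def)

lemma L2_norm_eq_0:
  assumes "f \<in> L2 M" "L2_norm M f = 0" shows "AE x in M. f x = 0"
proof -
  have "(\<integral>x. (cmod (f x))\<^sup>2 \<partial>M) = 0" using assms(2) L2_norm_sq[of M f] by simp
  then have "AE x in M. (cmod (f x))\<^sup>2 = 0"
    using integral_nonneg_eq_0_iff_AE[OF L2_integrable_sq[OF assms(1)]] by simp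
  then show ?thesis by simp
qed

lemma nn_integral_L2:
  assumes "f \<in> L2 M"
  shows "(\<integral>\<^sup>+x. ennreal ((cmod (f x))\<^sup>2) \<partial>M) = ennreal ((L2_norm M f)\<^sup>2)"
  using nn_integral_eq_integral[OF L2_integrable_sq[OF assms]] by (simp add: L2_norm_sq)

text \<open>The bound is on an extended-valued integral. A bound on \<open>L2_norm\<close> alone
  would prove nothing, because a non-integrable square has Bochner integral 0.\<close>

lemma L2I_nn:
  assumes "f \<in> borel_measurable M" "(\<integral>\<^sup>+x. ennreal ((cmod (f x))\<^sup>2) \<partial>M) \<le> ennreal (C\<^sup>2)"
  shows "f \<in> L2 M" and "0 \<le> C \<Longrightarrow> L2_norm M f \<le> C"
proof -
  have "integrable M (\<lambda>x. (cmod (f x))\<^sup>2)"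
    using assms by (intro integrableI_bounded) (auto intro: le_less_trans)
  then show *: "f \<in> L2 M" using assms(1) by (simp add: L2_def)
  assume C: "0 \<le> C"
  have "(L2_norm M f)\<^sup>2 \<le> C\<^sup>2"
    using assms(2) nn_integral_L2[OF *] by simp
  then show "L2_norm M f \<le> C" using C by (simp add: power2_le_iff_abs_le)
qed

lemma integrable_L2_mult:
  assumes "f \<in> L2 M" "g \<in> L2 M" shows "integrable M (\<lambda>x. f x * g x)"
proof (rule Bochner_Integration.integrable_bound)
  show "integrable M (\<lambda>x. (cmod (f x))\<^sup>2 + (cmod (g x))\<^sup>2)"
    using assms by (auto simp: L2_def)
  show "AE x in M. cmod (f x * g x) \<le> norm ((cmod (f x))\<^sup>2 + (cmod (g x))\<^sup>2)"
  proof (rule AE_I2)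
    fix x
    have "0 \<le> (cmod (f x) - cmod (g x))\<^sup>2" "0 \<le> (cmod (f x))\<^sup>2" "0 \<le> (cmod (g x))\<^sup>2" by auto
    then show "cmod (f x * g x) \<le> norm ((cmod (f x))\<^sup>2 + (cmod (g x))\<^sup>2)"
      unfolding power2_diff norm_mult real_norm_def by linarith
  qed
qed (use assms in \<open>auto simp: L2_def\<close>)

lemma L2_cnj: "f \<in> L2 M \<Longrightarrow> (\<lambda>x. cnj (f x)) \<in> L2 M"
  by (auto simp: L2_def)

lemma integrable_L2_inner:
  "f \<in> L2 M \<Longrightarrow> g \<in> L2 M \<Longrightarrow> integrable M (\<lambda>x. f x * cnj (g x))"
  using integrable_L2_mult[OF _ L2_cnj] .

lemma L2_inner_add_left:
  "f \<in> L2 M \<Longrightarrow> g \<in> L2 M \<Longrightarrow> h \<in> L2 M \<Longrightarrow>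
    L2_inner M (\<lambda>x. f x + g x) h = L2_inner M f h + L2_inner M g h"
  by (simp add: L2_inner_def distrib_right integrable_L2_inner)

lemma L2_inner_diff_left:
  "f \<in> L2 M \<Longrightarrow> g \<in> L2 M \<Longrightarrow> h \<in> L2 M \<Longrightarrow>
    L2_inner M (\<lambda>x. f x - g x) h = L2_inner M f h - L2_inner M g h"
  by (simp add: L2_inner_def left_diff_distrib integrable_L2_inner)

lemma L2_inner_scale_left: "L2_inner M (\<lambda>x. c * f x) h = c * L2_inner M f h"
  by (simp add: L2_inner_def mult.assoc)

lemma L2_inner_cnj: "L2_inner M g f = cnj (L2_inner M f g)"
proof -
  have "L2_inner M g f = (\<integral>x. cnj (f x * cnj (g x)) \<partial>M)"
    by (simp add: L2_inner_def mult.commute)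
  also have "\<dots> = cnj (\<integral>x. f x * cnj (g x) \<partial>M)" by (rule Bochner_Integration.integral_cnj)
  finally show ?thesis by (simp add: L2_inner_def)
qed

lemma L2_inner_add_right:
  assumes "f \<in> L2 M" "g \<in> L2 M" "h \<in> L2 M"
  shows "L2_inner M h (\<lambda>x. f x + g x) = L2_inner M h f + L2_inner M h g"
  by (subst (1 2 3) L2_inner_cnj) (simp add: L2_inner_add_left[OF assms])

lemma L2_inner_scale_right: "L2_inner M h (\<lambda>x. c * f x) = cnj c * L2_inner M h f"
  by (subst (1 2) L2_inner_cnj) (simp add: L2_inner_scale_left)

lemma L2_inner_cong_AE:
  assumes "AE x in M. f x = f' x" "AE x in M. g x = g' x"
    "f \<in> borel_measurable M" "f' \<in> borel_measurable M"
    "g \<in> borel_measurable M" "g' \<in> borel_measurable M"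
  shows "L2_inner M f g = L2_inner M f' g'"
  unfolding L2_inner_def by (rule integral_cong_AE) (use assms in auto)

lemma L2_inner_self: "L2_inner M f f = of_real ((L2_norm M f)\<^sup>2)"
  unfolding L2_norm_sq L2_inner_def complex_norm_square[symmetric]
  by (rule integral_complex_of_real)

section \<open>Cauchy-Schwarz, the triangle inequality and completeness\<close>

lemma L2_Cauchy_Schwarz:
  assumes f: "f \<in> L2 M" and g: "g \<in> L2 M"
  shows "cmod (L2_inner M f g) \<le> L2_norm M f * L2_norm M g"
proof -
  have [measurable]: "f \<in> borel_measurable M" "g \<in> borel_measurable M"
    using f g by (auto simp: L2_def)
  let ?I = "\<integral>x. cmod (f x) * cmod (g x) \<partial>M"
  have int: "integrable M (\<lambda>x. cmod (f x) * cmod (g x))"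
    using integrable_norm[OF integrable_L2_mult[OF f g]] by (simp add: norm_mult)
  have I: "0 \<le> ?I" by simp
  have "ennreal (?I\<^sup>2) = (\<integral>\<^sup>+x. ennreal (cmod (f x)) * ennreal (cmod (g x)) \<partial>M)\<^sup>2"
    using nn_integral_eq_integral[OF int] I by (simp add: ennreal_mult ennreal_power)
  also have "\<dots> \<le> (\<integral>\<^sup>+x. (ennreal (cmod (f x)))\<^sup>2 \<partial>M) * (\<integral>\<^sup>+x. (ennreal (cmod (g x)))\<^sup>2 \<partial>M)"
    by (rule Cauchy_Schwarz_nn_integral) auto
  also have "\<dots> = ennreal ((L2_norm M f * L2_norm M g)\<^sup>2)"
    using nn_integral_L2[OF f] nn_integral_L2[OF g]
    by (simp add: ennreal_power ennreal_mult power_mult_distrib)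
  finally have "?I\<^sup>2 \<le> (L2_norm M f * L2_norm M g)\<^sup>2" by simp
  then have "?I \<le> L2_norm M f * L2_norm M g" using I by (simp add: power2_le_iff_abs_le)
  moreover have "cmod (L2_inner M f g) \<le> ?I"
    unfolding L2_inner_def by (rule order_trans[OF integral_norm_bound]) (simp add: norm_mult)
  ultimately show ?thesis by linarith
qed

text \<open>For the sum h one has |h|^2 = <f,h> + <g,h>. Cauchy-Schwarz bounds both terms by
  multiples of |h|, which is then cancelled.\<close>

lemma L2_norm_triangle:
  assumes f: "f \<in> L2 M" and g: "g \<in> L2 M"
  shows "L2_norm M (\<lambda>x. f x + g x) \<le> L2_norm M f + L2_norm M g"
proof -
  let ?h = "\<lambda>x. f x + g x"
  have h: "?h \<in> L2 M" using f g by auto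
  have "of_real ((L2_norm M ?h)\<^sup>2) = L2_inner M f ?h + L2_inner M g ?h"
    unfolding L2_inner_self[symmetric] by (rule L2_inner_add_left[OF f g h])
  then have "(L2_norm M ?h)\<^sup>2 = cmod (L2_inner M f ?h + L2_inner M g ?h)"
    by (metis abs_of_nonneg norm_of_real zero_le_power2)
  also have "\<dots> \<le> cmod (L2_inner M f ?h) + cmod (L2_inner M g ?h)"
    by (rule norm_triangle_ineq)
  also have "\<dots> \<le> (L2_norm M f + L2_norm M g) * L2_norm M ?h"
    using L2_Cauchy_Schwarz[OF f h] L2_Cauchy_Schwarz[OF g h] by (simp add: distrib_right)
  finally show ?thesis
    by (cases "L2_norm M ?h = 0") (auto simp: power2_eq_square order_less_le)
qed

lemma L2_norm_triangle_diff:
  assumes "f \<in> L2 M" "g \<in> L2 M" "h \<in> L2 M"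
  shows "L2_norm M (\<lambda>x. f x - h x) \<le> L2_norm M (\<lambda>x. f x - g x) + L2_norm M (\<lambda>x. g x - h x)"
  using L2_norm_triangle[of "\<lambda>x. f x - g x" M "\<lambda>x. g x - h x"] assms by auto

lemma L2_norm_sum:
  assumes "finite I" "\<And>i. i \<in> I \<Longrightarrow> f i \<in> L2 M"
  shows "L2_norm M (\<lambda>x. \<Sum>i\<in>I. f i x) \<le> (\<Sum>i\<in>I. L2_norm M (f i))"
  using assms
proof (induction I rule: finite_induct)
  case (insert i I)
  have "L2_norm M (\<lambda>x. \<Sum>i\<in>insert i I. f i x) \<le> L2_norm M (f i) + L2_norm M (\<lambda>x. \<Sum>i\<in>I. f i x)"
    using insert.hyps by simp (rule L2_norm_triangle; use insert.prems in auto)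
  then show ?case using insert by fastforce
qed simp

text \<open>Riesz-Fischer: the partial sums \<open>G\<close> of the increments have norm at most 2,
  the sum of the geometric series. By monotone convergence their supremum is finite almost
  everywhere, and there the telescoping series converges absolutely.\<close>

lemma L2_complete_subseq:
  assumes f: "\<And>k. f k \<in> L2 M"
    and cau: "\<And>k. L2_norm M (\<lambda>x. f (Suc k) x - f k x) \<le> (1/2)^k"
  shows "\<exists>g\<in>borel_measurable M. AE x in M. (\<lambda>k. f k x) \<longlonglongrightarrow> g x"
proof -
  have [measurable]: "\<And>k. f k \<in> borel_measurable M" using f by (auto simp: L2_def)
  define h where "h k x = cmod (f (Suc k) x - f k x)" for k x
  have [measurable]: "h k \<in> borel_measurable M" for k unfolding h_def by measurable
  have hL2: "(\<lambda>x. complex_of_real (h k x)) \<in> L2 M" for k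
    using L2_diff[OF f[of "Suc k"] f[of k]] by (auto simp: L2_def h_def)
  have hn: "L2_norm M (\<lambda>x. complex_of_real (h k x)) \<le> (1/2)^k" for k
    using cau[of k] by (simp add: L2_norm_def h_def)
  define G where "G n x = (\<Sum>k<n. h k x)" for n x
  have G0: "0 \<le> G n x" for n x by (auto simp: G_def h_def intro: sum_nonneg)
  have GL2: "(\<lambda>x. \<Sum>k<n. complex_of_real (h k x)) \<in> L2 M" for n using hL2 by auto
  have "L2_norm M (\<lambda>x. \<Sum>k<n. complex_of_real (h k x)) \<le> 2" for n
  proof -
    have "L2_norm M (\<lambda>x. \<Sum>k<n. complex_of_real (h k x)) \<le> (\<Sum>k<n. (1/2)^k)"
      by (rule order_trans[OF L2_norm_sum sum_mono]) (use hL2 hn in auto)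
    also have "\<dots> \<le> (\<Sum>k. (1/2)^k :: real)" by (rule sum_le_suminf) (auto simp: summable_geometric)
    also have "\<dots> = 2" by (simp add: suminf_geometric)
    finally show ?thesis .
  qed
  then have G2: "(\<integral>\<^sup>+x. (ennreal (G n x))\<^sup>2 \<partial>M) \<le> 4" for n
  proof -
    assume *: "\<And>n. L2_norm M (\<lambda>x. \<Sum>k<n. complex_of_real (h k x)) \<le> 2"
    have "(\<integral>\<^sup>+x. (ennreal (G n x))\<^sup>2 \<partial>M) = ennreal ((L2_norm M (\<lambda>x. \<Sum>k<n. complex_of_real (h k x)))\<^sup>2)"
      unfolding nn_integral_L2[OF GL2, symmetric] using G0
      by (simp add: ennreal_power G_def flip: of_real_sum)
    also have "\<dots> \<le> ennreal (2\<^sup>2)" by (intro ennreal_leI power_mono *) simp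
    finally show ?thesis by simp
  qed
  have inc: "incseq (\<lambda>n x. (ennreal (G n x))\<^sup>2)"
    unfolding incseq_def le_fun_def
    by (intro allI impI power_mono ennreal_leI) (auto simp: G_def h_def intro!: sum_mono2)
  have "(\<integral>\<^sup>+x. (SUP n. (ennreal (G n x))\<^sup>2) \<partial>M) = (SUP n. \<integral>\<^sup>+x. (ennreal (G n x))\<^sup>2 \<partial>M)"
    using inc by (intro nn_integral_monotone_convergence_SUP) (auto simp: G_def)
  also have "\<dots> \<le> 4" using G2 by (intro SUP_least) auto
  finally have "(\<integral>\<^sup>+x. (SUP n. (ennreal (G n x))\<^sup>2) \<partial>M) \<noteq> \<infinity>"
    by (metis ennreal_numeral ennreal_less_top infinity_ennreal_def not_less top.not_eq_extremum)
  then have "AE x in M. (SUP n. (ennreal (G n x))\<^sup>2) \<noteq> \<infinity>"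
    by (intro nn_integral_PInf_AE) (auto simp: G_def)
  then have conv: "AE x in M. convergent (\<lambda>k. f k x)"
  proof (eventually_elim)
    case (elim x)
    obtain B where B: "B \<ge> 0" "(SUP n. (ennreal (G n x))\<^sup>2) = ennreal B"
      using elim by (cases "(SUP n. (ennreal (G n x))\<^sup>2)") auto
    \<comment> \<open>For B at least 0 the number 1 + B bounds the square root of B.\<close>
    have Gb: "G n x \<le> 1 + B" for n
    proof -
      have "(ennreal (G n x))\<^sup>2 \<le> ennreal B" unfolding B(2)[symmetric] by (rule SUP_upper) simp
      then have "(G n x)\<^sup>2 \<le> B" using G0[of n x] B(1) by (simp add: ennreal_power)
      also have "B \<le> (1 + B)\<^sup>2" using B(1) by (simp add: power2_sum)
      finally show ?thesis by (rule power2_le_imp_le) (use B(1) in simp)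
    qed
    have "summable (\<lambda>k. h k x)"
      by (rule summableI_nonneg_bounded[where x = "1 + B"]) (use Gb in \<open>auto simp: G_def h_def\<close>)
    then have "summable (\<lambda>k. norm (f (Suc k) x - f k x))" by (simp add: h_def)
    then have "summable (\<lambda>k. f (Suc k) x - f k x)" by (rule summable_norm_cancel)
    then have "convergent (\<lambda>n. \<Sum>k<n. f (Suc k) x - f k x)"
      by (simp add: summable_iff_convergent)
    then have "convergent (\<lambda>n. f n x - f 0 x)" by (simp add: sum_lessThan_telescope[of "\<lambda>k. f k x"])
    then have "convergent (\<lambda>n. (f n x - f 0 x) + f 0 x)" by (intro convergent_add convergent_const)
    then show ?case by simp
  qed
  show ?thesis
  proof (rule bexI[of _ "\<lambda>x. lim (\<lambda>k. f k x)"])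
    show "(\<lambda>x. lim (\<lambda>k. f k x)) \<in> borel_measurable M" by measurable
    show "AE x in M. (\<lambda>k. f k x) \<longlonglongrightarrow> lim (\<lambda>k. f k x)"
      using conv by eventually_elim (simp add: convergent_LIMSEQ_iff)
  qed
qed

theorem L2_complete:
  assumes f: "\<And>k. f k \<in> L2 M"
    and cau: "\<And>e. e > 0 \<Longrightarrow> \<exists>N::nat. \<forall>m\<ge>N. \<forall>n\<ge>N. L2_norm M (\<lambda>x. f m x - f n x) < e"
  shows "\<exists>g\<in>L2 M. (\<lambda>n. L2_norm M (\<lambda>x. f n x - g x)) \<longlonglongrightarrow> 0"
proof -
  have [measurable]: "\<And>k. f k \<in> borel_measurable M" using f by (auto simp: L2_def)
  obtain N where N: "\<And>e m n. e > 0 \<Longrightarrow> m \<ge> N e \<Longrightarrow> n \<ge> N e \<Longrightarrow> L2_norm M (\<lambda>x. f m x - f n x) < e"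
    using cau by metis
  \<comment> \<open>The maximum makes \<open>r\<close> monotone, and the summand k makes it
    unbounded (\<open>r3\<close>).\<close>
  define r where "r k = Max ((\<lambda>j. N ((1/2)^j)) ` {..k})+k" for k :: nat
  have r1: "r k \<le> r (Suc k)" for k
    unfolding r_def by (intro add_mono Max_mono) auto
  have r2: "r k \<ge> N ((1/2)^k)" for k
    unfolding r_def by (intro trans_le_add1 Max_ge) auto
  have r3: "r k \<ge> k" for k by (simp add: r_def)
  have "\<exists>g\<in>borel_measurable M. AE x in M. (\<lambda>k. f (r k) x) \<longlonglongrightarrow> g x"
  proof (rule L2_complete_subseq)
    show "L2_norm M (\<lambda>x. f (r (Suc k)) x - f (r k) x) \<le> (1/2)^k" for k
      using N[of "(1/2)^k" "r (Suc k)" "r k"] r2[of k] r1[of k] by simp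
  qed (use f in auto)
  then obtain g where [measurable]: "g \<in> borel_measurable M"
    and g: "AE x in M. (\<lambda>k. f (r k) x) \<longlonglongrightarrow> g x" by auto
  \<comment> \<open>Fatou's lemma along the subsequence turns the Cauchy estimate between members of
    the sequence into an estimate against the limit.\<close>
  have bd: "(\<integral>\<^sup>+x. ennreal ((cmod (f n x - g x))\<^sup>2) \<partial>M) \<le> ennreal (e\<^sup>2)"
    if "e > 0" "n \<ge> N e" for e n
  proof -
    have "(\<integral>\<^sup>+x. ennreal ((cmod (f n x - g x))\<^sup>2) \<partial>M)
        = (\<integral>\<^sup>+x. liminf (\<lambda>k. ennreal ((cmod (f n x - f (r k) x))\<^sup>2)) \<partial>M)"
    proof (rule nn_integral_cong_AE)
      show "AE x in M. ennreal ((cmod (f n x - g x))\<^sup>2) = liminf (\<lambda>k. ennreal ((cmod (f n x - f (r k) x))\<^sup>2))"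
        using g
      proof eventually_elim
        case (elim x)
        have "(\<lambda>k. ennreal ((cmod (f n x - f (r k) x))\<^sup>2)) \<longlonglongrightarrow> ennreal ((cmod (f n x - g x))\<^sup>2)"
          using elim by (intro tendsto_ennrealI tendsto_intros)
        then show ?case by (intro lim_imp_Liminf[symmetric]) auto
      qed
    qed
    also have "\<dots> \<le> liminf (\<lambda>k. \<integral>\<^sup>+x. ennreal ((cmod (f n x - f (r k) x))\<^sup>2) \<partial>M)"
      by (rule nn_integral_liminf) measurable
    also have "\<dots> \<le> ennreal (e\<^sup>2)"
    proof (rule Liminf_le, simp)
      have "\<forall>\<^sub>F k in sequentially. k \<ge> N e" by (rule eventually_ge_at_top)
      then show "\<forall>\<^sub>F k in sequentially. (\<integral>\<^sup>+x. ennreal ((cmod (f n x - f (r k) x))\<^sup>2) \<partial>M) \<le> ennreal (e\<^sup>2)"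
      proof eventually_elim
        case (elim k)
        have "L2_norm M (\<lambda>x. f n x - f (r k) x) \<le> e"
          using N[of e n "r k"] that elim r3[of k] by simp
        then show ?case
          unfolding nn_integral_L2[OF L2_diff[OF f[of n] f[of "r k"]]]
          by (intro ennreal_leI power_mono) auto
      qed
    qed
    finally show ?thesis .
  qed
  have gn: "L2_norm M (\<lambda>x. f n x - g x) \<le> e" if "e > 0" "n \<ge> N e" for e n
    by (rule L2I_nn(2)[OF _ bd[OF that]]) (use that in auto)
  have "(\<lambda>x. f (N 1) x - g x) \<in> L2 M"
    by (rule L2I_nn(1)[OF _ bd[of 1]]) auto
  then have "(\<lambda>x. f (N 1) x - (f (N 1) x - g x)) \<in> L2 M" by (rule L2_diff[OF f])
  then have gL2: "g \<in> L2 M" by simp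
  have "(\<lambda>n. L2_norm M (\<lambda>x. f n x - g x)) \<longlonglongrightarrow> 0"
  proof (rule LIMSEQ_I)
    fix e :: real assume "e > 0"
    then show "\<exists>no. \<forall>n\<ge>no. norm (L2_norm M (\<lambda>x. f n x - g x) - 0) < e"
      using gn[of "e/2"] by (intro exI[of _ "N (e/2)"]) fastforce
  qed
  then show ?thesis using gL2 by auto
qed

section \<open>Generators of measure spaces\<close>

text \<open>One condition for three purposes: sigma-finiteness, uniqueness of a measure with given
  values on \<open>E\<close>, and density of the span of the indicators of \<open>E\<close> in
  \<open>L2 M\<close>. The cover is disjoint so that the indicators of its pieces add up.\<close>

definition generates :: "'x measure \<Rightarrow> 'x set set \<Rightarrow> bool" where
  "generates M E \<longleftrightarrow> E \<subseteq> Pow (space M) \<and> sets M = sigma_sets (space M) E \<and> Int_stable E \<and>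
     (\<forall>A\<in>E. emeasure M A < \<infinity>) \<and>
     (\<exists>C :: nat \<Rightarrow> _. range C \<subseteq> E \<and> disjoint_family C \<and> \<Union>(range C) = space M)"

lemma generates_sets: "generates M E \<Longrightarrow> A \<in> E \<Longrightarrow> A \<in> sets M"
  by (auto simp: generates_def)

lemma generates_finite: "generates M E \<Longrightarrow> A \<in> E \<Longrightarrow> emeasure M A < \<infinity>"
  by (auto simp: generates_def)

lemma generates_L2: "generates M E \<Longrightarrow> A \<in> E \<Longrightarrow> (\<lambda>x. indicator A x) \<in> L2 M"
  by (intro L2_indicator generates_sets generates_finite)

lemma generates_sigma_finite:
  assumes "generates M E" shows "sigma_finite_measure M"
proof -
  obtain C :: "nat \<Rightarrow> _" where C: "range C \<subseteq> E" "\<Union>(range C) = space M"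
    using assms by (auto simp: generates_def)
  have fin: "emeasure M (C i) \<noteq> \<infinity>" for i
    using generates_finite[OF assms, of "C i"] subsetD[OF C(1) rangeI[of C i]] by auto
  show ?thesis
    by (rule sigma_finite_measure.intro, rule exI[of _ "range C"])
       (use C assms fin in \<open>auto simp: generates_def\<close>)
qed

lemma generates_pair:
  assumes M: "generates M E" and N: "generates N E'"
  shows "generates (M \<Otimes>\<^sub>M N) {A \<times> B |A B. A \<in> E \<and> B \<in> E'}"
proof -
  obtain C :: "nat \<Rightarrow> _" where C: "range C \<subseteq> E" "disjoint_family C" "\<Union>(range C) = space M"
    using M by (auto simp: generates_def)
  obtain C' :: "nat \<Rightarrow> _" where C': "range C' \<subseteq> E'" "disjoint_family C'" "\<Union>(range C') = space N"
    using N by (auto simp: generates_def)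
  interpret N: sigma_finite_measure N by (rule generates_sigma_finite[OF N])
  let ?P = "{A \<times> B |A B. A \<in> E \<and> B \<in> E'}"
  have sub: "?P \<subseteq> Pow (space M \<times> space N)"
    using M N by (auto simp: generates_def)
  have "sets (M \<Otimes>\<^sub>M N) = sets (sigma (space M \<times> space N) ?P)"
    by (rule sets_pair_eq[of E M "range C" E' N "range C'"])
       (use M N C C' in \<open>auto simp: generates_def\<close>)
  also have "\<dots> = sigma_sets (space M \<times> space N) ?P"
    using sub by (simp add: sets_measure_of)
  finally have sets: "sets (M \<Otimes>\<^sub>M N) = sigma_sets (space (M \<Otimes>\<^sub>M N)) ?P"
    by (simp add: space_pair_measure)
  have "Int_stable ?P"
  proof (rule Int_stableI)
    fix a b assume "a \<in> ?P" "b \<in> ?P"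
    then obtain A B A' B' where *: "a = A \<times> B" "b = A' \<times> B'" "A \<in> E" "A' \<in> E" "B \<in> E'" "B' \<in> E'"
      by auto
    then have "A \<inter> A' \<in> E" "B \<inter> B' \<in> E'"
      using M N by (auto simp: generates_def Int_stable_def)
    moreover have "a \<inter> b = (A \<inter> A') \<times> (B \<inter> B')" using * by auto
    ultimately show "a \<inter> b \<in> ?P" by auto
  qed
  moreover have "emeasure (M \<Otimes>\<^sub>M N) a < \<infinity>" if a: "a \<in> ?P" for a
  proof -
    obtain A B where *: "a = A \<times> B" "A \<in> E" "B \<in> E'" using a by blast
    then show ?thesis
      using generates_sets[OF M *(2)] generates_sets[OF N *(3)]
        generates_finite[OF M *(2)] generates_finite[OF N *(3)]
      by (simp add: N.emeasure_pair_measure_Times ennreal_mult_less_top)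
  qed
  moreover have "\<exists>D :: nat \<Rightarrow> _. range D \<subseteq> ?P \<and> disjoint_family D \<and> \<Union>(range D) = space (M \<Otimes>\<^sub>M N)"
  proof (intro exI conjI)
    \<comment> \<open>The pairing of natural numbers enumerates all products of the two countable
      covers.\<close>
    let ?D = "\<lambda>k. C (fst (prod_decode k)) \<times> C' (snd (prod_decode k))"
    show "range ?D \<subseteq> ?P"
    proof (rule image_subsetI)
      fix k :: nat
      have "C (fst (prod_decode k)) \<in> E" "C' (snd (prod_decode k)) \<in> E'" using C(1) C'(1) by auto
      then show "?D k \<in> ?P" by blast
    qed
    show "disjoint_family ?D"
      unfolding disjoint_family_on_def
    proof (intro ballI impI)
      fix m n :: nat assume "m \<noteq> n"
      then have "prod_decode m \<noteq> prod_decode n" by (metis prod_decode_inverse)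
      then have "fst (prod_decode m) \<noteq> fst (prod_decode n) \<or> snd (prod_decode m) \<noteq> snd (prod_decode n)"
        by (auto simp: prod_eq_iff)
      then show "?D m \<inter> ?D n = {}"
        using C(2) C'(2) by (fastforce simp: disjoint_family_on_def)
    qed
    have "(x, y) \<in> \<Union>(range ?D)" if xy: "x \<in> space M" "y \<in> space N" for x y
    proof -
      obtain i j where "x \<in> C i" "y \<in> C' j" using xy C(3) C'(3) by blast
      then have "(x, y) \<in> ?D (prod_encode (i, j))" by simp
      then show ?thesis by blast
    qed
    moreover have "\<Union>(range ?D) \<subseteq> space M \<times> space N" using C(3) C'(3) by auto
    ultimately show "\<Union>(range ?D) = space (M \<Otimes>\<^sub>M N)" by (auto simp: space_pair_measure)
  qed
  ultimately show ?thesis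
    unfolding generates_def using sub sets by (simp add: space_pair_measure)
qed

text \<open>The factor 2 is the one that comes with the approximation of a measurable function by
  simple functions. It leaves room for increasing sequences of indicators as well.\<close>

lemma L2_dominated:
  assumes f: "f \<in> L2 M" and s: "\<And>k. s k \<in> borel_measurable M"
    and lim: "\<And>x. x \<in> space M \<Longrightarrow> (\<lambda>k. s k x) \<longlonglongrightarrow> f x"
    and bd: "\<And>k x. x \<in> space M \<Longrightarrow> cmod (s k x) \<le> 2 * cmod (f x)"
  shows "\<And>k. s k \<in> L2 M" "(\<lambda>k. L2_norm M (\<lambda>x. f x - s k x)) \<longlonglongrightarrow> 0"
proof -
  have [measurable]: "f \<in> borel_measurable M" "\<And>k. s k \<in> borel_measurable M"
    using f s by (auto simp: L2_def)
  have sq: "(cmod (s k x))\<^sup>2 \<le> 4 * (cmod (f x))\<^sup>2" if "x \<in> space M" for k x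
    using power_mono[OF bd[OF that] norm_ge_zero, of k 2] by (simp add: power_mult_distrib)
  show "s k \<in> L2 M" for k
    by (rule L2_bound[OF s, of "\<lambda>x. 4 * (cmod (f x))\<^sup>2"])
       (use f sq in \<open>auto simp: L2_def\<close>)
  have "(\<lambda>k. \<integral>x. (cmod (f x - s k x))\<^sup>2 \<partial>M) \<longlonglongrightarrow> (\<integral>x. 0 \<partial>M)"
  \<comment> \<open>|f - s|^2 is at most 2|f|^2 + 2|s|^2, and |s|^2 is at most 4|f|^2; hence the
    constant 10.\<close>
  proof (rule integral_dominated_convergence[where w = "\<lambda>x. 10 * (cmod (f x))\<^sup>2"])
    show "AE x in M. (\<lambda>k. (cmod (f x - s k x))\<^sup>2) \<longlonglongrightarrow> 0"
    proof (rule AE_I2)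
      fix x assume "x \<in> space M"
      then have "(\<lambda>k. (cmod (f x - s k x))\<^sup>2) \<longlonglongrightarrow> (cmod (f x - f x))\<^sup>2"
        by (intro tendsto_intros lim)
      then show "(\<lambda>k. (cmod (f x - s k x))\<^sup>2) \<longlonglongrightarrow> 0" by simp
    qed
    show "AE x in M. norm ((cmod (f x - s k x))\<^sup>2) \<le> 10 * (cmod (f x))\<^sup>2" for k
    proof (rule AE_I2)
      fix x assume "x \<in> space M"
      then show "norm ((cmod (f x - s k x))\<^sup>2) \<le> 10 * (cmod (f x))\<^sup>2"
        using cmod_add_sq_le[of "f x" "- s k x"] sq[of x k] by simp
    qed
  qed (use f in \<open>auto simp: L2_def\<close>)
  then have "(\<lambda>k. sqrt (\<integral>x. (cmod (f x - s k x))\<^sup>2 \<partial>M)) \<longlonglongrightarrow> sqrt 0"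
    by (intro tendsto_real_sqrt) simp
  then show "(\<lambda>k. L2_norm M (\<lambda>x. f x - s k x)) \<longlonglongrightarrow> 0" by (simp add: L2_norm_def)
qed

text \<open>The limit rule asks for approximation in norm instead of pointwise, so the induction
  applies to properties that make sense in the Hilbert space, such as identities between bounded
  operators.\<close>

lemma L2_induct [consumes 2, case_names indicator add scale lim]:
  assumes gen: "generates M E" and f: "f \<in> L2 M"
    and ind: "\<And>A. A \<in> E \<Longrightarrow> P (\<lambda>x. indicator A x)"
    and add: "\<And>f g. f \<in> L2 M \<Longrightarrow> g \<in> L2 M \<Longrightarrow> P f \<Longrightarrow> P g \<Longrightarrow> P (\<lambda>x. f x + g x)"
    and scale: "\<And>c f. f \<in> L2 M \<Longrightarrow> P f \<Longrightarrow> P (\<lambda>x. c * f x)"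
    and lim: "\<And>f. f \<in> L2 M \<Longrightarrow>
      (\<And>e. e > 0 \<Longrightarrow> \<exists>g\<in>L2 M. P g \<and> L2_norm M (\<lambda>x. f x - g x) < e) \<Longrightarrow> P f"
  shows "P f"
proof -
  have seq: "P f" if f: "f \<in> L2 M" and s: "\<And>k::nat. s k \<in> borel_measurable M" and P: "\<And>k. P (s k)"
    and l: "\<And>x. x \<in> space M \<Longrightarrow> (\<lambda>k. s k x) \<longlonglongrightarrow> f x"
    and bd: "\<And>k x. x \<in> space M \<Longrightarrow> cmod (s k x) \<le> 2 * cmod (f x)" for f s
  proof (rule lim[OF f])
    fix e :: real assume "e > 0"
    note D = L2_dominated[OF f s l bd]
    have "\<forall>\<^sub>F k in sequentially. L2_norm M (\<lambda>x. f x - s k x) < e"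
      using D(2) \<open>e > 0\<close> by (rule order_tendstoD(2))
    then obtain k where "L2_norm M (\<lambda>x. f x - s k x) < e"
      by (auto simp: eventually_sequentially)
    then show "\<exists>g\<in>L2 M. P g \<and> L2_norm M (\<lambda>x. f x - g x) < e" using D(1)[of k] P by auto
  qed
  \<comment> \<open>\<open>P\<close> may depend on values outside \<open>space M\<close>. The limit
    rule with a constant sequence removes this dependence.\<close>
  have cong: "P g" if "f \<in> L2 M" "P f" "g \<in> borel_measurable M" "\<And>x. x \<in> space M \<Longrightarrow> g x = f x" for f g
  proof (rule seq[where s = "\<lambda>k. f"])
    show "g \<in> L2 M" using that by (intro L2_cong_AE[OF that(1)]) auto
  qed (use that in \<open>auto simp: L2_def\<close>)
  have P0: "P (\<lambda>x. 0)"
  proof -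
    obtain C :: "nat \<Rightarrow> _" where "range C \<subseteq> E" using gen by (auto simp: generates_def)
    then have "C 0 \<in> E" by auto
    then have "P (\<lambda>x. 0 * indicator (C 0) x)" by (intro scale ind generates_L2[OF gen])
    then show ?thesis by simp
  qed
  have Psum: "P (\<lambda>x. \<Sum>i\<in>I. g i x)" if "\<And>i. i \<in> I \<Longrightarrow> g i \<in> L2 M \<and> P (g i)" for g and I :: "'i set"
    using that
  proof (induction I rule: infinite_finite_induct)
    case (insert i I)
    have "P (\<lambda>x. g i x + (\<Sum>i\<in>I. g i x))"
      by (rule add) (use insert in auto)
    then show ?case using insert by simp
  qed (auto simp: P0)
  obtain C :: "nat \<Rightarrow> _" where C: "range C \<subseteq> E" "disjoint_family C" "\<Union>(range C) = space M"
    using gen by (auto simp: generates_def)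
  have CE: "C i \<in> E" for i using C(1) by auto
  have CM [measurable]: "C i \<in> sets M" for i by (rule generates_sets[OF gen CE])
  have AC: "(\<lambda>x. indicator (A \<inter> C i) x) \<in> L2 M" if "A \<in> sets M" for A i
  proof (rule L2_indicator)
    show "emeasure M (A \<inter> C i) < \<infinity>"
      using emeasure_mono[of "A \<inter> C i" "C i" M] generates_finite[OF gen CE[of i]] CM[of i]
      by (auto intro: le_less_trans)
  qed (use that in auto)
  \<comment> \<open>Dynkin's argument runs inside one piece \<open>C i\<close>, because a complement
    in the whole space may have infinite measure.\<close>
  have step1: "P (\<lambda>x. indicator (A \<inter> C i) x)" if "A \<in> sets M" for A i
  proof -
    have "Int_stable E" "E \<subseteq> Pow (space M)" "A \<in> sigma_sets (space M) E"
      using that gen by (auto simp: generates_def)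
    then show ?thesis
    proof (induction rule: sigma_sets_induct_disjoint)
      case (basic A)
      then show ?case using gen CE[of i] by (intro ind) (auto simp: generates_def Int_stable_def)
    next
      case empty
      then show ?case using P0 by simp
    next
      case (compl A)
      then have A: "A \<in> sets M" using gen by (simp add: generates_def)
      have "P (\<lambda>x. indicator (C i) x + (-1) * indicator (A \<inter> C i) x)"
        by (intro add scale L2_scale AC A compl.IH ind CE generates_L2[OF gen])
      moreover have "(\<lambda>x. indicator ((space M - A) \<inter> C i) x :: complex) =
          (\<lambda>x. indicator (C i) x + (-1) * indicator (A \<inter> C i) x)"
        using sets.sets_into_space[OF CM[of i]] by (auto simp: indicator_def fun_eq_iff)
      ultimately show ?case by simp
    next
      case (union A)
      then have A [measurable]: "A j \<in> sets M" for j using gen by (auto simp: generates_def)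
      show ?case
      proof (rule seq[where s = "\<lambda>k x. \<Sum>j<k. indicator (A j \<inter> C i) x"])
        show "P (\<lambda>x. \<Sum>j<k. indicator (A j \<inter> C i) x)" for k
          by (rule Psum) (use AC A union.IH in auto)
        have eq: "(\<Sum>j<k. indicator (A j \<inter> C i) x :: complex) = indicator ((\<Union>j<k. A j) \<inter> C i) x" for k x
        proof -
          have *: "(\<Union>j<k. A j) \<inter> C i = (\<Union>j<k. A j \<inter> C i)" by auto
          have "disjoint_family_on (\<lambda>j. A j \<inter> C i) {..<k}"
            using union.hyps(1) by (auto simp: disjoint_family_on_def)
          then show ?thesis unfolding * by (intro indicator_UN_disjoint[symmetric]) auto
        qed
        show "(\<lambda>k. \<Sum>j<k. indicator (A j \<inter> C i) x :: complex) \<longlonglongrightarrow> indicator ((\<Union>j. A j) \<inter> C i) x" for x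
          unfolding eq
        proof (cases "x \<in> (\<Union>j. A j)")
          case True
          then obtain j where "x \<in> A j" by auto
          then have "indicator ((\<Union>j<k. A j) \<inter> C i) x = (indicator ((\<Union>j. A j) \<inter> C i) x :: complex)"
            if "k > j" for k using that by (auto simp: indicator_def)
          then show "(\<lambda>k. indicator ((\<Union>j<k. A j) \<inter> C i) x :: complex) \<longlonglongrightarrow> indicator ((\<Union>j. A j) \<inter> C i) x"
            by (intro tendsto_eventually eventually_sequentiallyI[of "Suc j"]) auto
        qed (auto simp: indicator_def)
        show "cmod (\<Sum>j<k. indicator (A j \<inter> C i) x) \<le> 2 * cmod (indicator ((\<Union>j. A j) \<inter> C i) x)" for k x
          unfolding eq by (auto simp: indicator_def)
      qed (use AC in auto)
    qed
  qed
  have step2: "P (\<lambda>x. indicator A x)" if A [measurable]: "A \<in> sets M" and fin: "emeasure M A < \<infinity>" for A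
  proof (rule seq[where s = "\<lambda>k x. \<Sum>i<k. indicator (A \<inter> C i) x"])
    have eq: "(\<Sum>i<k. indicator (A \<inter> C i) x :: complex) = indicator (A \<inter> (\<Union>i<k. C i)) x" for k x
    proof -
      have *: "A \<inter> (\<Union>i<k. C i) = (\<Union>i<k. A \<inter> C i)" by auto
      have "disjoint_family_on (\<lambda>i. A \<inter> C i) {..<k}"
        using C(2) by (auto simp: disjoint_family_on_def)
      then show ?thesis unfolding * by (intro indicator_UN_disjoint[symmetric]) auto
    qed
    show "(\<lambda>k. \<Sum>i<k. indicator (A \<inter> C i) x :: complex) \<longlonglongrightarrow> indicator A x" if x: "x \<in> space M" for x
    proof -
      obtain j where "x \<in> C j" using x C(3) by blast
      then show ?thesis unfolding eq
        by (intro tendsto_eventually eventually_sequentiallyI[of "Suc j"]) (auto simp: indicator_def)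
    qed
    show "cmod (\<Sum>i<k. indicator (A \<inter> C i) x) \<le> 2 * cmod (indicator A x)" for k x
      unfolding eq by (auto simp: indicator_def)
    show "P (\<lambda>x. \<Sum>i<k. indicator (A \<inter> C i) x)" for k
      by (rule Psum) (use AC A step1 in auto)
  qed (use A L2_indicator[OF A fin] in auto)
  have [measurable]: "f \<in> borel_measurable M" using f by (simp add: L2_def)
  obtain S where S: "\<And>i. simple_function M (S i)" "\<And>x. x \<in> space M \<Longrightarrow> (\<lambda>i. S i x) \<longlonglongrightarrow> f x"
    "\<And>i x. x \<in> space M \<Longrightarrow> cmod (S i x) \<le> 2 * cmod (f x)"
    using borel_measurable_implies_sequence_metric[OF L2_measurable[OF f], of 0]
    unfolding dist_norm diff_zero by blast
  have Sm [measurable]: "S i \<in> borel_measurable M" for i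
    by (rule borel_measurable_simple_function[OF S(1)])
  have SL2: "S i \<in> L2 M" for i by (rule L2_dominated(1)[OF f Sm S(2,3)])
  show "P f"
  proof (rule seq[OF f Sm _ S(2,3)])
    fix i
    let ?Y = "S i ` space M - {0}"
    let ?A = "\<lambda>y. S i -` {y} \<inter> space M"
    have finY: "finite ?Y" using S(1)[of i] by (auto simp: simple_function_def)
    have meas: "?A y \<in> sets M" for y
      using Sm[of i] by (rule measurable_sets) auto
    \<comment> \<open>Chebyshev: on the level set of y the integrable function |S i|^2 / |y|^2
      equals 1.\<close>
    have fin: "emeasure M (?A y) < \<infinity>" if "y \<noteq> 0" for y
    proof -
      have "integrable M (indicator (?A y) :: _ \<Rightarrow> real)"
      proof (rule Bochner_Integration.integrable_bound)
        show "integrable M (\<lambda>x. (cmod (S i x))\<^sup>2 / (cmod y)\<^sup>2)"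
          using SL2[of i] by (auto simp: L2_def)
      qed (use meas that in \<open>auto simp: indicator_def\<close>)
      then show ?thesis unfolding integrable_indicator_iff by simp
    qed
    show "P (S i)"
    proof (rule cong[of "\<lambda>x. \<Sum>y\<in>?Y. y * indicator (?A y) x"])
      show "S i x = (\<Sum>y\<in>?Y. y * indicator (?A y) x)" if "x \<in> space M" for x
      proof (cases "S i x = 0")
        case True
        then have "(\<Sum>y\<in>?Y. y * indicator (?A y) x) = 0" by (intro sum.neutral) (auto simp: indicator_def)
        then show ?thesis using True by simp
      next
        case False
        have "(\<Sum>y\<in>?Y. y * indicator (?A y) x) = (\<Sum>y\<in>{S i x}. y * indicator (?A y) x)"
          by (rule sum.mono_neutral_right[OF finY]) (use False that in \<open>auto simp: indicator_def\<close>)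
        then show ?thesis using that by simp
      qed
      show "(\<lambda>x. \<Sum>y\<in>?Y. y * indicator (?A y) x) \<in> L2 M"
        by (intro L2_sum L2_scale L2_indicator meas fin) auto
      show "P (\<lambda>x. \<Sum>y\<in>?Y. y * indicator (?A y) x)"
        by (rule Psum) (intro conjI scale step2 L2_scale L2_indicator meas fin; simp)
    qed (rule Sm)
  qed
qed

text \<open>The vectors orthogonal to f form a closed subspace. It contains the generating
  indicators, hence everything, in particular f itself.\<close>

lemma L2_orthogonal_imp_zero:
  assumes gen: "generates M E" and f: "f \<in> L2 M"
    and orth: "\<And>A. A \<in> E \<Longrightarrow> L2_inner M f (\<lambda>x. indicator A x) = 0"
  shows "AE x in M. f x = 0"
proof -
  have "L2_inner M f g = 0" if "g \<in> L2 M" for g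
    using gen that
  proof (induction rule: L2_induct)
    case (lim g)
    have "cmod (L2_inner M f g) \<le> 0"
    proof (rule field_le_epsilon)
      fix e :: real assume e: "e > 0"
      have pos: "L2_norm M f + 1 > 0" using L2_norm_nonneg[of M f] by linarith
      obtain h where h: "h \<in> L2 M" "L2_inner M f h = 0"
        "L2_norm M (\<lambda>x. g x - h x) < e / (L2_norm M f + 1)"
        using lim.IH[of "e / (L2_norm M f + 1)"] e pos by auto
      have "L2_inner M f g = L2_inner M f (\<lambda>x. (g x - h x) + h x)" by simp
      also have "\<dots> = L2_inner M f (\<lambda>x. g x - h x)"
        by (subst L2_inner_add_right) (use f lim.hyps h in auto)
      finally have "cmod (L2_inner M f g) \<le> L2_norm M f * L2_norm M (\<lambda>x. g x - h x)"
        using L2_Cauchy_Schwarz[OF f L2_diff[OF lim.hyps h(1)]] by simp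
      also have "\<dots> \<le> (L2_norm M f + 1) * (e / (L2_norm M f + 1))"
        by (rule mult_mono) (use h(3) pos in auto)
      also have "\<dots> = 0 + e" using pos by simp
      finally show "cmod (L2_inner M f g) \<le> 0 + e" .
    qed
    then show ?case by simp
  qed (use f orth in \<open>auto simp: L2_inner_add_right L2_inner_scale_right\<close>)
  from this[OF f] have "L2_norm M f = 0" by (simp add: L2_inner_self)
  then show ?thesis by (rule L2_norm_eq_0[OF f])
qed

section \<open>Bounded operators\<close>

lemma bounded_ops_L2: "T \<in> bounded_ops M \<Longrightarrow> f \<in> L2 M \<Longrightarrow> T f \<in> L2 M"
  by (auto simp: bounded_ops_def)

lemma bounded_ops_add:
  "T \<in> bounded_ops M \<Longrightarrow> f \<in> L2 M \<Longrightarrow> g \<in> L2 M \<Longrightarrow>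
    AE x in M. T (\<lambda>y. f y + g y) x = T f x + T g x"
  by (auto simp: bounded_ops_def)

lemma bounded_ops_scale:
  "T \<in> bounded_ops M \<Longrightarrow> f \<in> L2 M \<Longrightarrow> AE x in M. T (\<lambda>y. c * f y) x = c * T f x"
  by (auto simp: bounded_ops_def)

lemma bounded_ops_bound:
  assumes "T \<in> bounded_ops M"
  obtains K where "K > 0" "\<And>f. f \<in> L2 M \<Longrightarrow> L2_norm M (T f) \<le> K * L2_norm M f"
proof -
  obtain K where K: "\<And>f. f \<in> L2 M \<Longrightarrow> L2_norm M (T f) \<le> K * L2_norm M f"
    using assms unfolding bounded_ops_def by blast
  have "L2_norm M (T f) \<le> (\<bar>K\<bar> + 1) * L2_norm M f" if "f \<in> L2 M" for f
    by (rule order_trans[OF K[OF that]]) (intro mult_right_mono; simp)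
  then show thesis by (intro that[of "\<bar>K\<bar> + 1"]) auto
qed

lemma bounded_ops_diff:
  assumes T: "T \<in> bounded_ops M" and f: "f \<in> L2 M" and g: "g \<in> L2 M"
  shows "AE x in M. T (\<lambda>y. f y - g y) x = T f x - T g x"
  using bounded_ops_add[OF T f L2_scale[OF g, of "-1"]] bounded_ops_scale[OF T g, of "-1"]
  by eventually_elim simp

text \<open>The difference of the arguments has norm 0, and the operator bound gives its image norm
  0. Thus operators defined on functions descend to classes.\<close>

lemma bounded_ops_cong:
  assumes T: "T \<in> bounded_ops M" and f: "f \<in> L2 M" and g: "g \<in> L2 M"
    and eq: "AE x in M. f x = g x"
  shows "AE x in M. T f x = T g x"
proof -
  obtain K where K: "K > 0" "\<And>f. f \<in> L2 M \<Longrightarrow> L2_norm M (T f) \<le> K * L2_norm M f"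
    using bounded_ops_bound[OF T] by blast
  have fg: "(\<lambda>y. f y - g y) \<in> L2 M" using f g by auto
  have "L2_norm M (\<lambda>y. f y - g y) = L2_norm M (\<lambda>y. 0)"
    by (rule L2_norm_cong_AE) (use eq fg in \<open>auto simp: L2_def\<close>)
  then have "L2_norm M (T (\<lambda>y. f y - g y)) = 0"
    using K(2)[OF fg] L2_norm_nonneg[of M "T (\<lambda>y. f y - g y)"] by simp
  from L2_norm_eq_0[OF bounded_ops_L2[OF T fg] this] bounded_ops_diff[OF T f g]
  show ?thesis by eventually_elim simp
qed

lemma bounded_ops_zero: "T \<in> bounded_ops M \<Longrightarrow> AE x in M. T (\<lambda>y. 0) x = 0"
  using bounded_ops_scale[of T M "\<lambda>y. 0" 0] by simp

lemma bounded_ops_sum: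
  assumes T: "T \<in> bounded_ops M" and f: "\<And>i. i \<in> I \<Longrightarrow> f i \<in> L2 M"
  shows "AE x in M. T (\<lambda>y. \<Sum>i\<in>I. f i y) x = (\<Sum>i\<in>I. T (f i) x)"
  using f
proof (induction I rule: infinite_finite_induct)
  case (insert i I)
  have "AE x in M. T (\<lambda>y. f i y + (\<Sum>i\<in>I. f i y)) x = T (f i) x + T (\<lambda>y. \<Sum>i\<in>I. f i y) x"
    by (rule bounded_ops_add[OF T]) (use insert in auto)
  moreover have "AE x in M. T (\<lambda>y. \<Sum>i\<in>I. f i y) x = (\<Sum>i\<in>I. T (f i) x)"
    using insert by auto
  ultimately show ?case by eventually_elim (simp add: insert.hyps)
qed (use bounded_ops_zero[OF T] in auto)

lemma bounded_opsI:
  assumes "\<And>f. f \<in> L2 M \<Longrightarrow> T f \<in> L2 M"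
    and "\<And>f g. f \<in> L2 M \<Longrightarrow> g \<in> L2 M \<Longrightarrow> AE x in M. T (\<lambda>y. f y + g y) x = T f x + T g x"
    and "\<And>c f. f \<in> L2 M \<Longrightarrow> AE x in M. T (\<lambda>y. c * f y) x = c * T f x"
    and "\<And>f. f \<in> L2 M \<Longrightarrow> L2_norm M (T f) \<le> K * L2_norm M f"
  shows "T \<in> bounded_ops M"
  unfolding bounded_ops_def using assms by blast

lemma bounded_ops_id [simp]: "id \<in> bounded_ops M"
  by (rule bounded_opsI[where K = 1]) auto

lemma bounded_ops_comp:
  assumes S: "S \<in> bounded_ops M" and T: "T \<in> bounded_ops M"
  shows "S \<circ> T \<in> bounded_ops M"
proof -
  obtain K where K: "K > 0" "\<And>f. f \<in> L2 M \<Longrightarrow> L2_norm M (S f) \<le> K * L2_norm M f"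
    using bounded_ops_bound[OF S] by blast
  obtain L where L: "L > 0" "\<And>f. f \<in> L2 M \<Longrightarrow> L2_norm M (T f) \<le> L * L2_norm M f"
    using bounded_ops_bound[OF T] by blast
  note TL = bounded_ops_L2[OF T]
  show ?thesis
  proof (rule bounded_opsI[where K = "K * L"])
    fix f g assume f: "f \<in> L2 M" and g: "g \<in> L2 M"
    have "AE x in M. S (T (\<lambda>y. f y + g y)) x = S (\<lambda>y. T f y + T g y) x"
      by (rule bounded_ops_cong[OF S]) (use f g TL bounded_ops_add[OF T] in auto)
    with bounded_ops_add[OF S TL[OF f] TL[OF g]]
    show "AE x in M. (S \<circ> T) (\<lambda>y. f y + g y) x = (S \<circ> T) f x + (S \<circ> T) g x"
      by eventually_elim simp
  next
    fix c f assume f: "f \<in> L2 M"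
    have "AE x in M. S (T (\<lambda>y. c * f y)) x = S (\<lambda>y. c * T f y) x"
      by (rule bounded_ops_cong[OF S]) (use f TL bounded_ops_scale[OF T] in auto)
    with bounded_ops_scale[OF S TL[OF f], of c]
    show "AE x in M. (S \<circ> T) (\<lambda>y. c * f y) x = c * (S \<circ> T) f x"
      by eventually_elim simp
  next
    fix f assume f: "f \<in> L2 M"
    have "L2_norm M (S (T f)) \<le> K * L2_norm M (T f)" by (rule K(2)[OF TL[OF f]])
    also have "\<dots> \<le> K * (L * L2_norm M f)" using K(1) L(2)[OF f] by simp
    finally show "L2_norm M ((S \<circ> T) f) \<le> K * L * L2_norm M f" by simp
  qed (use S TL bounded_ops_L2 in auto)
qed

lemma bounded_ops_op_add:
  assumes S: "S \<in> bounded_ops M" and T: "T \<in> bounded_ops M"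
  shows "op_add S T \<in> bounded_ops M"
proof -
  obtain K where K: "K > 0" "\<And>f. f \<in> L2 M \<Longrightarrow> L2_norm M (S f) \<le> K * L2_norm M f"
    using bounded_ops_bound[OF S] by blast
  obtain L where L: "L > 0" "\<And>f. f \<in> L2 M \<Longrightarrow> L2_norm M (T f) \<le> L * L2_norm M f"
    using bounded_ops_bound[OF T] by blast
  show ?thesis
  proof (rule bounded_opsI[where K = "K + L"])
    fix f g assume f: "f \<in> L2 M" and g: "g \<in> L2 M"
    show "AE x in M. op_add S T (\<lambda>y. f y + g y) x = op_add S T f x + op_add S T g x"
      using bounded_ops_add[OF S f g] bounded_ops_add[OF T f g]
      by eventually_elim (simp add: op_add_def)
  next
    fix c f assume f: "f \<in> L2 M"
    show "AE x in M. op_add S T (\<lambda>y. c * f y) x = c * op_add S T f x"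
      using bounded_ops_scale[OF S f, of c] bounded_ops_scale[OF T f, of c]
      by eventually_elim (simp add: op_add_def distrib_left)
  next
    fix f assume f: "f \<in> L2 M"
    show "L2_norm M (op_add S T f) \<le> (K + L) * L2_norm M f"
      using L2_norm_triangle[OF bounded_ops_L2[OF S f] bounded_ops_L2[OF T f]] K(2)[OF f] L(2)[OF f]
      by (simp add: op_add_def distrib_right)
  qed (use S T bounded_ops_L2 in \<open>auto simp: op_add_def\<close>)
qed

lemma bounded_ops_op_scale:
  assumes T: "T \<in> bounded_ops M"
  shows "op_scale c T \<in> bounded_ops M"
proof -
  obtain L where L: "L > 0" "\<And>f. f \<in> L2 M \<Longrightarrow> L2_norm M (T f) \<le> L * L2_norm M f"
    using bounded_ops_bound[OF T] by blast
  show ?thesis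
  proof (rule bounded_opsI[where K = "cmod c * L"])
    fix f g assume f: "f \<in> L2 M" and g: "g \<in> L2 M"
    show "AE x in M. op_scale c T (\<lambda>y. f y + g y) x = op_scale c T f x + op_scale c T g x"
      using bounded_ops_add[OF T f g] by eventually_elim (simp add: op_scale_def distrib_left)
  next
    fix d f assume f: "f \<in> L2 M"
    show "AE x in M. op_scale c T (\<lambda>y. d * f y) x = d * op_scale c T f x"
      using bounded_ops_scale[OF T f, of d] by eventually_elim (simp add: op_scale_def)
  next
    fix f assume f: "f \<in> L2 M"
    show "L2_norm M (op_scale c T f) \<le> cmod c * L * L2_norm M f"
      using mult_left_mono[OF L(2)[OF f] norm_ge_zero[of c]]
      by (simp add: op_scale_def L2_norm_scale mult.assoc)
  qed (use T bounded_ops_L2 in \<open>auto simp: op_scale_def\<close>)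
qed

section \<open>Equality and extension of bounded operators\<close>

lemma op_eqD: "op_eq M S T \<Longrightarrow> f \<in> L2 M \<Longrightarrow> AE x in M. S f x = T f x"
  by (simp add: op_eq_def)

lemma op_eq_sym: "op_eq M S T \<Longrightarrow> op_eq M T S"
  unfolding op_eq_def by (simp add: eq_commute)

lemma op_eq_trans:
  assumes "op_eq M R S" "op_eq M S T" shows "op_eq M R T"
  unfolding op_eq_def
proof
  fix f assume f: "f \<in> L2 M"
  from op_eqD[OF assms(1) f] op_eqD[OF assms(2) f] show "AE x in M. R f x = T f x"
    by eventually_elim simp
qed

text \<open>Two bounded operators agree on a closed subspace. In this way the cocycle relation is
  finally reduced to indicators of products of three basic sets.\<close>

lemma op_eq_generates:
  assumes gen: "generates M E" and S: "S \<in> bounded_ops M" and T: "T \<in> bounded_ops M"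
    and eq: "\<And>A. A \<in> E \<Longrightarrow> AE x in M. S (\<lambda>x. indicator A x) x = T (\<lambda>x. indicator A x) x"
  shows "op_eq M S T"
  unfolding op_eq_def
proof
  fix f assume "f \<in> L2 M"
  with gen show "AE x in M. S f x = T f x"
  proof (induction rule: L2_induct)
    case (add f g)
    show ?case
      using bounded_ops_add[OF S add.hyps] bounded_ops_add[OF T add.hyps] add.IH
      by eventually_elim simp
  next
    case (scale c f)
    show ?case
      using bounded_ops_scale[OF S scale.hyps, of c] bounded_ops_scale[OF T scale.hyps, of c] scale.IH
      by eventually_elim simp
  next
    case (lim f)
    note f = lim.hyps
    note SL = bounded_ops_L2[OF S] and TL = bounded_ops_L2[OF T]
    obtain K where K: "K > 0" "\<And>f. f \<in> L2 M \<Longrightarrow> L2_norm M (S f) \<le> K * L2_norm M f"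
      using bounded_ops_bound[OF S] by blast
    obtain L where L: "L > 0" "\<And>f. f \<in> L2 M \<Longrightarrow> L2_norm M (T f) \<le> L * L2_norm M f"
      using bounded_ops_bound[OF T] by blast
    have "L2_norm M (\<lambda>x. S f x - T f x) \<le> 0"
    proof (rule field_le_epsilon)
      fix e :: real assume e: "e > 0"
      have KL: "K + L > 0" using K L by simp
      obtain g where g: "g \<in> L2 M" "AE x in M. S g x = T g x" "L2_norm M (\<lambda>x. f x - g x) < e / (K + L)"
        using lim.IH[of "e / (K + L)"] e KL by auto
      have fg: "(\<lambda>x. f x - g x) \<in> L2 M" "(\<lambda>x. g x - f x) \<in> L2 M" using f g by auto
      have "L2_norm M (\<lambda>x. S f x - T f x)
          = L2_norm M (\<lambda>x. S (\<lambda>y. f y - g y) x + T (\<lambda>y. g y - f y) x)"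
      proof (rule L2_norm_cong_AE)
        show "AE x in M. S f x - T f x = S (\<lambda>y. f y - g y) x + T (\<lambda>y. g y - f y) x"
          using bounded_ops_diff[OF S f g(1)] bounded_ops_diff[OF T g(1) f] g(2)
          by eventually_elim simp
      qed (use L2_measurable[OF SL] L2_measurable[OF TL] f g fg in auto)
      also have "\<dots> \<le> K * L2_norm M (\<lambda>y. f y - g y) + L * L2_norm M (\<lambda>y. g y - f y)"
        using L2_norm_triangle[OF SL[OF fg(1)] TL[OF fg(2)]] K(2)[OF fg(1)] L(2)[OF fg(2)] by linarith
      also have "\<dots> = (K + L) * L2_norm M (\<lambda>y. f y - g y)"
        by (simp add: L2_norm_minus_commute[of M g f] distrib_right)
      also have "\<dots> \<le> 0 + e" using g(3) KL by (simp add: field_simps)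
      finally show "L2_norm M (\<lambda>x. S f x - T f x) \<le> 0 + e" .
    qed
    then have "L2_norm M (\<lambda>x. S f x - T f x) = 0"
      using L2_norm_nonneg[of M "\<lambda>x. S f x - T f x"] by linarith
    from L2_norm_eq_0[OF L2_diff[OF SL[OF f] TL[OF f]] this] show ?case by simp
  qed (rule eq)
qed

text \<open>Extension by density, with values chosen up to null sets. Linearity of the chosen
  extension is recovered almost everywhere from the uniqueness of limits.\<close>

theorem bounded_op_extend:
  assumes D: "D \<subseteq> L2 M" and dense: "\<And>f e. f \<in> L2 M \<Longrightarrow> e > 0 \<Longrightarrow> \<exists>g\<in>D. L2_norm M (\<lambda>x. f x - g x) < e"
    and Dadd: "\<And>f g. f \<in> D \<Longrightarrow> g \<in> D \<Longrightarrow> (\<lambda>x. f x + g x) \<in> D"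
    and Dscale: "\<And>c f. f \<in> D \<Longrightarrow> (\<lambda>x. c * f x) \<in> D"
    and R: "\<And>f. f \<in> D \<Longrightarrow> R f \<in> L2 M"
    and Radd: "\<And>f g. f \<in> D \<Longrightarrow> g \<in> D \<Longrightarrow> AE x in M. R (\<lambda>x. f x + g x) x = R f x + R g x"
    and Rscale: "\<And>c f. f \<in> D \<Longrightarrow> AE x in M. R (\<lambda>x. c * f x) x = c * R f x"
    and Rbd: "\<And>f. f \<in> D \<Longrightarrow> L2_norm M (R f) \<le> K * L2_norm M f" and K: "K > 0"
  shows "\<exists>T\<in>bounded_ops M. \<forall>f\<in>D. AE x in M. T f x = R f x"
proof -
  have DL: "f \<in> L2 M" if "f \<in> D" for f using D that by blast
  note Rm = L2_measurable[OF R]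
  have Ddiff: "(\<lambda>x. f x - g x) \<in> D" if "f \<in> D" "g \<in> D" for f g
    using Dadd[OF that(1) Dscale[OF that(2), of "-1"]] by simp
  have Rdiff: "L2_norm M (\<lambda>x. R f x - R g x) \<le> K * L2_norm M (\<lambda>x. f x - g x)"
    if f: "f \<in> D" and g: "g \<in> D" for f g
  proof -
    have "L2_norm M (\<lambda>x. R f x - R g x) = L2_norm M (R (\<lambda>x. f x - g x))"
    proof (rule L2_norm_cong_AE)
      have "AE x in M. R (\<lambda>x. f x + (-1) * g x) x = R f x + R (\<lambda>x. (-1) * g x) x"
        by (rule Radd[OF f Dscale[OF g]])
      with Rscale[OF g, of "-1"] show "AE x in M. R f x - R g x = R (\<lambda>x. f x - g x) x"
        by eventually_elim simp
    qed (use Rm f g Ddiff in auto)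
    also have "\<dots> \<le> K * L2_norm M (\<lambda>x. f x - g x)" by (rule Rbd[OF Ddiff[OF f g]])
    finally show ?thesis .
  qed
  \<comment> \<open>\<open>Lim f g\<close> says that (f, g) lies in the closure of the graph of
    \<open>R\<close>. The linear structure of the graph passes to this closure.\<close>
  define Lim where "Lim f g \<longleftrightarrow> g \<in> L2 M \<and>
    (\<forall>e>0. \<exists>h\<in>D. L2_norm M (\<lambda>x. f x - h x) < e \<and> L2_norm M (\<lambda>x. g x - R h x) < e)" for f g
  have ex: "\<exists>g. Lim f g" if f: "f \<in> L2 M" for f
  proof -
    have "\<exists>h\<in>D. L2_norm M (\<lambda>x. f x - h x) < (1/2)^k" for k :: nat by (rule dense[OF f]) simp
    then obtain h where h: "\<And>k. h k \<in> D" "\<And>k. L2_norm M (\<lambda>x. f x - h k x) < (1/2)^k" by metis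
    have h0: "(\<lambda>k. L2_norm M (\<lambda>x. f x - h k x)) \<longlonglongrightarrow> 0"
      by (rule Lim_null_comparison[OF _ LIMSEQ_power_zero[of "1/2::real"]])
         (use h(2) in \<open>auto intro!: always_eventually less_imp_le\<close>)
    have "\<exists>g\<in>L2 M. (\<lambda>n. L2_norm M (\<lambda>x. R (h n) x - g x)) \<longlonglongrightarrow> 0"
    proof (rule L2_complete)
      fix e :: real assume e: "e > 0"
      have "\<forall>\<^sub>F k in sequentially. L2_norm M (\<lambda>x. f x - h k x) < e / (2 * K)"
        using h0 by (rule order_tendstoD(2)) (use e K in simp)
      then obtain N where N: "\<And>k. k \<ge> N \<Longrightarrow> L2_norm M (\<lambda>x. f x - h k x) < e / (2 * K)"
        by (auto simp: eventually_sequentially)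
      have "L2_norm M (\<lambda>x. R (h m) x - R (h n) x) < e" if "m \<ge> N" "n \<ge> N" for m n
      proof -
        have "L2_norm M (\<lambda>x. R (h m) x - R (h n) x) \<le> K * L2_norm M (\<lambda>x. h m x - h n x)"
          by (rule Rdiff[OF h(1) h(1)])
        also have "\<dots> \<le> K * (L2_norm M (\<lambda>x. f x - h m x) + L2_norm M (\<lambda>x. f x - h n x))"
          using L2_norm_triangle_diff[OF DL[OF h(1)[of m]] f DL[OF h(1)[of n]]] K
          by (simp add: L2_norm_minus_commute[of M "h m" f])
        also have "\<dots> < K * (e / (2 * K) + e / (2 * K))"
          using N[OF that(1)] N[OF that(2)] K by (intro mult_strict_left_mono) auto
        also have "\<dots> = e" using K by (simp add: field_simps)
        finally show ?thesis .
      qed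
      then show "\<exists>N. \<forall>m\<ge>N. \<forall>n\<ge>N. L2_norm M (\<lambda>x. R (h m) x - R (h n) x) < e" by blast
    qed (use R h in auto)
    then obtain g where g: "g \<in> L2 M" "(\<lambda>n. L2_norm M (\<lambda>x. R (h n) x - g x)) \<longlonglongrightarrow> 0" by auto
    have "Lim f g" unfolding Lim_def
    proof (intro conjI allI impI)
      fix e :: real assume e: "e > 0"
      have "\<forall>\<^sub>F k in sequentially. L2_norm M (\<lambda>x. f x - h k x) < e \<and> L2_norm M (\<lambda>x. R (h k) x - g x) < e"
        using order_tendstoD(2)[OF h0 e] order_tendstoD(2)[OF g(2) e] by (rule eventually_conj)
      then obtain k where "L2_norm M (\<lambda>x. f x - h k x) < e" "L2_norm M (\<lambda>x. R (h k) x - g x) < e"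
        by (auto simp: eventually_sequentially)
      then show "\<exists>h\<in>D. L2_norm M (\<lambda>x. f x - h x) < e \<and> L2_norm M (\<lambda>x. g x - R h x) < e"
        using h(1)[of k] by (auto simp: L2_norm_minus_commute[of M g])
    qed (rule g)
    then show ?thesis by blast
  qed
  define T where "T f = (SOME g. Lim f g)" for f
  have T: "Lim f (T f)" if "f \<in> L2 M" for f
    unfolding T_def by (rule someI_ex[OF ex[OF that]])
  have uniq: "AE x in M. g x = g' x" if f: "f \<in> L2 M" and g: "Lim f g" "Lim f g'" for f g g'
  proof -
    have gL: "g \<in> L2 M" "g' \<in> L2 M" using g by (auto simp: Lim_def)
    have "L2_norm M (\<lambda>x. g x - g' x) \<le> 0"
    proof (rule field_le_epsilon)
      fix e :: real assume e: "e > 0"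
      \<comment> \<open>Two errors enter directly and two more after multiplication by K; with equal
        errors d this gives (2 + 2 * K) * d.\<close>
      have e': "e / (2 + 2 * K) > 0" using e K by simp
      obtain h where h: "h \<in> D" "L2_norm M (\<lambda>x. f x - h x) < e / (2 + 2 * K)"
        "L2_norm M (\<lambda>x. g x - R h x) < e / (2 + 2 * K)"
        using g(1) e' unfolding Lim_def by blast
      obtain h' where h': "h' \<in> D" "L2_norm M (\<lambda>x. f x - h' x) < e / (2 + 2 * K)"
        "L2_norm M (\<lambda>x. g' x - R h' x) < e / (2 + 2 * K)"
        using g(2) e' unfolding Lim_def by blast
      have "L2_norm M (\<lambda>x. h x - h' x) \<le> L2_norm M (\<lambda>x. h x - f x) + L2_norm M (\<lambda>x. f x - h' x)"
        by (rule L2_norm_triangle_diff) (use f h h' DL in auto)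
      then have "L2_norm M (\<lambda>x. h x - h' x) \<le> e / (2 + 2 * K) + e / (2 + 2 * K)"
        using h(2) h'(2) by (simp add: L2_norm_minus_commute[of M h f])
      then have "K * L2_norm M (\<lambda>x. h x - h' x) \<le> K * (e / (2 + 2 * K) + e / (2 + 2 * K))"
        using K by (intro mult_left_mono) auto
      then have "L2_norm M (\<lambda>x. R h x - R h' x) \<le> K * (e / (2 + 2 * K) + e / (2 + 2 * K))"
        using Rdiff[OF h(1) h'(1)] by linarith
      moreover have "L2_norm M (\<lambda>x. g x - g' x) \<le> L2_norm M (\<lambda>x. g x - R h x) + L2_norm M (\<lambda>x. R h x - g' x)"
        by (rule L2_norm_triangle_diff) (use gL R h in auto)
      moreover have "L2_norm M (\<lambda>x. R h x - g' x) \<le> L2_norm M (\<lambda>x. R h x - R h' x) + L2_norm M (\<lambda>x. R h' x - g' x)"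
        by (rule L2_norm_triangle_diff) (use gL R h h' in auto)
      ultimately have "L2_norm M (\<lambda>x. g x - g' x)
          \<le> e / (2 + 2 * K) + K * (e / (2 + 2 * K) + e / (2 + 2 * K)) + e / (2 + 2 * K)"
        using h(3) h'(3) by (simp add: L2_norm_minus_commute[of M "R h'" g'])
      also have "\<dots> = 0 + e"
      proof -
        have *: "d + K * (d + d) + d = (2 + 2 * K) * d" for d by (simp add: algebra_simps)
        show ?thesis unfolding * using K by simp
      qed
      finally show "L2_norm M (\<lambda>x. g x - g' x) \<le> 0 + e" .
    qed
    then have "L2_norm M (\<lambda>x. g x - g' x) = 0"
      using L2_norm_nonneg[of M "\<lambda>x. g x - g' x"] by linarith
    from L2_norm_eq_0[OF L2_diff[OF gL] this] show ?thesis by simp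
  qed
  have "T \<in> bounded_ops M"
  proof (rule bounded_opsI[where K = K])
    fix f assume f: "f \<in> L2 M"
    show TfL: "T f \<in> L2 M" using T[OF f] by (simp add: Lim_def)
    show "L2_norm M (T f) \<le> K * L2_norm M f"
    proof (rule field_le_epsilon)
      fix e :: real assume e: "e > 0"
      have e': "e / (1 + K) > 0" using e K by simp
      obtain h where h: "h \<in> D" "L2_norm M (\<lambda>x. f x - h x) < e / (1 + K)"
        "L2_norm M (\<lambda>x. T f x - R h x) < e / (1 + K)"
        using T[OF f] e' unfolding Lim_def by blast
      have "L2_norm M h \<le> L2_norm M f + L2_norm M (\<lambda>x. f x - h x)"
        using L2_norm_triangle[OF f L2_diff[OF DL[OF h(1)] f]] by (simp add: L2_norm_minus_commute[of M h f])
      then have "K * L2_norm M h \<le> K * (L2_norm M f + e / (1 + K))"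
        using h(2) K by (intro mult_left_mono) auto
      moreover have "L2_norm M (T f) \<le> L2_norm M (\<lambda>x. T f x - R h x) + L2_norm M (R h)"
        using L2_norm_triangle[OF L2_diff[OF TfL R[OF h(1)]] R[OF h(1)]] by simp
      ultimately have "L2_norm M (T f) \<le> e / (1 + K) + K * (L2_norm M f + e / (1 + K))"
        using Rbd[OF h(1)] h(3) by linarith
      also have "\<dots> = K * L2_norm M f + e"
      proof -
        have *: "d + K * (L2_norm M f + d) = K * L2_norm M f + (1 + K) * d" for d by (simp add: algebra_simps)
        show ?thesis unfolding * using K by simp
      qed
      finally show "L2_norm M (T f) \<le> K * L2_norm M f + e" .
    qed
  next
    fix f g assume f: "f \<in> L2 M" and g: "g \<in> L2 M"
    have TL: "T f \<in> L2 M" "T g \<in> L2 M" using T[OF f] T[OF g] by (auto simp: Lim_def)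
    have "Lim (\<lambda>x. f x + g x) (\<lambda>x. T f x + T g x)" unfolding Lim_def
    proof (intro conjI allI impI)
      show "(\<lambda>x. T f x + T g x) \<in> L2 M" using TL by auto
      fix e :: real assume e: "e > 0"
      then have e2: "e / 2 > 0" by simp
      obtain h where h: "h \<in> D" "L2_norm M (\<lambda>x. f x - h x) < e / 2" "L2_norm M (\<lambda>x. T f x - R h x) < e / 2"
        using T[OF f] e2 unfolding Lim_def by blast
      obtain h' where h': "h' \<in> D" "L2_norm M (\<lambda>x. g x - h' x) < e / 2" "L2_norm M (\<lambda>x. T g x - R h' x) < e / 2"
        using T[OF g] e2 unfolding Lim_def by blast
      have "L2_norm M (\<lambda>x. (f x - h x) + (g x - h' x)) < e"
        using L2_norm_triangle[OF L2_diff[OF f DL[OF h(1)]] L2_diff[OF g DL[OF h'(1)]]] h(2) h'(2) by simp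
      moreover have "L2_norm M (\<lambda>x. T f x + T g x - R (\<lambda>x. h x + h' x) x)
          = L2_norm M (\<lambda>x. (T f x - R h x) + (T g x - R h' x))"
      proof (rule L2_norm_cong_AE)
        show "AE x in M. T f x + T g x - R (\<lambda>x. h x + h' x) x = (T f x - R h x) + (T g x - R h' x)"
          using Radd[OF h(1) h'(1)] by eventually_elim simp
      qed (use L2_measurable[OF TL(1)] L2_measurable[OF TL(2)] Rm h h' Dadd in auto)
      moreover have "L2_norm M (\<lambda>x. (T f x - R h x) + (T g x - R h' x)) < e"
        using L2_norm_triangle[OF L2_diff[OF TL(1) R[OF h(1)]] L2_diff[OF TL(2) R[OF h'(1)]]] h(3) h'(3) by simp
      ultimately show "\<exists>h\<in>D. L2_norm M (\<lambda>x. f x + g x - h x) < e \<and>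
          L2_norm M (\<lambda>x. T f x + T g x - R h x) < e"
        by (intro bexI[of _ "\<lambda>x. h x + h' x"] conjI) (use Dadd[OF h(1) h'(1)] in \<open>auto simp: algebra_simps\<close>)
    qed
    then show "AE x in M. T (\<lambda>y. f y + g y) x = T f x + T g x"
      by (intro uniq[of "\<lambda>x. f x + g x"] T) (use f g in auto)
  next
    fix c f assume f: "f \<in> L2 M"
    have TL: "T f \<in> L2 M" using T[OF f] by (auto simp: Lim_def)
    have "Lim (\<lambda>x. c * f x) (\<lambda>x. c * T f x)" unfolding Lim_def
    proof (intro conjI allI impI)
      show "(\<lambda>x. c * T f x) \<in> L2 M" using TL by auto
      fix e :: real assume e: "e > 0"
      have pos: "cmod c + 1 > 0" using norm_ge_zero[of c] by linarith
      have e2: "e / (cmod c + 1) > 0" using e pos by simp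
      obtain h where h: "h \<in> D" "L2_norm M (\<lambda>x. f x - h x) < e / (cmod c + 1)"
        "L2_norm M (\<lambda>x. T f x - R h x) < e / (cmod c + 1)"
        using T[OF f] e2 unfolding Lim_def by blast
      have lt: "cmod c * r < e" if "r < e / (cmod c + 1)" "r \<ge> 0" for r
      proof -
        have "cmod c * r \<le> (cmod c + 1) * r" using that by (intro mult_right_mono) auto
        also have "\<dots> < (cmod c + 1) * (e / (cmod c + 1))" using that pos by (intro mult_strict_left_mono) auto
        also have "\<dots> = e" using pos by simp
        finally show ?thesis .
      qed
      have "L2_norm M (\<lambda>x. c * (f x - h x)) < e" unfolding L2_norm_scale by (rule lt[OF h(2)]) simp
      moreover have "L2_norm M (\<lambda>x. c * T f x - R (\<lambda>x. c * h x) x) = L2_norm M (\<lambda>x. c * (T f x - R h x))"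
      proof (rule L2_norm_cong_AE)
        show "AE x in M. c * T f x - R (\<lambda>x. c * h x) x = c * (T f x - R h x)"
          using Rscale[OF h(1), of c] by eventually_elim (simp add: right_diff_distrib)
      qed (use L2_measurable[OF TL] Rm h Dscale in auto)
      moreover have "L2_norm M (\<lambda>x. c * (T f x - R h x)) < e" unfolding L2_norm_scale by (rule lt[OF h(3)]) simp
      ultimately show "\<exists>h\<in>D. L2_norm M (\<lambda>x. c * f x - h x) < e \<and> L2_norm M (\<lambda>x. c * T f x - R h x) < e"
        by (intro bexI[of _ "\<lambda>x. c * h x"] conjI) (use Dscale[OF h(1)] in \<open>auto simp: right_diff_distrib\<close>)
    qed
    then show "AE x in M. T (\<lambda>y. c * f y) x = c * T f x"
      by (intro uniq[of "\<lambda>x. c * f x"] T) (use f in auto)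
  qed
  moreover have "AE x in M. T f x = R f x" if "f \<in> D" for f
  proof (rule uniq[OF DL[OF that] T[OF DL[OF that]]])
    show "Lim f (R f)" unfolding Lim_def using that R by (auto intro!: bexI[of _ f])
  qed
  ultimately show ?thesis by blast
qed

section \<open>Tensor products of operators\<close>

lemma generates_dense:
  assumes gen: "generates M E" and f: "f \<in> L2 M" and e: "e > (0::real)"
    and D: "D \<subseteq> L2 M" and ind: "\<And>A. A \<in> E \<Longrightarrow> (\<lambda>x. indicator A x) \<in> D"
    and Dadd: "\<And>f g. f \<in> D \<Longrightarrow> g \<in> D \<Longrightarrow> (\<lambda>x. f x + g x) \<in> D"
    and Dscale: "\<And>c f. f \<in> D \<Longrightarrow> (\<lambda>x. c * f x) \<in> D"
  shows "\<exists>g\<in>D. L2_norm M (\<lambda>x. f x - g x) < e"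
proof -
  have DL: "f \<in> L2 M" if "f \<in> D" for f using D that by blast
  have "\<forall>e>0. \<exists>g\<in>D. L2_norm M (\<lambda>x. f x - g x) < e"
    using gen f
  proof (induction rule: L2_induct)
    case (indicator A)
    then show ?case using ind[OF indicator] by (auto intro!: bexI[of _ "\<lambda>x. indicator A x"])
  next
    case (add f g)
    show ?case
    proof (intro allI impI)
      fix e :: real assume "e > 0"
      then have e2: "e / 2 > 0" by simp
      obtain f' where f': "f' \<in> D" "L2_norm M (\<lambda>x. f x - f' x) < e / 2" using add.IH(1) e2 by blast
      obtain g' where g': "g' \<in> D" "L2_norm M (\<lambda>x. g x - g' x) < e / 2" using add.IH(2) e2 by blast
      have "L2_norm M (\<lambda>x. (f x - f' x) + (g x - g' x)) < e"
        using L2_norm_triangle[OF L2_diff[OF add.hyps(1) DL[OF f'(1)]] L2_diff[OF add.hyps(2) DL[OF g'(1)]]]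
          f'(2) g'(2) by simp
      then show "\<exists>h\<in>D. L2_norm M (\<lambda>x. f x + g x - h x) < e"
        by (intro bexI[of _ "\<lambda>x. f' x + g' x"] Dadd f' g') (simp add: algebra_simps)
    qed
  next
    case (scale c f)
    show ?case
    proof (intro allI impI)
      fix e :: real assume e: "e > 0"
      have pos: "cmod c + 1 > 0" using norm_ge_zero[of c] by linarith
      have e2: "e / (cmod c + 1) > 0" using e pos by simp
      obtain h where h: "h \<in> D" "L2_norm M (\<lambda>x. f x - h x) < e / (cmod c + 1)"
        using scale.IH e2 by blast
      have "cmod c * L2_norm M (\<lambda>x. f x - h x) \<le> (cmod c + 1) * L2_norm M (\<lambda>x. f x - h x)"
        by (intro mult_right_mono) auto
      also have "\<dots> < (cmod c + 1) * (e / (cmod c + 1))" using h(2) pos by (intro mult_strict_left_mono) auto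
      also have "\<dots> = e" using pos by simp
      finally have "L2_norm M (\<lambda>x. c * (f x - h x)) < e" by (simp add: L2_norm_scale)
      then show "\<exists>h\<in>D. L2_norm M (\<lambda>x. c * f x - h x) < e"
        by (intro bexI[of _ "\<lambda>x. c * h x"] Dscale h) (simp add: algebra_simps)
    qed
  next
    case (lim f)
    show ?case
    proof (intro allI impI)
      fix e :: real assume "e > 0"
      then have e2: "e / 2 > 0" by simp
      obtain g where g: "g \<in> L2 M" "\<forall>e>0. \<exists>h\<in>D. L2_norm M (\<lambda>x. g x - h x) < e"
        "L2_norm M (\<lambda>x. f x - g x) < e / 2" using lim.IH[OF e2] by blast
      obtain h where h: "h \<in> D" "L2_norm M (\<lambda>x. g x - h x) < e / 2" using g(2) e2 by blast
      have "L2_norm M (\<lambda>x. f x - h x) < e"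
        using L2_norm_triangle_diff[OF lim.hyps g(1) DL[OF h(1)]] g(3) h(2) by linarith
      then show "\<exists>h\<in>D. L2_norm M (\<lambda>x. f x - h x) < e" using h(1) by blast
    qed
  qed
  then show ?thesis using e by blast
qed

lemma L2_tensor:
  assumes "sigma_finite_measure N" and f: "f \<in> L2 M" and g: "g \<in> L2 N"
  shows "(\<lambda>(x, y). f x * g y) \<in> L2 (M \<Otimes>\<^sub>M N)"
    and "L2_norm (M \<Otimes>\<^sub>M N) (\<lambda>(x, y). f x * g y) = L2_norm M f * L2_norm N g"
proof -
  interpret N: sigma_finite_measure N by fact
  have [measurable]: "f \<in> borel_measurable M" "g \<in> borel_measurable N" using f g by (auto simp: L2_def)
  let ?h = "\<lambda>(x, y). f x * g y"
  have hm: "?h \<in> borel_measurable (M \<Otimes>\<^sub>M N)" by measurable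
  have "(\<integral>\<^sup>+z. ennreal ((cmod (?h z))\<^sup>2) \<partial>(M \<Otimes>\<^sub>M N)) =
      (\<integral>\<^sup>+x. \<integral>\<^sup>+y. ennreal ((cmod (?h (x, y)))\<^sup>2) \<partial>N \<partial>M)"
    by (rule N.nn_integral_fst[symmetric]) measurable
  also have "\<dots> = (\<integral>\<^sup>+x. \<integral>\<^sup>+y. ennreal ((cmod (f x))\<^sup>2) * ennreal ((cmod (g y))\<^sup>2) \<partial>N \<partial>M)"
    by (simp add: norm_mult power_mult_distrib ennreal_mult)
  also have "\<dots> = ennreal ((L2_norm M f)\<^sup>2) * ennreal ((L2_norm N g)\<^sup>2)"
    by (simp add: nn_integral_cmult nn_integral_multc nn_integral_L2[OF f] nn_integral_L2[OF g])
  also have "\<dots> = ennreal ((L2_norm M f * L2_norm N g)\<^sup>2)"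
    by (simp add: ennreal_mult power_mult_distrib)
  finally have eq: "(\<integral>\<^sup>+z. ennreal ((cmod (?h z))\<^sup>2) \<partial>(M \<Otimes>\<^sub>M N)) =
      ennreal ((L2_norm M f * L2_norm N g)\<^sup>2)" .
  show L2: "?h \<in> L2 (M \<Otimes>\<^sub>M N)" by (rule L2I_nn(1)[OF hm, of "L2_norm M f * L2_norm N g"]) (simp add: eq)
  have "(L2_norm (M \<Otimes>\<^sub>M N) ?h)\<^sup>2 = (L2_norm M f * L2_norm N g)\<^sup>2"
    using eq unfolding nn_integral_L2[OF L2] by simp
  then show "L2_norm (M \<Otimes>\<^sub>M N) ?h = L2_norm M f * L2_norm N g"
    by (rule power2_eq_imp_eq) auto
qed

lemma AE_pair_sections:
  assumes "sigma_finite_measure M" "sigma_finite_measure N"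
    and "u \<in> borel_measurable (M \<Otimes>\<^sub>M N)" "w \<in> borel_measurable (M \<Otimes>\<^sub>M N)"
    and "\<And>x. x \<in> space M \<Longrightarrow> AE y in N. u (x, y) = (w (x, y) :: complex)"
  shows "AE z in M \<Otimes>\<^sub>M N. u z = w z"
proof -
  interpret pair_sigma_finite M N using assms by (simp add: pair_sigma_finite_def)
  note [measurable] = assms(3,4)
  show ?thesis by (rule AE_pair_measure) (use assms(5) in auto)
qed

text \<open>One would like to apply T to every section f(x, .), but for a general f the result need
  not be measurable in x. If only countably many sections occur, measurability is automatic, the
  norm bound holds fibre by fibre, and such functions are dense.\<close>

lemma ex_id_tensor:
  assumes M: "generates M E" and N: "generates N E'" and T: "T \<in> bounded_ops N"
  shows "\<exists>R\<in>bounded_ops (M \<Otimes>\<^sub>M N). \<forall>f\<in>L2 M. \<forall>g\<in>L2 N.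
    AE z in M \<Otimes>\<^sub>M N. R (\<lambda>(x, y). f x * g y) z = f (fst z) * T g (snd z)"
proof -
  have sfM: "sigma_finite_measure M" and sfN: "sigma_finite_measure N"
    using generates_sigma_finite M N by auto
  interpret N: sigma_finite_measure N by fact
  obtain K where K: "K > 0" "\<And>f. f \<in> L2 N \<Longrightarrow> L2_norm N (T f) \<le> K * L2_norm N f"
    using bounded_ops_bound[OF T] by blast
  note TL = bounded_ops_L2[OF T]
  let ?MN = "M \<Otimes>\<^sub>M N"
  \<comment> \<open>The index \<open>s x\<close> names the section of f over x, and \<open>G\<close>
    lists the sections.\<close>
  define rep where "rep f s G \<longleftrightarrow> s \<in> measurable M (count_space (UNIV :: nat set)) \<and>
    (\<forall>i. G i \<in> L2 N) \<and> (\<forall>x y. f (x, y) = G (s x) y)" for f s G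
  define D where "D = {f \<in> L2 ?MN. \<exists>s G. rep f s G}"
  have rep_rect: "rep (\<lambda>(x, y). indicator A x * g y) (\<lambda>x. if x \<in> A then 1 else 0) (\<lambda>i. if i = 1 then g else (\<lambda>y. 0))"
    if "A \<in> sets M" "g \<in> L2 N" for A g
    using that by (auto simp: rep_def intro!: measurable_If)
  have rect: "(\<lambda>(x, y). indicator A x * g y) \<in> D" if "A \<in> E" "g \<in> L2 N" for A g
    unfolding D_def using rep_rect[OF generates_sets[OF M that(1)] that(2)]
      L2_tensor(1)[OF sfN generates_L2[OF M that(1)] that(2)] by blast
  \<comment> \<open>A section of the sum is determined by a pair of indices, coded as one
    number.\<close>
  have rep_add: "rep (\<lambda>z. f z + g z) (\<lambda>x. prod_encode (s x, t x))
      (\<lambda>i y. G (fst (prod_decode i)) y + H (snd (prod_decode i)) y)"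
    if "rep f s G" "rep g t H" for f g s t G H
  proof -
    have [measurable]: "s \<in> measurable M (count_space UNIV)" "t \<in> measurable M (count_space UNIV)"
      using that by (auto simp: rep_def)
    have "(\<lambda>x. prod_encode (s x, t x)) \<in> measurable M (count_space UNIV)"
      by (rule measurable_compose_countable[of "\<lambda>i x. prod_encode (i, t x)", OF _ \<open>s \<in> _\<close>]) measurable
    then show ?thesis using that by (auto simp: rep_def)
  qed
  have rep_scale: "rep (\<lambda>z. c * f z) s (\<lambda>i y. c * G i y)" if "rep f s G" for c f s G
    using that by (auto simp: rep_def)
  have Dadd: "(\<lambda>z. f z + g z) \<in> D" if "f \<in> D" "g \<in> D" for f g
    using that rep_add unfolding D_def by blast
  have Dscale: "(\<lambda>z. c * f z) \<in> D" if "f \<in> D" for c f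
    using that rep_scale unfolding D_def by blast
  define R0 where "R0 f = (\<lambda>z. T (\<lambda>y. f (fst z, y)) (snd z))" for f :: "'a \<times> 'b \<Rightarrow> complex"
  have R0_rep: "R0 f z = T (G (s (fst z))) (snd z)" if "rep f s G" for f s G z
  proof -
    have "(\<lambda>y. f (fst z, y)) = G (s (fst z))" using that by (auto simp: rep_def)
    then show ?thesis by (simp add: R0_def)
  qed
  have R0_meas: "R0 f \<in> borel_measurable ?MN" if r: "rep f s G" for f s G
  proof -
    have [measurable]: "s \<in> measurable M (count_space UNIV)" "\<And>i. T (G i) \<in> borel_measurable N"
      using r L2_measurable[OF TL] by (auto simp: rep_def)
    have "(\<lambda>z. T (G (s (fst z))) (snd z)) \<in> borel_measurable ?MN"
      by (rule measurable_compose_countable[of "\<lambda>i z. T (G i) (snd z)"]) measurable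
    then show ?thesis using R0_rep[OF r] by (simp add: cong: measurable_cong)
  qed
  \<comment> \<open>Tonelli: the square of the norm is the integral of the squared norms of the
    sections, each enlarged at most by the factor K^2.\<close>
  have R0_bd: "(\<integral>\<^sup>+z. ennreal ((cmod (R0 f z))\<^sup>2) \<partial>?MN) \<le> ennreal ((K * L2_norm ?MN f)\<^sup>2)"
    if r: "rep f s G" and f: "f \<in> L2 ?MN" for f s G
  proof -
    note [measurable] = R0_meas[OF r] L2_measurable[OF f]
    have G: "G i \<in> L2 N" for i using r by (simp add: rep_def)
    have "(\<integral>\<^sup>+z. ennreal ((cmod (R0 f z))\<^sup>2) \<partial>?MN) = (\<integral>\<^sup>+x. \<integral>\<^sup>+y. ennreal ((cmod (R0 f (x, y)))\<^sup>2) \<partial>N \<partial>M)"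
      by (rule N.nn_integral_fst[symmetric]) measurable
    also have "\<dots> = (\<integral>\<^sup>+x. ennreal ((L2_norm N (T (G (s x))))\<^sup>2) \<partial>M)"
      by (simp add: R0_rep[OF r] nn_integral_L2[OF TL[OF G]])
    also have "\<dots> \<le> (\<integral>\<^sup>+x. ennreal (K\<^sup>2) * ennreal ((L2_norm N (G (s x)))\<^sup>2) \<partial>M)"
    proof (rule nn_integral_mono)
      fix x
      have "(L2_norm N (T (G (s x))))\<^sup>2 \<le> (K * L2_norm N (G (s x)))\<^sup>2"
        by (intro power_mono K(2) G) simp
      then show "ennreal ((L2_norm N (T (G (s x))))\<^sup>2) \<le> ennreal (K\<^sup>2) * ennreal ((L2_norm N (G (s x)))\<^sup>2)"
        by (simp add: power_mult_distrib flip: ennreal_mult)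
    qed
    also have "\<dots> = (\<integral>\<^sup>+x. ennreal (K\<^sup>2) * (\<integral>\<^sup>+y. ennreal ((cmod (f (x, y)))\<^sup>2) \<partial>N) \<partial>M)"
    proof (rule nn_integral_cong)
      fix x
      have "(\<integral>\<^sup>+y. ennreal ((cmod (f (x, y)))\<^sup>2) \<partial>N) = (\<integral>\<^sup>+y. ennreal ((cmod (G (s x) y))\<^sup>2) \<partial>N)"
        using r by (simp add: rep_def)
      then show "ennreal (K\<^sup>2) * ennreal ((L2_norm N (G (s x)))\<^sup>2) =
          ennreal (K\<^sup>2) * (\<integral>\<^sup>+y. ennreal ((cmod (f (x, y)))\<^sup>2) \<partial>N)"
        by (simp add: nn_integral_L2[OF G])
    qed
    also have "\<dots> = ennreal (K\<^sup>2) * (\<integral>\<^sup>+z. ennreal ((cmod (f z))\<^sup>2) \<partial>?MN)"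
      by (subst nn_integral_cmult)
         (measurable, simp add: N.nn_integral_fst[of "\<lambda>z. ennreal ((cmod (f z))\<^sup>2)"])
    also have "\<dots> = ennreal ((K * L2_norm ?MN f)\<^sup>2)"
      by (simp add: nn_integral_L2[OF f] power_mult_distrib flip: ennreal_mult)
    finally show ?thesis .
  qed
  have "\<exists>R\<in>bounded_ops ?MN. \<forall>f\<in>D. AE z in ?MN. R f z = R0 f z"
  proof (rule bounded_op_extend[where K = K])
    show DL: "D \<subseteq> L2 ?MN" by (auto simp: D_def)
    show "\<exists>g\<in>D. L2_norm ?MN (\<lambda>x. f x - g x) < e" if "f \<in> L2 ?MN" "e > 0" for f e
    proof (rule generates_dense[OF generates_pair[OF M N] that DL _ Dadd Dscale])
      fix X assume "X \<in> {A \<times> B |A B. A \<in> E \<and> B \<in> E'}"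
      then obtain A B where X: "X = A \<times> B" "A \<in> E" "B \<in> E'" by blast
      have "(\<lambda>(x, y). indicator A x * indicator B y) \<in> D"
        by (rule rect[OF X(2) generates_L2[OF N X(3)]])
      moreover have "(\<lambda>(x, y). indicator A x * indicator B y) = (\<lambda>z. indicator X z :: complex)"
        using X(1) by (auto simp: indicator_def fun_eq_iff)
      ultimately show "(\<lambda>z. indicator X z) \<in> D" by simp
    qed
    show "R0 f \<in> L2 ?MN" if f: "f \<in> D" for f
    proof -
      obtain s G where r: "rep f s G" "f \<in> L2 ?MN" using f by (auto simp: D_def)
      show ?thesis by (rule L2I_nn(1)[OF R0_meas[OF r(1)] R0_bd[OF r]])
    qed
    show "L2_norm ?MN (R0 f) \<le> K * L2_norm ?MN f" if f: "f \<in> D" for f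
    proof -
      obtain s G where r: "rep f s G" "f \<in> L2 ?MN" using f by (auto simp: D_def)
      show ?thesis by (rule L2I_nn(2)[OF R0_meas[OF r(1)] R0_bd[OF r]]) (use K in simp)
    qed
    show "AE z in ?MN. R0 (\<lambda>z. f z + g z) z = R0 f z + R0 g z" if fg: "f \<in> D" "g \<in> D" for f g
    proof -
      obtain s G where r: "rep f s G" using fg(1) by (auto simp: D_def)
      obtain t H where r': "rep g t H" using fg(2) by (auto simp: D_def)
      note [measurable] = R0_meas[OF r] R0_meas[OF r'] R0_meas[OF rep_add[OF r r']]
      show ?thesis
      proof (rule AE_pair_sections[OF sfM sfN])
        fix x
        have "AE y in N. T (\<lambda>y. G (s x) y + H (t x) y) y = T (G (s x)) y + T (H (t x)) y"
          by (rule bounded_ops_add[OF T]) (use r r' in \<open>auto simp: rep_def\<close>)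
        then show "AE y in N. R0 (\<lambda>z. f z + g z) (x, y) = R0 f (x, y) + R0 g (x, y)"
          by (simp add: R0_rep[OF r] R0_rep[OF r'] R0_rep[OF rep_add[OF r r']])
      qed measurable
    qed
    show "AE z in ?MN. R0 (\<lambda>z. c * f z) z = c * R0 f z" if f: "f \<in> D" for c f
    proof -
      obtain s G where r: "rep f s G" using f by (auto simp: D_def)
      note [measurable] = R0_meas[OF r] R0_meas[OF rep_scale[OF r]]
      show ?thesis
      proof (rule AE_pair_sections[OF sfM sfN])
        fix x
        have "AE y in N. T (\<lambda>y. c * G (s x) y) y = c * T (G (s x)) y"
          by (rule bounded_ops_scale[OF T]) (use r in \<open>auto simp: rep_def\<close>)
        then show "AE y in N. R0 (\<lambda>z. c * f z) (x, y) = c * R0 f (x, y)"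
          by (simp add: R0_rep[OF r] R0_rep[OF rep_scale[OF r]])
      qed measurable
    qed
  qed (use Dadd Dscale K in auto)
  then obtain R where R: "R \<in> bounded_ops ?MN" "\<And>f. f \<in> D \<Longrightarrow> AE z in ?MN. R f z = R0 f z" by blast
  obtain L where L: "L > 0" "\<And>f. f \<in> L2 ?MN \<Longrightarrow> L2_norm ?MN (R f) \<le> L * L2_norm ?MN f"
    using bounded_ops_bound[OF R(1)] by blast
  have "AE z in ?MN. R (\<lambda>(x, y). f x * g y) z = f (fst z) * T g (snd z)"
    if f: "f \<in> L2 M" and g: "g \<in> L2 N" for f g
  proof -
    note tens = L2_tensor(1)[OF sfN] and Tg = TL[OF g]
    show ?thesis
      using M f
    \<comment> \<open>So far the product formula is known if the first factor is the indicator of a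
      generator. Both sides are linear and continuous in that factor.\<close>
    proof (induction rule: L2_induct)
      case (indicator A)
      note r = rep_rect[OF generates_sets[OF M indicator] g]
      have "AE z in ?MN. T (\<lambda>y. 0) (snd z) = 0"
      proof (rule AE_pair_sections[OF sfM sfN])
        note [measurable] = L2_measurable[OF TL[OF L2_zero]]
        show "(\<lambda>z. T (\<lambda>y. 0) (snd z)) \<in> borel_measurable ?MN" by measurable
      qed (use bounded_ops_zero[OF T] in auto)
      with R(2)[OF rect[OF indicator g]] show ?case
        by eventually_elim (simp only: R0_rep[OF r], auto)
    next
      case (add f f')
      have "(\<lambda>(x, y). (f x + f' x) * g y) = (\<lambda>z. (case z of (x, y) \<Rightarrow> f x * g y) + (case z of (x, y) \<Rightarrow> f' x * g y))"
        by (auto simp: fun_eq_iff distrib_right)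
      with bounded_ops_add[OF R(1) tens[OF add.hyps(1) g] tens[OF add.hyps(2) g]]
      have "AE z in ?MN. R (\<lambda>(x, y). (f x + f' x) * g y) z =
          R (\<lambda>(x, y). f x * g y) z + R (\<lambda>(x, y). f' x * g y) z" by simp
      with add.IH show ?case by eventually_elim (simp add: distrib_right)
    next
      case (scale c f)
      have "(\<lambda>(x, y). (c * f x) * g y) = (\<lambda>z. c * (case z of (x, y) \<Rightarrow> f x * g y))"
        by (auto simp: fun_eq_iff)
      with bounded_ops_scale[OF R(1) tens[OF scale.hyps g], of c]
      have "AE z in ?MN. R (\<lambda>(x, y). (c * f x) * g y) z = c * R (\<lambda>(x, y). f x * g y) z" by simp
      with scale.IH show ?case by eventually_elim simp
    next
      case (lim f)
      note RL = bounded_ops_L2[OF R(1)]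
      let ?t = "\<lambda>f. \<lambda>(x, y). f x * g y" and ?u = "\<lambda>f. \<lambda>(x, y). f x * T g y"
      have "L2_norm ?MN (\<lambda>z. R (?t f) z - ?u f z) \<le> 0"
      proof (rule field_le_epsilon)
        fix e :: real assume e: "e > 0"
        define B where "B = L * L2_norm N g + L2_norm N (T g) + 1"
        have B: "B > 0" using L(1) by (auto simp: B_def intro!: add_nonneg_pos)
        obtain h where h: "h \<in> L2 M" "AE z in ?MN. R (?t h) z = h (fst z) * T g (snd z)"
          "L2_norm M (\<lambda>x. f x - h x) < e / B" using lim.IH[of "e / B"] e B by auto
        have "L2_norm ?MN (\<lambda>z. R (?t f) z - ?u f z) \<le>
            L2_norm ?MN (\<lambda>z. R (?t f) z - ?u h z) + L2_norm ?MN (\<lambda>z. ?u h z - ?u f z)"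
          by (intro L2_norm_triangle_diff RL tens lim.hyps h g Tg)
        also have "L2_norm ?MN (\<lambda>z. ?u h z - ?u f z) = L2_norm ?MN (?u (\<lambda>x. h x - f x))"
          by (rule arg_cong[where f = "L2_norm ?MN"]) (auto simp: fun_eq_iff left_diff_distrib)
        also have "\<dots> = L2_norm M (\<lambda>x. f x - h x) * L2_norm N (T g)"
          by (subst L2_tensor(2)[OF sfN]) (use lim.hyps h Tg in \<open>auto simp: L2_norm_minus_commute[of M f]\<close>)
        also have "L2_norm ?MN (\<lambda>z. R (?t f) z - ?u h z) = L2_norm ?MN (R (?t (\<lambda>x. f x - h x)))"
        proof (rule L2_norm_cong_AE)
          have "?t (\<lambda>x. f x - h x) = (\<lambda>z. ?t f z - ?t h z)" by (auto simp: fun_eq_iff left_diff_distrib)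
          with bounded_ops_diff[OF R(1) tens[OF lim.hyps g] tens[OF h(1) g]]
          have "AE z in ?MN. R (?t (\<lambda>x. f x - h x)) z = R (?t f) z - R (?t h) z" by simp
          with h(2) show "AE z in ?MN. R (?t f) z - ?u h z = R (?t (\<lambda>x. f x - h x)) z"
            by eventually_elim (simp add: case_prod_beta)
        qed (intro L2_measurable L2_diff RL tens lim.hyps h g Tg)+
        also have "\<dots> \<le> L * (L2_norm M (\<lambda>x. f x - h x) * L2_norm N g)"
          using L(2)[OF tens[OF L2_diff[OF lim.hyps h(1)] g]] L2_tensor(2)[OF sfN L2_diff[OF lim.hyps h(1)] g]
          by simp
        finally have "L2_norm ?MN (\<lambda>z. R (?t f) z - ?u f z) \<le>
            (L * L2_norm N g + L2_norm N (T g)) * L2_norm M (\<lambda>x. f x - h x)"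
          by (simp add: algebra_simps)
        also have "\<dots> \<le> B * (e / B)"
          by (rule mult_mono) (use h(3) B in \<open>auto simp: B_def\<close>)
        also have "\<dots> = 0 + e" using B by simp
        finally show "L2_norm ?MN (\<lambda>z. R (?t f) z - ?u f z) \<le> 0 + e" .
      qed
      then have "L2_norm ?MN (\<lambda>z. R (?t f) z - ?u f z) = 0"
        using L2_norm_nonneg[of ?MN "\<lambda>z. R (?t f) z - ?u f z"] by linarith
      from L2_norm_eq_0[OF L2_diff[OF RL[OF tens[OF lim.hyps g]] tens[OF lim.hyps Tg]] this]
      show ?case by eventually_elim (simp split: prod.splits)
    qed
  qed
  then show ?thesis using R(1) by blast
qed

section \<open>Measure preserving maps and tensor products of two operators\<close>

lemma L2_pullback:
  assumes \<phi>: "\<phi> \<in> measurable P Q" and d: "distr P Q \<phi> = Q" and f: "f \<in> L2 Q"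
  shows "(\<lambda>z. f (\<phi> z)) \<in> L2 P" "L2_norm P (\<lambda>z. f (\<phi> z)) = L2_norm Q f"
proof -
  have fm: "f \<in> borel_measurable Q" using f by (rule L2_measurable)
  have m: "(\<lambda>z. f (\<phi> z)) \<in> borel_measurable P" using \<phi> fm by (rule measurable_compose)
  have "(\<integral>\<^sup>+z. ennreal ((cmod (f (\<phi> z)))\<^sup>2) \<partial>P) = (\<integral>\<^sup>+z. ennreal ((cmod (f z))\<^sup>2) \<partial>(distr P Q \<phi>))"
    using fm by (subst nn_integral_distr[OF \<phi>]) auto
  then have eq: "(\<integral>\<^sup>+z. ennreal ((cmod (f (\<phi> z)))\<^sup>2) \<partial>P) = ennreal ((L2_norm Q f)\<^sup>2)"
    unfolding d nn_integral_L2[OF f] .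
  show L2: "(\<lambda>z. f (\<phi> z)) \<in> L2 P" by (rule L2I_nn(1)[OF m, of "L2_norm Q f"]) (simp add: eq)
  have "(L2_norm P (\<lambda>z. f (\<phi> z)))\<^sup>2 = (L2_norm Q f)\<^sup>2"
    using eq unfolding nn_integral_L2[OF L2] by simp
  then show "L2_norm P (\<lambda>z. f (\<phi> z)) = L2_norm Q f" by (rule power2_eq_imp_eq) auto
qed

lemma AE_pullback:
  "\<phi> \<in> measurable P Q \<Longrightarrow> distr P Q \<phi> = Q \<Longrightarrow> AE x in Q. Pr x \<Longrightarrow> AE x in P. Pr (\<phi> x)"
  by (metis AE_distrD)

text \<open>One statement for the flip of two factors, for reassociation of three factors and for
  the pullback along a single measure preserving map.\<close>

lemma bounded_ops_conj:
  assumes \<phi>: "\<phi> \<in> measurable P Q" "distr P Q \<phi> = Q"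
    and \<psi>: "\<psi> \<in> measurable Q P" "distr Q P \<psi> = P" and R: "R \<in> bounded_ops Q"
  shows "(\<lambda>f z. R (\<lambda>w. f (\<psi> w)) (\<phi> z)) \<in> bounded_ops P"
proof -
  obtain L where L: "L > 0" "\<And>f. f \<in> L2 Q \<Longrightarrow> L2_norm Q (R f) \<le> L * L2_norm Q f"
    using bounded_ops_bound[OF R] by blast
  note RL = bounded_ops_L2[OF R] and p\<phi> = L2_pullback[OF \<phi>] and p\<psi> = L2_pullback[OF \<psi>]
  show ?thesis
  proof (rule bounded_opsI[where K = L])
    fix f g assume "f \<in> L2 P" "g \<in> L2 P"
    then show "AE x in P. R (\<lambda>w. f (\<psi> w) + g (\<psi> w)) (\<phi> x) = R (\<lambda>w. f (\<psi> w)) (\<phi> x) + R (\<lambda>w. g (\<psi> w)) (\<phi> x)"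
      by (intro AE_pullback[OF \<phi>] bounded_ops_add[OF R] p\<psi>)
  next
    fix c f assume "f \<in> L2 P"
    then show "AE x in P. R (\<lambda>w. c * f (\<psi> w)) (\<phi> x) = c * R (\<lambda>w. f (\<psi> w)) (\<phi> x)"
      by (intro AE_pullback[OF \<phi>] bounded_ops_scale[OF R] p\<psi>)
  next
    fix f assume f: "f \<in> L2 P"
    show "(\<lambda>z. R (\<lambda>w. f (\<psi> w)) (\<phi> z)) \<in> L2 P" by (intro p\<phi> RL p\<psi> f)
    show "L2_norm P (\<lambda>z. R (\<lambda>w. f (\<psi> w)) (\<phi> z)) \<le> L * L2_norm P f"
      using L(2)[OF p\<psi>(1)[OF f]] p\<phi>(2)[OF RL[OF p\<psi>(1)[OF f]]] p\<psi>(2)[OF f] by simp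
  qed
qed

text \<open>S (x) T is the product of S (x) 1 and 1 (x) T, and S (x) 1 is conjugate to 1 (x) S under
  the flip.\<close>

lemma ex_op_tensor:
  assumes M: "generates M E" and N: "generates N E'" and S: "S \<in> bounded_ops M" and T: "T \<in> bounded_ops N"
  shows "\<exists>R\<in>bounded_ops (M \<Otimes>\<^sub>M N). \<forall>f\<in>L2 M. \<forall>g\<in>L2 N.
    AE z in M \<Otimes>\<^sub>M N. R (\<lambda>(x, y). f x * g y) z = S f (fst z) * T g (snd z)"
proof -
  have sf: "sigma_finite_measure M" "sigma_finite_measure N"
    using generates_sigma_finite M N by auto
  interpret MN: pair_sigma_finite M N using sf by (simp add: pair_sigma_finite_def)
  interpret NM: pair_sigma_finite N M using sf by (simp add: pair_sigma_finite_def)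
  let ?sw = "\<lambda>z. (snd z, fst z)"
  have sw: "?sw \<in> measurable (M \<Otimes>\<^sub>M N) (N \<Otimes>\<^sub>M M)" "distr (M \<Otimes>\<^sub>M N) (N \<Otimes>\<^sub>M M) ?sw = N \<Otimes>\<^sub>M M"
    using NM.distr_pair_swap by (auto simp: case_prod_beta')
  have sw': "?sw \<in> measurable (N \<Otimes>\<^sub>M M) (M \<Otimes>\<^sub>M N)" "distr (N \<Otimes>\<^sub>M M) (M \<Otimes>\<^sub>M N) ?sw = M \<Otimes>\<^sub>M N"
    using MN.distr_pair_swap by (auto simp: case_prod_beta')
  obtain R1 where R1: "R1 \<in> bounded_ops (M \<Otimes>\<^sub>M N)" "\<And>f g. f \<in> L2 M \<Longrightarrow> g \<in> L2 N \<Longrightarrow>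
      AE z in M \<Otimes>\<^sub>M N. R1 (\<lambda>(x, y). f x * g y) z = f (fst z) * T g (snd z)"
    using ex_id_tensor[OF M N T] by blast
  obtain R2 where R2: "R2 \<in> bounded_ops (N \<Otimes>\<^sub>M M)" "\<And>f g. f \<in> L2 N \<Longrightarrow> g \<in> L2 M \<Longrightarrow>
      AE z in N \<Otimes>\<^sub>M M. R2 (\<lambda>(x, y). f x * g y) z = f (fst z) * S g (snd z)"
    using ex_id_tensor[OF N M S] by blast
  define R3 where "R3 = (\<lambda>f z. R2 (\<lambda>w. f (?sw w)) (?sw z))"
  have R3: "R3 \<in> bounded_ops (M \<Otimes>\<^sub>M N)"
    unfolding R3_def by (rule bounded_ops_conj[OF sw sw' R2(1)])
  have "AE z in M \<Otimes>\<^sub>M N. (R3 \<circ> R1) (\<lambda>(x, y). f x * g y) z = S f (fst z) * T g (snd z)"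
    if f: "f \<in> L2 M" and g: "g \<in> L2 N" for f g
  proof -
    note tens = L2_tensor(1)[OF sf(2)] and Tg = bounded_ops_L2[OF T g]
    have "AE z in M \<Otimes>\<^sub>M N. R3 (R1 (\<lambda>(x, y). f x * g y)) z = R3 (\<lambda>(x, y). f x * T g y) z"
      by (rule bounded_ops_cong[OF R3 bounded_ops_L2[OF R1(1) tens[OF f g]] tens[OF f Tg]])
         (use R1(2)[OF f g] in \<open>simp add: case_prod_beta\<close>)
    moreover have "AE z in M \<Otimes>\<^sub>M N. R3 (\<lambda>(x, y). f x * T g y) z = T g (snd z) * S f (fst z)"
    proof -
      have "(\<lambda>w. (case ?sw w of (x, y) \<Rightarrow> f x * T g y)) = (\<lambda>(x, y). T g x * f y)"
        by (auto simp: fun_eq_iff)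
      then have "R3 (\<lambda>(x, y). f x * T g y) = (\<lambda>z. R2 (\<lambda>(x, y). T g x * f y) (?sw z))"
        by (simp only: R3_def)
      then show ?thesis using AE_pullback[OF sw R2(2)[OF Tg f]] by simp
    qed
    ultimately show ?thesis by eventually_elim (simp add: mult.commute)
  qed
  then show ?thesis using bounded_ops_comp[OF R3 R1(1)] by blast
qed

text \<open>\<open>op_tensor\<close> is a choice, and existence makes the chosen operator satisfy
  its specification.\<close>

lemma op_tensor:
  assumes "generates M E" "generates N E'" "S \<in> bounded_ops M" "T \<in> bounded_ops N"
  shows op_tensor_bounded: "op_tensor M N S T \<in> bounded_ops (M \<Otimes>\<^sub>M N)"
    and op_tensor_apply: "f \<in> L2 M \<Longrightarrow> g \<in> L2 N \<Longrightarrow>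
      AE z in M \<Otimes>\<^sub>M N. op_tensor M N S T (\<lambda>(x, y). f x * g y) z = S f (fst z) * T g (snd z)"
proof -
  have ex: "\<exists>R. R \<in> bounded_ops (M \<Otimes>\<^sub>M N) \<and> (\<forall>f\<in>L2 M. \<forall>g\<in>L2 N.
      AE z in M \<Otimes>\<^sub>M N. R (\<lambda>(x, y). f x * g y) z = S f (fst z) * T g (snd z))"
    using ex_op_tensor[OF assms] by blast
  have "op_tensor M N S T \<in> bounded_ops (M \<Otimes>\<^sub>M N) \<and> (\<forall>f\<in>L2 M. \<forall>g\<in>L2 N.
      AE z in M \<Otimes>\<^sub>M N. op_tensor M N S T (\<lambda>(x, y). f x * g y) z = S f (fst z) * T g (snd z))"
    unfolding op_tensor_def by (rule someI_ex[OF ex])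
  then show "op_tensor M N S T \<in> bounded_ops (M \<Otimes>\<^sub>M N)"
    "f \<in> L2 M \<Longrightarrow> g \<in> L2 N \<Longrightarrow>
      AE z in M \<Otimes>\<^sub>M N. op_tensor M N S T (\<lambda>(x, y). f x * g y) z = S f (fst z) * T g (snd z)"
    by blast+
qed

section \<open>Von Neumann algebras and normal homomorphisms\<close>

lemma l2_sequence_single:
  assumes "\<xi> \<in> L2 M" shows "l2_sequence M (\<lambda>i. if i = 0 then \<xi> else (\<lambda>x. 0))"
proof -
  have "summable (\<lambda>i::nat. (L2_norm M (if i = 0 then \<xi> else (\<lambda>x. 0)))\<^sup>2)"
    by (rule summable_finite[of "{0}"]) auto
  then show ?thesis using assms by (auto simp: l2_sequence_def)
qed

lemma openin_sigma_weak_subbase: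
  assumes "l2_sequence M \<xi>" "l2_sequence M \<eta>" "open U"
  shows "openin (sigma_weak_topology M)
    {T \<in> bounded_ops M. (\<Sum>i. L2_inner M (T (\<xi> i)) (\<eta> i)) \<in> U}"
  unfolding sigma_weak_topology_def
  by (rule topology_generated_by_Basis) (use assms in blast)

lemma topspace_sigma_weak [simp]: "topspace (sigma_weak_topology M) = bounded_ops M"
proof
  show "topspace (sigma_weak_topology M) \<subseteq> bounded_ops M"
    unfolding sigma_weak_topology_def topology_generated_by_topspace by blast
  have "openin (sigma_weak_topology M)
      {T \<in> bounded_ops M. (\<Sum>i. L2_inner M (T (if i = 0 then \<lambda>x. 0 else (\<lambda>x. 0))) (if i = 0 then \<lambda>x. 0 else (\<lambda>x. 0))) \<in> UNIV}"
    by (intro openin_sigma_weak_subbase l2_sequence_single) auto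
  then show "bounded_ops M \<subseteq> topspace (sigma_weak_topology M)"
    using openin_subset by fastforce
qed

lemma summable_sigma_weak:
  assumes T: "T \<in> bounded_ops M" and \<xi>: "l2_sequence M \<xi>" and \<eta>: "l2_sequence M \<eta>"
  shows "summable (\<lambda>i. L2_inner M (T (\<xi> i)) (\<eta> i))"
proof -
  obtain K where K: "K > 0" "\<And>f. f \<in> L2 M \<Longrightarrow> L2_norm M (T f) \<le> K * L2_norm M f"
    using bounded_ops_bound[OF T] by blast
  have L: "\<xi> i \<in> L2 M" "\<eta> i \<in> L2 M" for i using \<xi> \<eta> by (auto simp: l2_sequence_def)
  have "summable (\<lambda>i. K * ((L2_norm M (\<xi> i))\<^sup>2 + (L2_norm M (\<eta> i))\<^sup>2))"
    using \<xi> \<eta> by (intro summable_mult summable_add) (auto simp: l2_sequence_def)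
  then show ?thesis
  proof (rule summable_comparison_test[rotated], intro exI allI impI)
    fix i
    have "cmod (L2_inner M (T (\<xi> i)) (\<eta> i)) \<le> L2_norm M (T (\<xi> i)) * L2_norm M (\<eta> i)"
      by (rule L2_Cauchy_Schwarz[OF bounded_ops_L2[OF T L(1)] L(2)])
    also have "\<dots> \<le> K * L2_norm M (\<xi> i) * L2_norm M (\<eta> i)"
      by (intro mult_right_mono K(2) L) simp
    also have "\<dots> = K * (L2_norm M (\<xi> i) * L2_norm M (\<eta> i))" by simp
    also have "\<dots> \<le> K * ((L2_norm M (\<xi> i))\<^sup>2 + (L2_norm M (\<eta> i))\<^sup>2)"
    proof (rule mult_left_mono)
      have "0 \<le> (L2_norm M (\<xi> i) - L2_norm M (\<eta> i))\<^sup>2" "0 \<le> L2_norm M (\<xi> i) * L2_norm M (\<eta> i)" by auto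
      then show "L2_norm M (\<xi> i) * L2_norm M (\<eta> i) \<le> (L2_norm M (\<xi> i))\<^sup>2 + (L2_norm M (\<eta> i))\<^sup>2"
        unfolding power2_diff by linarith
    qed (use K in simp)
    finally show "norm (L2_inner M (T (\<xi> i)) (\<eta> i)) \<le> K * ((L2_norm M (\<xi> i))\<^sup>2 + (L2_norm M (\<eta> i))\<^sup>2)" .
  qed
qed

text \<open>The topology sees operators only through coefficients, which are equal for operators
  that agree almost everywhere. The claim spreads from the subbase to all open sets.\<close>

lemma sigma_weak_op_eq:
  assumes "openin (sigma_weak_topology M) V" and S: "S \<in> bounded_ops M" and T: "T \<in> bounded_ops M"
    and eq: "op_eq M S T"
  shows "S \<in> V \<longleftrightarrow> T \<in> V"
proof -
  have "generate_topology_on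
     {{T \<in> bounded_ops M. (\<Sum>i. L2_inner M (T (\<xi> i)) (\<eta> i)) \<in> U} |\<xi> \<eta> U.
        l2_sequence M \<xi> \<and> l2_sequence M \<eta> \<and> open U} V"
    using assms(1) unfolding sigma_weak_topology_def by (rule openin_topology_generated_by)
  then show ?thesis
  proof induction
    case (Basis V)
    then obtain \<xi> \<eta> U where V: "V = {T \<in> bounded_ops M. (\<Sum>i. L2_inner M (T (\<xi> i)) (\<eta> i)) \<in> U}"
      and L: "l2_sequence M \<xi>" "l2_sequence M \<eta>" by blast
    have "L2_inner M (S (\<xi> i)) (\<eta> i) = L2_inner M (T (\<xi> i)) (\<eta> i)" for i
    proof -
      have "\<xi> i \<in> L2 M" "\<eta> i \<in> L2 M" using L by (auto simp: l2_sequence_def)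
      then show ?thesis
        using bounded_ops_L2[OF S] bounded_ops_L2[OF T] op_eqD[OF eq]
        by (intro L2_inner_cong_AE) (auto intro: L2_measurable)
    qed
    then show ?case using V S T by simp
  qed auto
qed

section \<open>Continuity of the algebraic operations\<close>

lemma continuous_map_sigma_weakI:
  assumes "\<And>T. T \<in> bounded_ops M \<Longrightarrow> g T \<in> bounded_ops M"
    and "\<And>\<xi> \<eta> U. l2_sequence M \<xi> \<Longrightarrow> l2_sequence M \<eta> \<Longrightarrow> open U \<Longrightarrow>
      openin (sigma_weak_topology M)
        {T \<in> bounded_ops M. (\<Sum>i. L2_inner M (g T (\<xi> i)) (\<eta> i)) \<in> U}"
  shows "continuous_map (sigma_weak_topology M) (sigma_weak_topology M) g"
  unfolding sigma_weak_topology_def[of M] 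
proof (rule continuous_on_generated_topo)
  let ?S = "{{T \<in> bounded_ops M. (\<Sum>i. L2_inner M (T (\<xi> i)) (\<eta> i)) \<in> U} |\<xi> \<eta> U.
        l2_sequence M \<xi> \<and> l2_sequence M \<eta> \<and> open U}"
  have ts: "topspace (topology_generated_by ?S) = bounded_ops M"
    using topspace_sigma_weak[of M] by (simp only: sigma_weak_topology_def)
  show "g ` topspace (topology_generated_by ?S) \<subseteq> \<Union>?S"
    using assms(1) ts unfolding topology_generated_by_topspace by blast
  fix V assume "V \<in> ?S"
  then obtain \<xi> \<eta> U where V: "V = {T \<in> bounded_ops M. (\<Sum>i. L2_inner M (T (\<xi> i)) (\<eta> i)) \<in> U}"
    "l2_sequence M \<xi>" "l2_sequence M \<eta>" "open U" by blast
  have "g -` V \<inter> bounded_ops M = {T \<in> bounded_ops M. (\<Sum>i. L2_inner M (g T (\<xi> i)) (\<eta> i)) \<in> U}"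
    using V(1) assms(1) by auto
  then show "openin (topology_generated_by ?S) (g -` V \<inter> topspace (topology_generated_by ?S))"
    unfolding ts using assms(2)[OF V(2-4)] by (simp only: sigma_weak_topology_def)
qed

lemma l2_sequence_op:
  assumes T: "T \<in> bounded_ops M" and \<xi>: "l2_sequence M \<xi>"
  shows "l2_sequence M (\<lambda>i. T (\<xi> i))"
proof -
  obtain K where K: "K > 0" "\<And>f. f \<in> L2 M \<Longrightarrow> L2_norm M (T f) \<le> K * L2_norm M f"
    using bounded_ops_bound[OF T] by blast
  have L: "\<xi> i \<in> L2 M" for i using \<xi> by (auto simp: l2_sequence_def)
  have "summable (\<lambda>i. K\<^sup>2 * (L2_norm M (\<xi> i))\<^sup>2)"
    using \<xi> by (intro summable_mult) (auto simp: l2_sequence_def)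
  then have "summable (\<lambda>i. (L2_norm M (T (\<xi> i)))\<^sup>2)"
  proof (rule summable_comparison_test[rotated], intro exI allI impI)
    fix i
    have "(L2_norm M (T (\<xi> i)))\<^sup>2 \<le> (K * L2_norm M (\<xi> i))\<^sup>2"
      by (intro power_mono K(2) L) simp
    then show "norm ((L2_norm M (T (\<xi> i)))\<^sup>2) \<le> K\<^sup>2 * (L2_norm M (\<xi> i))\<^sup>2"
      by (simp add: power_mult_distrib)
  qed
  then show ?thesis using L bounded_ops_L2[OF T] by (auto simp: l2_sequence_def)
qed

text \<open>Left multiplication is absorbed by the second vector of each coefficient, which takes
  the adjoint as a bounded operator. Right multiplication is absorbed by the first vector.\<close>

lemma continuous_map_comp_left:
  assumes S: "S \<in> bounded_ops M" and S': "S' \<in> bounded_ops M" and adj: "is_adjoint M S S'"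
  shows "continuous_map (sigma_weak_topology M) (sigma_weak_topology M) (\<lambda>T. S \<circ> T)"
proof (rule continuous_map_sigma_weakI)
  fix \<xi> \<eta> and U :: "complex set"
  assume \<xi>: "l2_sequence M \<xi>" and \<eta>: "l2_sequence M \<eta>" and U: "open U"
  have "{T \<in> bounded_ops M. (\<Sum>i. L2_inner M ((S \<circ> T) (\<xi> i)) (\<eta> i)) \<in> U} =
      {T \<in> bounded_ops M. (\<Sum>i. L2_inner M (T (\<xi> i)) (S' (\<eta> i))) \<in> U}"
  proof (rule Collect_cong, rule conj_cong[OF refl])
    fix T assume T: "T \<in> bounded_ops M"
    have "L2_inner M ((S \<circ> T) (\<xi> i)) (\<eta> i) = L2_inner M (T (\<xi> i)) (S' (\<eta> i))" for i
      using adj \<xi> \<eta> bounded_ops_L2[OF T] by (auto simp: is_adjoint_def l2_sequence_def)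
    then show "((\<Sum>i. L2_inner M ((S \<circ> T) (\<xi> i)) (\<eta> i)) \<in> U) = ((\<Sum>i. L2_inner M (T (\<xi> i)) (S' (\<eta> i))) \<in> U)"
      by simp
  qed
  then show "openin (sigma_weak_topology M) {T \<in> bounded_ops M. (\<Sum>i. L2_inner M ((S \<circ> T) (\<xi> i)) (\<eta> i)) \<in> U}"
    using openin_sigma_weak_subbase[OF \<xi> l2_sequence_op[OF S' \<eta>] U] by simp
qed (rule bounded_ops_comp[OF S])

lemma continuous_map_comp_right:
  assumes S: "S \<in> bounded_ops M"
  shows "continuous_map (sigma_weak_topology M) (sigma_weak_topology M) (\<lambda>T. T \<circ> S)"
proof (rule continuous_map_sigma_weakI)
  fix \<xi> \<eta> and U :: "complex set"
  assume \<xi>: "l2_sequence M \<xi>" and \<eta>: "l2_sequence M \<eta>" and U: "open U"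
  show "openin (sigma_weak_topology M) {T \<in> bounded_ops M. (\<Sum>i. L2_inner M ((T \<circ> S) (\<xi> i)) (\<eta> i)) \<in> U}"
    using openin_sigma_weak_subbase[OF l2_sequence_op[OF S \<xi>] \<eta> U] by simp
qed (rule bounded_ops_comp[OF _ S])

lemma continuous_map_op_add:
  assumes S: "S \<in> bounded_ops M"
  shows "continuous_map (sigma_weak_topology M) (sigma_weak_topology M) (op_add S)"
proof (rule continuous_map_sigma_weakI)
  fix \<xi> \<eta> and U :: "complex set"
  assume \<xi>: "l2_sequence M \<xi>" and \<eta>: "l2_sequence M \<eta>" and U: "open U"
  define c where "c = (\<Sum>i. L2_inner M (S (\<xi> i)) (\<eta> i))"
  have eq: "{T \<in> bounded_ops M. (\<Sum>i. L2_inner M (op_add S T (\<xi> i)) (\<eta> i)) \<in> U} =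
      {T \<in> bounded_ops M. (\<Sum>i. L2_inner M (T (\<xi> i)) (\<eta> i)) \<in> (\<lambda>z. c + z) -` U}"
  proof (rule Collect_cong, rule conj_cong[OF refl])
    fix T assume T: "T \<in> bounded_ops M"
    have "L2_inner M (op_add S T (\<xi> i)) (\<eta> i) = L2_inner M (S (\<xi> i)) (\<eta> i) + L2_inner M (T (\<xi> i)) (\<eta> i)" for i
      unfolding op_add_def using \<xi> \<eta> bounded_ops_L2[OF T] bounded_ops_L2[OF S]
      by (intro L2_inner_add_left) (auto simp: l2_sequence_def)
    then have "(\<Sum>i. L2_inner M (op_add S T (\<xi> i)) (\<eta> i)) = c + (\<Sum>i. L2_inner M (T (\<xi> i)) (\<eta> i))"
      unfolding c_def using summable_sigma_weak[OF S \<xi> \<eta>] summable_sigma_weak[OF T \<xi> \<eta>]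
      by (simp add: suminf_add)
    then show "((\<Sum>i. L2_inner M (op_add S T (\<xi> i)) (\<eta> i)) \<in> U) =
        ((\<Sum>i. L2_inner M (T (\<xi> i)) (\<eta> i)) \<in> (\<lambda>z. c + z) -` U)" by simp
  qed
  show "openin (sigma_weak_topology M) {T \<in> bounded_ops M. (\<Sum>i. L2_inner M (op_add S T (\<xi> i)) (\<eta> i)) \<in> U}"
    unfolding eq
    by (rule openin_sigma_weak_subbase[OF \<xi> \<eta>]) (intro open_vimage U continuous_intros)
qed (rule bounded_ops_op_add[OF S])

lemma continuous_map_op_scale:
  "continuous_map (sigma_weak_topology M) (sigma_weak_topology M) (op_scale c)"
proof (rule continuous_map_sigma_weakI)
  fix \<xi> \<eta> and U :: "complex set"
  assume \<xi>: "l2_sequence M \<xi>" and \<eta>: "l2_sequence M \<eta>" and U: "open U"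
  have eq: "{T \<in> bounded_ops M. (\<Sum>i. L2_inner M (op_scale c T (\<xi> i)) (\<eta> i)) \<in> U} =
      {T \<in> bounded_ops M. (\<Sum>i. L2_inner M (T (\<xi> i)) (\<eta> i)) \<in> (\<lambda>z. c * z) -` U}"
  proof (rule Collect_cong, rule conj_cong[OF refl])
    fix T assume T: "T \<in> bounded_ops M"
    show "((\<Sum>i. L2_inner M (op_scale c T (\<xi> i)) (\<eta> i)) \<in> U) =
        ((\<Sum>i. L2_inner M (T (\<xi> i)) (\<eta> i)) \<in> (\<lambda>z. c * z) -` U)"
      by (simp add: op_scale_def L2_inner_scale_left suminf_mult[OF summable_sigma_weak[OF T \<xi> \<eta>]])
  qed
  show "openin (sigma_weak_topology M) {T \<in> bounded_ops M. (\<Sum>i. L2_inner M (op_scale c T (\<xi> i)) (\<eta> i)) \<in> U}"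
    unfolding eq
    by (rule openin_sigma_weak_subbase[OF \<xi> \<eta>]) (intro open_vimage U continuous_intros)
qed (rule bounded_ops_op_scale)

text \<open>This is continuity of the involution. Adjoints are given by a relation and not by a
  function, so the preimage of V is described by a second open set V'. On the subbase it exchanges
  the two sequences and conjugates U.\<close>

lemma sigma_weak_adjoint:
  assumes "openin (sigma_weak_topology M) V"
  shows "\<exists>V'. openin (sigma_weak_topology M) V' \<and>
    (\<forall>S\<in>bounded_ops M. \<forall>T\<in>bounded_ops M. is_adjoint M T S \<longrightarrow> (S \<in> V \<longleftrightarrow> T \<in> V'))"
proof -
  have "generate_topology_on
     {{T \<in> bounded_ops M. (\<Sum>i. L2_inner M (T (\<xi> i)) (\<eta> i)) \<in> U} |\<xi> \<eta> U.
        l2_sequence M \<xi> \<and> l2_sequence M \<eta> \<and> open U} V"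
    using assms(1) unfolding sigma_weak_topology_def by (rule openin_topology_generated_by)
  then show ?thesis
  proof induction
    case Empty
    then show ?case by (intro exI[of _ "{}"]) auto
  next
    case (Int a b)
    then obtain a' b' where
      "openin (sigma_weak_topology M) a'" "openin (sigma_weak_topology M) b'"
      "\<forall>S\<in>bounded_ops M. \<forall>T\<in>bounded_ops M. is_adjoint M T S \<longrightarrow> (S \<in> a \<longleftrightarrow> T \<in> a')"
      "\<forall>S\<in>bounded_ops M. \<forall>T\<in>bounded_ops M. is_adjoint M T S \<longrightarrow> (S \<in> b \<longleftrightarrow> T \<in> b')"
      by blast
    then show ?case by (intro exI[of _ "a' \<inter> b'"]) auto
  next
    case (UN K)
    then have "\<forall>k\<in>K. \<exists>V'. openin (sigma_weak_topology M) V' \<and>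
        (\<forall>S\<in>bounded_ops M. \<forall>T\<in>bounded_ops M. is_adjoint M T S \<longrightarrow> (S \<in> k \<longleftrightarrow> T \<in> V'))" by blast
    from bchoice[OF this] obtain h where h: "\<forall>k\<in>K. openin (sigma_weak_topology M) (h k) \<and>
        (\<forall>S\<in>bounded_ops M. \<forall>T\<in>bounded_ops M. is_adjoint M T S \<longrightarrow> (S \<in> k \<longleftrightarrow> T \<in> h k))" by blast
    have "openin (sigma_weak_topology M) (\<Union>(h ` K))" using h by (intro openin_Union) blast
    moreover have "S \<in> \<Union>K \<longleftrightarrow> T \<in> \<Union>(h ` K)"
      if ST: "S \<in> bounded_ops M" "T \<in> bounded_ops M" "is_adjoint M T S" for S T
    proof -
      have "S \<in> k \<longleftrightarrow> T \<in> h k" if k: "k \<in> K" for k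
        using bspec[OF h k] ST by simp
      then show ?thesis by auto
    qed
    ultimately show ?case by (intro exI[of _ "\<Union>(h ` K)"] conjI ballI impI)
  next
    case (Basis V)
    then obtain \<xi> \<eta> U where V: "V = {T \<in> bounded_ops M. (\<Sum>i. L2_inner M (T (\<xi> i)) (\<eta> i)) \<in> U}"
      and L: "l2_sequence M \<xi>" "l2_sequence M \<eta>" "open U" by blast
    let ?V' = "{T \<in> bounded_ops M. (\<Sum>i. L2_inner M (T (\<eta> i)) (\<xi> i)) \<in> cnj -` U}"
    have "openin (sigma_weak_topology M) ?V'"
      by (intro openin_sigma_weak_subbase L open_vimage continuous_intros)
    moreover have "S \<in> V \<longleftrightarrow> T \<in> ?V'"
      if S: "S \<in> bounded_ops M" and T: "T \<in> bounded_ops M" and adj: "is_adjoint M T S" for S T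
    proof -
      have "L2_inner M (T (\<eta> i)) (\<xi> i) = cnj (L2_inner M (S (\<xi> i)) (\<eta> i))" for i
        using adj L by (auto simp: is_adjoint_def l2_sequence_def L2_inner_cnj[of M "\<eta> i" "S (\<xi> i)"])
      then have "(\<Sum>i. L2_inner M (T (\<eta> i)) (\<xi> i)) = cnj (\<Sum>i. L2_inner M (S (\<xi> i)) (\<eta> i))"
        using bounded_linear.suminf[OF bounded_linear_cnj summable_sigma_weak[OF S L(1,2)]] by simp
      then show ?thesis using V S T by simp
    qed
    ultimately show ?case by blast
  qed
qed

text \<open>A linear span, saturated under \<open>op_eq\<close> because laws such as S(T + T') = ST
  + ST' hold only almost everywhere.\<close>

inductive_set op_span :: "'x measure \<Rightarrow> 'x op set \<Rightarrow> 'x op set" for M B where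
  base: "T \<in> B \<Longrightarrow> T \<in> bounded_ops M \<Longrightarrow> T \<in> op_span M B"
| add: "S \<in> op_span M B \<Longrightarrow> T \<in> op_span M B \<Longrightarrow> op_add S T \<in> op_span M B"
| scale: "T \<in> op_span M B \<Longrightarrow> op_scale c T \<in> op_span M B"
| eq: "T \<in> op_span M B \<Longrightarrow> S \<in> bounded_ops M \<Longrightarrow> op_eq M S T \<Longrightarrow> S \<in> op_span M B"

lemma op_span_bounded: "T \<in> op_span M B \<Longrightarrow> T \<in> bounded_ops M"
  by (induction rule: op_span.induct) (auto intro: bounded_ops_op_add bounded_ops_op_scale)

lemma op_span_adjoint:
  assumes "\<And>T. T \<in> B \<Longrightarrow> \<exists>T'\<in>op_span M B. is_adjoint M T T'"
    and "T \<in> op_span M B"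
  shows "\<exists>T'\<in>op_span M B. is_adjoint M T T'"
  using assms(2)
proof (induction rule: op_span.induct)
  case (base T)
  then show ?case using assms(1) by blast
next
  case (add S T)
  then obtain S' T' where *: "S' \<in> op_span M B" "T' \<in> op_span M B" "is_adjoint M S S'" "is_adjoint M T T'"
    by blast
  have "is_adjoint M (op_add S T) (op_add S' T')"
    using * add.hyps unfolding is_adjoint_def op_add_def
    by (auto simp: L2_inner_add_left L2_inner_add_right bounded_ops_L2 op_span_bounded)
  then show ?case using op_span.add[OF *(1,2)] by blast
next
  case (scale T c)
  then obtain T' where *: "T' \<in> op_span M B" "is_adjoint M T T'" by blast
  have "is_adjoint M (op_scale c T) (op_scale (cnj c) T')"
    using * unfolding is_adjoint_def op_scale_def
    by (auto simp: L2_inner_scale_left L2_inner_scale_right)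
  then show ?case using op_span.scale[OF *(1)] by blast
next
  case (eq T S)
  then obtain T' where *: "T' \<in> op_span M B" "is_adjoint M T T'" by blast
  have "L2_inner M (S f) g = L2_inner M (T f) g" if "f \<in> L2 M" "g \<in> L2 M" for f g
    using that op_eqD[OF eq.hyps(3)] bounded_ops_L2[OF eq.hyps(2)] bounded_ops_L2[OF op_span_bounded[OF eq.hyps(1)]]
    by (intro L2_inner_cong_AE) (auto intro: L2_measurable)
  then have "is_adjoint M S T'" using *(2) by (auto simp: is_adjoint_def)
  then show ?case using *(1) by blast
qed

lemma op_eq_comp:
  assumes "S \<in> bounded_ops M" "T \<in> bounded_ops M" "T' \<in> bounded_ops M" "op_eq M T T'"
  shows "op_eq M (S \<circ> T) (S \<circ> T')"
  unfolding op_eq_def comp_def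
proof
  fix f assume f: "f \<in> L2 M"
  show "AE x in M. S (T f) x = S (T' f) x"
    by (rule bounded_ops_cong[OF assms(1) bounded_ops_L2[OF assms(2) f] bounded_ops_L2[OF assms(3) f]
          op_eqD[OF assms(4) f]])
qed

text \<open>The product is bilinear, so the induction is done in one factor at a time: first in T
  with S a generator, then in S.\<close>

lemma op_span_comp:
  assumes B: "\<And>S T. S \<in> B \<Longrightarrow> T \<in> B \<Longrightarrow> S \<circ> T \<in> op_span M B" and Bb: "B \<subseteq> bounded_ops M"
    and S: "S \<in> op_span M B" and T: "T \<in> op_span M B"
  shows "S \<circ> T \<in> op_span M B"
proof -
  have step: "S \<circ> T \<in> op_span M B" if SB: "S \<in> B" and "T \<in> op_span M B" for S T
    using that(2)
  proof (induction rule: op_span.induct)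
    case (base T)
    then show ?case using B[OF SB] by blast
  next
    case (add T T')
    have S: "S \<in> bounded_ops M" using SB Bb by blast
    note T = op_span_bounded[OF add.hyps(1)] op_span_bounded[OF add.hyps(2)]
    have "op_eq M (S \<circ> op_add T T') (op_add (S \<circ> T) (S \<circ> T'))"
      unfolding op_eq_def op_add_def comp_def
      using bounded_ops_add[OF S bounded_ops_L2[OF T(1)] bounded_ops_L2[OF T(2)]] by blast
    then show ?case
      by (intro op_span.eq[OF op_span.add[OF add.IH]] bounded_ops_comp S bounded_ops_op_add T)
  next
    case (scale T c)
    have S: "S \<in> bounded_ops M" using SB Bb by blast
    note T = op_span_bounded[OF scale.hyps]
    have "op_eq M (S \<circ> op_scale c T) (op_scale c (S \<circ> T))"
      unfolding op_eq_def op_scale_def comp_def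
      using bounded_ops_scale[OF S bounded_ops_L2[OF T]] by blast
    then show ?case
      by (intro op_span.eq[OF op_span.scale[OF scale.IH]] bounded_ops_comp S bounded_ops_op_scale T)
  next
    case (eq T T')
    have S: "S \<in> bounded_ops M" using SB Bb by blast
    show ?case
      by (intro op_span.eq[OF eq.IH] bounded_ops_comp S eq.hyps op_eq_comp op_span_bounded[OF eq.hyps(1)])
  qed
  show ?thesis using S
  proof (induction rule: op_span.induct)
    case (base S)
    then show ?case using step T by blast
  next
    case (add S S')
    have "op_add S S' \<circ> T = op_add (S \<circ> T) (S' \<circ> T)" by (simp add: op_add_def comp_def)
    then show ?case using op_span.add[OF add.IH] by (simp only:)
  next
    case (scale S c)
    have "op_scale c S \<circ> T = op_scale c (S \<circ> T)" by (simp add: op_scale_def comp_def)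
    then show ?case using op_span.scale[OF scale.IH] by (simp only:)
  next
    case (eq S S')
    have "op_eq M (S' \<circ> T) (S \<circ> T)"
      using eq.hyps(3) bounded_ops_L2[OF op_span_bounded[OF T]] by (auto simp: op_eq_def)
    then show ?case by (intro op_span.eq[OF eq.IH] bounded_ops_comp eq.hyps op_span_bounded[OF T])
  qed
qed

text \<open>The easy half of the double commutant theorem: separate \<open>\<sigma>\<close>-weak continuity of the
  product shows that the \<open>\<sigma>\<close>-weak closure of a unital \<open>*\<close>-algebra is a von Neumann algebra.\<close>

theorem vn_generated_subset_closure:
  assumes B: "\<And>S T. S \<in> B \<Longrightarrow> T \<in> B \<Longrightarrow> S \<circ> T \<in> op_span M B" and Bb: "B \<subseteq> bounded_ops M"
    and adj: "\<And>T. T \<in> B \<Longrightarrow> \<exists>T'\<in>op_span M B. is_adjoint M T T'"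
    and id: "id \<in> op_span M B"
  shows "vn_generated M B \<subseteq> sigma_weak_topology M closure_of op_span M B"
proof -
  let ?X = "sigma_weak_topology M" and ?A = "op_span M B"
  let ?C = "?X closure_of ?A"
  have AC: "?A \<subseteq> ?C" by (rule closure_of_subset) (auto intro: op_span_bounded)
  have Cb: "T \<in> bounded_ops M" if "T \<in> ?C" for T
    using closure_of_subset_topspace[of ?X ?A] that by auto
  have map: "g T \<in> ?C" if "continuous_map ?X ?X g" "\<And>S. S \<in> ?A \<Longrightarrow> g S \<in> ?C" "T \<in> ?C" for g T
  proof -
    have "g T \<in> ?X closure_of (g ` ?A)"
      using continuous_map_image_closure_subset[OF that(1)] that(3) by blast
    also have "\<dots> \<subseteq> ?X closure_of ?C" using that(2) by (intro closure_of_mono) auto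
    finally show ?thesis by simp
  qed
  have "von_neumann_algebra M ?C"
    unfolding von_neumann_algebra_def
  proof (intro conjI ballI allI impI)
    show "?C \<subseteq> bounded_ops M" using Cb by blast
    show "id \<in> ?C" using id AC by blast
    show "op_add S T \<in> ?C" if S: "S \<in> ?C" and T: "T \<in> ?C" for S T
    proof -
      \<comment> \<open>Continuity is available in one summand at a time. Therefore one summand
        stays in the span first, and is moved to the closure afterwards.\<close>
      have claim: "op_add T' S' \<in> ?C" if "S' \<in> ?C" "T' \<in> ?A" for S' T'
        by (rule map[OF continuous_map_op_add[OF op_span_bounded[OF that(2)]] _ that(1)])
           (use op_span.add[OF that(2)] AC in blast)
      have comm: "op_add S' T' = op_add T' S'" for S' T' :: "'a op"
        by (auto simp: op_add_def add.commute)
      show ?thesis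
      proof (rule map[OF continuous_map_op_add[OF Cb[OF S]] _ T])
        fix T' assume "T' \<in> ?A"
        then show "op_add S T' \<in> ?C" unfolding comm[of S T'] by (rule claim[OF S])
      qed
    qed
    show "S \<circ> T \<in> ?C" if S: "S \<in> ?C" and T: "T \<in> ?C" for S T
    \<comment> \<open>The left factor varies first: right multiplication by T is continuous for
      every bounded T. What remains is left multiplication by an element of the span, and its
      adjoint lies in the span again.\<close>
    proof (rule map[OF continuous_map_comp_right[OF Cb[OF T]] _ S])
      fix S' assume S': "S' \<in> ?A"
      obtain S'' where S'': "S'' \<in> ?A" "is_adjoint M S' S''" using op_span_adjoint[OF adj S'] by blast
      show "S' \<circ> T \<in> ?C"
        by (rule map[OF continuous_map_comp_left[OF op_span_bounded[OF S'] op_span_bounded[OF S''(1)] S''(2)] _ T])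
           (use op_span_comp[OF B Bb S'] AC in blast)
    qed
    show "op_scale c T \<in> ?C" if "T \<in> ?C" for c T
      by (rule map[OF continuous_map_op_scale _ that]) (use op_span.scale AC in blast)
    show "S \<in> ?C" if T: "T \<in> ?C" and S: "S \<in> bounded_ops M" and TS: "is_adjoint M T S" for S T
      unfolding in_closure_of
    proof (intro conjI allI impI)
      show "S \<in> topspace ?X" using S by simp
      fix V assume V: "S \<in> V \<and> openin ?X V"
      from sigma_weak_adjoint[OF conjunct2[OF V]] obtain V' where V1: "openin ?X V'"
        and V0: "\<forall>S\<in>bounded_ops M. \<forall>T\<in>bounded_ops M. is_adjoint M T S \<longrightarrow> (S \<in> V \<longleftrightarrow> T \<in> V')" by (elim exE conjE)
      have V2: "S \<in> V \<longleftrightarrow> T \<in> V'"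
        if "S \<in> bounded_ops M" "T \<in> bounded_ops M" "is_adjoint M T S" for S T
        using V0 that by simp
      have "T \<in> V'" using V2[OF S Cb[OF T] TS] V by simp
      then obtain R where R: "R \<in> ?A" "R \<in> V'" using T V1 by (auto simp: in_closure_of)
      obtain R' where R': "R' \<in> ?A" "is_adjoint M R R'" using op_span_adjoint[OF adj R(1)] by blast
      then have "R' \<in> V" using V2[OF op_span_bounded[OF R'(1)] op_span_bounded[OF R(1)]] R by simp
      then show "\<exists>y. y \<in> ?A \<and> y \<in> V" using R' by blast
    qed
    show "closedin ?X ?C" by simp
  qed
  moreover have "B \<subseteq> ?C" using AC Bb by (auto intro: op_span.base)
  ultimately show ?thesis unfolding vn_generated_def by blast
qed

section \<open>Generated algebras and the transfer of coefficients\<close>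

lemma von_neumann_algebra_bounded_ops: "von_neumann_algebra M (bounded_ops M)"
  unfolding von_neumann_algebra_def
proof (intro conjI ballI allI impI)
  show "closedin (sigma_weak_topology M) (bounded_ops M)"
    using closedin_topspace[of "sigma_weak_topology M"] unfolding topspace_sigma_weak .
  show "bounded_ops M \<subseteq> bounded_ops M" by (rule subset_refl)
  show "id \<in> bounded_ops M" by (rule bounded_ops_id)
  show "op_add S T \<in> bounded_ops M" "S \<circ> T \<in> bounded_ops M"
    if "S \<in> bounded_ops M" "T \<in> bounded_ops M" for S T
    using that by (rule bounded_ops_op_add, rule bounded_ops_comp)
  show "op_scale c T \<in> bounded_ops M" if "T \<in> bounded_ops M" for c T
    using that by (rule bounded_ops_op_scale)
qed assumption

lemma von_neumann_algebra_vn_generated: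
  assumes "B \<subseteq> bounded_ops M" shows "von_neumann_algebra M (vn_generated M B)"
proof -
  define \<A> where "\<A> = {A. von_neumann_algebra M A \<and> B \<subseteq> A}"
  have bd: "bounded_ops M \<in> \<A>"
    using assms von_neumann_algebra_bounded_ops by (simp add: \<A>_def)
  have A: "von_neumann_algebra M A" if "A \<in> \<A>" for A using that by (simp add: \<A>_def)
  have "von_neumann_algebra M (\<Inter>\<A>)"
    unfolding von_neumann_algebra_def[of M "\<Inter>\<A>"]
  proof (intro conjI ballI allI impI InterI)
    show "\<Inter>\<A> \<subseteq> bounded_ops M" using bd by (rule Inter_lower)
    show "closedin (sigma_weak_topology M) (\<Inter>\<A>)"
    proof (rule closedin_Inter)
      show "\<A> \<noteq> {}" using bd by auto
      show "closedin (sigma_weak_topology M) K" if "K \<in> \<A>" for K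
        using A[OF that] by (simp add: von_neumann_algebra_def)
    qed
  next
    fix K assume K: "K \<in> \<A>"
    note vN = A[OF K, unfolded von_neumann_algebra_def]
    show "id \<in> K" using vN by simp
    show "op_add S T \<in> K" "S \<circ> T \<in> K" if "S \<in> \<Inter>\<A>" "T \<in> \<Inter>\<A>" for S T
      using vN InterD[OF that(1) K] InterD[OF that(2) K] by simp_all
    show "op_scale c T \<in> K" if "T \<in> \<Inter>\<A>" for c T
      using vN InterD[OF that K] by simp
    show "S \<in> K" if T: "T \<in> \<Inter>\<A>" and S: "S \<in> bounded_ops M" "is_adjoint M T S" for S T
    proof -
      have "\<forall>T\<in>K. \<forall>S\<in>bounded_ops M. is_adjoint M T S \<longrightarrow> S \<in> K" using vN by (elim conjE)
      then show ?thesis using InterD[OF T K] S by blast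
    qed
  qed
  then show ?thesis by (simp add: vn_generated_def \<A>_def)
qed

lemma vn_generated_superset: "B \<subseteq> vn_generated M B"
  by (auto simp: vn_generated_def)

text \<open>The complement of A is open, and an open set cannot separate operators that agree almost
  everywhere.\<close>

lemma von_neumann_algebra_op_eq:
  assumes A: "von_neumann_algebra M A" and T: "T \<in> A" and S: "S \<in> bounded_ops M" and eq: "op_eq M S T"
  shows "S \<in> A"
proof (rule ccontr)
  assume "S \<notin> A"
  have "openin (sigma_weak_topology M) (bounded_ops M - A)"
    using A openin_diff[OF openin_topspace[of "sigma_weak_topology M"]] by (auto simp: von_neumann_algebra_def)
  from sigma_weak_op_eq[OF this S _ eq] show False
    using A T S \<open>S \<notin> A\<close> by (auto simp: von_neumann_algebra_def)
qed

text \<open>A sequence that vanishes after its first entry turns a single coefficient into one of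
  the functionals that define the topology.\<close>

lemma continuous_map_coefficient:
  assumes "\<xi> \<in> L2 M" "\<eta> \<in> L2 M"
  shows "continuous_map (sigma_weak_topology M) euclidean (\<lambda>T. L2_inner M (T \<xi>) \<eta>)"
proof -
  have eq: "(\<Sum>i. L2_inner M (T (if i = (0::nat) then \<xi> else (\<lambda>x. 0))) (if i = 0 then \<eta> else (\<lambda>x. 0)))
      = L2_inner M (T \<xi>) \<eta>" for T
    by (subst suminf_finite[of "{0}"]) (auto simp: L2_inner_def)
  show ?thesis
    unfolding continuous_map_def
    using openin_sigma_weak_subbase[OF l2_sequence_single[OF assms(1)] l2_sequence_single[OF assms(2)]]
    by (simp add: eq)
qed

lemma op_eq_coefficientI:
  assumes S: "S \<in> bounded_ops M" and T: "T \<in> bounded_ops M"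
    and eq: "\<And>\<xi> \<eta>. \<xi> \<in> L2 M \<Longrightarrow> \<eta> \<in> L2 M \<Longrightarrow> L2_inner M (S \<xi>) \<eta> = L2_inner M (T \<xi>) \<eta>"
  shows "op_eq M S T"
  unfolding op_eq_def
proof
  fix \<xi> assume \<xi>: "\<xi> \<in> L2 M"
  let ?d = "\<lambda>x. S \<xi> x - T \<xi> x"
  have L: "S \<xi> \<in> L2 M" "T \<xi> \<in> L2 M" using bounded_ops_L2 S T \<xi> by auto
  then have d: "?d \<in> L2 M" by auto
  have "of_real ((L2_norm M ?d)\<^sup>2) = L2_inner M (S \<xi>) ?d - L2_inner M (T \<xi>) ?d"
    unfolding L2_inner_self[symmetric] by (rule L2_inner_diff_left[OF L d])
  then have "L2_norm M ?d = 0" using eq[OF \<xi> d] by simp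
  from L2_norm_eq_0[OF d this] show "AE x in M. S \<xi> x = T \<xi> x" by simp
qed

text \<open>Compatibility with almost everywhere equality is a consequence of normality: a
  coefficient separating the images would pull back to an open set separating S from T.\<close>

lemma normal_star_hom_op_eq:
  assumes \<Theta>: "normal_star_hom P D Q B \<Theta>" and B: "B \<subseteq> bounded_ops Q" and D: "D \<subseteq> bounded_ops P"
    and S: "S \<in> D" and T: "T \<in> D" and eq: "op_eq P S T"
  shows "op_eq Q (\<Theta> S) (\<Theta> T)"
proof (rule op_eq_coefficientI)
  show "\<Theta> S \<in> bounded_ops Q" "\<Theta> T \<in> bounded_ops Q"
    using \<Theta> B S T by (auto simp: normal_star_hom_def)
  fix \<xi> \<eta> assume L: "\<xi> \<in> L2 Q" "\<eta> \<in> L2 Q"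
  have "continuous_map (subtopology (sigma_weak_topology P) D) (sigma_weak_topology Q) \<Theta>"
    using \<Theta> by (auto simp: normal_star_hom_def continuous_map_in_subtopology)
  from continuous_map_compose[OF this continuous_map_coefficient[OF L]]
  have cont: "continuous_map (subtopology (sigma_weak_topology P) D) euclidean (\<lambda>T. L2_inner Q (\<Theta> T \<xi>) \<eta>)"
    by (simp add: comp_def)
  show "L2_inner Q (\<Theta> S \<xi>) \<eta> = L2_inner Q (\<Theta> T \<xi>) \<eta>"
  proof (rule ccontr)
    assume ne: "L2_inner Q (\<Theta> S \<xi>) \<eta> \<noteq> L2_inner Q (\<Theta> T \<xi>) \<eta>"
    let ?U = "- {L2_inner Q (\<Theta> T \<xi>) \<eta>}"
    have oU: "open ?U" by (rule open_Compl[OF closed_singleton])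
    have ts: "topspace (subtopology (sigma_weak_topology P) D) = D" using D by auto
    have "openin (subtopology (sigma_weak_topology P) D) {T' \<in> D. L2_inner Q (\<Theta> T' \<xi>) \<eta> \<in> ?U}"
      using openin_continuous_map_preimage[OF cont, of ?U] oU unfolding ts by simp
    then obtain W where W: "openin (sigma_weak_topology P) W" "{T' \<in> D. L2_inner Q (\<Theta> T' \<xi>) \<eta> \<in> ?U} = W \<inter> D"
      by (auto simp: openin_subtopology)
    then show False using sigma_weak_op_eq[OF W(1) _ _ eq] S T D ne by blast
  qed
qed

text \<open>The transfer principle. Both coefficients are linear and continuous in the operator,
  hence they agree on a closed set as soon as they agree on the generators. The vectors on the two
  sides live on different spaces and are tied together only by the assumption on
  \<open>B\<close>.\<close>

lemma normal_star_hom_coefficient: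
  assumes \<Theta>: "normal_star_hom P D Q B' \<Theta>" and B': "B' \<subseteq> bounded_ops Q" and D: "von_neumann_algebra P D"
    and B: "B \<subseteq> D" and F: "F \<in> sigma_weak_topology P closure_of op_span P B"
    and \<xi>: "\<xi> \<in> L2 P" "\<eta> \<in> L2 P" and \<Xi>: "\<Xi> \<in> L2 Q" "H \<in> L2 Q"
    and base: "\<And>T. T \<in> B \<Longrightarrow> L2_inner Q (\<Theta> T \<Xi>) H = L2_inner P (T \<xi>) \<eta>"
  shows "F \<in> D" "L2_inner Q (\<Theta> F \<Xi>) H = L2_inner P (F \<xi>) \<eta>"
proof -
  have Db: "D \<subseteq> bounded_ops P" and Dc: "closedin (sigma_weak_topology P) D"
    using D by (auto simp: von_neumann_algebra_def)
  have \<Theta>b: "\<Theta> T \<in> bounded_ops Q" if "T \<in> D" for T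
    using \<Theta> B' that by (auto simp: normal_star_hom_def)
  have span: "T \<in> D \<and> L2_inner Q (\<Theta> T \<Xi>) H = L2_inner P (T \<xi>) \<eta>" if "T \<in> op_span P B" for T
    using that
  proof (induction rule: op_span.induct)
    case (base T)
    then show ?case using B assms(10) by blast
  next
    case (add S T)
    then have ST: "op_add S T \<in> D" using D by (auto simp: von_neumann_algebra_def)
    have "op_eq Q (\<Theta> (op_add S T)) (op_add (\<Theta> S) (\<Theta> T))"
      using \<Theta> add.IH by (auto simp: normal_star_hom_def)
    then have "L2_inner Q (\<Theta> (op_add S T) \<Xi>) H = L2_inner Q (\<lambda>x. \<Theta> S \<Xi> x + \<Theta> T \<Xi> x) H"
      using bounded_ops_L2[OF \<Theta>b[OF ST] \<Xi>(1)] bounded_ops_L2[OF \<Theta>b \<Xi>(1)] add.IH \<Xi>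
      by (intro L2_inner_cong_AE) (auto intro!: L2_measurable dest!: op_eqD[OF _ \<Xi>(1)] simp: op_add_def)
    also have "\<dots> = L2_inner P (S \<xi>) \<eta> + L2_inner P (T \<xi>) \<eta>"
      using add.IH bounded_ops_L2[OF \<Theta>b \<Xi>(1)] \<Xi> by (simp add: L2_inner_add_left)
    also have "\<dots> = L2_inner P (op_add S T \<xi>) \<eta>"
      unfolding op_add_def using add.IH Db bounded_ops_L2[OF _ \<xi>(1)] \<xi> by (subst L2_inner_add_left) auto
    finally show ?case using ST by simp
  next
    case (scale T c)
    then have cT: "op_scale c T \<in> D" using D by (auto simp: von_neumann_algebra_def)
    have "op_eq Q (\<Theta> (op_scale c T)) (op_scale c (\<Theta> T))"
      using \<Theta> scale.IH by (auto simp: normal_star_hom_def)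
    then have "L2_inner Q (\<Theta> (op_scale c T) \<Xi>) H = L2_inner Q (\<lambda>x. c * \<Theta> T \<Xi> x) H"
      using bounded_ops_L2[OF \<Theta>b[OF cT] \<Xi>(1)] bounded_ops_L2[OF \<Theta>b \<Xi>(1)] scale.IH \<Xi>
      by (intro L2_inner_cong_AE) (auto intro!: L2_measurable dest!: op_eqD[OF _ \<Xi>(1)] simp: op_scale_def)
    then show ?case using scale.IH cT by (simp add: L2_inner_scale_left op_scale_def)
  next
    case (eq T S)
    have S: "S \<in> D" using von_neumann_algebra_op_eq[OF D] eq by blast
    have "L2_inner Q (\<Theta> S \<Xi>) H = L2_inner Q (\<Theta> T \<Xi>) H"
      using normal_star_hom_op_eq[OF \<Theta> B' Db S _ eq.hyps(3)] eq.IH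
        bounded_ops_L2[OF \<Theta>b \<Xi>(1)] S \<Xi>
      by (intro L2_inner_cong_AE) (auto intro!: L2_measurable dest!: op_eqD[OF _ \<Xi>(1)])
    moreover have "L2_inner P (S \<xi>) \<eta> = L2_inner P (T \<xi>) \<eta>"
      using op_eqD[OF eq.hyps(3) \<xi>(1)] eq.IH Db S \<xi> bounded_ops_L2[OF _ \<xi>(1)]
      by (intro L2_inner_cong_AE) (auto intro!: L2_measurable)
    ultimately show ?case using eq.IH S by simp
  qed
  let ?X = "subtopology (sigma_weak_topology P) D"
  have ts: "topspace ?X = D" using Db by auto
  have "continuous_map ?X (sigma_weak_topology Q) \<Theta>"
    using \<Theta> by (auto simp: normal_star_hom_def continuous_map_in_subtopology)
  from continuous_map_compose[OF this continuous_map_coefficient[OF \<Xi>]]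
  have c1: "continuous_map ?X euclidean (\<lambda>T. L2_inner Q (\<Theta> T \<Xi>) H)" by (simp add: comp_def)
  have c2: "continuous_map ?X euclidean (\<lambda>T. L2_inner P (T \<xi>) \<eta>)"
    by (rule continuous_map_from_subtopology[OF continuous_map_coefficient[OF \<xi>]])
  have "closedin ?X {T \<in> topspace ?X. L2_inner Q (\<Theta> T \<Xi>) H = L2_inner P (T \<xi>) \<eta>}"
    by (rule closedin_continuous_maps_eq[OF Hausdorff_space_euclidean c1 c2])
  then have "closedin (sigma_weak_topology P) {T \<in> D. L2_inner Q (\<Theta> T \<Xi>) H = L2_inner P (T \<xi>) \<eta>}"
    unfolding ts using Dc closedin_trans_full by blast
  then have "sigma_weak_topology P closure_of op_span P B \<subseteq>
      {T \<in> D. L2_inner Q (\<Theta> T \<Xi>) H = L2_inner P (T \<xi>) \<eta>}"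
    using span by (intro closure_of_minimal) auto
  then show "F \<in> D" "L2_inner Q (\<Theta> F \<Xi>) H = L2_inner P (F \<xi>) \<eta>" using F by auto
qed

section \<open>Balls in local fields\<close>

context nonarch_local_field
begin

section \<open>Ultrametric inequalities and finite nets\<close>

lemma val_uniformizer_pos: "0 < v \<pi>"
  using uniformizer_nonzero val_nonneg[of \<pi>] val_eq_0_iff[of \<pi>] by (simp add: order_less_le)

lemma val_0 [simp]: "v 0 = 0"
  by (simp add: val_eq_0_iff)

lemma val_inverse: "v (inverse x) = inverse (v x)"
proof (cases "x = 0")
  case False
  then have "v x * v (inverse x) = 1" using val_mult[of x "inverse x"] val_1 by simp
  then show ?thesis using False by (metis inverse_unique)
qed simp

lemma val_divide: "v (x / y) = v x / v y"
  by (simp add: divide_inverse val_mult val_inverse)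

lemma val_power: "v (x ^ m) = v x ^ m"
  by (induction m) (auto simp: val_1 val_mult)

lemma val_minus_commute: "v (x - y) = v (y - x)"
  using val_minus[of "x - y"] by simp

lemma val_add_le: "v x \<le> c \<Longrightarrow> v y \<le> c \<Longrightarrow> v (x + y) \<le> c"
  using val_ultrametric[of x y] by linarith

lemma val_diff_le: "v x \<le> c \<Longrightarrow> v y \<le> c \<Longrightarrow> v (x - y) \<le> c"
  using val_diff[of x y] by linarith

lemma val_triangle: "v (x - y) \<le> c \<Longrightarrow> v (y - z) \<le> c \<Longrightarrow> v (x - z) \<le> c"
  using val_add_le[of "x - y" c "y - z"] by simp

lemma val_add_eq: "v y < v x \<Longrightarrow> v (x + y) = v x"
  using val_ultrametric[of x y] val_diff[of "x + y" y] by (auto simp: max_def split: if_splits)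

text \<open>Discreteness of the valuation: y / x lies in the maximal ideal, which
  \<open>\<pi>\<close> generates.\<close>

lemma val_gap:
  assumes "v y < v x" shows "v y \<le> v \<pi> * v x"
proof -
  have x: "v x > 0" using assms val_nonneg[of y] by linarith
  then have "v (y / x) < 1" using assms by (simp add: val_divide)
  then have "y / x \<in> frac_ideal v \<pi> 1" using uniformizer_generates by auto
  then have "v y / v x \<le> v \<pi>" by (simp add: frac_ideal_eq val_divide)
  then show ?thesis using x by (simp add: field_simps)
qed

lemma uniformizer_power_antimono: "m \<le> k \<Longrightarrow> v \<pi> ^ k \<le> v \<pi> ^ m"
  using val_uniformizer_less_1 val_uniformizer_pos by (intro power_decreasing) auto

lemma uniformizer_power_le_1: "v \<pi> ^ k \<le> 1"
  using uniformizer_power_antimono[of 0 k] by simp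

lemma uniformizer_power_small: "e > 0 \<Longrightarrow> \<exists>m. v \<pi> ^ m < e"
  using real_arch_pow_inv[of e "v \<pi>"] val_uniformizer_less_1 by auto

lemma uniformizer_power_bounded: "\<exists>m. v x * v \<pi> ^ m \<le> 1"
proof -
  obtain m where m: "v \<pi> ^ m < 1 / (v x + 1)"
    using uniformizer_power_small[of "1 / (v x + 1)"] val_nonneg[of x] by (auto simp: add_nonneg_pos)
  have "v x * v \<pi> ^ m \<le> v x * (1 / (v x + 1))"
    using m val_nonneg[of x] by (intro mult_left_mono) auto
  also have "\<dots> \<le> 1" using val_nonneg[of x] by (simp add: divide_le_eq_1)
  finally show ?thesis by blast
qed

lemma principal_units_iff: "a \<in> principal_units v \<pi> n \<longleftrightarrow> v (a - 1) \<le> v \<pi> ^ n"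
proof -
  have "a \<in> principal_units v \<pi> n \<longleftrightarrow> (\<exists>y. a = 1 + y \<and> v y \<le> v \<pi> ^ n)"
    by (auto simp: principal_units_def frac_ideal_eq)
  also have "\<dots> \<longleftrightarrow> v (a - 1) \<le> v \<pi> ^ n"
    by (auto intro!: exI[of _ "a - 1"])
  finally show ?thesis .
qed

lemma finite_residue_reps:
  "\<exists>S. finite S \<and> (\<forall>x. v x \<le> 1 \<longrightarrow> (\<exists>s\<in>S. v (x - s) \<le> v \<pi>))"
proof -
  let ?R = "{(x, y). x \<in> integers_of v \<and> y \<in> integers_of v \<and> x - y \<in> frac_ideal v \<pi> 1}"
  let ?S = "(\<lambda>C. SOME y. y \<in> C) ` residue_field v \<pi>"
  have "\<exists>s\<in>?S. v (x - s) \<le> v \<pi>" if x: "v x \<le> 1" for x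
  proof -
    have C: "?R `` {x} \<in> residue_field v \<pi>"
      unfolding residue_field_def by (rule quotientI) (use x in \<open>simp add: integers_of_def\<close>)
    have "x \<in> ?R `` {x}"
      using x val_nonneg[of \<pi>] by (auto simp: integers_of_def frac_ideal_eq)
    then have "(SOME y. y \<in> ?R `` {x}) \<in> ?R `` {x}" by (rule someI)
    then have "v (x - (SOME y. y \<in> ?R `` {x})) \<le> v \<pi>" by (auto simp: frac_ideal_eq)
    then show ?thesis using C by blast
  qed
  then show ?thesis using residue_field_finite by blast
qed

text \<open>Expansion in powers of \<open>\<pi>\<close>: the representatives for m + 1 digits are
  those for m digits plus \<open>\<pi> ^ m\<close> times a representative of the residue of the
  rescaled remainder.\<close>

lemma finite_reps:
  "\<exists>S. finite S \<and> (\<forall>x. v x \<le> 1 \<longrightarrow> (\<exists>s\<in>S. v (x - s) \<le> v \<pi> ^ m))"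
proof (induction m)
  case 0
  then show ?case by (intro exI[of _ "{0}"]) auto
next
  case (Suc m)
  obtain S where S: "finite S" "\<And>x. v x \<le> 1 \<Longrightarrow> \<exists>s\<in>S. v (x - s) \<le> v \<pi> ^ m" using Suc by blast
  obtain R where R: "finite R" "\<And>x. v x \<le> 1 \<Longrightarrow> \<exists>s\<in>R. v (x - s) \<le> v \<pi>"
    using finite_residue_reps by blast
  have "\<exists>s\<in>(\<lambda>(s, t). s + \<pi> ^ m * t) ` (S \<times> R). v (x - s) \<le> v \<pi> ^ Suc m" if x: "v x \<le> 1" for x
  proof -
    obtain s where s: "s \<in> S" "v (x - s) \<le> v \<pi> ^ m" using S(2)[OF x] by blast
    have "v ((x - s) / \<pi> ^ m) \<le> 1"
      using s(2) val_uniformizer_pos by (simp add: val_divide val_power)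
    then obtain t where t: "t \<in> R" "v ((x - s) / \<pi> ^ m - t) \<le> v \<pi>" using R(2) by blast
    have "x - (s + \<pi> ^ m * t) = \<pi> ^ m * ((x - s) / \<pi> ^ m - t)"
      using uniformizer_nonzero by (simp add: field_simps)
    then have "v (x - (s + \<pi> ^ m * t)) \<le> v \<pi> ^ Suc m"
      using mult_left_mono[OF t(2), of "v \<pi> ^ m"] val_uniformizer_pos
      by (simp add: val_mult val_power mult.commute)
    then show ?thesis using s(1) t(1) by force
  qed
  then show ?case using S(1) R(1) by (intro exI[of _ "(\<lambda>(s, t). s + \<pi> ^ m * t) ` (S \<times> R)"]) auto
qed

text \<open>The net has to consist of points of A, and A may be any subset of a ball. Hence each
  grid point c + d * s that is close to A is replaced by a chosen nearby point of A.\<close>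

lemma finite_net:
  assumes d: "d \<noteq> 0" and A: "\<And>x. x \<in> A \<Longrightarrow> v (x - c) \<le> v d"
  shows "\<exists>K\<subseteq>A. finite K \<and> (\<forall>x\<in>A. \<exists>y\<in>K. v (x - y) \<le> v d * v \<pi> ^ m)"
proof -
  have dpos: "v d > 0" using d val_nonneg[of d] val_eq_0_iff[of d] by linarith
  obtain S where S: "finite S" "\<And>x. v x \<le> 1 \<Longrightarrow> \<exists>s\<in>S. v (x - s) \<le> v \<pi> ^ m"
    using finite_reps by blast
  define f where "f s = (SOME y. y \<in> A \<and> v (y - (c + d * s)) \<le> v d * v \<pi> ^ m)" for s
  define K where "K = f ` {s \<in> S. \<exists>y. y \<in> A \<and> v (y - (c + d * s)) \<le> v d * v \<pi> ^ m}"
  have f: "f s \<in> A \<and> v (f s - (c + d * s)) \<le> v d * v \<pi> ^ m"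
    if "\<exists>y. y \<in> A \<and> v (y - (c + d * s)) \<le> v d * v \<pi> ^ m" for s
    unfolding f_def using that by (rule someI_ex)
  have "\<exists>y\<in>K. v (x - y) \<le> v d * v \<pi> ^ m" if x: "x \<in> A" for x
  proof -
    have "v ((x - c) / d) \<le> 1" using A[OF x] dpos by (simp add: val_divide)
    then obtain s where s: "s \<in> S" "v ((x - c) / d - s) \<le> v \<pi> ^ m" using S(2) by blast
    have "x - (c + d * s) = d * ((x - c) / d - s)" using d by (simp add: field_simps)
    then have xs: "v (x - (c + d * s)) \<le> v d * v \<pi> ^ m"
      using mult_left_mono[OF s(2), of "v d"] dpos by (simp add: val_mult)
    have fs: "f s \<in> A" "v (f s - (c + d * s)) \<le> v d * v \<pi> ^ m" using f[of s] x xs by auto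
    have "v (x - f s) \<le> v d * v \<pi> ^ m"
      using val_triangle[OF xs] fs(2) by (simp add: val_minus_commute[of "f s"])
    moreover have "f s \<in> K" unfolding K_def using s(1) x xs by blast
    ultimately show ?thesis by blast
  qed
  moreover have "K \<subseteq> A" "finite K" unfolding K_def using f S(1) by auto
  ultimately show ?thesis by blast
qed

text \<open>The field is the union over k of the balls of radius |\<pi>|^(-k), each of which has
  finite nets of every fineness. The shift from m to k + m compensates for the radius.\<close>

lemma countable_dense_net:
  "\<exists>Q. countable Q \<and> (\<forall>x m. \<exists>s\<in>Q. v (x - s) \<le> v \<pi> ^ m)"
proof -
  let ?A = "\<lambda>k. {x. v (x - 0) \<le> v (inverse (\<pi> ^ k))}"
  have "\<exists>K. finite K \<and> (\<forall>x\<in>?A k. \<exists>y\<in>K. v (x - y) \<le> v (inverse (\<pi> ^ k)) * v \<pi> ^ m)" for k m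
    using finite_net[of "inverse (\<pi> ^ k)" "?A k" 0 m] uniformizer_nonzero by auto
  then obtain K where K: "\<And>k m. finite (K k m)"
    "\<And>k m x. x \<in> ?A k \<Longrightarrow> \<exists>y\<in>K k m. v (x - y) \<le> v (inverse (\<pi> ^ k)) * v \<pi> ^ m" by metis
  have "\<exists>s\<in>(\<Union>k m. K k m). v (x - s) \<le> v \<pi> ^ m" for x m
  proof -
    obtain k where k: "v x * v \<pi> ^ k \<le> 1" using uniformizer_power_bounded by blast
    then have "x \<in> ?A k" using val_uniformizer_pos by (simp add: val_divide val_1 val_inverse val_power field_simps)
    then obtain y where "y \<in> K k (k + m)" "v (x - y) \<le> v (inverse (\<pi> ^ k)) * v \<pi> ^ (k + m)"
      using K(2) by blast
    moreover have "v (inverse (\<pi> ^ k)) * v \<pi> ^ (k + m) = v \<pi> ^ m"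
      using val_uniformizer_pos by (simp add: val_divide val_1 val_inverse val_power power_add)
    ultimately show ?thesis by auto
  qed
  moreover have "countable (\<Union>k m. K k m)" by (intro countable_UN countable_finite[OF K(1)]) auto
  ultimately show ?thesis by blast
qed

section \<open>Balls, topology and Borel sets\<close>

definition vball :: "nat \<Rightarrow> 'k \<Rightarrow> 'k set" where
  "vball N c = {x. v (x - c) \<le> v \<pi> ^ N}"

lemma vball_self: "c \<in> vball N c"
  using val_uniformizer_pos by (simp add: vball_def)

lemma vball_eq:
  assumes "x \<in> vball N c" shows "vball N c = vball N x"
proof -
  have xc: "v (x - c) \<le> v \<pi> ^ N" "v (c - x) \<le> v \<pi> ^ N"
    using assms by (auto simp: vball_def val_minus_commute[of c x])
  show ?thesis unfolding vball_def using val_triangle[OF _ xc(1)] val_triangle[OF _ xc(2)] by blast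
qed

lemma vball_mono: "m \<le> k \<Longrightarrow> vball k c \<subseteq> vball m c"
  unfolding vball_def using uniformizer_power_antimono[of m k] by auto

text \<open>Two balls are disjoint or nested, since every point of a ball is a centre. The empty set
  is added for the sake of the first case.\<close>

lemma vball_Int: "vball N c \<inter> vball N' c' \<in> insert {} {vball N c |N c. True}"
proof (cases "vball N c \<inter> vball N' c' = {}")
  case False
  then obtain x where x: "x \<in> vball N c" "x \<in> vball N' c'" by blast
  then have "vball N c \<inter> vball N' c' = vball (max N N') x"
    using vball_eq[OF x(1)] vball_eq[OF x(2)] vball_mono[of N "max N N'" x] vball_mono[of N' "max N N'" x]
    by (cases "N \<le> N'") (auto simp: max_def split: if_splits)
  then show ?thesis by blast
qed auto

sublocale metric: Metric_space UNIV "val_dist v"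
proof
  fix x y z
  show "0 \<le> val_dist v x y" by (simp add: val_dist_def val_nonneg)
  show "val_dist v x y = val_dist v y x" by (simp add: val_dist_def val_minus_commute[of x])
  show "val_dist v x y = 0 \<longleftrightarrow> x = y" by (simp add: val_dist_def val_eq_0_iff)
  show "val_dist v x z \<le> val_dist v x y + val_dist v y z"
    using val_ultrametric[of "x - y" "y - z"] val_nonneg[of "x - y"] val_nonneg[of "y - z"]
    by (simp add: val_dist_def)
qed

lemma topspace_val_topology [simp]: "topspace (val_topology v) = UNIV"
  by (simp add: val_topology_def)

lemma openin_val_topology:
  "openin (val_topology v) U \<longleftrightarrow> (\<forall>x\<in>U. \<exists>N. vball N x \<subseteq> U)"
proof
  assume "openin (val_topology v) U"
  then have U: "\<And>x. x \<in> U \<Longrightarrow> \<exists>r>0. metric.mball x r \<subseteq> U"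
    by (auto simp: val_topology_def metric.openin_mtopology)
  show "\<forall>x\<in>U. \<exists>N. vball N x \<subseteq> U"
  proof
    fix x assume "x \<in> U"
    then obtain r where r: "r > 0" "metric.mball x r \<subseteq> U" using U by blast
    obtain N where N: "v \<pi> ^ N < r" using uniformizer_power_small[OF r(1)] by blast
    have "vball N x \<subseteq> metric.mball x r"
      using N by (auto simp: vball_def val_dist_def val_minus_commute[of x])
    then show "\<exists>N. vball N x \<subseteq> U" using r by blast
  qed
next
  assume U: "\<forall>x\<in>U. \<exists>N. vball N x \<subseteq> U"
  have "\<exists>r>0. metric.mball x r \<subseteq> U" if x: "x \<in> U" for x
  proof -
    obtain N where N: "vball N x \<subseteq> U" using U x by blast
    have "metric.mball x (v \<pi> ^ N) \<subseteq> vball N x"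
      by (auto simp: vball_def val_dist_def val_minus_commute[of x])
    then show ?thesis using N val_uniformizer_pos by (meson order_trans zero_less_power)
  qed
  then show "openin (val_topology v) U" by (simp add: val_topology_def metric.openin_mtopology)
qed

lemma openin_vball: "openin (val_topology v) (vball N c)"
  unfolding openin_val_topology using vball_eq by blast

lemma closedin_vball: "closedin (val_topology v) (vball N c)"
proof -
  have "openin (val_topology v) (- vball N c)"
    unfolding openin_val_topology
  proof
    fix x assume x: "x \<in> - vball N c"
    have "y \<notin> vball N c" if "y \<in> vball N x" for y
      using vball_eq[of y N c] vball_eq[OF that] x vball_self[of x N] by blast
    then show "\<exists>N'. vball N' x \<subseteq> - vball N c" by blast
  qed
  then show ?thesis by (simp add: closedin_def Compl_eq_Diff_UNIV)
qed

text \<open>Complete and totally bounded, by \<open>finite_net\<close>. It is what makes indicators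
  of balls test functions.\<close>

lemma compactin_vball: "compactin (val_topology v) (vball N c)"
proof -
  have "metric.mtotally_bounded (vball N c)"
    unfolding metric.mtotally_bounded_def
  proof (intro allI impI)
    fix e :: real assume "e > 0"
    then obtain m where m: "v \<pi> ^ m < e" using uniformizer_power_small by blast
    have le: "v (x - c) \<le> v 1" if "x \<in> vball N c" for x
      using that uniformizer_power_le_1[of N] by (simp add: vball_def val_1)
    have "\<exists>K\<subseteq>vball N c. finite K \<and> (\<forall>x\<in>vball N c. \<exists>y\<in>K. v (x - y) \<le> v 1 * v \<pi> ^ m)"
      by (rule finite_net[of 1 _ c]) (use le in auto)
    then obtain K where K: "K \<subseteq> vball N c" "finite K" "\<And>x. x \<in> vball N c \<Longrightarrow> \<exists>y\<in>K. v (x - y) \<le> v 1 * v \<pi> ^ m"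
      by blast
    have net: "\<exists>y\<in>K. x \<in> metric.mball y e" if x: "x \<in> vball N c" for x
    proof -
      obtain y where y: "y \<in> K" "v (x - y) \<le> v 1 * v \<pi> ^ m" using K(3)[OF x] by blast
      have "v (y - x) < e" using y(2) m by (simp add: val_1 val_minus_commute[of y x])
      then have "x \<in> metric.mball y e" by (simp add: val_dist_def)
      then show ?thesis using y(1) by (rule bexI)
    qed
    then show "\<exists>K. finite K \<and> K \<subseteq> vball N c \<and> vball N c \<subseteq> (\<Union>x\<in>K. metric.mball x e)"
    proof (intro exI[of _ K] conjI subsetI)
      show "x \<in> (\<Union>y\<in>K. metric.mball y e)" if "x \<in> vball N c" for x
        using net[OF that] by (simp only: UN_iff)
    qed (use K in auto)
  qed
  then have "compactin metric.mtopology (metric.mtopology closure_of vball N c)"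
    using metric.mtotally_bounded_eq_compact_closure_of[OF val_complete] by blast
  moreover have "metric.mtopology closure_of vball N c = vball N c"
    using closedin_vball[of N c] by (simp add: val_topology_def closure_of_eq)
  ultimately show ?thesis by (simp add: val_topology_def)
qed

text \<open>By separability an open set is the union of the balls it contains with centres in a
  countable set. Thus balls generate the Borel sets and equality of measures can be tested on
  them.\<close>

lemma sigma_sets_vball:
  "sigma_sets UNIV {A. openin (val_topology v) A} = sigma_sets UNIV (insert {} {vball N c |N c. True})"
proof
  show "sigma_sets UNIV (insert {} {vball N c |N c. True}) \<subseteq> sigma_sets UNIV {A. openin (val_topology v) A}"
    by (rule sigma_sets_mono) (auto intro: openin_vball)
  show "sigma_sets UNIV {A. openin (val_topology v) A} \<subseteq> sigma_sets UNIV (insert {} {vball N c |N c. True})"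
  proof (rule sigma_sets_mono, rule subsetI)
    fix U assume U: "U \<in> {A. openin (val_topology v) A}"
    obtain Q where Q: "countable Q" "\<And>x m. \<exists>s\<in>Q. v (x - s) \<le> v \<pi> ^ m" using countable_dense_net by blast
    let ?I = "{(s, N). s \<in> Q \<and> vball N s \<subseteq> U}"
    have "U = (\<Union>(s, N)\<in>?I. vball N s)"
    proof
      show "U \<subseteq> (\<Union>(s, N)\<in>?I. vball N s)"
      proof
        fix x assume x: "x \<in> U"
        then obtain N where N: "vball N x \<subseteq> U" using U by (auto simp: openin_val_topology)
        obtain s where s: "s \<in> Q" "v (x - s) \<le> v \<pi> ^ N" using Q(2) by blast
        have "x \<in> vball N s" using s(2) by (simp add: vball_def)
        then show "x \<in> (\<Union>(s, N)\<in>?I. vball N s)" using N s(1) vball_eq[of x N s] by auto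
      qed
    qed auto
    moreover have "(\<Union>(s, N)\<in>?I. vball N s) \<in> sigma_sets UNIV (insert {} {vball N c |N c. True})"
    proof (rule sigma_sets_UNION)
      have "countable ?I"
        by (rule countable_subset[of _ "Q \<times> UNIV"]) (use Q(1) in auto)
      then show "countable ((\<lambda>(s, N). vball N s) ` ?I)" by (rule countable_image)
      fix B assume "B \<in> (\<lambda>(s, N). vball N s) ` ?I"
      then obtain s N where "B = vball N s" by auto
      then show "B \<in> sigma_sets UNIV (insert {} {vball N c |N c. True})"
        by (auto intro!: sigma_sets.Basic)
    qed
    ultimately show "U \<in> sigma_sets UNIV (insert {} {vball N c |N c. True})" by simp
  qed
qed

lemma Int_stable_vball: "Int_stable (insert {} {vball N c |N c. True})"
proof (rule Int_stableI)
  fix a b assume "a \<in> insert {} {vball N c |N c. True}" "b \<in> insert {} {vball N c |N c. True}"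
  then consider "a = {} \<or> b = {}" | N c N' c' where "a = vball N c" "b = vball N' c'" by blast
  then show "a \<inter> b \<in> insert {} {vball N c |N c. True}"
    by cases (auto simp only: vball_Int Int_empty_left Int_empty_right insertI1)
qed

end

section \<open>The valuation of 2\<close>

context nonarch_local_field
begin

lemma val_of_nat_le_1: "v (of_nat m) \<le> 1"
  by (induction m) (auto intro: val_add_le simp: val_1)

lemma val_of_int_le_1: "v (of_int a) \<le> 1"
  by (cases a) (auto simp: val_of_nat_le_1 val_minus simp del: of_nat_Suc)

text \<open>In characteristic 2m + 1 the equation 2 * m = -1 makes 2 a unit.\<close>

lemma val_2_CHAR_pos:
  assumes "CHAR('k) \<noteq> 0" "CHAR('k) \<noteq> 2" shows "v 2 = 1"
proof -
  have "prime CHAR('k)" using assms(1) by (intro prime_CHAR_semidom) auto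
  then have "odd CHAR('k)" using assms(2) prime_odd_nat[of "CHAR('k)"] prime_ge_2_nat[of "CHAR('k)"] by simp
  then obtain m where m: "CHAR('k) = 2 * m + 1" by (elim oddE)
  have "of_nat CHAR('k) = (0 :: 'k)" by (rule of_nat_CHAR)
  then have "1 + (2 :: 'k) * of_nat m = 0" unfolding m by simp
  then have "(2 :: 'k) * of_nat m = - 1" by (rule minus_unique[symmetric])
  then have "v 2 * v (of_nat m) = 1" using val_mult[of 2 "of_nat m"] by (simp add: val_minus val_1)
  moreover have "v 2 \<le> 1" using val_of_nat_le_1[of 2] by simp
  ultimately show ?thesis
    using val_of_nat_le_1[of m] val_nonneg[of 2] mult_left_le[of "v (of_nat m)" "v 2"] by simp
qed

text \<open>The prime field map. It is spelled out through fractions because \<open>'k\<close> is an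
  arbitrary field, whose characteristic is known to be 0 only in the context below.\<close>

definition rat_embed :: "rat \<Rightarrow> 'k" where
  "rat_embed x = of_int (fst (quotient_of x)) / of_int (snd (quotient_of x))"

context
  assumes char_0: "CHAR('k) = 0" and val_2: "v 2 < 1"
begin

lemma of_int_eq_0: "(of_int a :: 'k) = 0 \<longleftrightarrow> a = 0"
  using char_0 of_int_eq_0_iff_char_dvd[of a, where ?'a = 'k] by simp

lemma rat_embed_Fract:
  assumes "b \<noteq> 0" shows "rat_embed (Rat.Fract a b) = of_int a / of_int b"
proof -
  obtain p q where pq: "quotient_of (Rat.Fract a b) = (p, q)" by fastforce
  then have q: "q > 0" using quotient_of_denom_pos by simp
  have "Rat.Fract a b = Rat.Fract p q" using quotient_of_div[OF pq] by (simp add: Fract_of_int_quotient)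
  then have "a * q = p * b" using assms q by (simp add: eq_rat)
  then have "(of_int a :: 'k) * of_int q = of_int p * of_int b"
    by (metis of_int_mult)
  moreover have "(of_int b :: 'k) \<noteq> 0" "(of_int q :: 'k) \<noteq> 0" using of_int_eq_0 assms q by auto
  ultimately show ?thesis by (simp add: rat_embed_def pq frac_eq_eq)
qed

lemma rat_embed_1: "rat_embed 1 = 1"
  using rat_embed_Fract[of 1 1] by (simp add: One_rat_def)

lemma rat_embed_add: "rat_embed (x + y) = rat_embed x + rat_embed y"
proof -
  obtain a b where x: "x = Rat.Fract a b" "b > 0" by (rule Rat_cases)
  obtain c d where y: "y = Rat.Fract c d" "d > 0" by (rule Rat_cases)
  have nz: "(of_int b :: 'k) \<noteq> 0" "(of_int d :: 'k) \<noteq> 0" using of_int_eq_0 x y by auto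
  have "x + y = Rat.Fract (a * d + c * b) (b * d)" using x y by simp
  then have "rat_embed (x + y) = of_int (a * d + c * b) / of_int (b * d)"
    using rat_embed_Fract x y by simp
  also have "\<dots> = of_int a / of_int b + of_int c / of_int d" using nz by (simp add: add_frac_eq)
  finally show ?thesis using rat_embed_Fract x y by simp
qed

lemma rat_embed_mult: "rat_embed (x * y) = rat_embed x * rat_embed y"
proof -
  obtain a b where x: "x = Rat.Fract a b" "b > 0" by (rule Rat_cases)
  obtain c d where y: "y = Rat.Fract c d" "d > 0" by (rule Rat_cases)
  have "x * y = Rat.Fract (a * c) (b * d)" using x y by simp
  then show ?thesis using rat_embed_Fract x y by simp
qed

lemma rat_embed_diff: "rat_embed (x - y) = rat_embed x - rat_embed y"
  using rat_embed_add[of "x - y" y] by simp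

lemma rat_embed_0: "rat_embed 0 = 0"
  using rat_embed_diff[of 0 0] by simp

lemma rat_embed_inverse: "rat_embed (inverse x) = inverse (rat_embed x)"
proof (cases "x = 0")
  case False
  then have "rat_embed x * rat_embed (inverse x) = 1" by (simp flip: rat_embed_mult add: rat_embed_1)
  then show ?thesis by (metis inverse_unique)
qed (simp add: rat_embed_0)

lemma val_2_pos: "v 2 > 0"
proof -
  have "(2 :: 'k) \<noteq> 0" using of_int_eq_0[of 2] by simp
  then show ?thesis using val_nonneg[of 2] val_eq_0_iff[of 2] by linarith
qed

text \<open>An odd integer is 1 + 2d with |2d| < 1, so it has absolute value 1. Only the power of 2
  contributes.\<close>

lemma val_of_int:
  assumes "a \<noteq> 0" shows "v (of_int a) = v 2 ^ multiplicity 2 a"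
proof -
  obtain c where c: "a = 2 ^ multiplicity 2 a * c" "odd c"
    using multiplicity_decompose'[of a "2 :: int"] assms by auto
  then obtain d where d: "c = 2 * d + 1" by (elim oddE)
  have "v (2 * of_int d) \<le> v 2"
    using mult_left_le[OF val_of_int_le_1[of d] val_nonneg[of 2]] by (simp add: val_mult)
  then have "v (1 + 2 * of_int d) = v 1" using val_2 by (intro val_add_eq) (simp add: val_1)
  then have "v (of_int c) = 1" by (simp add: d val_1 add.commute)
  then have "v (of_int (2 ^ multiplicity 2 a * c)) = v 2 ^ multiplicity 2 a"
    by (simp add: val_mult val_power)
  then show ?thesis using c(1) by simp
qed

text \<open>The exponent c is forced by the value at 2: (1/2)^c has to equal \<open>v 2\<close>, and
  c is positive since \<open>v 2 < 1\<close>.\<close>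

lemma val_rat_embed: "v (rat_embed x) = rat_abs2 x powr (- log 2 (v 2))"
proof (cases "x = 0")
  case True
  then show ?thesis by (simp add: rat_embed_0 rat_abs2_def)
next
  case False
  define p q where "p = fst (quotient_of x)" and "q = snd (quotient_of x)"
  have q: "q > 0" using quotient_of_denom_pos[of x p q] by (simp add: p_def q_def)
  have "x = of_int p / of_int q" by (rule quotient_of_div) (simp add: p_def q_def)
  then have p: "p \<noteq> 0" using False by auto
  let ?m = "multiplicity 2 p" and ?k = "multiplicity 2 q"
  have v2: "v 2 = 2 powr (log 2 (v 2))" using val_2_pos by simp
  have "v (rat_embed x) = v 2 ^ ?m / v 2 ^ ?k"
    using p q by (simp add: rat_embed_def val_divide val_of_int p_def q_def)
  also have "\<dots> = (v 2) powr (real ?m - real ?k)"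
    using val_2_pos by (simp add: powr_diff powr_realpow)
  also have "\<dots> = 2 powr (log 2 (v 2) * (real ?m - real ?k))"
    by (subst v2) (simp add: powr_powr)
  finally have l: "v (rat_embed x) = 2 powr (log 2 (v 2) * (real ?m - real ?k))" .
  have "rat_abs2 x = 2 powi (int ?k - int ?m)"
    using False by (simp add: rat_abs2_def p_def q_def)
  also have "\<dots> = 2 powr (real ?k - real ?m)"
    using powr_real_of_int'[of 2 "int ?k - int ?m"] by simp
  finally have "rat_abs2 x powr (- log 2 (v 2)) = 2 powr ((real ?k - real ?m) * (- log 2 (v 2)))"
    by (simp add: powr_powr)
  also have "(real ?k - real ?m) * (- log 2 (v 2)) = log 2 (v 2) * (real ?m - real ?k)"
    by (simp add: algebra_simps)
  finally show ?thesis using l by simp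
qed

text \<open>The closure of the image of the rationals is complete as a closed subset. The field
  operations extend to it because they are uniformly continuous on suitable neighbourhoods, which
  the estimates make explicit.\<close>

lemma extension_of_Q2: "extension_of_Q2 v"
proof -
  define K where "K = val_topology v closure_of range rat_embed"
  have K: "x \<in> K \<longleftrightarrow> (\<forall>e>0. \<exists>r. v (x - rat_embed r) < e)" for x
    by (auto simp: K_def val_topology_def metric.metric_closure_of val_dist_def)
  have rK: "rat_embed r \<in> K" for r unfolding K by (auto intro!: exI[of _ r])
  have diff: "x - y \<in> K" if x: "x \<in> K" and y: "y \<in> K" for x y
    unfolding K
  proof (intro allI impI)
    fix e :: real assume e: "e > 0"
    obtain r where r: "v (x - rat_embed r) < e" using x e K by blast
    obtain s where s: "v (y - rat_embed s) < e" using y e K by blast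
    have "x - y - rat_embed (r - s) = (x - rat_embed r) - (y - rat_embed s)"
      by (simp add: rat_embed_diff)
    then have "v (x - y - rat_embed (r - s)) \<le> max (v (x - rat_embed r)) (v (y - rat_embed s))"
      using val_diff[of "x - rat_embed r" "y - rat_embed s"] by (simp only:)
    then have "v (x - y - rat_embed (r - s)) < e" using r s by simp
    then show "\<exists>r. v (x - y - rat_embed r) < e" by blast
  qed
  have mult: "x * y \<in> K" if x: "x \<in> K" and y: "y \<in> K" for x y
    unfolding K
  proof (intro allI impI)
    fix e :: real assume e: "e > 0"
    define B where "B = 1 + v x + v y"
    have B: "B \<ge> 1" "v x \<le> B" "v y \<le> B" "B > 0" using val_nonneg[of x] val_nonneg[of y] by (auto simp: B_def)
    \<comment> \<open>The bound 1 keeps the approximant of y within B, and the bound e / B makes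
      both error terms of the product small.\<close>
    define d where "d = min 1 (e / B)"
    have d: "d > 0" "d \<le> 1" "d * B \<le> e" using e B by (auto simp: d_def min_def field_simps)
    obtain r where r: "v (x - rat_embed r) < d" using x d K by blast
    obtain s where s: "v (y - rat_embed s) < d" using y d K by blast
    have "v (rat_embed s) \<le> max (v y) (v (y - rat_embed s))"
      using val_diff[of y "y - rat_embed s"] by simp
    then have vs: "v (rat_embed s) \<le> B" using B s d by simp
    have "v (x * (y - rat_embed s)) \<le> B * v (y - rat_embed s)"
      using B val_nonneg by (simp add: val_mult mult_right_mono)
    also have "\<dots> < B * d" using s B by simp
    finally have 1: "v (x * (y - rat_embed s)) < e" using d by (simp add: mult.commute)
    have "v ((x - rat_embed r) * rat_embed s) \<le> v (x - rat_embed r) * B"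
      using vs val_nonneg by (simp add: val_mult mult_left_mono)
    also have "\<dots> < d * B" using r B by simp
    finally have 2: "v ((x - rat_embed r) * rat_embed s) < e" using d by simp
    have "x * y - rat_embed (r * s) = x * (y - rat_embed s) + (x - rat_embed r) * rat_embed s"
      by (simp add: rat_embed_mult algebra_simps)
    then have "v (x * y - rat_embed (r * s)) < e"
      using val_ultrametric[of "x * (y - rat_embed s)" "(x - rat_embed r) * rat_embed s"] 1 2 by simp
    then show "\<exists>r. v (x * y - rat_embed r) < e" by blast
  qed
  have inverse: "inverse x \<in> K" if x: "x \<in> K" for x
  proof (cases "x = 0")
    case True
    then show ?thesis using x by simp
  next
    case False
    then have vx: "v x > 0" using val_nonneg[of x] val_eq_0_iff[of x] by linarith
    show ?thesis unfolding K
    proof (intro allI impI)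
      fix e :: real assume e: "e > 0"
      \<comment> \<open>The bound \<open>v x\<close> forces the approximant to have the same
        absolute value as x, so the difference of the inverses is divided by exactly
        \<open>v x * v x\<close>.\<close>
      define d where "d = min (v x) (e * (v x * v x))"
      have d: "d > 0" "d \<le> v x" "d \<le> e * (v x * v x)" using e vx by (auto simp: d_def)
      obtain r where r: "v (x - rat_embed r) < d" using x d K by blast
      have "v (x + - (x - rat_embed r)) = v x"
        by (rule val_add_eq) (use r d val_minus[of "x - rat_embed r"] in simp)
      then have vr: "v (rat_embed r) = v x" by simp
      then have nz: "rat_embed r \<noteq> 0" using vx by auto
      have "inverse x - rat_embed (inverse r) = - ((x - rat_embed r) / (x * rat_embed r))"
        unfolding rat_embed_inverse using nz False by (simp add: field_simps)
      then have "v (inverse x - rat_embed (inverse r)) = v (x - rat_embed r) / (v x * v x)"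
        by (simp add: val_minus val_divide val_mult vr del: minus_divide_left)
      also have "\<dots> < e" using r d vx by (simp add: field_simps)
      finally show "\<exists>r. v (inverse x - rat_embed r) < e" by blast
    qed
  qed
  interpret Submetric UNIV "val_dist v" K by unfold_locales simp
  have "closedin metric.mtopology K" unfolding K_def val_topology_def by (rule closedin_closure_of)
  then have complete: "Metric_space.mcomplete K (val_dist v)"
    using closedin_mcomplete_imp_mcomplete val_complete by blast
  have "log 2 (v 2) < 0" using val_2 val_2_pos by simp
  moreover have "0 \<in> K" "1 \<in> K" using rK[of 0] rK[of 1] by (auto simp: rat_embed_0 rat_embed_1)
  ultimately show ?thesis
    unfolding extension_of_Q2_def
    using diff mult inverse complete rat_embed_1 rat_embed_add rat_embed_mult val_rat_embed rK
    by (intro exI[of _ K] exI[of _ rat_embed] exI[of _ "- log 2 (v 2)"] conjI)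
       (auto simp: K_def)
qed

end

text \<open>The hypotheses on the field mean precisely that 2 is a unit of the ring of integers, and
  they enter the proof in this form. If |2| < 1 in characteristic 0, the field would contain the
  2-adic numbers.\<close>

lemma val_two:
  assumes "CHAR('k) \<noteq> 2" "\<not> extension_of_Q2 v" shows "v 2 = 1"
proof (cases "CHAR('k) = 0")
  case True
  then have "\<not> v 2 < 1" using extension_of_Q2 assms(2) by blast
  then show ?thesis using val_of_nat_le_1[of 2] by simp
next
  case False
  then show ?thesis using val_2_CHAR_pos assms(1) by blast
qed

section \<open>Principal units and the map phi\<close>

lemma principal_unit_mult:
  assumes "v (a - 1) \<le> c" "v (b - 1) \<le> c" "c \<le> 1" shows "v (a * b - 1) \<le> c"
proof -
  have "v b \<le> 1" using val_add_le[of "b - 1" 1 1] assms by (simp add: val_1)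
  then have "v ((a - 1) * b) \<le> c"
    using assms(1) mult_left_le[of "v b" "v (a - 1)"] val_nonneg by (auto simp: val_mult intro: order_trans)
  then have "v ((a - 1) * b + (b - 1)) \<le> c" using assms(2) by (rule val_add_le)
  moreover have "(a - 1) * b + (b - 1) = a * b - 1" by (simp add: algebra_simps)
  ultimately show ?thesis by (simp only:)
qed

lemma val_inverse_diff:
  assumes "v a = 1" "v b = 1" shows "v (inverse a - inverse b) = v (a - b)"
proof -
  have "a \<noteq> 0" "b \<noteq> 0" using assms by auto
  then have "inverse a - inverse b = (b - a) / (a * b)" by (simp add: field_simps)
  then show ?thesis using assms by (simp add: val_divide val_mult val_minus_commute[of b])
qed

text \<open>The second factor is 1 + 1/(ab). Written as 2 plus a term that is small for principal
  units, it has absolute value 1 as soon as 2 is a unit.\<close>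

lemma phi_diff:
  assumes nz: "a \<noteq> 0" "b \<noteq> 0"
  shows "phi a - phi b = (a - b) * (2 + (inverse (a * b) - 1))"
  using nz by (simp add: phi_def field_simps)

lemma phi_isometry:
  assumes v2: "v 2 = 1" and a: "v (a - 1) < 1" and b: "v (b - 1) < 1"
  shows "v (phi a - phi b) = v (a - b)"
proof -
  have va: "v a = 1" "v b = 1"
    using val_add_eq[of "a - 1" 1] val_add_eq[of "b - 1" 1] a b by (auto simp: val_1)
  then have nz: "a \<noteq> 0" "b \<noteq> 0" by auto
  have "v (a * b - 1) \<le> max (v (a - 1)) (v (b - 1))"
    by (rule principal_unit_mult) (use a b in auto)
  then have "v (a * b - 1) < 1" using a b by simp
  then have "v (inverse (a * b) - inverse 1) < 1"
    by (subst val_inverse_diff) (auto simp: val_mult va val_1)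
  then have "v (2 + (inverse (a * b) - 1)) = 1" using v2 by (subst val_add_eq) auto
  then show ?thesis unfolding phi_diff[OF nz] by (simp add: val_mult)
qed

text \<open>The first-order expansion of \<open>phi\<close>: the derivative at a principal unit is 2
  up to smaller terms. By discreteness \<open>smaller\<close> gains a full factor |\<pi>|, and this
  is what the evaluation of the oscillating integral rests on.\<close>

lemma phi_shift:
  assumes a: "v (a - 1) < 1" and h: "v h < 1"
  shows "v (phi (a + h) - phi a - 2 * h) \<le> v \<pi> * v h"
proof -
  have b: "v (a + h - 1) < 1" using val_ultrametric[of "a - 1" h] a h by (simp add: algebra_simps)
  have va: "v a = 1" "v (a + h) = 1"
    using val_add_eq[of "a - 1" 1] val_add_eq[of "a + h - 1" 1] a b by (auto simp: val_1)
  then have nz: "a \<noteq> 0" "a + h \<noteq> 0" by auto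
  have "v ((a + h) * a - 1) \<le> max (v (a + h - 1)) (v (a - 1))"
    by (rule principal_unit_mult) (use a b in auto)
  then have "v ((a + h) * a - 1) < 1" using a b by simp
  then have "v (inverse ((a + h) * a) - inverse 1) < 1"
    by (subst val_inverse_diff) (auto simp: val_mult va val_1)
  then have "v (inverse ((a + h) * a) - 1) \<le> v \<pi>"
    using val_gap[of "inverse ((a + h) * a) - 1" 1] by (simp add: val_1)
  then have "v (inverse ((a + h) * a) - 1) * v h \<le> v \<pi> * v h"
    using val_nonneg by (rule mult_right_mono)
  then have "v (h * (inverse ((a + h) * a) - 1)) \<le> v \<pi> * v h"
    unfolding val_mult[of h] by (simp only: mult.commute[of "v h"])
  moreover have "phi (a + h) - phi a - 2 * h = h * (inverse ((a + h) * a) - 1)"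
    unfolding phi_diff[OF nz(2,1)] by (simp add: algebra_simps)
  ultimately show ?thesis by simp
qed

end

section \<open>Haar measure on the groups X\<close>

locale local_field_haar = nonarch_local_field v \<pi>
  for v :: "'k::field \<Rightarrow> real" and \<pi> :: 'k +
  fixes \<mu> :: "'k measure" and n :: nat
  assumes haar: "haar_measure v \<mu>" and n: "n \<ge> 1"
begin

abbreviation "U \<equiv> principal_units v \<pi> n"
abbreviation "\<Gamma> \<equiv> Gamma_quot v \<pi> n"
abbreviation "cls \<equiv> Gamma_cls v \<pi> n"
abbreviation "X \<equiv> X_group v \<pi> n"
abbreviation "M \<equiv> X_measure v \<pi> \<mu> n"

section \<open>Haar measure of balls and scaling by units\<close>

lemma sets_haar: "sets \<mu> = sigma_sets UNIV (insert {} {vball N c |N c. True})"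
  using haar by (simp add: haar_measure_def sets_measure_of sigma_sets_vball)

lemma space_haar [simp]: "space \<mu> = UNIV"
proof -
  have "sets \<mu> = sets (sigma UNIV {A. openin (val_topology v) A})"
    using haar by (simp add: haar_measure_def)
  from sets_eq_imp_space_eq[OF this] show ?thesis by (simp add: space_measure_of)
qed

lemma vball_sets [measurable]: "vball N c \<in> sets \<mu>"
  unfolding sets_haar by (rule sigma_sets.Basic) blast

lemma vball_translate: "(+) x ` vball N c = vball N (x + c)"
proof
  show "vball N (x + c) \<subseteq> (+) x ` vball N c"
  proof
    fix y assume "y \<in> vball N (x + c)"
    then have "y - x \<in> vball N c" by (simp add: vball_def diff_diff_eq)
    then show "y \<in> (+) x ` vball N c" by (intro image_eqI[of _ _ "y - x"]) auto
  qed
qed (auto simp: vball_def)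

lemma emeasure_vball: "emeasure \<mu> (vball N c) = emeasure \<mu> (vball N 0)"
proof -
  have "emeasure \<mu> ((+) c ` vball N 0) = emeasure \<mu> (vball N 0)"
    using haar vball_sets unfolding haar_measure_def by blast
  then show ?thesis by (simp add: vball_translate)
qed

lemma emeasure_vball_finite: "emeasure \<mu> (vball N c) < \<infinity>"
proof -
  have eq: "integers_of v = vball 0 0" by (auto simp: integers_of_def vball_def)
  have "emeasure \<mu> (integers_of v) = 1" using haar by (simp add: haar_measure_def)
  then have 1: "emeasure \<mu> (vball 0 0) = 1" by (simp only: eq)
  have "emeasure \<mu> (vball N 0) \<le> emeasure \<mu> (vball 0 0)"
    by (rule emeasure_mono) (use vball_mono[of 0 N 0] in auto)
  then show ?thesis unfolding emeasure_vball[of N c] using 1 by (auto intro: le_less_trans)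
qed

lemma vimage_scale:
  assumes a: "v a = 1" shows "(\<lambda>x. a * x) -` vball N c = vball N (c / a)"
proof -
  have nz: "a \<noteq> 0" using a by auto
  have "v (a * x - c) = v (x - c / a)" for x
  proof -
    have "a * x - c = a * (x - c / a)" using nz by (simp add: field_simps)
    then show ?thesis using a by (simp add: val_mult)
  qed
  then show ?thesis by (simp add: vball_def vimage_def)
qed

lemma measurable_scale:
  assumes a: "v a = 1" shows "(\<lambda>x. a * x) \<in> measurable \<mu> \<mu>"
proof (rule measurable_sigma_sets[OF sets_haar])
  fix A assume "A \<in> insert {} {vball N c |N c. True}"
  then consider "A = {}" | N c where "A = vball N c" by blast
  then show "(\<lambda>x. a * x) -` A \<inter> space \<mu> \<in> sets \<mu>" by cases (auto simp: vimage_scale[OF a])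
qed auto

text \<open>Multiplication by a unit carries balls to balls of the same radius, whose measures agree
  by translation invariance. Countably many unit balls cover the field, so the measures
  agree.\<close>

lemma haar_scale:
  assumes a: "v a = 1" shows "distr \<mu> \<mu> (\<lambda>x. a * x) = \<mu>"
proof -
  note m = measurable_scale[OF a] and pre = vimage_scale[OF a]
  obtain Q where Q: "countable Q" "\<And>x m. \<exists>s\<in>Q. v (x - s) \<le> v \<pi> ^ m" using countable_dense_net by blast
  let ?D = "distr \<mu> \<mu> (\<lambda>x. a * x)"
  have fin: "emeasure ?D (vball 0 c) \<noteq> \<infinity>" for c
    using emeasure_vball_finite[of 0 "c / a"] by (simp add: emeasure_distr[OF m] pre)
  have eq: "emeasure ?D A = emeasure \<mu> A" if "A \<in> insert {} {vball N c |N c. True}" for A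
  proof -
    from that consider "A = {}" | N c where "A = vball N c" by blast
    then show ?thesis
    proof cases
      case 2
      then show ?thesis
        using emeasure_vball[of N c] emeasure_vball[of N "c / a"] by (simp add: emeasure_distr[OF m] pre)
    qed simp
  qed
  have un: "(\<Union>i. vball 0 (from_nat_into Q i)) = UNIV"
  proof (rule UNIV_eq_I[symmetric])
    fix x
    obtain s where s: "s \<in> Q" "v (x - s) \<le> v \<pi> ^ 0" using Q(2) by blast
    obtain i where "from_nat_into Q i = s" using from_nat_into_surj[OF Q(1) s(1)] by blast
    then have "x \<in> vball 0 (from_nat_into Q i)" using s(2) by (simp add: vball_def)
    then show "x \<in> (\<Union>i. vball 0 (from_nat_into Q i))" by blast
  qed
  have sD: "sets ?D = sigma_sets UNIV (insert {} {vball N c |N c. True})" by (simp add: sets_haar)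
  show ?thesis
    by (rule measure_eqI_generator_eq[OF Int_stable_vball _ eq sD sets_haar _ un fin]) auto
qed

text \<open>If f is constant on balls of one fixed radius, its preimages are countable unions of
  balls, by separability. The measurability of class maps, characters and translated inner products
  is obtained in this way.\<close>

lemma measurable_locally_const:
  assumes f: "\<And>x y. x \<in> A \<Longrightarrow> y \<in> A \<Longrightarrow> v (x - y) \<le> v \<pi> ^ m \<Longrightarrow> f x = f y"
    and sp: "\<And>x. x \<in> A \<Longrightarrow> f x \<in> space K"
  shows "f \<in> measurable (restrict_space \<mu> A) K"
proof (rule measurableI)
  show "f x \<in> space K" if "x \<in> space (restrict_space \<mu> A)" for x
    using that sp by (simp add: space_restrict_space)
  fix B assume "B \<in> sets K"
  obtain Q where Q: "countable Q" "\<And>x m. \<exists>s\<in>Q. v (x - s) \<le> v \<pi> ^ m" using countable_dense_net by blast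
  define Q' where "Q' = {s \<in> Q. \<exists>x\<in>A \<inter> vball m s. f x \<in> B}"
  have "f -` B \<inter> A = A \<inter> (\<Union>s\<in>Q'. vball m s)"
  proof (intro equalityI subsetI)
    fix x assume x: "x \<in> f -` B \<inter> A"
    obtain s where s: "s \<in> Q" "v (x - s) \<le> v \<pi> ^ m" using Q(2) by blast
    then have "x \<in> vball m s" by (simp add: vball_def)
    then have "s \<in> Q'" using x s(1) by (auto simp: Q'_def)
    then show "x \<in> A \<inter> (\<Union>s\<in>Q'. vball m s)" using x \<open>x \<in> vball m s\<close> by auto
  next
    fix x assume "x \<in> A \<inter> (\<Union>s\<in>Q'. vball m s)"
    then obtain s y where s: "x \<in> A" "x \<in> vball m s" "y \<in> A" "y \<in> vball m s" "f y \<in> B"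
      by (auto simp: Q'_def)
    have "v (x - y) \<le> v \<pi> ^ m"
      using val_triangle[of x s _ y] s(2,4) by (simp add: vball_def val_minus_commute[of y s])
    then show "x \<in> f -` B \<inter> A" using f[OF s(1,3)] s(1,5) by simp
  qed
  moreover have "(\<Union>s\<in>Q'. vball m s) \<in> sets \<mu>"
    by (rule sets.countable_UN') (auto simp: Q'_def intro: countable_subset[OF _ Q(1)])
  ultimately show "f -` B \<inter> space (restrict_space \<mu> A) \<in> sets (restrict_space \<mu> A)"
    by (auto simp: space_restrict_space sets_restrict_space)
qed

section \<open>Units, classes and the group law\<close>

lemma U_eq: "U = vball n 1"
  by (auto simp: principal_units_iff vball_def)

lemma U_iff: "a \<in> U \<longleftrightarrow> v (a - 1) \<le> v \<pi> ^ n"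
  by (rule principal_units_iff)

lemma U_val: "a \<in> U \<Longrightarrow> v a = 1"
  by (rule val_principal_unit[OF n])

lemma U_nonzero: "a \<in> U \<Longrightarrow> a \<noteq> 0"
  using U_val[of a] by auto

lemma U_one: "1 \<in> U"
  using val_uniformizer_pos by (simp add: U_iff)

lemma U_mult: "a \<in> U \<Longrightarrow> b \<in> U \<Longrightarrow> a * b \<in> U"
  unfolding U_iff by (rule principal_unit_mult[OF _ _ uniformizer_power_le_1])

lemma U_inverse: "a \<in> U \<Longrightarrow> inverse a \<in> U"
  using val_inverse_diff[of a 1] U_val[of a] by (simp add: U_iff val_1)

lemma U_divide: "a \<in> U \<Longrightarrow> b \<in> U \<Longrightarrow> a / b \<in> U"
  unfolding divide_inverse by (intro U_mult U_inverse)

lemma U_lt_1: "a \<in> U \<Longrightarrow> v (a - 1) < 1"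
  using uniformizer_power_antimono[OF n] val_uniformizer_less_1 by (simp add: U_iff)

lemma U_sets [measurable]: "U \<in> sets \<mu>"
  by (simp add: U_eq)

text \<open>The multiplicative form avoids the negative exponent in the ideal and matches the
  cut-off condition used for the kernel.\<close>

lemma cls_eq_iff: "cls s = cls t \<longleftrightarrow> v (s - t) * v \<pi> ^ n \<le> 1"
proof -
  have "cls s = cls t \<longleftrightarrow> (s, t) \<in> Gamma_rel v \<pi> n"
    unfolding Gamma_cls_def using eq_equiv_class_iff[OF equiv_Gamma_rel] by simp
  also have "\<dots> \<longleftrightarrow> v (s - t) * v \<pi> ^ n \<le> 1"
    using val_uniformizer_pos by (simp add: Gamma_rel_def frac_ideal_eq power_int_minus field_simps)
  finally show ?thesis .
qed

lemma Gamma_iff: "C \<in> \<Gamma> \<longleftrightarrow> (\<exists>t. C = cls t)"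
  by (auto simp: Gamma_quot_def Gamma_cls_def quotient_def)

lemma cls_in_Gamma [simp]: "cls t \<in> \<Gamma>"
  by (auto simp: Gamma_iff)

lemma cls_translate: "(+) s ` cls t = cls (s + t)"
proof
  have iff: "x \<in> cls t \<longleftrightarrow> v (t - x) * v \<pi> ^ n \<le> 1" for x t
    using val_uniformizer_pos
    by (simp add: Gamma_cls_def Gamma_rel_def frac_ideal_eq power_int_minus field_simps)
  show "(+) s ` cls t \<subseteq> cls (s + t)" by (auto simp: iff)
  show "cls (s + t) \<subseteq> (+) s ` cls t"
  proof
    fix x assume "x \<in> cls (s + t)"
    then have "x - s \<in> cls t" by (simp add: iff algebra_simps)
    then show "x \<in> (+) s ` cls t" by (intro image_eqI[of _ _ "x - s"]) auto
  qed
qed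

lemma bij_cls_translate: "bij_betw ((`) ((+) s)) \<Gamma> \<Gamma>"
proof (rule bij_betw_byWitness[where f' = "(`) ((+) (- s))"])
  show "\<forall>C\<in>\<Gamma>. (+) (- s) ` ((+) s ` C) = C" "\<forall>C\<in>\<Gamma>. (+) s ` ((+) (- s) ` C) = C"
    unfolding image_image by auto
  show "(`) ((+) s) ` \<Gamma> \<subseteq> \<Gamma>" "(`) ((+) (- s)) ` \<Gamma> \<subseteq> \<Gamma>"
    by (auto simp: Gamma_iff simp del: uminus_add_conv_diff) (metis cls_translate)+
qed

text \<open>Classes are cosets of an open subgroup of a separable group. Countability makes the
  counting measure sigma-finite and lets measurability be checked one class at a time.\<close>

lemma countable_Gamma: "countable \<Gamma>"
proof -
  obtain Q where Q: "countable Q" "\<And>x m. \<exists>s\<in>Q. v (x - s) \<le> v \<pi> ^ m" using countable_dense_net by blast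
  have "\<Gamma> \<subseteq> cls ` Q"
  proof
    fix C assume "C \<in> \<Gamma>"
    then obtain t where t: "C = cls t" by (auto simp: Gamma_iff)
    obtain s where s: "s \<in> Q" "v (t - s) \<le> v \<pi> ^ 0" using Q(2) by blast
    have "v (t - s) * v \<pi> ^ n \<le> 1"
      using s(2) uniformizer_power_le_1[of n] val_nonneg by (simp add: mult_le_one)
    then show "C \<in> cls ` Q" using t s(1) by (auto simp: cls_eq_iff[symmetric])
  qed
  then show ?thesis using Q(1) by (meson countable_image countable_subset)
qed

lemma carrier_X: "carrier X = U \<times> \<Gamma>"
  by (simp add: X_group_def)

lemma X_cases:
  assumes "x \<in> carrier X" obtains a t where "a \<in> U" "x = (a, cls t)"
  using assms by (auto simp: carrier_X Gamma_iff)

lemma in_carrier_X [simp]: "(a, cls t) \<in> carrier X \<longleftrightarrow> a \<in> U"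
  by (simp add: carrier_X)

lemma one_X: "\<one>\<^bsub>X\<^esub> = (1, cls 0)"
  by (simp add: X_group_def)

lemma mult_X: "b \<in> U \<Longrightarrow> (a, cls t) \<otimes>\<^bsub>X\<^esub> (b, cls s) = (a * b, cls (inverse b * t + s))"
  by (rule X_mult_class[OF n])

lemma group_X: "group X"
proof (rule groupI)
  fix x y z assume "x \<in> carrier X" "y \<in> carrier X" "z \<in> carrier X"
  then obtain a t b s c r where *: "a \<in> U" "x = (a, cls t)" "b \<in> U" "y = (b, cls s)" "c \<in> U" "z = (c, cls r)"
    by (metis X_cases)
  have nz: "b \<noteq> 0" "c \<noteq> 0" using * U_nonzero by auto
  show "x \<otimes>\<^bsub>X\<^esub> y \<otimes>\<^bsub>X\<^esub> z = x \<otimes>\<^bsub>X\<^esub> (y \<otimes>\<^bsub>X\<^esub> z)"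
    using * nz by (simp add: mult_X U_mult algebra_simps)
next
  fix x y assume "x \<in> carrier X" "y \<in> carrier X"
  then obtain a t b s where "a \<in> U" "x = (a, cls t)" "b \<in> U" "y = (b, cls s)"
    by (metis X_cases)
  then show "x \<otimes>\<^bsub>X\<^esub> y \<in> carrier X" by (simp add: mult_X U_mult)
next
  show "\<one>\<^bsub>X\<^esub> \<in> carrier X" by (simp add: one_X U_one)
next
  fix x assume "x \<in> carrier X"
  then obtain a t where *: "a \<in> U" "x = (a, cls t)" by (rule X_cases)
  then show "\<one>\<^bsub>X\<^esub> \<otimes>\<^bsub>X\<^esub> x = x" by (simp add: one_X mult_X)
  have "(inverse a, cls (- a * t)) \<otimes>\<^bsub>X\<^esub> x = \<one>\<^bsub>X\<^esub>"
    using * U_nonzero[of a] by (simp add: one_X mult_X mult.assoc[symmetric])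
  then show "\<exists>y\<in>carrier X. y \<otimes>\<^bsub>X\<^esub> x = \<one>\<^bsub>X\<^esub>"
    using * U_inverse by (intro bexI[of _ "(inverse a, cls (- a * t))"]) auto
qed

sublocale G: group X by (rule group_X)

lemma inv_X: "a \<in> U \<Longrightarrow> inv\<^bsub>X\<^esub> (a, cls t) = (inverse a, cls (- a * t))"
  using U_nonzero[of a] by (intro G.inv_equality) (simp_all add: one_X mult_X U_inverse mult.assoc[symmetric])

lemma mult_inv_X:
  "a \<in> U \<Longrightarrow> b \<in> U \<Longrightarrow> (b, cls s) \<otimes>\<^bsub>X\<^esub> inv\<^bsub>X\<^esub> (a, cls t) = (b / a, cls (a * (s - t)))"
  by (simp add: inv_X mult_X U_inverse divide_inverse algebra_simps)

lemma inv_mult_X: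
  "a \<in> U \<Longrightarrow> b \<in> U \<Longrightarrow> inv\<^bsub>X\<^esub> (a, cls t) \<otimes>\<^bsub>X\<^esub> (b, cls s) = (b / a, cls (s - a * t / b))"
  by (simp add: inv_X mult_X divide_inverse algebra_simps)

section \<open>Generators and left invariance of the product measure\<close>

lemma space_M: "space M = carrier X"
  by (simp add: X_measure_def space_pair_measure space_restrict_space carrier_X)

definition unit_sets :: "'k set set" where
  "unit_sets = (\<inter>) U ` insert {} {vball N c |N c. True}"

definition basic_sets :: "('k \<times> 'k set) set set" where
  "basic_sets = {A \<times> B |A B. A \<in> unit_sets \<and> B \<in> insert {} {{C} |C. C \<in> \<Gamma>}}"

lemma emeasure_U: "A \<subseteq> U \<Longrightarrow> emeasure (restrict_space \<mu> U) A = emeasure \<mu> A"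
  by (rule emeasure_restrict_space) auto

lemma generates_U: "generates (restrict_space \<mu> U) unit_sets"
proof -
  let ?E = "insert {} {vball N c |N c. True}"
  have sp: "space (restrict_space \<mu> U) = U" by (simp add: space_restrict_space)
  have "sets (restrict_space \<mu> U) = (\<inter>) U ` sigma_sets UNIV ?E"
    by (simp add: sets_restrict_space sets_haar)
  also have "\<dots> = sigma_sets U ((\<inter>) U ` ?E)"
    by (rule sigma_sets_Int) (use U_sets sets_haar in auto)
  finally have sets: "sets (restrict_space \<mu> U) = sigma_sets U unit_sets" by (simp add: unit_sets_def)
  have int: "Int_stable unit_sets"
  proof (rule Int_stableI)
    fix a b assume "a \<in> unit_sets" "b \<in> unit_sets"
    then obtain a' b' where ab: "a = U \<inter> a'" "b = U \<inter> b'" "a' \<in> ?E" "b' \<in> ?E" by (auto simp: unit_sets_def)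
    then have "a' \<inter> b' \<in> ?E" using Int_stable_vball by (meson Int_stable_def)
    moreover have "a \<inter> b = U \<inter> (a' \<inter> b')" using ab by auto
    ultimately show "a \<inter> b \<in> unit_sets" unfolding unit_sets_def by blast
  qed
  have fin: "emeasure (restrict_space \<mu> U) A < \<infinity>" if "A \<in> unit_sets" for A
  proof -
    have A: "A \<subseteq> U" using that by (auto simp: unit_sets_def)
    then have "emeasure \<mu> A \<le> emeasure \<mu> (vball n 1)" by (intro emeasure_mono) (auto simp: U_eq)
    then show ?thesis using emeasure_vball_finite[of n 1] emeasure_U[OF A] by (auto intro: le_less_trans)
  qed
  have "U \<in> unit_sets" "{} \<in> unit_sets"
    unfolding unit_sets_def by (auto intro!: image_eqI[of _ _ "vball n 1"] simp: U_eq)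
  then have "\<exists>C :: nat \<Rightarrow> _. range C \<subseteq> unit_sets \<and> disjoint_family C \<and> \<Union>(range C) = U"
    by (intro exI[of _ "\<lambda>i. if i = 0 then U else {}"]) (auto simp: disjoint_family_on_def split: if_splits)
  then show ?thesis
    unfolding generates_def sp using sets int fin by (auto simp: unit_sets_def)
qed

lemma generates_Gamma: "generates (count_space \<Gamma>) (insert {} {{C} |C. C \<in> \<Gamma>})"
proof -
  let ?E = "insert {} {{C} |C. C \<in> \<Gamma>}"
  have "Pow \<Gamma> = sigma_sets \<Gamma> ?E"
  proof
    show "Pow \<Gamma> \<subseteq> sigma_sets \<Gamma> ?E"
    proof
      fix A assume A: "A \<in> Pow \<Gamma>"
      have "\<Union>((\<lambda>C. {C}) ` A) \<in> sigma_sets \<Gamma> ?E"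
      proof (rule sigma_sets_UNION)
        show "countable ((\<lambda>C. {C}) ` A)"
          using A countable_Gamma by (auto intro: countable_subset)
        fix B assume "B \<in> (\<lambda>C. {C}) ` A"
        then obtain C where "B = {C}" "C \<in> \<Gamma>" using A by auto
        then show "B \<in> sigma_sets \<Gamma> ?E" by (intro sigma_sets.Basic insertI2 CollectI exI[of _ C] conjI)
      qed
      then show "A \<in> sigma_sets \<Gamma> ?E" by simp
    qed
    show "sigma_sets \<Gamma> ?E \<subseteq> Pow \<Gamma>" using sigma_sets_into_sp[of ?E \<Gamma>] by auto
  qed
  moreover have "Int_stable ?E"
  proof (rule Int_stableI)
    fix a b assume "a \<in> ?E" "b \<in> ?E"
    then have "\<exists>C. a \<subseteq> {C}" by auto
    then have "a \<inter> b = {} \<or> a \<inter> b = a" by blast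
    then show "a \<inter> b \<in> ?E" using \<open>a \<in> ?E\<close> by (elim disjE) (simp_all only: insertI1)
  qed
  moreover have "\<exists>D :: nat \<Rightarrow> _. range D \<subseteq> ?E \<and> disjoint_family D \<and> \<Union>(range D) = \<Gamma>"
  proof (intro exI conjI)
    let ?D = "\<lambda>i. {C \<in> \<Gamma>. to_nat_on \<Gamma> C = i}"
    have inj: "inj_on (to_nat_on \<Gamma>) \<Gamma>" by (rule inj_on_to_nat_on[OF countable_Gamma])
    show "range ?D \<subseteq> ?E"
    proof (rule image_subsetI)
      fix i
      show "?D i \<in> ?E"
      proof (cases "?D i = {}")
        case False
        then obtain C where "C \<in> \<Gamma>" "to_nat_on \<Gamma> C = i" by blast
        then have "?D i = {C}" using inj by (auto dest: inj_onD)
        moreover have "{C} \<in> ?E" using \<open>C \<in> \<Gamma>\<close> by (intro insertI2 CollectI exI[of _ C] conjI refl)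
        ultimately show ?thesis by (simp only:)
      qed (simp only: insertI1)
    qed
  qed (auto simp: disjoint_family_on_def)
  moreover have "emeasure (count_space \<Gamma>) A < \<infinity>" if "A \<in> ?E" for A
    using that by (auto simp: emeasure_count_space)
  moreover have "?E \<subseteq> Pow \<Gamma>" by auto
  ultimately show ?thesis
    unfolding generates_def space_count_space sets_count_space by (intro conjI ballI)
qed

lemma generates_M: "generates M basic_sets"
  unfolding X_measure_def basic_sets_def by (rule generates_pair[OF generates_U generates_Gamma])

text \<open>The element (a, t) is the product of (a, 0) and (1, t). The first scales the unit
  coordinate and fixes the class; the second is a shear, which fixes the unit x and adds t/x to the
  class.\<close>

lemma left_mult_measure_preserving:
  assumes g: "g \<in> carrier X"
  shows "(\<lambda>x. g \<otimes>\<^bsub>X\<^esub> x) \<in> measurable M M" "distr M M (\<lambda>x. g \<otimes>\<^bsub>X\<^esub> x) = M"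
proof -
  let ?M1 = "restrict_space \<mu> U" and ?N = "count_space \<Gamma>"
  interpret N: sigma_finite_measure ?N by (rule generates_sigma_finite[OF generates_Gamma])
  interpret M1: sigma_finite_measure ?M1 by (rule generates_sigma_finite[OF generates_U])
  obtain a t where a: "a \<in> U" and g_eq: "g = (a, cls t)" using g by (rule X_cases)
  let ?f = "\<lambda>x. (a, cls 0) \<otimes>\<^bsub>X\<^esub> x" and ?h = "\<lambda>x. (1, cls t) \<otimes>\<^bsub>X\<^esub> x"
  have f: "?f \<in> measurable M M \<and> distr M M ?f = M"
  proof -
    have sc: "(\<lambda>x. a * x) \<in> measurable ?M1 ?M1"
      using measurable_scale[OF U_val[OF a]] U_mult[OF a]
      by (auto intro!: measurable_restrict_space3)
    have d: "distr ?M1 ?M1 (\<lambda>x. a * x) = ?M1"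
    proof (rule measure_eqI)
      fix A assume A: "A \<in> sets (distr ?M1 ?M1 (\<lambda>x. a * x))"
      then have AU: "A \<subseteq> U" "A \<in> sets \<mu>" by (auto simp: sets_restrict_space)
      have pre: "(\<lambda>x. a * x) -` A \<inter> U = (\<lambda>x. a * x) -` A"
      proof -
        have "x \<in> U" if "a * x \<in> A" for x
          using U_divide[of "a * x" a] that AU(1) a U_nonzero[OF a] by auto
        then show ?thesis by auto
      qed
      have "emeasure (distr ?M1 ?M1 (\<lambda>x. a * x)) A = emeasure ?M1 ((\<lambda>x. a * x) -` A \<inter> U)"
        using A by (simp add: emeasure_distr[OF sc] space_restrict_space)
      also have "\<dots> = emeasure \<mu> ((\<lambda>x. a * x) -` A \<inter> U)" by (rule emeasure_U) auto
      also have "\<dots> = emeasure (distr \<mu> \<mu> (\<lambda>x. a * x)) A"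
        using AU measurable_scale[OF U_val[OF a]] by (simp add: emeasure_distr pre)
      also have "\<dots> = emeasure ?M1 A" using haar_scale[OF U_val[OF a]] emeasure_U[OF AU(1)] by simp
      finally show "emeasure (distr ?M1 ?M1 (\<lambda>x. a * x)) A = emeasure ?M1 A" .
    qed simp
    have m: "(\<lambda>(x, y). (a * x, y)) \<in> measurable (?M1 \<Otimes>\<^sub>M ?N) (?M1 \<Otimes>\<^sub>M ?N)"
      using sc by measurable
    have idN: "distr ?N ?N (\<lambda>y. y) = ?N" by (rule distr_id)
    have "distr ?M1 ?M1 (\<lambda>x. a * x) \<Otimes>\<^sub>M distr ?N ?N (\<lambda>y. y)
        = distr (?M1 \<Otimes>\<^sub>M ?N) (?M1 \<Otimes>\<^sub>M ?N) (\<lambda>(x, y). (a * x, y))"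
      by (rule pair_measure_distr[OF sc]) (use idN N.sigma_finite_measure_axioms in auto)
    then have "distr M M (\<lambda>(x, y). (a * x, y)) = M" by (simp add: d idN X_measure_def)
    moreover have eq: "?f x = (case x of (x, y) \<Rightarrow> (a * x, y))" if "x \<in> space M" for x
      using that unfolding space_M by (elim X_cases) (simp add: mult_X)
    ultimately show ?thesis
      using m measurable_cong[of M ?f "\<lambda>(x, y). (a * x, y)" M] distr_cong[of M M M M ?f "\<lambda>(x, y). (a * x, y)"]
      by (auto simp: X_measure_def)
  qed
  have h: "?h \<in> measurable M M \<and> distr M M ?h = M"
  proof -
    let ?k = "\<lambda>(x, y). (x, (+) (inverse x * t) ` y)"
    have snd: "(\<lambda>(x, y). (+) (inverse x * t) ` y) \<in> measurable (?M1 \<Otimes>\<^sub>M ?N) ?N"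
    proof -
      \<comment> \<open>For a fixed class the shear is locally constant in x, because inversion is
        an isometry on units. There are countably many classes.\<close>
      have slice: "(\<lambda>x. (+) (inverse x * t) ` C) \<in> measurable ?M1 ?N" if "C \<in> \<Gamma>" for C
      proof -
      obtain s where s: "C = cls s" using \<open>C \<in> \<Gamma>\<close> by (auto simp: Gamma_iff)
      obtain m where m: "v t * v \<pi> ^ m \<le> 1" using uniformizer_power_bounded by blast
      have "(\<lambda>x. cls (inverse x * t + s)) \<in> measurable ?M1 ?N"
      proof (rule measurable_locally_const[where m = m])
        fix x y assume xy: "x \<in> U" "y \<in> U" "v (x - y) \<le> v \<pi> ^ m"
        have "v (inverse x * t + s - (inverse y * t + s)) = v (x - y) * v t"
          using val_inverse_diff[OF U_val[OF xy(1)] U_val[OF xy(2)]]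
          by (simp add: val_mult flip: left_diff_distrib)
        also have "\<dots> \<le> v \<pi> ^ m * v t" using xy(3) val_nonneg by (rule mult_right_mono)
        also have "\<dots> \<le> 1" using m by (simp add: mult.commute)
        finally have "v (inverse x * t + s - (inverse y * t + s)) * v \<pi> ^ n \<le> 1"
          using uniformizer_power_le_1[of n] val_nonneg val_uniformizer_pos by (intro mult_le_one) auto
        then show "cls (inverse x * t + s) = cls (inverse y * t + s)" by (simp only: cls_eq_iff)
      qed simp
      then show ?thesis by (simp add: s cls_translate)
      qed
      have "(\<lambda>z. (+) (inverse (fst z) * t) ` snd z) \<in> measurable (?M1 \<Otimes>\<^sub>M ?N) ?N"
        by (rule measurable_compose_countable'[where f = "\<lambda>C z. (+) (inverse (fst z) * t) ` C" and g = snd,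
              OF measurable_compose[OF measurable_fst slice] measurable_snd countable_Gamma])
      then show ?thesis by (simp add: case_prod_beta')
    qed
    have k: "?k \<in> measurable (?M1 \<Otimes>\<^sub>M ?N) (?M1 \<Otimes>\<^sub>M ?N)"
      using measurable_Pair[OF measurable_fst[of ?M1 ?N] snd] by (simp add: case_prod_beta')
    have "distr (?M1 \<Otimes>\<^sub>M ?N) (?M1 \<Otimes>\<^sub>M ?N) ?k = ?M1 \<Otimes>\<^sub>M ?N"
    proof (rule measure_eqI)
      fix A assume "A \<in> sets (distr (?M1 \<Otimes>\<^sub>M ?N) (?M1 \<Otimes>\<^sub>M ?N) ?k)"
      then have A [measurable]: "A \<in> sets (?M1 \<Otimes>\<^sub>M ?N)" by simp
      have "emeasure (distr (?M1 \<Otimes>\<^sub>M ?N) (?M1 \<Otimes>\<^sub>M ?N) ?k) A = emeasure (?M1 \<Otimes>\<^sub>M ?N) (?k -` A \<inter> space (?M1 \<Otimes>\<^sub>M ?N))"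
        by (rule emeasure_distr[OF k A])
      also have "\<dots> = (\<integral>\<^sup>+x. emeasure ?N (Pair x -` (?k -` A \<inter> space (?M1 \<Otimes>\<^sub>M ?N))) \<partial>?M1)"
        by (rule N.emeasure_pair_measure_alt) (rule measurable_sets[OF k A])
      also have "\<dots> = (\<integral>\<^sup>+x. emeasure ?N (Pair x -` A) \<partial>?M1)"
      \<comment> \<open>On each fibre the shear is a bijection of the classes, and counting measure
        is invariant under bijections.\<close>
      proof (rule nn_integral_cong)
        fix x assume x: "x \<in> space ?M1"
        let ?s = "(`) ((+) (inverse x * t))"
        have "Pair x -` (?k -` A \<inter> space (?M1 \<Otimes>\<^sub>M ?N)) = ?s -` (Pair x -` A) \<inter> space ?N"
          using x by (auto simp: space_pair_measure)
        moreover have "emeasure (distr ?N ?N ?s) (Pair x -` A) = emeasure ?N (?s -` (Pair x -` A) \<inter> space ?N)"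
        proof (rule emeasure_distr)
          show "?s \<in> measurable ?N ?N"
            using bij_betw_imp_funcset[OF bij_cls_translate] by simp
          show "Pair x -` A \<in> sets ?N" by (rule sets_Pair1[OF A])
        qed
        moreover have "distr ?N ?N ?s = ?N" by (rule distr_bij_count_space[OF bij_cls_translate])
        ultimately show "emeasure ?N (Pair x -` (?k -` A \<inter> space (?M1 \<Otimes>\<^sub>M ?N))) = emeasure ?N (Pair x -` A)"
          by simp
      qed
      also have "\<dots> = emeasure (?M1 \<Otimes>\<^sub>M ?N) A" by (rule N.emeasure_pair_measure_alt[OF A, symmetric])
      finally show "emeasure (distr (?M1 \<Otimes>\<^sub>M ?N) (?M1 \<Otimes>\<^sub>M ?N) ?k) A = emeasure (?M1 \<Otimes>\<^sub>M ?N) A" .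
    qed simp
    moreover have eq: "?h x = ?k x" if "x \<in> space M" for x
      using that unfolding space_M by (elim X_cases) (simp add: mult_X cls_translate)
    ultimately show ?thesis
      using k measurable_cong[of M ?h ?k M] distr_cong[of M M M M ?h ?k]
      by (auto simp: X_measure_def)
  qed
  have fh: "g \<otimes>\<^bsub>X\<^esub> x = (?f \<circ> ?h) x" if x: "x \<in> space M" for x
  proof -
    have "g = (a, cls 0) \<otimes>\<^bsub>X\<^esub> (1, cls t)" using U_one by (simp add: g_eq mult_X)
    then show ?thesis using x a U_one unfolding space_M by (simp add: G.m_assoc)
  qed
  have comp: "?f \<circ> ?h \<in> measurable M M" using f h by (auto intro: measurable_comp)
  show "(\<lambda>x. g \<otimes>\<^bsub>X\<^esub> x) \<in> measurable M M"
    using comp fh by (simp cong: measurable_cong)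
  have "distr M M (\<lambda>x. g \<otimes>\<^bsub>X\<^esub> x) = distr M M (?f \<circ> ?h)"
    by (rule distr_cong) (use fh in auto)
  also have "\<dots> = distr (distr M M ?h) M ?f" by (rule distr_distr[symmetric]) (use f h in auto)
  finally show "distr M M (\<lambda>x. g \<otimes>\<^bsub>X\<^esub> x) = M" using f h by simp
qed

end

section \<open>The twist on indicators of balls\<close>

lemma integral_tensor:
  fixes f :: "'a \<Rightarrow> complex" and g :: "'b \<Rightarrow> complex"
  assumes M: "sigma_finite_measure M" and N: "sigma_finite_measure N"
    and f: "integrable M f" and g: "integrable N g"
  shows "(\<integral>z. f (fst z) * g (snd z) \<partial>(M \<Otimes>\<^sub>M N)) = (\<integral>x. f x \<partial>M) * (\<integral>y. g y \<partial>N)"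
proof -
  interpret pair_sigma_finite M N using M N by (simp add: pair_sigma_finite_def)
  have [measurable]: "f \<in> borel_measurable M" "g \<in> borel_measurable N" using f g by auto
  have "(\<integral>\<^sup>+z. ennreal (cmod (f (fst z) * g (snd z))) \<partial>(M \<Otimes>\<^sub>M N)) =
      (\<integral>\<^sup>+x. \<integral>\<^sup>+y. ennreal (cmod (f x)) * ennreal (cmod (g y)) \<partial>N \<partial>M)"
    by (subst M2.nn_integral_fst[symmetric]) (auto simp: norm_mult ennreal_mult)
  also have "\<dots> = (\<integral>\<^sup>+x. ennreal (cmod (f x)) \<partial>M) * (\<integral>\<^sup>+y. ennreal (cmod (g y)) \<partial>N)"
    by (simp add: nn_integral_cmult nn_integral_multc)
  also have "\<dots> < \<infinity>"
    using f g by (auto simp: integrable_iff_bounded ennreal_mult_less_top)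
  finally have int: "integrable (M \<Otimes>\<^sub>M N) (\<lambda>z. f (fst z) * g (snd z))"
    by (intro integrableI_bounded) auto
  show ?thesis
    using integral_fst'[OF int] by simp
qed

locale twist_setting = local_field_haar v \<pi> \<mu> n
  for v :: "'k::field \<Rightarrow> real" and \<pi> :: 'k and \<mu> :: "'k measure" and n :: nat +
  fixes \<Psi> :: "'k \<Rightarrow> complex"
  assumes character: "unitary_character v \<Psi>"
    and trivial: "\<forall>x\<in>integers_of v. \<Psi> x = 1"
    and nontrivial: "\<exists>x\<in>frac_ideal v \<pi> (- 1). \<Psi> x \<noteq> 1"
    and val_2: "v 2 = 1"
begin

section \<open>The character and its integrals over balls of units\<close>

lemma char_add: "\<Psi> (x + y) = \<Psi> x * \<Psi> y"
  using character by (simp add: unitary_character_def)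

lemma char_norm: "cmod (\<Psi> x) = 1"
  using character by (simp add: unitary_character_def)

lemma char_trivial: "v x \<le> 1 \<Longrightarrow> \<Psi> x = 1"
  using trivial by (simp add: integers_of_def)

lemma char_cong: "v (x - y) \<le> 1 \<Longrightarrow> \<Psi> x = \<Psi> y"
  using char_add[of "x - y" y] char_trivial[of "x - y"] by simp

lemma char_nontrivial: obtains w where "v w * v \<pi> \<le> 1" "\<Psi> w \<noteq> 1"
proof -
  obtain w where "v w \<le> v \<pi> powi (- 1)" "\<Psi> w \<noteq> 1" using nontrivial by (auto simp: frac_ideal_eq)
  then show thesis using val_uniformizer_pos by (intro that[of w]) (auto simp: power_int_minus field_simps)
qed

text \<open>By discreteness, failing the cut-off means exceeding it by a full factor 1/|\<pi>|. That
  room is needed for a shift by w, where |w| may be as large as 1/|\<pi>|.\<close>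

lemma val_large:
  assumes "\<not> v t * v \<pi> ^ N \<le> 1" shows "1 \<le> v t * v \<pi> ^ N * v \<pi>"
proof -
  have pos: "v \<pi> ^ N > 0" using val_uniformizer_pos by simp
  have "v (inverse (\<pi> ^ N)) < v t" unfolding val_inverse val_power using assms pos by (simp add: field_simps)
  from val_gap[OF this] show ?thesis unfolding val_inverse val_power using pos by (simp add: field_simps)
qed

lemma haar_translate:
  "(\<lambda>x. h + x) \<in> measurable \<mu> \<mu>" "distr \<mu> \<mu> (\<lambda>x. h + x) = \<mu>"
proof -
  have pre: "(\<lambda>x. h + x) -` A = (+) (- h) ` A" for A
  proof (intro equalityI subsetI)
    fix x assume "x \<in> (\<lambda>x. h + x) -` A"
    then show "x \<in> (+) (- h) ` A" by (intro image_eqI[of _ _ "h + x"]) auto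
  qed auto
  show m: "(\<lambda>x. h + x) \<in> measurable \<mu> \<mu>"
  proof (rule measurable_sigma_sets[OF sets_haar])
    fix A assume "A \<in> insert {} {vball N c |N c. True}"
    then consider "A = {}" | N c where "A = vball N c" by blast
    then show "(\<lambda>x. h + x) -` A \<inter> space \<mu> \<in> sets \<mu>"
      by cases (auto simp only: pre vball_translate image_empty space_haar Int_UNIV_right vball_sets sets.empty_sets)
  qed auto
  show "distr \<mu> \<mu> (\<lambda>x. h + x) = \<mu>"
  proof (rule measure_eqI)
    fix A assume "A \<in> sets (distr \<mu> \<mu> (\<lambda>x. h + x))"
    then have A: "A \<in> sets \<mu>" by simp
    have "emeasure (distr \<mu> \<mu> (\<lambda>x. h + x)) A = emeasure \<mu> ((+) (- h) ` A)"
      unfolding emeasure_distr[OF m A] pre by simp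
    also have "\<dots> = emeasure \<mu> A" using haar A unfolding haar_measure_def by blast
    finally show "emeasure (distr \<mu> \<mu> (\<lambda>x. h + x)) A = emeasure \<mu> A" .
  qed simp
qed

definition ball_volume :: "nat \<Rightarrow> real" where
  "ball_volume N = measure \<mu> (vball N 0)"

lemma measure_vball: "measure \<mu> (vball N c) = ball_volume N"
  using emeasure_vball[of N c] by (simp add: measure_def ball_volume_def)

lemma vball_subset_U:
  assumes "N \<ge> n" "c \<in> U" shows "vball N c \<subseteq> U"
  using vball_mono[OF assms(1), of c] assms(2) vball_eq[of c n 1] unfolding U_eq by simp

lemma U_phi_isometry: "a \<in> U \<Longrightarrow> b \<in> U \<Longrightarrow> v (phi a - phi b) = v (a - b)"
  by (rule phi_isometry[OF val_2 U_lt_1 U_lt_1])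

lemma measurable_char_phi:
  assumes N: "N \<ge> n" and c: "c \<in> U"
  shows "(\<lambda>a. indicator (vball N c) a * \<Psi> (phi a * t)) \<in> borel_measurable \<mu>"
proof -
  obtain m where m: "v t * v \<pi> ^ m \<le> 1" using uniformizer_power_bounded by blast
  have "(\<lambda>a. \<Psi> (phi a * t)) \<in> borel_measurable (restrict_space \<mu> (vball N c))"
  proof (rule measurable_locally_const[where m = m])
    fix x y assume xy: "x \<in> vball N c" "y \<in> vball N c" "v (x - y) \<le> v \<pi> ^ m"
    have U: "x \<in> U" "y \<in> U" using xy vball_subset_U[OF N c] by auto
    have "v (phi x * t - phi y * t) = v (x - y) * v t"
      using U_phi_isometry[OF U] by (simp add: val_mult flip: left_diff_distrib)
    also have "\<dots> \<le> v \<pi> ^ m * v t" using xy(3) val_nonneg by (rule mult_right_mono)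
    finally show "\<Psi> (phi x * t) = \<Psi> (phi y * t)" using m by (intro char_cong) (simp add: mult.commute)
  qed auto
  then have "(\<lambda>a. indicator (vball N c) a *\<^sub>R \<Psi> (phi a * t)) \<in> borel_measurable \<mu>"
    by (subst (asm) borel_measurable_restrict_space_iff) auto
  moreover have "(\<lambda>a. indicator (vball N c) a *\<^sub>R \<Psi> (phi a * t)) = (\<lambda>a. indicator (vball N c) a * \<Psi> (phi a * t))"
    by (auto simp: indicator_def)
  ultimately show ?thesis by simp
qed

text \<open>For large \<open>t\<close> translation of \<open>a\<close> by a suitable small \<open>h\<close> multiplies \<open>\<Psi> (phi a * t)\<close> by a
  constant different from \<open>1\<close>, since \<open>phi (a + h)\<close> is \<open>phi a + 2 * h\<close> up to smaller terms.\<close>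

lemma integral_char_phi:
  assumes N: "N \<ge> n" and c: "c \<in> U"
  shows "(\<integral>a. indicator (vball N c) a * \<Psi> (phi a * t) \<partial>\<mu>) =
    (if v t * v \<pi> ^ N \<le> 1 then of_real (ball_volume N) * \<Psi> (phi c * t) else 0)"
proof (cases "v t * v \<pi> ^ N \<le> 1")
  case True
  have "indicator (vball N c) a * \<Psi> (phi a * t) = indicator (vball N c) a *\<^sub>R \<Psi> (phi c * t)" for a
  proof (cases "a \<in> vball N c")
    case a: True
    then have U: "a \<in> U" using vball_subset_U[OF N c] by auto
    have "v (phi a * t - phi c * t) = v (a - c) * v t"
      using U_phi_isometry[OF U c] by (simp add: val_mult flip: left_diff_distrib)
    also have "\<dots> \<le> v \<pi> ^ N * v t" using a val_nonneg by (intro mult_right_mono) (auto simp: vball_def)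
    finally show ?thesis using a True char_cong[of "phi a * t" "phi c * t"] by (simp add: mult.commute)
  qed simp
  then have "(\<integral>a. indicator (vball N c) a * \<Psi> (phi a * t) \<partial>\<mu>) = (\<integral>a. indicator (vball N c) a *\<^sub>R \<Psi> (phi c * t) \<partial>\<mu>)"
    by simp
  also have "\<dots> = measure \<mu> (vball N c) *\<^sub>R \<Psi> (phi c * t)"
    using emeasure_vball_finite[of N c] by (subst integral_scaleR_left) auto
  finally show ?thesis using True by (simp add: measure_vball scaleR_conv_of_real)
next
  case False
  let ?g = "\<lambda>a. indicator (vball N c) a * \<Psi> (phi a * t)"
  obtain w where w: "v w * v \<pi> \<le> 1" "\<Psi> w \<noteq> 1" by (rule char_nontrivial)
  have t0: "t \<noteq> 0" using False by auto
  then have vt: "v t > 0" using val_nonneg[of t] val_eq_0_iff[of t] by linarith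
  have two: "(2 :: 'k) \<noteq> 0" using val_2 by auto
  \<comment> \<open>The shift is chosen so that 2 * h * t = w, the phase at which the character is
    nontrivial. Since t is large, h stays within the radius of the ball.\<close>
  define h where "h = w / (2 * t)"
  have vh: "v h = v w / v t" by (simp add: h_def val_divide val_mult val_2)
  have "v w * v \<pi> \<le> v t * v \<pi> ^ N * v \<pi>" using w(1) val_large[OF False] by linarith
  then have "v w \<le> v t * v \<pi> ^ N" using val_uniformizer_pos by simp
  then have hN: "v h \<le> v \<pi> ^ N" unfolding vh using vt by (simp add: field_simps)
  have h1: "v h < 1"
    using hN uniformizer_power_antimono[of 1 N] N n val_uniformizer_less_1 by simp
  have shift: "?g (h + a) = \<Psi> w * ?g a" for a
  proof -
    have "h + a \<in> vball N c \<longleftrightarrow> a \<in> vball N c"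
    proof -
      have "v (h + a - a) \<le> v \<pi> ^ N" using hN by simp
      then have "h + a \<in> vball N a" by (simp only: vball_def mem_Collect_eq)
      then have "vball N (h + a) = vball N a" using vball_eq by blast
      then show ?thesis using vball_eq[of a N c] vball_eq[of "h + a" N c] vball_self by blast
    qed
    moreover have "\<Psi> (phi (h + a) * t) = \<Psi> w * \<Psi> (phi a * t)" if a: "a \<in> vball N c"
    proof -
      have U: "a \<in> U" using vball_subset_U[OF N c] a by auto
      have "v ((phi (a + h) - phi a - 2 * h) * t) \<le> v \<pi> * v h * v t"
        unfolding val_mult[of _ t] by (intro mult_right_mono phi_shift[OF U_lt_1[OF U] h1] val_nonneg)
      also have "\<dots> = v w * v \<pi>" using vt by (simp add: vh)
      finally have "v ((phi (a + h) - phi a - 2 * h) * t) \<le> 1" using w(1) by simp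
      moreover have "(phi (a + h) - phi a - 2 * h) * t = phi (h + a) * t - (w + phi a * t)"
        using two t0 by (simp add: h_def add.commute left_diff_distrib)
      ultimately have "\<Psi> (phi (h + a) * t) = \<Psi> (w + phi a * t)" by (intro char_cong) (simp only:)
      then show ?thesis by (simp add: char_add)
    qed
    ultimately show ?thesis by (cases "a \<in> vball N c") auto
  qed
  have "(\<integral>a. ?g a \<partial>\<mu>) = (\<integral>a. ?g a \<partial>(distr \<mu> \<mu> (\<lambda>x. h + x)))" unfolding haar_translate(2) ..
  also have "\<dots> = (\<integral>a. ?g (h + a) \<partial>\<mu>)"
    by (rule integral_distr[OF haar_translate(1) measurable_char_phi[OF N c]])
  also have "\<dots> = \<Psi> w * (\<integral>a. ?g a \<partial>\<mu>)" unfolding shift by simp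
  finally have "(1 - \<Psi> w) * (\<integral>a. ?g a \<partial>\<mu>) = 0" by (simp add: left_diff_distrib)
  then show ?thesis using w(2) False by simp
qed

definition uball :: "nat \<Rightarrow> 'k \<times> 'k set \<Rightarrow> ('k \<times> 'k set) set" where
  "uball N p = {x \<in> carrier X. v (fst x - fst p) \<le> v \<pi> ^ N \<and> snd x = snd p}"

definition bounded_part :: "nat \<Rightarrow> ('k \<times> 'k set) set" where
  "bounded_part N = {x \<in> carrier X. \<exists>t. snd x = cls t \<and> v t * v \<pi> ^ N \<le> 1}"

text \<open>Membership asks for one good representative of the class. For N at least n all
  representatives are equally good, as they differ by at most |\<pi>|^(-n).\<close>

lemma bounded_part_iff:
  assumes N: "N \<ge> n" and a: "a \<in> U"
  shows "(a, cls t) \<in> bounded_part N \<longleftrightarrow> v t * v \<pi> ^ N \<le> 1"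
proof
  assume "(a, cls t) \<in> bounded_part N"
  then obtain s where s: "cls t = cls s" "v s * v \<pi> ^ N \<le> 1" by (auto simp: bounded_part_def)
  have "v (t - s) * v \<pi> ^ N \<le> v (t - s) * v \<pi> ^ n"
    by (intro mult_left_mono uniformizer_power_antimono N val_nonneg)
  also have "\<dots> \<le> 1" using s(1) by (simp add: cls_eq_iff)
  finally have "v (\<pi> ^ N * (t - s)) \<le> 1" by (simp add: val_mult val_power mult.commute)
  then have "v (\<pi> ^ N * (t - s) + \<pi> ^ N * s) \<le> 1"
    using s(2) by (intro val_add_le) (auto simp: val_mult val_power mult.commute)
  moreover have "\<pi> ^ N * (t - s) + \<pi> ^ N * s = \<pi> ^ N * t" by (simp add: right_diff_distrib)
  ultimately show "v t * v \<pi> ^ N \<le> 1" by (simp add: val_mult val_power mult.commute)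
qed (use a in \<open>auto simp: bounded_part_def\<close>)

text \<open>Each of the two integrals over balls contributes one factor \<open>ball_volume N\<close>
  and one cut-off. The remaining factor is the kernel of F at the two centres.\<close>

definition kappa :: "nat \<Rightarrow> 'k \<times> 'k set \<Rightarrow> 'k \<times> 'k set \<Rightarrow> complex" where
  "kappa N x y = (if x \<in> bounded_part N \<and> y \<in> bounded_part N
     then of_nat (residue_card v \<pi>) ^ (2 * n) * (of_real (ball_volume N))\<^sup>2 * twist_kernel \<Psi> (x, y) else 0)"

lemma twist_kernel_cls:
  "a \<in> U \<Longrightarrow> b \<in> U \<Longrightarrow> twist_kernel \<Psi> ((a, cls t), (b, cls s)) = \<Psi> (phi a * s - phi b * t)"
  by (rule twist_kernel_class[OF n _ _ character trivial])

lemma kappa_cls: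
  assumes "N \<ge> n" "a \<in> U" "b \<in> U"
  shows "kappa N (a, cls t) (b, cls s) = (if v t * v \<pi> ^ N \<le> 1 \<and> v s * v \<pi> ^ N \<le> 1
     then of_nat (residue_card v \<pi>) ^ (2 * n) * (of_real (ball_volume N))\<^sup>2 * \<Psi> (phi a * s - phi b * t) else 0)"
  using assms by (simp add: kappa_def bounded_part_iff twist_kernel_cls)

lemma uball_eq:
  assumes "N \<ge> n" "b \<in> U" shows "uball N (b, cls s) = vball N b \<times> {cls s}"
  using vball_subset_U[OF assms] by (auto simp: uball_def carrier_X vball_def)

lemma uball_sets: "p \<in> carrier X \<Longrightarrow> uball N p \<in> basic_sets"
proof -
  assume "p \<in> carrier X"
  then obtain b s where p: "b \<in> U" "p = (b, cls s)" by (rule X_cases)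
  have "uball N p = (U \<inter> vball N b) \<times> {cls s}"
    by (rule Set.set_eqI) (simp add: p(2) uball_def carrier_X vball_def mem_Times_iff, metis cls_in_Gamma)
  moreover have "U \<inter> vball N b \<in> unit_sets"
    unfolding unit_sets_def by (intro imageI insertI2 CollectI exI[of _ N] exI[of _ b] conjI refl TrueI)
  moreover have "{cls s} \<in> insert {} {{C} |C. C \<in> \<Gamma>}" by (intro insertI2 CollectI exI[of _ "cls s"]) simp
  ultimately show "uball N p \<in> basic_sets"
    unfolding basic_sets_def by (intro CollectI exI[of _ "U \<inter> vball N b"] exI[of _ "{cls s}"] conjI)
qed

lemma uball_L2: "p \<in> carrier X \<Longrightarrow> (\<lambda>x. indicator (uball N p) x) \<in> L2 M"
  by (rule generates_L2[OF generates_M uball_sets])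

text \<open>The class is constant on the ball, so counting measure contributes the factor 1 and the
  integral over units remains.\<close>

lemma integral_uball_char:
  assumes N: "N \<ge> n" and b: "b \<in> U"
  shows "integrable M (\<lambda>x. indicator (uball N (b, cls s)) x * \<Psi> (phi (fst x) * t))"
    and "(\<integral>x. indicator (uball N (b, cls s)) x * \<Psi> (phi (fst x) * t) \<partial>M) =
      (if v t * v \<pi> ^ N \<le> 1 then of_real (ball_volume N) * \<Psi> (phi b * t) else 0)"
proof -
  let ?M1 = "restrict_space \<mu> U" and ?N = "count_space \<Gamma>"
  let ?g = "\<lambda>a. indicator (vball N b) a * \<Psi> (phi a * t)"
  have eq: "indicator (uball N (b, cls s)) x * \<Psi> (phi (fst x) * t) = ?g (fst x) * indicator {cls s} (snd x)" for x
    unfolding uball_eq[OF N b] by (cases x) (auto simp: indicator_def)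
  have gm: "?g \<in> borel_measurable ?M1"
    using measurable_char_phi[OF N b] by (rule measurable_restrict_space1)
  have wm: "(indicator {cls s} :: _ \<Rightarrow> complex) \<in> borel_measurable ?N" by simp
  have gi: "integrable ?M1 ?g"
  proof (rule Bochner_Integration.integrable_bound[OF _ gm])
    have "vball N b \<in> sets ?M1" using vball_subset_U[OF N b] by (auto simp: sets_restrict_space)
    moreover have "emeasure ?M1 (vball N b) < \<infinity>"
      using emeasure_U[OF vball_subset_U[OF N b]] emeasure_vball_finite by simp
    ultimately show "integrable ?M1 (indicator (vball N b) :: _ \<Rightarrow> real)" by simp
  qed (auto simp: norm_mult char_norm indicator_def)
  have wi: "integrable ?N (indicator {cls s} :: _ \<Rightarrow> complex)"
  proof -
    have "integrable ?N (\<lambda>x. complex_of_real (indicator {cls s} x))"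
      by (intro integrable_of_real) (auto simp: integrable_indicator_iff emeasure_count_space)
    moreover have "(\<lambda>x. complex_of_real (indicator {cls s} x)) = indicator {cls s}"
      by (auto simp: indicator_def)
    ultimately show ?thesis by simp
  qed
  have sf: "sigma_finite_measure ?M1" "sigma_finite_measure ?N"
    using generates_sigma_finite generates_U generates_Gamma by auto
  have Mm: "(\<lambda>x. indicator (uball N (b, cls s)) x * \<Psi> (phi (fst x) * t)) \<in> borel_measurable M"
    unfolding eq X_measure_def
    by (intro borel_measurable_times measurable_compose[OF measurable_fst gm] measurable_compose[OF measurable_snd wm])
  show "integrable M (\<lambda>x. indicator (uball N (b, cls s)) x * \<Psi> (phi (fst x) * t))"
  proof (rule Bochner_Integration.integrable_bound[OF _ Mm])
    have p: "(b, cls s) \<in> carrier X" using b by simp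
    show "integrable M (indicator (uball N (b, cls s)) :: _ \<Rightarrow> real)"
      using generates_sets[OF generates_M uball_sets[OF p]] generates_finite[OF generates_M uball_sets[OF p]] by simp
  qed (auto simp: norm_mult char_norm indicator_def)
  have "(\<integral>x. indicator (uball N (b, cls s)) x * \<Psi> (phi (fst x) * t) \<partial>M) =
      (\<integral>a. ?g a \<partial>?M1) * (\<integral>C. indicator {cls s} C \<partial>?N)"
    unfolding eq X_measure_def by (rule integral_tensor[OF sf gi wi])
  also have "(\<integral>C. indicator {cls s} C \<partial>?N) = (1 :: complex)"
  proof -
    have "(\<integral>C. indicator {cls s} C \<partial>?N) = (\<integral>C. complex_of_real (indicator {cls s} C) \<partial>?N)"
      by (rule Bochner_Integration.integral_cong) (auto simp: indicator_def)
    also have "\<dots> = complex_of_real (\<integral>C. indicator {cls s} C \<partial>?N)" by (rule integral_complex_of_real)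
    also have "(\<integral>C. indicator {cls s} C \<partial>?N) = measure ?N {cls s}" by simp
    also have "measure ?N {cls s} = 1" by (simp add: measure_count_space)
    finally show ?thesis by simp
  qed
  also have "(\<integral>a. ?g a \<partial>?M1) = (\<integral>a. indicator U a *\<^sub>R ?g a \<partial>\<mu>)"
    by (rule integral_restrict_space) simp
  also have "\<dots> = (\<integral>a. ?g a \<partial>\<mu>)"
    using vball_subset_U[OF N b] by (intro Bochner_Integration.integral_cong) (auto simp: indicator_def)
  finally show "(\<integral>x. indicator (uball N (b, cls s)) x * \<Psi> (phi (fst x) * t) \<partial>M) =
      (if v t * v \<pi> ^ N \<le> 1 then of_real (ball_volume N) * \<Psi> (phi b * t) else 0)"
    by (simp only: integral_char_phi[OF N b] mult_1_right)
qed

text \<open>Right translation by x is isometric without restriction: it multiplies the unit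
  coordinate by a unit, and its effect on the class does not depend on the unit coordinate of
  g.\<close>

lemma mult_in_uball_iff:
  assumes "g \<in> carrier X" "x \<in> carrier X" "p \<in> carrier X"
  shows "g \<otimes>\<^bsub>X\<^esub> x \<in> uball N p \<longleftrightarrow> g \<in> uball N (p \<otimes>\<^bsub>X\<^esub> inv\<^bsub>X\<^esub> x)"
proof -
  obtain a t where g: "a \<in> U" "g = (a, cls t)" using assms(1) by (rule X_cases)
  obtain b s where x: "b \<in> U" "x = (b, cls s)" using assms(2) by (rule X_cases)
  obtain c r where p: "c \<in> U" "p = (c, cls r)" using assms(3) by (rule X_cases)
  have nz: "b \<noteq> 0" and vb: "v b = 1" using x U_nonzero U_val by auto
  have "a * b - c = b * (a - c / b)" using nz by (simp add: field_simps)
  then have 1: "v (a * b - c) = v (a - c / b)" using vb by (simp add: val_mult)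
  have "inverse b * t + s - r = inverse b * (t - b * (r - s))" using nz by (simp add: field_simps)
  then have "v (inverse b * t + s - r) = v (t - b * (r - s))" using vb by (simp add: val_mult val_inverse)
  then have 2: "cls (inverse b * t + s) = cls r \<longleftrightarrow> cls t = cls (b * (r - s))" by (simp only: cls_eq_iff)
  show ?thesis
    using g x p 1 2 by (simp add: uball_def mult_X mult_inv_X U_mult)
qed

lemma uball_sym: "x \<in> carrier X \<Longrightarrow> y \<in> carrier X \<Longrightarrow> x \<in> uball N y \<longleftrightarrow> y \<in> uball N x"
  by (auto simp: uball_def val_minus_commute[of "fst x"])

lemma uball_cong: "y \<in> uball N x \<Longrightarrow> x \<in> carrier X \<Longrightarrow> z \<in> uball N y \<longleftrightarrow> z \<in> uball N x"
  unfolding uball_def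
  using val_triangle[of "fst z" "fst y" "v \<pi> ^ N" "fst x"] val_triangle[of "fst z" "fst x" "v \<pi> ^ N" "fst y"]
    val_minus_commute[of "fst x" "fst y"] by auto

lemma uball_test_function:
  assumes N: "N \<ge> n" and p: "p \<in> carrier X" and p': "p' \<in> carrier X"
  shows "(\<lambda>(x, y). indicator (uball N p) x * indicator (uball N p') y)
    \<in> test_functions (prod_topology (X_topology v \<pi> n) (X_topology v \<pi> n))"
proof -
  let ?T = "X_topology v \<pi> n"
  let ?f = "\<lambda>(x, y). indicator (uball N p) x * indicator (uball N p') y :: complex"
  have ts: "topspace ?T = carrier X" by (simp add: X_topology_def carrier_X)
  have op: "openin ?T (uball N x)" if x0: "x \<in> carrier X" for x
  proof -
    obtain b s where x: "b \<in> U" "x = (b, cls s)" using x0 by (rule X_cases)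
    have "openin (subtopology (val_topology v) U) (vball N b)"
      unfolding openin_subtopology using openin_vball[of N b] vball_subset_U[OF N x(1)]
      by (intro exI[of _ "vball N b"] conjI) (simp, rule Int_absorb2[symmetric])
    then show ?thesis
      unfolding x(2) uball_eq[OF N x(1)] X_topology_def by (simp add: openin_prod_Times_iff)
  qed
  have co: "compactin ?T (uball N x)" if x0: "x \<in> carrier X" for x
  proof -
    obtain b s where x: "b \<in> U" "x = (b, cls s)" using x0 by (rule X_cases)
    have "compactin (subtopology (val_topology v) U) (vball N b)"
      using compactin_vball[of N b] vball_subset_U[OF N x(1)] by (simp add: compactin_subtopology)
    then show ?thesis
      unfolding x(2) uball_eq[OF N x(1)] X_topology_def by (simp add: compactin_Times)
  qed
  show ?thesis
    unfolding test_functions_def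
  proof (intro CollectI conjI ballI)
    fix z assume "z \<in> topspace (prod_topology ?T ?T)"
    then obtain x y where z: "z = (x, y)" "x \<in> carrier X" "y \<in> carrier X" by (auto simp: ts)
    have self: "x \<in> uball N x" "y \<in> uball N y" using z val_uniformizer_pos by (auto simp: uball_def)
    show "\<exists>W. openin (prod_topology ?T ?T) W \<and> z \<in> W \<and> (\<forall>w\<in>W. ?f w = ?f z)"
    proof (intro exI[of _ "uball N x \<times> uball N y"] conjI ballI)
      show "openin (prod_topology ?T ?T) (uball N x \<times> uball N y)" using op z by (simp add: openin_prod_Times_iff)
      show "z \<in> uball N x \<times> uball N y" using z self by simp
      fix w assume "w \<in> uball N x \<times> uball N y"
      then obtain x' y' where w: "w = (x', y')" "x' \<in> uball N x" "y' \<in> uball N y" by auto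
      have car: "x' \<in> carrier X" "y' \<in> carrier X" using w by (auto simp: uball_def)
      have "x' \<in> uball N p \<longleftrightarrow> x \<in> uball N p"
        using uball_cong[OF w(2) z(2), of p] uball_sym[OF car(1) p] uball_sym[OF z(2) p] by simp
      moreover have "y' \<in> uball N p' \<longleftrightarrow> y \<in> uball N p'"
        using uball_cong[OF w(3) z(3), of p'] uball_sym[OF car(2) p'] uball_sym[OF z(3) p'] by simp
      ultimately show "?f w = ?f z"
        using w z by (simp add: indicator_def)
    qed
  next
    show "\<exists>K. compactin (prod_topology ?T ?T) K \<and> (\<forall>z\<in>topspace (prod_topology ?T ?T) - K. ?f z = 0)"
      using co[OF p] co[OF p']
      by (intro exI[of _ "uball N p \<times> uball N p'"]) (auto simp: compactin_Times indicator_def)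
  qed
qed

text \<open>Right translation by z turns f(g z) into the indicator of balls around p z1^(-1) and p'
  z2^(-1). There the classes are fixed and the double integral factors.\<close>

lemma twist_uball:
  assumes F: "is_twist v \<pi> \<mu> \<Psi> n F" and N: "N \<ge> n" and p: "p \<in> carrier X" and p': "p' \<in> carrier X"
  shows "AE z in M \<Otimes>\<^sub>M M. F (\<lambda>(x, y). indicator (uball N p) x * indicator (uball N p') y) z =
    kappa N (p \<otimes>\<^bsub>X\<^esub> inv\<^bsub>X\<^esub> fst z) (p' \<otimes>\<^bsub>X\<^esub> inv\<^bsub>X\<^esub> snd z)"
proof -
  let ?f = "\<lambda>(x, y). indicator (uball N p) x * indicator (uball N p') y :: complex"
  let ?q = "of_nat (residue_card v \<pi>) ^ (2 * n) :: complex"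
  have "AE z in M \<Otimes>\<^sub>M M. F ?f z = ?q *
      (\<integral>g. twist_kernel \<Psi> g * ?f (fst g \<otimes>\<^bsub>X\<^esub> fst z, snd g \<otimes>\<^bsub>X\<^esub> snd z) \<partial>(M \<Otimes>\<^sub>M M))"
    using F uball_test_function[OF N p p'] unfolding is_twist_def Let_def by blast
  moreover have "AE z in M \<Otimes>\<^sub>M M. z \<in> space (M \<Otimes>\<^sub>M M)" by (rule AE_space)
  ultimately show ?thesis
  proof eventually_elim
    case (elim z)
    have z: "fst z \<in> carrier X" "snd z \<in> carrier X"
      using elim(2) by (auto simp: space_pair_measure space_M)
    define x where "x = p \<otimes>\<^bsub>X\<^esub> inv\<^bsub>X\<^esub> fst z"
    define x' where "x' = p' \<otimes>\<^bsub>X\<^esub> inv\<^bsub>X\<^esub> snd z"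
    have "x \<in> carrier X" "x' \<in> carrier X" using z p p' by (auto simp: x_def x'_def)
    then obtain c t c' t' where xc: "c \<in> U" "x = (c, cls t)" "c' \<in> U" "x' = (c', cls t')"
      by (metis X_cases)
    \<comment> \<open>The frequencies are crossed: the integral over the first unit coordinate cuts
      off t', the one over the second cuts off t.\<close>
    let ?A = "\<lambda>g. indicator (uball N x) g * \<Psi> (phi (fst g) * t')"
    let ?B = "\<lambda>g. indicator (uball N x') g * \<Psi> (phi (fst g) * (- t))"
    note sf = generates_sigma_finite[OF generates_M]
    have "(\<integral>g. twist_kernel \<Psi> g * ?f (fst g \<otimes>\<^bsub>X\<^esub> fst z, snd g \<otimes>\<^bsub>X\<^esub> snd z) \<partial>(M \<Otimes>\<^sub>M M)) =
        (\<integral>g. ?A (fst g) * ?B (snd g) \<partial>(M \<Otimes>\<^sub>M M))"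
    proof (rule Bochner_Integration.integral_cong[OF refl])
      fix g assume "g \<in> space (M \<Otimes>\<^sub>M M)"
      then have g: "fst g \<in> carrier X" "snd g \<in> carrier X" by (auto simp: space_pair_measure space_M)
      have ind: "?f (fst g \<otimes>\<^bsub>X\<^esub> fst z, snd g \<otimes>\<^bsub>X\<^esub> snd z) = indicator (uball N x) (fst g) * indicator (uball N x') (snd g)"
        using mult_in_uball_iff[OF g(1) z(1) p] mult_in_uball_iff[OF g(2) z(2) p']
        by (simp add: indicator_def x_def x'_def)
      show "twist_kernel \<Psi> g * ?f (fst g \<otimes>\<^bsub>X\<^esub> fst z, snd g \<otimes>\<^bsub>X\<^esub> snd z) = ?A (fst g) * ?B (snd g)"
      proof (cases "fst g \<in> uball N x \<and> snd g \<in> uball N x'")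
        case True
        then obtain a b where ab: "a \<in> U" "b \<in> U" "g = ((a, cls t), (b, cls t'))"
          using xc by (cases g) (auto simp: uball_def carrier_X)
        have "phi a * t' + phi b * (- t) = phi a * t' - phi b * t" by simp
        then have "\<Psi> (phi a * t') * \<Psi> (phi b * (- t)) = \<Psi> (phi a * t' - phi b * t)"
          using char_add[of "phi a * t'" "phi b * (- t)"] by (simp only:)
        then show ?thesis unfolding ind using True twist_kernel_cls[OF ab(1,2)] ab(3) by simp
      next
        case False
        then show ?thesis unfolding ind by auto
      qed
    qed
    also have "\<dots> = (\<integral>g. ?A g \<partial>M) * (\<integral>g. ?B g \<partial>M)"
      unfolding xc(2,4) by (rule integral_tensor[OF sf sf integral_uball_char(1)[OF N xc(1)] integral_uball_char(1)[OF N xc(3)]])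
    also have "\<dots> = (if v t' * v \<pi> ^ N \<le> 1 then of_real (ball_volume N) * \<Psi> (phi c * t') else 0) *
        (if v (- t) * v \<pi> ^ N \<le> 1 then of_real (ball_volume N) * \<Psi> (phi c' * (- t)) else 0)"
      unfolding xc(2,4) integral_uball_char(2)[OF N xc(1)] integral_uball_char(2)[OF N xc(3)] ..
    also have "?q * \<dots> = kappa N x x'"
    proof -
      have "phi c * t' + phi c' * (- t) = phi c * t' - phi c' * t" by simp
      then have "\<Psi> (phi c * t') * \<Psi> (phi c' * (- t)) = \<Psi> (phi c * t' - phi c' * t)"
        using char_add[of "phi c * t'" "phi c' * (- t)"] by (simp only:)
      then show ?thesis unfolding xc(2,4) kappa_cls[OF N xc(1,3)]
        by (simp add: val_minus power2_eq_square)
    qed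
    finally show ?case using elim(1) by (simp only: x_def x'_def)
  qed
qed

end

section \<open>The finite-level cocycle identity\<close>

context twist_setting
begin

text \<open>The predicate under the choice depends only on the ball around a, hence so does the
  chosen point (\<open>unit_rep_cong\<close>).\<close>

definition unit_rep :: "nat \<Rightarrow> 'k \<Rightarrow> 'k" where
  "unit_rep N a = (SOME b. b \<in> U \<and> v (a - b) \<le> v \<pi> ^ N)"

definition unit_reps :: "nat \<Rightarrow> 'k set" where
  "unit_reps N = unit_rep N ` U"

definition class_reps :: "nat \<Rightarrow> 'k set set" where
  "class_reps N = cls ` {t. v t * v \<pi> ^ N \<le> 1}"

text \<open>For N at least n this is one point in each ball of radius |\<pi>|^N inside
  \<open>bounded_part N\<close>, so sums over it are discretised integrals over that set.\<close>

definition reps :: "nat \<Rightarrow> ('k \<times> 'k set) set" where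
  "reps N = unit_reps N \<times> class_reps N"

section \<open>Representatives of balls and finite expansions\<close>

lemma val_scaled_add:
  assumes "v s * v \<pi> ^ N \<le> 1" "v t * v \<pi> ^ N \<le> 1" shows "v (s + t) * v \<pi> ^ N \<le> 1"
proof -
  have "v (s + t) * v \<pi> ^ N \<le> max (v s) (v t) * v \<pi> ^ N"
    using val_uniformizer_pos by (intro mult_right_mono val_ultrametric) simp
  also have "\<dots> \<le> 1" using assms by (simp add: max_def)
  finally show ?thesis .
qed

lemma unit_rep:
  assumes "a \<in> U" shows "unit_rep N a \<in> U" "v (a - unit_rep N a) \<le> v \<pi> ^ N"
proof -
  have "a \<in> U \<and> v (a - a) \<le> v \<pi> ^ N" using assms val_uniformizer_pos by simp
  from someI[of "\<lambda>b. b \<in> U \<and> v (a - b) \<le> v \<pi> ^ N", OF this]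
  show "unit_rep N a \<in> U" "v (a - unit_rep N a) \<le> v \<pi> ^ N" by (simp_all add: unit_rep_def)
qed

lemma unit_rep_cong:
  assumes "v (a - b) \<le> v \<pi> ^ N" shows "unit_rep N a = unit_rep N b"
proof -
  have "v (a - x) \<le> v \<pi> ^ N \<longleftrightarrow> v (b - x) \<le> v \<pi> ^ N" for x
    using val_triangle[of b a "v \<pi> ^ N" x] val_triangle[of a b "v \<pi> ^ N" x] assms val_minus_commute[of a b]
    by auto
  then show ?thesis by (simp add: unit_rep_def)
qed

lemma unit_reps_U: "c \<in> unit_reps N \<Longrightarrow> c \<in> U"
  using unit_rep(1) by (auto simp: unit_reps_def)

lemma unit_rep_reps: "c \<in> unit_reps N \<Longrightarrow> unit_rep N c = c"
proof -
  assume "c \<in> unit_reps N"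
  then obtain a where a: "a \<in> U" "c = unit_rep N a" by (auto simp: unit_reps_def)
  show ?thesis using unit_rep_cong[OF unit_rep(2)[OF a(1)], of N] a(2) by simp
qed

lemma unit_reps_eq:
  assumes "c \<in> unit_reps N" "d \<in> unit_reps N" "v (c - d) \<le> v \<pi> ^ N" shows "c = d"
  using unit_rep_cong[OF assms(3)] unit_rep_reps assms by simp

lemma finite_unit_reps: "finite (unit_reps N)"
proof -
  have le: "v (x - 1) \<le> v 1" if "x \<in> U" for x
    using that uniformizer_power_le_1[of n] by (simp add: U_iff val_1)
  have "\<exists>K\<subseteq>U. finite K \<and> (\<forall>x\<in>U. \<exists>y\<in>K. v (x - y) \<le> v 1 * v \<pi> ^ N)"
    by (rule finite_net[of 1 _ 1]) (use le in auto)
  then obtain K where K: "finite K" "\<And>x. x \<in> U \<Longrightarrow> \<exists>y\<in>K. v (x - y) \<le> v 1 * v \<pi> ^ N" by blast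
  have "unit_reps N \<subseteq> unit_rep N ` K"
  proof
    fix c assume "c \<in> unit_reps N"
    then obtain a where a: "a \<in> U" "c = unit_rep N a" by (auto simp: unit_reps_def)
    obtain y where y: "y \<in> K" "v (a - y) \<le> v 1 * v \<pi> ^ N" using K(2)[OF a(1)] by blast
    then have "c = unit_rep N y" using unit_rep_cong[of a y N] a(2) by (simp add: val_1)
    then show "c \<in> unit_rep N ` K" using y(1) by blast
  qed
  then show ?thesis using K(1) by (meson finite_imageI finite_subset)
qed

lemma finite_class_reps: "finite (class_reps N)"
proof -
  let ?A = "{t. v t * v \<pi> ^ N \<le> 1}"
  have d: "inverse (\<pi> ^ N) \<noteq> 0" using uniformizer_nonzero by simp
  have vd: "v (inverse (\<pi> ^ N)) = inverse (v \<pi> ^ N)" by (simp only: val_inverse val_power)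
  have "\<exists>K\<subseteq>?A. finite K \<and> (\<forall>x\<in>?A. \<exists>y\<in>K. v (x - y) \<le> v (inverse (\<pi> ^ N)) * v \<pi> ^ N)"
  proof (rule finite_net[OF d])
    show "v (x - 0) \<le> v (inverse (\<pi> ^ N))" if "x \<in> ?A" for x
      unfolding vd using that val_uniformizer_pos by (simp add: field_simps)
  qed
  then obtain K where K: "finite K" "\<And>x. x \<in> ?A \<Longrightarrow> \<exists>y\<in>K. v (x - y) \<le> v (inverse (\<pi> ^ N)) * v \<pi> ^ N" by blast
  have "class_reps N \<subseteq> cls ` K"
  proof
    fix C assume "C \<in> class_reps N"
    then obtain t where t: "C = cls t" "t \<in> ?A" by (auto simp: class_reps_def)
    obtain y where y: "y \<in> K" "v (t - y) \<le> v (inverse (\<pi> ^ N)) * v \<pi> ^ N" using K(2)[OF t(2)] by blast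
    then have "v (t - y) \<le> 1" unfolding vd using val_uniformizer_pos by simp
    then have "v (t - y) * v \<pi> ^ n \<le> 1"
      using uniformizer_power_le_1[of n] val_nonneg val_uniformizer_pos by (intro mult_le_one) auto
    then have "C = cls y" by (simp only: t cls_eq_iff)
    then show "C \<in> cls ` K" using y(1) by blast
  qed
  then show ?thesis using K(1) by (meson finite_imageI finite_subset)
qed

lemma finite_reps_X: "finite (reps N)"
  unfolding reps_def using finite_unit_reps finite_class_reps by auto

lemma reps_cases:
  assumes "y \<in> reps N" obtains c t where "c \<in> unit_reps N" "c \<in> U" "v t * v \<pi> ^ N \<le> 1" "y = (c, cls t)"
  using assms unit_reps_U by (auto simp: reps_def class_reps_def)

lemma reps_bounded: "N \<ge> n \<Longrightarrow> y \<in> reps N \<Longrightarrow> y \<in> bounded_part N"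
  by (elim reps_cases) (simp add: bounded_part_iff)

lemma bounded_part_cases:
  assumes "N \<ge> n" "x \<in> bounded_part N" obtains a t where "a \<in> U" "v t * v \<pi> ^ N \<le> 1" "x = (a, cls t)"
proof -
  have "x \<in> carrier X" using assms(2) by (simp add: bounded_part_def)
  then obtain a t where "a \<in> U" "x = (a, cls t)" by (rule X_cases)
  then show thesis using that[of a t] assms by (simp add: bounded_part_iff)
qed

lemma bounded_part_carrier: "x \<in> bounded_part N \<Longrightarrow> x \<in> carrier X"
  by (simp add: bounded_part_def)

lemma rep_exists:
  assumes N: "N \<ge> n" and x: "x \<in> bounded_part N"
  shows "\<exists>y\<in>reps N. x \<in> uball N y"
proof -
  obtain a t where a: "a \<in> U" "v t * v \<pi> ^ N \<le> 1" "x = (a, cls t)"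
    using N x by (rule bounded_part_cases)
  have "(unit_rep N a, cls t) \<in> reps N"
    using a by (auto simp: reps_def unit_reps_def class_reps_def)
  moreover have "x \<in> uball N (unit_rep N a, cls t)"
    using a unit_rep(2)[OF a(1)] by (simp add: uball_def)
  ultimately show ?thesis by blast
qed

lemma uball_carrier: "x \<in> uball N p \<Longrightarrow> x \<in> carrier X"
  by (simp add: uball_def)

lemma rep_unique:
  assumes "y \<in> reps N" "y' \<in> reps N" "x \<in> uball N y" "x \<in> uball N y'" shows "y = y'"
proof -
  have "v (fst y - fst y') \<le> v \<pi> ^ N"
    using assms(3,4) val_triangle[of "fst y" "fst x" "v \<pi> ^ N" "fst y'"]
    by (simp add: uball_def val_minus_commute[of "fst y" "fst x"])
  then have "fst y = fst y'" using assms(1,2) unit_reps_eq by (auto simp: reps_def)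
  moreover have "snd y = snd y'" using assms(3,4) by (simp add: uball_def)
  ultimately show ?thesis by (simp add: prod_eq_iff)
qed

lemma uball_bounded:
  assumes "N \<ge> n" "x \<in> uball N y" "y \<in> carrier X" shows "x \<in> bounded_part N \<longleftrightarrow> y \<in> bounded_part N"
  using assms by (auto simp: uball_def bounded_part_def)

lemma sum_reps_single:
  fixes f :: "'k \<times> 'k set \<Rightarrow> complex"
  assumes "y \<in> reps N" "x \<in> uball N y"
  shows "(\<Sum>y\<in>reps N. f y * indicator (uball N y) x) = f y"
proof -
  have "f z * indicator (uball N z) x = 0" if z: "z \<in> reps N - {y}" for z
  proof -
    have "x \<notin> uball N z" using rep_unique[OF _ assms(1) _ assms(2), of z] z by blast
    then show ?thesis by simp
  qed
  then have "(\<Sum>y\<in>reps N. f y * indicator (uball N y) x) = (\<Sum>y\<in>{y}. f y * indicator (uball N y) x)"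
    by (intro sum.mono_neutral_right[OF finite_reps_X]) (simp add: assms(1), blast)
  then show ?thesis using assms by simp
qed

text \<open>A coarse ball is a disjoint union of balls of level N. At the end this brings three
  balls of different radii to a common radius, for which the kernel is explicit.\<close>

lemma indicator_uball_expand:
  assumes N: "m \<le> N" "N \<ge> n" and p: "p \<in> bounded_part N" and x: "x \<in> carrier X"
  shows "(indicator (uball m p) x :: complex) = (\<Sum>y\<in>reps N. indicator (uball m p) y * indicator (uball N y) x)"
proof (cases "x \<in> bounded_part N")
  case True
  then obtain y where y: "y \<in> reps N" "x \<in> uball N y" using rep_exists N by blast
  have yb: "y \<in> carrier X" using reps_bounded[OF N(2) y(1)] by (rule bounded_part_carrier)
  have "uball N y \<subseteq> uball m y" using uniformizer_power_antimono[OF N(1)] by (auto simp: uball_def)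
  then have "x \<in> uball m y" using y(2) by blast
  then have "x \<in> uball m p \<longleftrightarrow> y \<in> uball m p"
    using uball_cong[of x m y p] uball_sym[of p x m] uball_sym[of p y m] bounded_part_carrier[OF p] x yb by simp
  then show ?thesis using sum_reps_single[OF y, of "indicator (uball m p)"] by (simp add: indicator_def)
next
  case False
  then have "x \<notin> uball m p" using p x by (auto simp: uball_def bounded_part_def)
  moreover have "x \<notin> uball N y" if "y \<in> reps N" for y
    using uball_bounded[OF N(2), of x y] reps_bounded[OF N(2) that] bounded_part_carrier False by blast
  ultimately show ?thesis by simp
qed

lemma char_phi_cong:
  assumes "x \<in> U" "y \<in> U" "v (x - y) \<le> v \<pi> ^ N" "v t * v \<pi> ^ N \<le> 1"
  shows "\<Psi> (phi x * t) = \<Psi> (phi y * t)"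
proof (rule char_cong)
  have "v (phi x * t - phi y * t) = v (x - y) * v t"
    using U_phi_isometry[OF assms(1,2)] by (simp add: val_mult flip: left_diff_distrib)
  also have "\<dots> \<le> v \<pi> ^ N * v t" using assms(3) val_nonneg by (rule mult_right_mono)
  finally show "v (phi x * t - phi y * t) \<le> 1" using assms(4) by (simp add: mult.commute)
qed

text \<open>The kernel is constant on balls of its own level: moving a unit within its ball changes
  the phase by an integral element for frequencies below the cut-off, and beyond the cut-off the
  kernel vanishes.\<close>

lemma kappa_cong:
  assumes N: "N \<ge> n" and x: "x \<in> carrier X" and y: "y \<in> carrier X" and y': "y' \<in> uball N y"
  shows "kappa N x y' = kappa N x y" "kappa N y' x = kappa N y x"
proof -
  obtain a t where x: "a \<in> U" "x = (a, cls t)" using x by (rule X_cases)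
  obtain b s where y: "b \<in> U" "y = (b, cls s)" using y by (rule X_cases)
  obtain c where c: "c \<in> U" "v (c - b) \<le> v \<pi> ^ N" "y' = (c, cls s)"
    using y' y by (cases y') (auto simp: uball_def)
  have d: "\<Psi> (r - phi c * u) = \<Psi> (r - phi b * u)" "\<Psi> (phi c * u - r) = \<Psi> (phi b * u - r)"
    if "v u * v \<pi> ^ N \<le> 1" for u r
  proof -
    have "\<Psi> (phi c * u) = \<Psi> (phi b * u)" "\<Psi> (phi c * (- u)) = \<Psi> (phi b * (- u))"
      by (rule char_phi_cong[OF c(1) y(1) c(2)]; use that in \<open>simp add: val_minus\<close>)+
    then show "\<Psi> (r - phi c * u) = \<Psi> (r - phi b * u)" "\<Psi> (phi c * u - r) = \<Psi> (phi b * u - r)"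
      using char_add[of r "phi c * (- u)"] char_add[of r "phi b * (- u)"]
        char_add[of "phi c * u" "- r"] char_add[of "phi b * u" "- r"] by simp_all
  qed
  show "kappa N x y' = kappa N x y" "kappa N y' x = kappa N y x"
    using d by (simp_all add: x(2) y(2) c(3) kappa_cls[OF N] x(1) y(1) c(1))
qed

text \<open>Left translation by an element with class t moves the class of a point by t divided by
  the unit coordinate of that point. Over a ball of radius |\<pi>|^N this varies by at most |t|
  |\<pi>|^N, so boundedness of y is what makes the translate a ball.\<close>

lemma mult_inv_uball_iff:
  assumes N: "N \<ge> n" and y: "y \<in> bounded_part N" and p: "p \<in> carrier X" and x: "x \<in> carrier X"
  shows "p \<otimes>\<^bsub>X\<^esub> inv\<^bsub>X\<^esub> x \<in> uball N y \<longleftrightarrow> x \<in> uball N (inv\<^bsub>X\<^esub> y \<otimes>\<^bsub>X\<^esub> p)"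
proof -
  obtain c t where y: "c \<in> U" "v t * v \<pi> ^ N \<le> 1" "y = (c, cls t)" using N y by (rule bounded_part_cases)
  obtain b s where p: "b \<in> U" "p = (b, cls s)" using p by (rule X_cases)
  obtain a u where x: "a \<in> U" "x = (a, cls u)" using x by (rule X_cases)
  have nz: "a \<noteq> 0" "b \<noteq> 0" "c \<noteq> 0" and va: "v a = 1" "v b = 1" "v c = 1"
    using U_nonzero U_val y p x by auto
  have 1: "v (b / a - c) = v (a - b / c)"
  proof -
    have "b / a - c = - (c / a) * (a - b / c)" using nz by (simp add: field_simps)
    then have "v (b / a - c) = v (- (c / a)) * v (a - b / c)" by (simp only: val_mult)
    then show ?thesis by (simp only: val_minus val_divide va; simp)
  qed
  have 2: "cls (a * (s - u)) = cls t \<longleftrightarrow> cls u = cls (s - c * t / b)" if le: "v (a - b / c) \<le> v \<pi> ^ N"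
  proof -
    have "a * (s - u) - t = - a * (u - (s - t / a))" using nz by (simp add: field_simps)
    then have "v (a * (s - u) - t) = v (- a) * v (u - (s - t / a))" by (simp only: val_mult)
    then have "v (a * (s - u) - t) = v (u - (s - t / a))" by (simp only: val_minus va; simp)
    then have "cls (a * (s - u)) = cls t \<longleftrightarrow> cls u = cls (s - t / a)" by (simp only: cls_eq_iff)
    moreover have "cls (s - t / a) = cls (s - c * t / b)"
    proof -
      have "s - t / a - (s - c * t / b) = (c / (a * b)) * (a - b / c) * t" using nz by (simp add: field_simps)
      then have "v (s - t / a - (s - c * t / b)) = v (a - b / c) * v t"
        using va by (simp add: val_mult val_divide)
      also have "\<dots> \<le> v \<pi> ^ N * v t" using le val_nonneg by (rule mult_right_mono)
      also have "\<dots> \<le> 1" using y(2) by (simp add: mult.commute)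
      finally have "v (s - t / a - (s - c * t / b)) * v \<pi> ^ n \<le> 1"
        using uniformizer_power_le_1[of n] val_nonneg val_uniformizer_pos by (intro mult_le_one) auto
      then show ?thesis by (simp only: cls_eq_iff)
    qed
    ultimately show ?thesis by simp
  qed
  have "p \<otimes>\<^bsub>X\<^esub> inv\<^bsub>X\<^esub> x \<in> uball N y \<longleftrightarrow> v (b / a - c) \<le> v \<pi> ^ N \<and> cls (a * (s - u)) = cls t"
    using U_divide[OF p(1) x(1)] by (simp add: p(2) x(2) y(3) mult_inv_X[OF x(1) p(1)] uball_def)
  also have "\<dots> \<longleftrightarrow> v (a - b / c) \<le> v \<pi> ^ N \<and> cls u = cls (s - c * t / b)" using 1 2 by auto
  also have "\<dots> \<longleftrightarrow> x \<in> uball N (inv\<^bsub>X\<^esub> y \<otimes>\<^bsub>X\<^esub> p)"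
    using x(1) by (simp add: p(2) x(2) y(3) inv_mult_X[OF y(1) p(1)] uball_def)
  finally show ?thesis .
qed

text \<open>The character of t on classes with frequency w. The choice of a representative is
  harmless when |w| is at most |\<pi>|^n (\<open>class_char_cls\<close>).\<close>

definition class_char :: "'k \<Rightarrow> 'k set \<Rightarrow> complex" where
  "class_char w C = \<Psi> (w * (SOME t. C = cls t))"

lemma class_char_cls:
  assumes "v w \<le> v \<pi> ^ n" shows "class_char w (cls t) = \<Psi> (w * t)"
proof -
  let ?s = "SOME s. cls t = cls s"
  have "cls t = cls ?s" by (rule someI[of _ t]) simp
  then have s: "v (t - ?s) * v \<pi> ^ n \<le> 1" by (simp only: cls_eq_iff)
  have "v (w * t - w * ?s) = v w * v (t - ?s)" by (simp add: val_mult flip: right_diff_distrib)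
  also have "\<dots> \<le> v \<pi> ^ n * v (t - ?s)" using assms val_nonneg by (rule mult_right_mono)
  finally show ?thesis unfolding class_char_def using s by (intro char_cong[symmetric]) (simp add: mult.commute)
qed

text \<open>Orthogonality of characters on the finite group \<open>class_reps N\<close>: some
  translation of the group multiplies a nontrivial character by a number other than 1.\<close>

lemma sum_class_char:
  assumes w: "v w \<le> v \<pi> ^ n"
  shows "(\<Sum>C\<in>class_reps N. class_char w C) = (if v w \<le> v \<pi> ^ N then of_nat (card (class_reps N)) else 0)"
proof (cases "v w \<le> v \<pi> ^ N")
  case True
  have "class_char w C = 1" if "C \<in> class_reps N" for C
  proof -
    have "\<exists>t. C = cls t \<and> v t * v \<pi> ^ N \<le> 1" using that by (auto simp: class_reps_def)
    then obtain t where t: "C = cls t" "v t * v \<pi> ^ N \<le> 1" by blast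
    have "v (w * t) \<le> v \<pi> ^ N * v t" unfolding val_mult using True val_nonneg by (rule mult_right_mono)
    then show ?thesis unfolding t(1) class_char_cls[OF w] using t(2) by (intro char_trivial) (simp add: mult.commute)
  qed
  then show ?thesis using True by simp
next
  case False
  obtain \<omega> where \<omega>: "v \<omega> * v \<pi> \<le> 1" "\<Psi> \<omega> \<noteq> 1" by (rule char_nontrivial)
  have w0: "w \<noteq> 0" using False val_uniformizer_pos by auto
  then have vw: "v w > 0" using val_nonneg[of w] val_eq_0_iff[of w] by linarith
  \<comment> \<open>Translation by \<open>t0\<close> shifts w * t by exactly
    \<open>\<omega>\<close>. Discreteness of the valuation guarantees that \<open>t0\<close> is
    within the range of \<open>class_reps N\<close>.\<close>
  define t0 where "t0 = \<omega> / w"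
  have gap: "v \<pi> ^ N \<le> v \<pi> * v w" using val_gap[of "\<pi> ^ N" w] False by (simp add: val_power)
  have t0: "v t0 * v \<pi> ^ N \<le> 1"
  proof -
    have "v \<omega> * v \<pi> ^ N \<le> v \<omega> * (v \<pi> * v w)" using gap val_nonneg by (rule mult_left_mono)
    also have "\<dots> \<le> v w" using mult_right_mono[OF \<omega>(1), of "v w"] vw by (simp add: mult.assoc)
    finally show ?thesis using vw by (simp add: t0_def val_divide field_simps)
  qed
  have shift_in: "(+) u ` C \<in> class_reps N" if u: "v u * v \<pi> ^ N \<le> 1" and C: "C \<in> class_reps N" for u C
  proof -
    obtain t where t: "C = cls t" "v t * v \<pi> ^ N \<le> 1" using C by (auto simp: class_reps_def)
    have "v (u + t) * v \<pi> ^ N \<le> 1" using u t(2) by (rule val_scaled_add)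
    then show ?thesis by (auto simp: t(1) cls_translate class_reps_def)
  qed
  have "(\<Sum>C\<in>class_reps N. class_char w C) = (\<Sum>C\<in>class_reps N. class_char w ((+) t0 ` C))"
  proof (rule sum.reindex_bij_witness[where i = "(`) ((+) t0)" and j = "(`) ((+) (- t0))"])
    fix C
    show "(+) t0 ` (+) (- t0) ` C = C" "(+) (- t0) ` (+) t0 ` C = C" unfolding image_image by simp_all
    show "C \<in> class_reps N \<Longrightarrow> (+) (- t0) ` C \<in> class_reps N"
      by (rule shift_in) (use t0 val_minus in simp)
    show "C \<in> class_reps N \<Longrightarrow> (+) t0 ` C \<in> class_reps N" by (rule shift_in[OF t0])
  qed (simp add: image_image)
  also have "\<dots> = (\<Sum>C\<in>class_reps N. \<Psi> \<omega> * class_char w C)"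
  proof (rule sum.cong[OF refl])
    fix C assume "C \<in> class_reps N"
    then obtain t where t: "C = cls t" by (auto simp: class_reps_def)
    have "w * (t0 + t) = \<omega> + w * t" using w0 by (simp add: t0_def distrib_left)
    then show "class_char w ((+) t0 ` C) = \<Psi> \<omega> * class_char w C"
      by (simp only: t cls_translate class_char_cls[OF w] char_add)
  qed
  also have "\<dots> = \<Psi> \<omega> * (\<Sum>C\<in>class_reps N. class_char w C)" by (rule sum_distrib_left[symmetric])
  finally have "(1 - \<Psi> \<omega>) * (\<Sum>C\<in>class_reps N. class_char w C) = 0" by (simp add: left_diff_distrib)
  then show ?thesis using \<omega>(2) False by simp
qed

section \<open>The cocycle identity for the kernel\<close>

lemma phi_inverse: "phi (inverse a) = - phi a"
  by (simp add: phi_def)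

lemma phi_in_ideal: "a \<in> U \<Longrightarrow> v (phi a) \<le> v \<pi> ^ n"
  using U_phi_isometry[of a 1] U_one by (simp add: phi_def U_iff)

text \<open>The identity behind the cocycle relation. Summing over the second component of \<open>y\<close> forces
  \<open>a2 \<equiv> a1 * a3\<close> on both sides; what remains are two sums over units, exchanged by
  \<open>c \<mapsto> a2 / c\<close>. The additive identity used is \<open>phi (a * b) = phi a / b + a * phi b\<close>.\<close>

theorem kappa_cocycle:
  assumes N: "N \<ge> n" and x: "x1 \<in> carrier X" "x2 \<in> carrier X" "x3 \<in> carrier X"
  shows "(\<Sum>y\<in>reps N. kappa N x1 y * kappa N (inv\<^bsub>X\<^esub> y \<otimes>\<^bsub>X\<^esub> x2) (inv\<^bsub>X\<^esub> y \<otimes>\<^bsub>X\<^esub> x3)) =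
    (\<Sum>y\<in>reps N. kappa N y x3 * kappa N (inv\<^bsub>X\<^esub> y \<otimes>\<^bsub>X\<^esub> x1) (inv\<^bsub>X\<^esub> y \<otimes>\<^bsub>X\<^esub> x2))"
proof -
  obtain a1 t1 where x1: "a1 \<in> U" "x1 = (a1, cls t1)" using x(1) by (rule X_cases)
  obtain a2 t2 where x2: "a2 \<in> U" "x2 = (a2, cls t2)" using x(2) by (rule X_cases)
  obtain a3 t3 where x3: "a3 \<in> U" "x3 = (a3, cls t3)" using x(3) by (rule X_cases)
  have nz: "a1 \<noteq> 0" "a2 \<noteq> 0" "a3 \<noteq> 0" and va: "v a1 = 1" "v a2 = 1" "v a3 = 1"
    using U_nonzero U_val x1 x2 x3 by auto
  define bd where "bd t \<longleftrightarrow> v t * v \<pi> ^ N \<le> 1" for t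
  define K where "K = of_nat (residue_card v \<pi>) ^ (2 * n) * (complex_of_real (ball_volume N))\<^sup>2"
  have kap: "kappa N (a, cls t) (b, cls s) = (if bd t \<and> bd s then K * \<Psi> (phi a * s - phi b * t) else 0)"
    if "a \<in> U" "b \<in> U" for a b t s
    using kappa_cls[OF N that] by (simp add: bd_def K_def)
  have bd_add: "bd (t + s)" if "bd t" "bd s" for t s
    using that val_scaled_add by (simp add: bd_def)
  \<comment> \<open>Left translation by the inverse of a bounded element changes a class by c * t /
    a, of the same size as t. Hence it respects the cut-off in both directions.\<close>
  have bd_shift: "bd (s - c * t / a) \<longleftrightarrow> bd s" if "bd t" "c \<in> U" "a \<in> U" for s c t a
  proof -
    have "v (c * t / a) = v t" using U_val[OF that(2)] U_val[OF that(3)] by (simp add: val_mult val_divide)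
    then have b: "bd (c * t / a)" "bd (- (c * t / a))" using that(1) by (auto simp: bd_def val_minus)
    show ?thesis using bd_add[OF _ b(1), of "s - c * t / a"] bd_add[OF _ b(2), of s] by auto
  qed
  have L0: "kappa N x1 (c, cls t) * kappa N (inv\<^bsub>X\<^esub> (c, cls t) \<otimes>\<^bsub>X\<^esub> x2) (inv\<^bsub>X\<^esub> (c, cls t) \<otimes>\<^bsub>X\<^esub> x3) =
      (if bd t1 \<and> bd t2 \<and> bd t3 then K\<^sup>2 * (\<Psi> ((phi a1 + phi (a3 / a2)) * t) *
        \<Psi> (phi c * (- t1) + phi (a2 / c) * t3 + phi (a3 / c) * (- t2))) else 0)"
    if c: "c \<in> U" and t: "bd t" for c t
  proof -
    have c0: "c \<noteq> 0" using U_nonzero[OF c] .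
    \<comment> \<open>In the coefficient of t the terms with c^2 cancel, so it is free of c. The sum
      over t therefore separates from the sum over c.\<close>
    have "(phi a1 * t - phi c * t1) + (phi (a2 / c) * (t3 - c * t / a3) - phi (a3 / c) * (t2 - c * t / a2)) =
      (phi a1 + phi (a3 / a2)) * t + (phi c * (- t1) + phi (a2 / c) * t3 + phi (a3 / c) * (- t2))"
      using nz c0 unfolding phi_def by (simp add: field_simps)
    then have "\<Psi> (phi a1 * t - phi c * t1) * \<Psi> (phi (a2 / c) * (t3 - c * t / a3) - phi (a3 / c) * (t2 - c * t / a2)) =
      \<Psi> ((phi a1 + phi (a3 / a2)) * t) * \<Psi> (phi c * (- t1) + phi (a2 / c) * t3 + phi (a3 / c) * (- t2))"
      by (simp only: char_add[symmetric])
    then show ?thesis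
      unfolding x1(2) x2(2) x3(2) inv_mult_X[OF c x2(1)] inv_mult_X[OF c x3(1)]
        kap[OF x1(1) c] kap[OF U_divide[OF x2(1) c] U_divide[OF x3(1) c]]
        bd_shift[OF t c x2(1)] bd_shift[OF t c x3(1)]
      using t by (simp add: power2_eq_square)
  qed
  have R0: "kappa N (c, cls t) x3 * kappa N (inv\<^bsub>X\<^esub> (c, cls t) \<otimes>\<^bsub>X\<^esub> x1) (inv\<^bsub>X\<^esub> (c, cls t) \<otimes>\<^bsub>X\<^esub> x2) =
      (if bd t1 \<and> bd t2 \<and> bd t3 then K\<^sup>2 * (\<Psi> ((phi (a2 / a1) - phi a3) * t) *
        \<Psi> (phi c * t3 + phi (a1 / c) * t2 + phi (a2 / c) * (- t1))) else 0)"
    if c: "c \<in> U" and t: "bd t" for c t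
  proof -
    have c0: "c \<noteq> 0" using U_nonzero[OF c] .
    \<comment> \<open>The same cancellation of c^2, now leaving phi (a2 / a1).\<close>
    have "(phi c * t3 - phi a3 * t) + (phi (a1 / c) * (t2 - c * t / a2) - phi (a2 / c) * (t1 - c * t / a1)) =
      (phi (a2 / a1) - phi a3) * t + (phi c * t3 + phi (a1 / c) * t2 + phi (a2 / c) * (- t1))"
      using nz c0 unfolding phi_def by (simp add: field_simps)
    then have "\<Psi> (phi c * t3 - phi a3 * t) * \<Psi> (phi (a1 / c) * (t2 - c * t / a2) - phi (a2 / c) * (t1 - c * t / a1)) =
      \<Psi> ((phi (a2 / a1) - phi a3) * t) * \<Psi> (phi c * t3 + phi (a1 / c) * t2 + phi (a2 / c) * (- t1))"
      by (simp only: char_add[symmetric])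
    then show ?thesis
      unfolding x1(2) x2(2) x3(2) inv_mult_X[OF c x1(1)] inv_mult_X[OF c x2(1)]
        kap[OF c x3(1)] kap[OF U_divide[OF x1(1) c] U_divide[OF x2(1) c]]
        bd_shift[OF t c x1(1)] bd_shift[OF t c x2(1)]
      using t by (simp add: power2_eq_square)
  qed
  have split: "(\<Sum>y\<in>reps N. h y) = K\<^sup>2 * (\<Sum>c\<in>unit_reps N. E c) * (\<Sum>C\<in>class_reps N. class_char w C)"
    if w: "v w \<le> v \<pi> ^ n" and h: "\<And>c t. c \<in> U \<Longrightarrow> bd t \<Longrightarrow> h (c, cls t) = K\<^sup>2 * (\<Psi> (w * t) * E c)"
    for h w E
  proof -
    have "h (c, C) = K\<^sup>2 * (E c * class_char w C)" if c: "c \<in> unit_reps N" and C: "C \<in> class_reps N" for c C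
    proof -
      obtain t where t: "C = cls t" "bd t" using C by (auto simp: class_reps_def bd_def)
      show ?thesis unfolding t(1) class_char_cls[OF w] using h[OF unit_reps_U[OF c] t(2)] by simp
    qed
    then have "(\<Sum>y\<in>reps N. h y) = (\<Sum>c\<in>unit_reps N. \<Sum>C\<in>class_reps N. K\<^sup>2 * (E c * class_char w C))"
      unfolding reps_def by (simp add: sum.cartesian_product' cong: sum.cong)
    then show ?thesis by (simp only: sum_product sum_distrib_left[symmetric] mult.assoc)
  qed
  show ?thesis
  proof (cases "bd t1 \<and> bd t2 \<and> bd t3")
    case False
    have "kappa N x1 y * kappa N (inv\<^bsub>X\<^esub> y \<otimes>\<^bsub>X\<^esub> x2) (inv\<^bsub>X\<^esub> y \<otimes>\<^bsub>X\<^esub> x3) = 0"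
      "kappa N y x3 * kappa N (inv\<^bsub>X\<^esub> y \<otimes>\<^bsub>X\<^esub> x1) (inv\<^bsub>X\<^esub> y \<otimes>\<^bsub>X\<^esub> x2) = 0" if y0: "y \<in> reps N" for y
    proof -
      obtain c t where y: "c \<in> U" "v t * v \<pi> ^ N \<le> 1" "y = (c, cls t)"
        using y0 by (rule reps_cases)
      then have t: "bd t" by (simp add: bd_def)
      show "kappa N x1 y * kappa N (inv\<^bsub>X\<^esub> y \<otimes>\<^bsub>X\<^esub> x2) (inv\<^bsub>X\<^esub> y \<otimes>\<^bsub>X\<^esub> x3) = 0"
        "kappa N y x3 * kappa N (inv\<^bsub>X\<^esub> y \<otimes>\<^bsub>X\<^esub> x1) (inv\<^bsub>X\<^esub> y \<otimes>\<^bsub>X\<^esub> x2) = 0"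
        unfolding y(3) L0[OF y(1) t] R0[OF y(1) t] using False by auto
    qed
    note zero = this
    show ?thesis
      by (rule trans[OF sum.neutral sum.neutral[symmetric]]; intro ballI zero; assumption)
  next
    case True
    define wL where "wL = phi a1 + phi (a3 / a2)"
    define wR where "wR = phi (a2 / a1) - phi a3"
    define EL where "EL c = \<Psi> (phi c * (- t1) + phi (a2 / c) * t3 + phi (a3 / c) * (- t2))" for c
    define ER where "ER c = \<Psi> (phi c * t3 + phi (a1 / c) * t2 + phi (a2 / c) * (- t1))" for c
    have wLn: "v wL \<le> v \<pi> ^ n" unfolding wL_def
      by (intro val_add_le phi_in_ideal U_divide x1(1) x2(1) x3(1))
    have wRn: "v wR \<le> v \<pi> ^ n" unfolding wR_def
      by (intro val_diff_le phi_in_ideal U_divide x1(1) x2(1) x3(1))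
    have L: "(\<Sum>y\<in>reps N. kappa N x1 y * kappa N (inv\<^bsub>X\<^esub> y \<otimes>\<^bsub>X\<^esub> x2) (inv\<^bsub>X\<^esub> y \<otimes>\<^bsub>X\<^esub> x3)) =
        K\<^sup>2 * (\<Sum>c\<in>unit_reps N. EL c) * (\<Sum>C\<in>class_reps N. class_char wL C)"
      by (rule split[OF wLn]) (simp only: L0 True EL_def wL_def if_True simp_thms)
    have R: "(\<Sum>y\<in>reps N. kappa N y x3 * kappa N (inv\<^bsub>X\<^esub> y \<otimes>\<^bsub>X\<^esub> x1) (inv\<^bsub>X\<^esub> y \<otimes>\<^bsub>X\<^esub> x2)) =
        K\<^sup>2 * (\<Sum>c\<in>unit_reps N. ER c) * (\<Sum>C\<in>class_reps N. class_char wR C)"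
      by (rule split[OF wRn]) (simp only: R0 True ER_def wR_def if_True simp_thms)
    \<comment> \<open>Both frequencies have absolute value |a1 * a3 - a2|, because
      \<open>phi\<close> is an isometry on units. So the two character sums vanish for the same
      arguments and agree otherwise.\<close>
    have vL: "v wL = v (a1 * a3 - a2)"
    proof -
      have "phi (a3 / a2) = - phi (a2 / a3)" using phi_inverse[of "a2 / a3"] by simp
      then have "wL = phi a1 - phi (a2 / a3)" by (simp add: wL_def)
      then have "v wL = v (a1 - a2 / a3)" using U_phi_isometry[OF x1(1) U_divide[OF x2(1) x3(1)]] by simp
      also have "a1 - a2 / a3 = (a1 * a3 - a2) / a3" using nz by (simp add: field_simps)
      finally show ?thesis by (simp add: val_divide va)
    qed
    have vR: "v wR = v (a1 * a3 - a2)"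
    proof -
      have "v wR = v (a2 / a1 - a3)"
        unfolding wR_def by (rule U_phi_isometry[OF U_divide[OF x2(1) x1(1)] x3(1)])
      also have "a2 / a1 - a3 = - ((a1 * a3 - a2) / a1)" using nz by (simp add: field_simps)
      finally show ?thesis by (simp only: val_minus val_divide va; simp)
    qed
    show ?thesis
    proof (cases "v (a1 * a3 - a2) \<le> v \<pi> ^ N")
      case False
      then show ?thesis unfolding L R sum_class_char[OF wLn] sum_class_char[OF wRn] vL vR by simp
    next
      case close: True
      \<comment> \<open>The map c to a2 / c does not preserve the chosen representatives. Rounded to
        them it is still an involution, since inversion and multiplication by units preserve
        distances.\<close>
      let ?\<sigma> = "\<lambda>c. unit_rep N (a2 / c)"
      have \<sigma>: "?\<sigma> c \<in> unit_reps N" "?\<sigma> (?\<sigma> c) = c" if c: "c \<in> unit_reps N" for c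
      proof -
        have cU: "c \<in> U" by (rule unit_reps_U[OF c])
        then have a2c: "a2 / c \<in> U" using x2(1) by (intro U_divide)
        then show "?\<sigma> c \<in> unit_reps N" by (auto simp: unit_reps_def)
        let ?d = "?\<sigma> c"
        have d: "?d \<in> U" "v (a2 / c - ?d) \<le> v \<pi> ^ N" using unit_rep[OF a2c] by auto
        have "a2 / ?d - c = (c / ?d) * (a2 / c - ?d)"
          using U_nonzero[OF cU] U_nonzero[OF d(1)] by (simp add: field_simps)
        then have "v (a2 / ?d - c) = v (a2 / c - ?d)"
          using U_val[OF cU] U_val[OF d(1)] by (simp add: val_mult val_divide)
        then have "unit_rep N (a2 / ?d) = unit_rep N c" using d(2) by (intro unit_rep_cong) simp
        then show "?\<sigma> ?d = c" using unit_rep_reps[OF c] by simp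
      qed
      have "(\<Sum>c\<in>unit_reps N. EL c) = (\<Sum>c\<in>unit_reps N. ER c)"
      proof (rule sum.reindex_bij_witness[where i = ?\<sigma> and j = ?\<sigma>])
        fix c assume c: "c \<in> unit_reps N"
        show "?\<sigma> (?\<sigma> c) = c" "?\<sigma> c \<in> unit_reps N" using \<sigma>[OF c] by auto
        have cU: "c \<in> U" by (rule unit_reps_U[OF c])
        then have a2c: "a2 / c \<in> U" using x2(1) by (intro U_divide)
        define d where "d = ?\<sigma> c"
        have d: "d \<in> U" "v (a2 / c - d) \<le> v \<pi> ^ N" using unit_rep[OF a2c] by (auto simp: d_def)
        have nzd: "d \<noteq> 0" "c \<noteq> 0" and vd: "v d = 1" "v c = 1" using U_nonzero U_val d(1) cU by auto
        have 1: "\<Psi> (phi d * t3) = \<Psi> (phi (a2 / c) * t3)"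
          using d True by (intro char_phi_cong[OF d(1) a2c]) (auto simp: bd_def val_minus_commute[of d])
        have "a2 / d - c = (c / d) * (a2 / c - d)" using nzd by (simp add: field_simps)
        then have ad: "v (a2 / d - c) \<le> v \<pi> ^ N" using d(2) vd by (simp add: val_mult val_divide)
        have 2: "\<Psi> (phi (a2 / d) * (- t1)) = \<Psi> (phi c * (- t1))"
          using ad True by (intro char_phi_cong[OF U_divide[OF x2(1) d(1)] cU]) (auto simp: bd_def val_minus)
        \<comment> \<open>Up to |\<pi>|^N, d equals a2 / c and a2 equals a1 * a3, so a1 / d equals c
          / a3. The decomposition isolates these two errors.\<close>
        have 3: "\<Psi> (phi (a1 / d) * t2) = \<Psi> (phi (c / a3) * t2)"
        proof (rule char_phi_cong[OF U_divide[OF x1(1) d(1)] U_divide[OF cU x3(1)]])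
          have "a1 / d - c / a3 = (a1 / a2) * (a2 / d - c) + (c / (a2 * a3)) * (a1 * a3 - a2)"
            using nz nzd by (simp add: field_simps)
          moreover have "v ((a1 / a2) * (a2 / d - c)) \<le> v \<pi> ^ N" 
            unfolding val_mult[of "a1 / a2"] val_divide va using ad by simp
          moreover have "v ((c / (a2 * a3)) * (a1 * a3 - a2)) \<le> v \<pi> ^ N"
            unfolding val_mult[of "c / (a2 * a3)"] val_divide val_mult[of a2] va vd using close by simp
          ultimately show "v (a1 / d - c / a3) \<le> v \<pi> ^ N" using val_add_le by simp
          show "v t2 * v \<pi> ^ N \<le> 1" using True by (simp add: bd_def)
        qed
        have 4: "phi (c / a3) * t2 = phi (a3 / c) * (- t2)"
          using phi_inverse[of "a3 / c"] by simp
        have "ER d = EL c"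
          unfolding ER_def EL_def char_add 1 2 3 4 by (simp only: mult_ac)
        then show "ER (?\<sigma> c) = EL c" by (simp only: d_def)
      qed (use \<sigma> in auto)
      then show ?thesis
        unfolding L R sum_class_char[OF wLn] sum_class_char[OF wRn] vL vR by simp
    qed
  qed
qed

end

section \<open>Group von Neumann algebras and associativity of products\<close>

lemma bounded_ops_pullback:
  assumes "\<phi> \<in> measurable M M" "distr M M \<phi> = M"
  shows "(\<lambda>f z. f (\<phi> z)) \<in> bounded_ops M"
  using bounded_ops_conj[OF assms _ _ bounded_ops_id, where \<psi> = "\<lambda>x. x"] by (simp add: distr_id)

lemma left_regular_comp:
  assumes G: "group G" and sp: "space M = carrier G" and g: "g \<in> carrier G" and h: "h \<in> carrier G"
  shows "op_eq M (left_regular G g \<circ> left_regular G h) (left_regular G (g \<otimes>\<^bsub>G\<^esub> h))"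
proof -
  interpret group G by fact
  have "inv\<^bsub>G\<^esub> h \<otimes>\<^bsub>G\<^esub> (inv\<^bsub>G\<^esub> g \<otimes>\<^bsub>G\<^esub> x) = inv\<^bsub>G\<^esub> (g \<otimes>\<^bsub>G\<^esub> h) \<otimes>\<^bsub>G\<^esub> x" if "x \<in> space M" for x
    using that g h sp by (simp add: inv_mult_group m_assoc)
  then show ?thesis by (auto simp: op_eq_def left_regular_def)
qed

text \<open>Translations are closed under products and adjoints up to \<open>op_eq\<close>, the
  adjoint being translation by the inverse, by invariance of the measure. Their span is thus a
  unital *-algebra.\<close>

lemma group_vn_subset_closure:
  assumes G: "group G" and sp: "space M = carrier G"
    and mp: "\<And>g. g \<in> carrier G \<Longrightarrow> (\<lambda>x. g \<otimes>\<^bsub>G\<^esub> x) \<in> measurable M M"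
      "\<And>g. g \<in> carrier G \<Longrightarrow> distr M M (\<lambda>x. g \<otimes>\<^bsub>G\<^esub> x) = M"
  shows "left_regular G ` carrier G \<subseteq> bounded_ops M"
    and "group_vn G M \<subseteq> sigma_weak_topology M closure_of op_span M (left_regular G ` carrier G)"
proof -
  interpret group G by fact
  let ?B = "left_regular G ` carrier G"
  have bd: "left_regular G g \<in> bounded_ops M" if "g \<in> carrier G" for g
    unfolding left_regular_def by (rule bounded_ops_pullback[OF mp(1) mp(2)]) (use that in auto)
  then show Bb: "?B \<subseteq> bounded_ops M" by auto
  have base: "left_regular G g \<in> op_span M ?B" if "g \<in> carrier G" for g
    using that bd by (intro op_span.base) auto
  have comp: "S \<circ> T \<in> op_span M ?B" if ST: "S \<in> ?B" "T \<in> ?B" for S T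
  proof -
    obtain g h where gh: "g \<in> carrier G" "h \<in> carrier G" "S = left_regular G g" "T = left_regular G h"
      using ST by auto
    show ?thesis unfolding gh(3,4)
      by (rule op_span.eq[OF base bounded_ops_comp[OF bd bd] left_regular_comp[OF G sp]]) (use gh in auto)
  qed
  have "op_eq M id (left_regular G \<one>\<^bsub>G\<^esub>)" by (auto simp: op_eq_def left_regular_def sp)
  then have id: "id \<in> op_span M ?B" by (intro op_span.eq[OF base bounded_ops_id]) auto
  have adj: "\<exists>T'\<in>op_span M ?B. is_adjoint M T T'" if T: "T \<in> ?B" for T
  proof -
    obtain g where g: "g \<in> carrier G" "T = left_regular G g" using T by auto
    have "is_adjoint M (left_regular G g) (left_regular G (inv\<^bsub>G\<^esub> g))"
      unfolding is_adjoint_def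
    proof (intro ballI)
      fix f f' assume f: "f \<in> L2 M" "f' \<in> L2 M"
      let ?k = "\<lambda>x. f x * cnj (f' (g \<otimes>\<^bsub>G\<^esub> x))"
      have ig: "inv\<^bsub>G\<^esub> g \<in> carrier G" using g by simp
      have [measurable]: "f \<in> borel_measurable M" "(\<lambda>x. f' (g \<otimes>\<^bsub>G\<^esub> x)) \<in> borel_measurable M"
        using L2_measurable[OF f(1)] measurable_compose[OF mp(1)[OF g(1)] L2_measurable[OF f(2)]] by auto
      have km: "?k \<in> borel_measurable M" by measurable
      have "L2_inner M f (left_regular G (inv\<^bsub>G\<^esub> g) f') = (\<integral>x. ?k x \<partial>M)"
        using g by (simp add: L2_inner_def left_regular_def)
      also have "\<dots> = (\<integral>x. ?k x \<partial>(distr M M (\<lambda>x. inv\<^bsub>G\<^esub> g \<otimes>\<^bsub>G\<^esub> x)))" by (simp only: mp(2)[OF ig])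
      also have "\<dots> = (\<integral>x. ?k (inv\<^bsub>G\<^esub> g \<otimes>\<^bsub>G\<^esub> x) \<partial>M)" by (rule integral_distr[OF mp(1)[OF ig] km])
      also have "\<dots> = L2_inner M (left_regular G g f) f'"
        unfolding L2_inner_def left_regular_def
      proof (rule Bochner_Integration.integral_cong[OF refl])
        fix x assume "x \<in> space M"
        then have "g \<otimes>\<^bsub>G\<^esub> (inv\<^bsub>G\<^esub> g \<otimes>\<^bsub>G\<^esub> x) = x" using g sp by (simp add: m_assoc[symmetric])
        then show "?k (inv\<^bsub>G\<^esub> g \<otimes>\<^bsub>G\<^esub> x) = f (inv\<^bsub>G\<^esub> g \<otimes>\<^bsub>G\<^esub> x) * cnj (f' x)" by simp
      qed
      finally show "L2_inner M (left_regular G g f) f' = L2_inner M f (left_regular G (inv\<^bsub>G\<^esub> g) f')" by (rule sym)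
    qed
    then show ?thesis using base[of "inv\<^bsub>G\<^esub> g"] g by auto
  qed
  show "group_vn G M \<subseteq> sigma_weak_topology M closure_of op_span M ?B"
    unfolding group_vn_def by (rule vn_generated_subset_closure[OF comp Bb adj id])
qed

lemma von_neumann_algebra_vn_tensor:
  assumes "generates M E" "generates N E'" "A \<subseteq> bounded_ops M" "B \<subseteq> bounded_ops N"
  shows "von_neumann_algebra (M \<Otimes>\<^sub>M N) (vn_tensor M A N B)"
  unfolding vn_tensor_def
proof (rule von_neumann_algebra_vn_generated, rule subsetI)
  fix R assume "R \<in> {op_tensor M N S T |S T. S \<in> A \<and> T \<in> B}"
  then obtain S T where R: "R = op_tensor M N S T" "S \<in> A" "T \<in> B" by (elim CollectE exE conjE)
  show "R \<in> bounded_ops (M \<Otimes>\<^sub>M N)" unfolding R(1)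
    by (rule op_tensor_bounded[OF assms(1,2) subsetD[OF assms(3) R(2)] subsetD[OF assms(4) R(3)]])
qed

lemma von_neumann_algebra_subset: "von_neumann_algebra M A \<Longrightarrow> A \<subseteq> bounded_ops M"
  by (simp add: von_neumann_algebra_def)

lemma vn_tensor_superset: "S \<in> A \<Longrightarrow> T \<in> B \<Longrightarrow> op_tensor M N S T \<in> vn_tensor M A N B"
  unfolding vn_tensor_def
  by (rule subsetD[OF vn_generated_superset], rule CollectI, intro exI conjI, rule refl)

section \<open>Coefficients and null sets on product spaces\<close>

lemma L2_inner_tensor:
  assumes sf: "sigma_finite_measure M" "sigma_finite_measure N"
    and f: "f \<in> L2 M" "f' \<in> L2 M" and g: "g \<in> L2 N" "g' \<in> L2 N"
  shows "L2_inner (M \<Otimes>\<^sub>M N) (\<lambda>(x, y). f x * g y) (\<lambda>(x, y). f' x * g' y) = L2_inner M f f' * L2_inner N g g'"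
  using integral_tensor[OF sf integrable_L2_inner[OF f] integrable_L2_inner[OF g]]
  by (simp add: L2_inner_def case_prod_beta' mult_ac)

lemma L2_inner_sum_left:
  assumes "\<And>i. i \<in> I \<Longrightarrow> f i \<in> L2 M" "h \<in> L2 M"
  shows "L2_inner M (\<lambda>x. \<Sum>i\<in>I. f i x) h = (\<Sum>i\<in>I. L2_inner M (f i) h)"
  using assms(1)
proof (induction I rule: infinite_finite_induct)
  case (insert i I)
  have "L2_inner M (\<lambda>x. f i x + (\<Sum>i\<in>I. f i x)) h = L2_inner M (f i) h + L2_inner M (\<lambda>x. \<Sum>i\<in>I. f i x) h"
    by (rule L2_inner_add_left) (use insert assms(2) L2_sum in auto)
  then show ?case using insert by simp
qed (auto simp: L2_inner_def)

text \<open>It converts an explicit formula for a function into one for its coefficients, the form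
  in which normality delivers information about F.\<close>

lemma AE_eq_of_inner:
  assumes gen: "generates M E" and f: "f \<in> L2 M" and g: "g \<in> L2 M"
    and eq: "\<And>A. A \<in> E \<Longrightarrow> L2_inner M f (\<lambda>x. indicator A x) = L2_inner M g (\<lambda>x. indicator A x)"
  shows "AE x in M. f x = g x"
proof -
  have "AE x in M. f x - g x = 0"
  proof (rule L2_orthogonal_imp_zero[OF gen L2_diff[OF f g]])
    fix A assume A: "A \<in> E"
    show "L2_inner M (\<lambda>x. f x - g x) (\<lambda>x. indicator A x) = 0"
      using L2_inner_diff_left[OF f g generates_L2[OF gen A]] eq[OF A] by simp
  qed
  then show ?thesis by simp
qed

lemma AE_pair_sndI:
  assumes "sigma_finite_measure N" "AE y in N. P y"
  shows "AE z in M \<Otimes>\<^sub>M N. P (snd z)"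
proof -
  interpret sigma_finite_measure N by fact
  obtain Z where Z: "{y \<in> space N. \<not> P y} \<subseteq> Z" "emeasure N Z = 0" "Z \<in> sets N"
    using assms(2) by (rule AE_E)
  show ?thesis
  proof (rule AE_I[of _ _ "space M \<times> Z"])
    show "{z \<in> space (M \<Otimes>\<^sub>M N). \<not> P (snd z)} \<subseteq> space M \<times> Z" using Z(1) by (auto simp: space_pair_measure)
    show "emeasure (M \<Otimes>\<^sub>M N) (space M \<times> Z) = 0" using Z by (simp add: emeasure_pair_measure_Times)
  qed (use Z in auto)
qed

lemma AE_pair_fstI:
  assumes "sigma_finite_measure N" "AE x in M. P x"
  shows "AE z in M \<Otimes>\<^sub>M N. P (fst z)"
proof -
  interpret sigma_finite_measure N by fact
  obtain Z where Z: "{y \<in> space M. \<not> P y} \<subseteq> Z" "emeasure M Z = 0" "Z \<in> sets M"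
    using assms(2) by (rule AE_E)
  show ?thesis
  proof (rule AE_I[of _ _ "Z \<times> space N"])
    show "{z \<in> space (M \<Otimes>\<^sub>M N). \<not> P (fst z)} \<subseteq> Z \<times> space N" using Z(1) by (auto simp: space_pair_measure)
    show "emeasure (M \<Otimes>\<^sub>M N) (Z \<times> space N) = 0" using Z by (simp add: emeasure_pair_measure_Times)
  qed (use Z in auto)
qed

lemma indicator_Times_eq: "(\<lambda>z. indicator (A \<times> B) z :: complex) = (\<lambda>(x, y). indicator A x * indicator B y)"
  by (auto simp: indicator_def fun_eq_iff)

section \<open>Reassociation of products\<close>

lemma generates_measure_eqI:
  assumes gen: "generates M E" and sets: "sets N = sets M"
    and eq: "\<And>X. X \<in> E \<Longrightarrow> emeasure N X = emeasure M X"
  shows "N = M"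
proof -
  obtain C :: "nat \<Rightarrow> _" where C: "range C \<subseteq> E" "\<Union>(range C) = space M"
    using gen unfolding generates_def by (elim conjE exE)
  have D: "Int_stable E" "E \<subseteq> Pow (space M)" "sets M = sigma_sets (space M) E"
    using gen by (auto simp: generates_def)
  show ?thesis
  proof (rule measure_eqI_generator_eq[where E = E and \<Omega> = "space M" and A = C])
    show "sets N = sigma_sets (space M) E" using sets D by simp
    show "emeasure N (C i) \<noteq> \<infinity>" for i
      using eq[of "C i"] generates_finite[OF gen, of "C i"] subsetD[OF C(1) rangeI[of C i]] by auto
    show "range C \<subseteq> E" "(\<Union>i. C i) = space M" using C by auto
    show "Int_stable E" "E \<subseteq> Pow (space M)" "sets M = sigma_sets (space M) E" by (fact D)+
  qed (rule eq)
qed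

text \<open>The first equality is checked on boxes; the second follows because the two maps are
  inverse to each other.\<close>

lemma distr_assoc:
  assumes A: "generates A E" and B: "generates B E'" and C: "generates C E''"
  shows "distr ((A \<Otimes>\<^sub>M B) \<Otimes>\<^sub>M C) (A \<Otimes>\<^sub>M (B \<Otimes>\<^sub>M C)) (\<lambda>z. (fst (fst z), (snd (fst z), snd z))) = A \<Otimes>\<^sub>M (B \<Otimes>\<^sub>M C)"
    and "distr (A \<Otimes>\<^sub>M (B \<Otimes>\<^sub>M C)) ((A \<Otimes>\<^sub>M B) \<Otimes>\<^sub>M C) (\<lambda>z. ((fst z, fst (snd z)), snd (snd z))) = (A \<Otimes>\<^sub>M B) \<Otimes>\<^sub>M C"
proof -
  interpret B: sigma_finite_measure B by (rule generates_sigma_finite[OF B])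
  interpret C: sigma_finite_measure C by (rule generates_sigma_finite[OF C])
  interpret BC: sigma_finite_measure "B \<Otimes>\<^sub>M C" by (rule generates_sigma_finite[OF generates_pair[OF B C]])
  let ?P = "(A \<Otimes>\<^sub>M B) \<Otimes>\<^sub>M C" and ?Q = "A \<Otimes>\<^sub>M (B \<Otimes>\<^sub>M C)"
  let ?\<psi> = "\<lambda>z. (fst (fst z), (snd (fst z), snd z))" and ?\<phi> = "\<lambda>z. ((fst z, fst (snd z)), snd (snd z))"
  have m1: "?\<psi> \<in> measurable ?P ?Q" by measurable
  have m2: "?\<phi> \<in> measurable ?Q ?P" by measurable
  note gen = generates_pair[OF A generates_pair[OF B C]]
  let ?E = "{X \<times> Y |X Y. X \<in> E \<and> Y \<in> {X \<times> Y |X Y. X \<in> E' \<and> Y \<in> E''}}"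
  have em: "emeasure (distr ?P ?Q ?\<psi>) X = emeasure ?Q X" if X: "X \<in> ?E" for X
  proof -
    obtain a b c where abc: "a \<in> E" "b \<in> E'" "c \<in> E''" "X = a \<times> (b \<times> c)" using X by auto
    have s: "a \<in> sets A" "b \<in> sets B" "c \<in> sets C"
      using generates_sets[OF A abc(1)] generates_sets[OF B abc(2)] generates_sets[OF C abc(3)] by auto
    have v: "?\<psi> -` X \<inter> space ?P = (a \<times> b) \<times> c"
      using s[THEN sets.sets_into_space] unfolding abc(4) by (auto simp: space_pair_measure)
    have "emeasure (distr ?P ?Q ?\<psi>) X = emeasure ?P (?\<psi> -` X \<inter> space ?P)"
      by (rule emeasure_distr[OF m1]) (use s abc in auto)
    also have "\<dots> = emeasure ?P ((a \<times> b) \<times> c)" by (simp only: v)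
    also have "\<dots> = emeasure ?Q X" unfolding abc(4) using s
      by (simp add: C.emeasure_pair_measure_Times B.emeasure_pair_measure_Times BC.emeasure_pair_measure_Times mult.assoc)
    finally show ?thesis .
  qed
  show 1: "distr ?P ?Q ?\<psi> = ?Q" by (rule generates_measure_eqI[OF gen sets_distr em])
  have "distr ?Q ?P ?\<phi> = distr (distr ?P ?Q ?\<psi>) ?P ?\<phi>" by (simp only: 1)
  also have "\<dots> = distr ?P ?P (?\<phi> \<circ> ?\<psi>)" by (rule distr_distr[OF m2 m1])
  also have "\<dots> = ?P" by (simp add: comp_def distr_id2)
  finally show "distr ?Q ?P ?\<phi> = ?P" .
qed

lemma op_assoc_bounded:
  assumes A: "generates A E" and B: "generates B E'" and C: "generates C E''"
    and R: "R \<in> bounded_ops ((A \<Otimes>\<^sub>M B) \<Otimes>\<^sub>M C)"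
  shows "op_assoc R \<in> bounded_ops (A \<Otimes>\<^sub>M (B \<Otimes>\<^sub>M C))"
proof -
  have eq: "op_assoc R = (\<lambda>f z. R (\<lambda>w. f (fst (fst w), (snd (fst w), snd w))) ((fst z, fst (snd z)), snd (snd z)))"
    unfolding op_assoc_def by (simp add: case_prod_unfold)
  show ?thesis unfolding eq
  proof (rule bounded_ops_conj[OF _ distr_assoc(2)[OF A B C] _ distr_assoc(1)[OF A B C] R])
    show "(\<lambda>z. ((fst z, fst (snd z)), snd (snd z))) \<in> measurable (A \<Otimes>\<^sub>M (B \<Otimes>\<^sub>M C)) ((A \<Otimes>\<^sub>M B) \<Otimes>\<^sub>M C)" by measurable
    show "(\<lambda>w. (fst (fst w), (snd (fst w), snd w))) \<in> measurable ((A \<Otimes>\<^sub>M B) \<Otimes>\<^sub>M C) (A \<Otimes>\<^sub>M (B \<Otimes>\<^sub>M C))" by measurable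
  qed
qed

lemma AE_assoc:
  assumes "generates A E" "generates B E'" "generates C E''" and "AE z in (A \<Otimes>\<^sub>M B) \<Otimes>\<^sub>M C. P z"
  shows "AE z in A \<Otimes>\<^sub>M (B \<Otimes>\<^sub>M C). P ((fst z, fst (snd z)), snd (snd z))"
  by (rule AE_pullback[OF _ distr_assoc(2)[OF assms(1-3)] assms(4)]) measurable

lemma bounded_ops_agree_sum:
  assumes S: "S \<in> bounded_ops M" and T: "T \<in> bounded_ops M"
    and e: "\<And>i. i \<in> I \<Longrightarrow> e i \<in> L2 M" and agree: "\<And>i. i \<in> I \<Longrightarrow> AE x in M. S (e i) x = T (e i) x"
    and fin: "finite I" and g: "g \<in> L2 M" and eq: "AE x in M. g x = (\<Sum>i\<in>I. c i * e i x)"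
  shows "AE x in M. S g x = T g x"
proof -
  have exp: "AE x in M. R g x = (\<Sum>i\<in>I. c i * R (e i) x)" if R: "R \<in> bounded_ops M" for R
  proof -
    have s: "(\<lambda>x. c i * e i x) \<in> L2 M" if "i \<in> I" for i by (rule L2_scale[OF e]) fact
    have 1: "AE x in M. R g x = R (\<lambda>x. \<Sum>i\<in>I. c i * e i x) x"
      by (rule bounded_ops_cong[OF R g L2_sum eq]) (rule s)
    have 2: "AE x in M. R (\<lambda>x. \<Sum>i\<in>I. c i * e i x) x = (\<Sum>i\<in>I. R (\<lambda>x. c i * e i x) x)"
      by (rule bounded_ops_sum[OF R]) (use s fin in auto)
    have 3: "AE x in M. \<forall>i\<in>I. R (\<lambda>x. c i * e i x) x = c i * R (e i) x"
      by (rule AE_finite_allI[OF fin]) (rule bounded_ops_scale[OF R e])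
    show ?thesis using 1 2 3 by eventually_elim simp
  qed
  have "AE x in M. \<forall>i\<in>I. S (e i) x = T (e i) x" by (rule AE_finite_allI[OF fin]) (rule agree)
  with exp[OF S] exp[OF T] show ?thesis by eventually_elim simp
qed

section \<open>Translates of balls\<close>

context twist_setting
begin

abbreviation tensor_fun :: "('a \<Rightarrow> complex) \<Rightarrow> ('b \<Rightarrow> complex) \<Rightarrow> 'a \<times> 'b \<Rightarrow> complex" where
  "tensor_fun f g \<equiv> (\<lambda>(x, y). f x * g y)"

lemma sigma_finite_M: "sigma_finite_measure M"
  by (rule generates_sigma_finite[OF generates_M])

lemma sigma_finite_MM: "sigma_finite_measure (M \<Otimes>\<^sub>M M)"
  by (rule generates_sigma_finite[OF generates_pair[OF generates_M generates_M]])

text \<open>For a fixed class of x, the point p x^(-1) stays in one ball when x moves a little, so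
  the composition with f is locally constant.\<close>

lemma measurable_uball_invariant:
  fixes f :: "'k \<times> 'k set \<Rightarrow> complex"
  assumes f: "\<And>q q'. q \<in> carrier X \<Longrightarrow> q' \<in> uball N q \<Longrightarrow> f q' = f q" and p: "p \<in> carrier X"
  shows "(\<lambda>x. f (p \<otimes>\<^bsub>X\<^esub> inv\<^bsub>X\<^esub> x)) \<in> borel_measurable M"
proof -
  let ?g = "\<lambda>x. f (p \<otimes>\<^bsub>X\<^esub> inv\<^bsub>X\<^esub> x)"
  obtain b s where b: "b \<in> U" and p_eq: "p = (b, cls s)" using p by (rule X_cases)
  have loc: "(\<lambda>a. ?g (a, C)) \<in> measurable (restrict_space \<mu> U) borel" if C: "C \<in> \<Gamma>" for C
  proof -
    obtain t where t: "C = cls t" using C by (auto simp: Gamma_iff)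
    obtain m where m: "v (s - t) * v \<pi> ^ m \<le> 1" using uniformizer_power_bounded by blast
    show ?thesis
    \<comment> \<open>The level m keeps the class of p x^(-1) fixed, the level N keeps its unit
      coordinate in the ball.\<close>
    proof (rule measurable_locally_const[where m = "max m N"])
      fix x y assume xy: "x \<in> U" "y \<in> U" "v (x - y) \<le> v \<pi> ^ max m N"
      have le: "v (x - y) \<le> v \<pi> ^ m" "v (x - y) \<le> v \<pi> ^ N"
        using xy(3) uniformizer_power_antimono[of m "max m N"] uniformizer_power_antimono[of N "max m N"] by auto
      have "v (x * (s - t) - y * (s - t)) * v \<pi> ^ n = v (x - y) * v (s - t) * v \<pi> ^ n"
        by (simp add: left_diff_distrib[symmetric] val_mult)
      also have "\<dots> \<le> (v \<pi> ^ m * v (s - t)) * 1"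
        by (intro mult_mono mult_right_mono le uniformizer_power_le_1) (auto simp: val_nonneg)
      also have "\<dots> \<le> 1" using m by (simp add: mult.commute)
      finally have 1: "cls (x * (s - t)) = cls (y * (s - t))" by (simp add: cls_eq_iff)
      have "b / x - b / y = b * (y - x) / (x * y)" using U_nonzero xy by (simp add: field_simps)
      then have "v (b / x - b / y) = v (x - y)"
        using U_val xy b val_minus[of "x - y"] by (simp add: val_mult val_divide)
      then have "(b / x, cls (x * (s - t))) \<in> uball N (b / y, cls (y * (s - t)))"
        using le 1 xy b U_divide by (simp add: uball_def)
      from f[OF _ this] show "?g (x, C) = ?g (y, C)"
        using xy b U_divide by (simp add: p_eq t mult_inv_X)
    qed simp
  qed
  have "(\<lambda>x. ?g (fst x, snd x)) \<in> borel_measurable M"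
    unfolding X_measure_def
    by (rule measurable_compose_countable'[where f = "\<lambda>C x. ?g (fst x, C)" and g = snd and I = \<Gamma>,
        OF measurable_compose[OF measurable_fst loc] measurable_snd countable_Gamma])
  then show ?thesis by simp
qed

text \<open>The image of a ball indicator under lambda at the inverse of q. Parametrised by q it
  becomes a condition that p x^(-1) lies in the ball of q (\<open>translate_eq\<close>).\<close>

definition translate :: "nat \<Rightarrow> 'k \<times> 'k set \<Rightarrow> 'k \<times> 'k set \<Rightarrow> 'k \<times> 'k set \<Rightarrow> complex" where
  "translate N q p = (\<lambda>x. indicator (uball N p) (q \<otimes>\<^bsub>X\<^esub> x))"

lemma translate_L2: "q \<in> carrier X \<Longrightarrow> p \<in> carrier X \<Longrightarrow> translate N q p \<in> L2 M"
  unfolding translate_def by (rule L2_pullback[OF left_mult_measure_preserving uball_L2])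

lemma translate_eq:
  assumes "q \<in> carrier X" "p \<in> carrier X" "x \<in> carrier X"
  shows "translate N q p x = indicator (uball N q) (p \<otimes>\<^bsub>X\<^esub> inv\<^bsub>X\<^esub> x)"
proof -
  have "q \<otimes>\<^bsub>X\<^esub> x \<in> uball N p \<longleftrightarrow> p \<otimes>\<^bsub>X\<^esub> inv\<^bsub>X\<^esub> x \<in> uball N q"
    using assms mult_in_uball_iff[of q x p N] uball_sym[of q "p \<otimes>\<^bsub>X\<^esub> inv\<^bsub>X\<^esub> x" N] by simp
  then show ?thesis by (simp add: translate_def indicator_def)
qed

lemma translate_eq_uball:
  assumes "N \<ge> n" "q \<in> bounded_part N" "p \<in> carrier X" "x \<in> carrier X"
  shows "translate N q p x = indicator (uball N (inv\<^bsub>X\<^esub> q \<otimes>\<^bsub>X\<^esub> p)) x"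
  using mult_inv_uball_iff[OF assms] translate_eq[of q p x N] bounded_part_carrier[of q N] assms
  by (simp add: indicator_def)

text \<open>
  Testing \<open>\<lambda>\<^sub>h \<otimes> \<lambda>\<^sub>h\<close> against product vectors amounts to testing \<open>\<lambda>\<^sub>h\<close> against this vector
  (\<open>weight_inner\<close>), because the ball containing \<open>h\<close> is determined by a point of the first factor.
\<close>

definition weight :: "nat \<Rightarrow> 'k \<times> 'k set \<Rightarrow> 'k \<times> 'k set \<Rightarrow> ('k \<times> 'k set) set \<Rightarrow> ('k \<times> 'k set) set \<Rightarrow> 'k \<times> 'k set \<Rightarrow> complex" where
  "weight N p p' A A' = (\<lambda>x. indicator A x * cnj (L2_inner M (translate N (p \<otimes>\<^bsub>X\<^esub> inv\<^bsub>X\<^esub> x) p') (\<lambda>y. indicator A' y)))"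

text \<open>A translate depends on q only through its ball. This makes the inner product inside
  \<open>weight\<close> constant wherever a translate of the other ball is nonzero.\<close>

lemma inner_translate_cong:
  assumes q: "q \<in> carrier X" and q': "q' \<in> uball N q" and p: "p \<in> carrier X"
  shows "L2_inner M (translate N q' p) g = L2_inner M (translate N q p) g"
proof -
  have "translate N q' p x = translate N q p x" if "x \<in> carrier X" for x
    using uball_cong[OF q' q, of "p \<otimes>\<^bsub>X\<^esub> inv\<^bsub>X\<^esub> x"] q p that uball_carrier[OF q']
    by (simp add: translate_eq indicator_def)
  then show ?thesis
    unfolding L2_inner_def by (intro Bochner_Integration.integral_cong) (auto simp: space_M)
qed

lemma inner_translate_bound:
  assumes q: "q \<in> carrier X" and p: "p \<in> carrier X" and A: "A \<in> basic_sets"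
  shows "cmod (L2_inner M (translate N q p) (\<lambda>y. indicator A y)) \<le> measure M A"
proof -
  have s: "A \<in> sets M" "emeasure M A < \<infinity>"
    using generates_sets[OF generates_M A] generates_finite[OF generates_M A] by auto
  have "cmod (\<integral>x. translate N q p x * cnj (indicator A x) \<partial>M) \<le> (\<integral>x. cmod (translate N q p x * cnj (indicator A x)) \<partial>M)"
    by (rule Bochner_Integration.integral_norm_bound)
  also have "\<dots> \<le> (\<integral>x. indicator A x \<partial>M)"
  proof (rule Bochner_Integration.integral_mono)
    show "integrable M (\<lambda>x. cmod (translate N q p x * cnj (indicator A x)))"
      by (rule integrable_norm[OF integrable_L2_inner[OF translate_L2[OF q p] generates_L2[OF generates_M A]]])
    show "integrable M (\<lambda>x. indicator A x :: real)" using s by (simp add: integrable_indicator_iff)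
  qed (auto simp: translate_def indicator_def)
  also have "\<dots> = measure M A" using s sets.sets_into_space[OF s(1)] by (simp add: Int_absorb2)
  finally show ?thesis by (simp add: L2_inner_def)
qed

lemma weight_L2:
  assumes p: "p \<in> carrier X" "p' \<in> carrier X" and A: "A \<in> basic_sets" "A' \<in> basic_sets"
  shows "weight N p p' A A' \<in> L2 M"
proof -
  let ?c = "\<lambda>q. cnj (L2_inner M (translate N q p') (\<lambda>y. indicator A' y))"
  have s: "A \<in> sets M" "emeasure M A < \<infinity>"
    using generates_sets[OF generates_M A(1)] generates_finite[OF generates_M A(1)] by auto
  have c: "(\<lambda>x. ?c (p \<otimes>\<^bsub>X\<^esub> inv\<^bsub>X\<^esub> x)) \<in> borel_measurable M"
    by (rule measurable_uball_invariant[where N = N, OF _ p(1)]) (simp add: inner_translate_cong p)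
  have ind: "(\<lambda>x. indicator A x :: complex) \<in> borel_measurable M" using s by simp
  show ?thesis
  proof (rule L2_bound[where h = "\<lambda>x. (measure M A')\<^sup>2 * indicator A x"])
    show "weight N p p' A A' \<in> borel_measurable M"
      unfolding weight_def by (rule borel_measurable_times[OF ind c])
    show "integrable M (\<lambda>x. (measure M A')\<^sup>2 * indicator A x)" using s by (simp add: integrable_indicator_iff)
    have "(cmod (weight N p p' A A' x))\<^sup>2 \<le> (measure M A')\<^sup>2 * indicator A x" if "x \<in> space M" for x
      using inner_translate_bound[of "p \<otimes>\<^bsub>X\<^esub> inv\<^bsub>X\<^esub> x" p' A' N] p A that
      by (auto simp: weight_def space_M indicator_def intro!: power_mono)
    then show "AE x in M. (cmod (weight N p p' A A' x))\<^sup>2 \<le> (measure M A')\<^sup>2 * indicator A x" by (rule AE_I2)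
  qed
qed

lemma weight_inner:
  assumes p: "p \<in> carrier X" "p' \<in> carrier X" and q: "q \<in> carrier X"
  shows "L2_inner M (translate N q p) (weight N p p' A A') =
    L2_inner M (translate N q p) (\<lambda>x. indicator A x) * L2_inner M (translate N q p') (\<lambda>x. indicator A' x)"
proof -
  let ?c = "L2_inner M (translate N q p') (\<lambda>x. indicator A' x)"
  have "L2_inner M (translate N q p) (weight N p p' A A') =
      (\<integral>x. translate N q p x * cnj (indicator A x) * ?c \<partial>M)"
    unfolding L2_inner_def[of M "translate N q p"]
  proof (rule Bochner_Integration.integral_cong[OF refl])
    fix x assume "x \<in> space M"
    then have x: "x \<in> carrier X" by (simp add: space_M)
    show "translate N q p x * cnj (weight N p p' A A' x) = translate N q p x * cnj (indicator A x) * ?c"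
    \<comment> \<open>On the support of the translate, p x^(-1) lies in the ball of q, and the
      factor stored in \<open>weight\<close> is the coefficient for q itself. Off the support both
      sides vanish.\<close>
    proof (cases "p \<otimes>\<^bsub>X\<^esub> inv\<^bsub>X\<^esub> x \<in> uball N q")
      case True
      show ?thesis using inner_translate_cong[OF q True p(2)] by (simp add: weight_def)
    next
      case False
      then show ?thesis using translate_eq[OF q p(1) x] by simp
    qed
  qed
  then show ?thesis by (simp add: L2_inner_def)
qed

text \<open>A finite combination of translates, hence square-integrable. It is the kernel at p
  x^(-1) in its first argument (\<open>kappa_left_eq\<close>), since the kernel is constant on balls
  of level N.\<close>

definition kappa_left :: "nat \<Rightarrow> 'k \<times> 'k set \<Rightarrow> 'k \<times> 'k set \<Rightarrow> 'k \<times> 'k set \<Rightarrow> complex" where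
  "kappa_left N p y x = (\<Sum>z\<in>reps N. kappa N z y * translate N z p x)"

definition kappa_right :: "nat \<Rightarrow> 'k \<times> 'k set \<Rightarrow> 'k \<times> 'k set \<Rightarrow> 'k \<times> 'k set \<Rightarrow> complex" where
  "kappa_right N p y x = (\<Sum>z\<in>reps N. kappa N y z * translate N z p x)"

context
  fixes N assumes N: "N \<ge> n"
begin

lemma reps_carrier: "y \<in> reps N \<Longrightarrow> y \<in> carrier X"
  using reps_bounded[OF N] bounded_part_carrier by blast

lemma kappa_left_L2: "p \<in> carrier X \<Longrightarrow> kappa_left N p y \<in> L2 M"
  unfolding kappa_left_def by (intro L2_sum L2_scale translate_L2) (use reps_carrier in auto)

lemma kappa_right_L2: "p \<in> carrier X \<Longrightarrow> kappa_right N p y \<in> L2 M"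
  unfolding kappa_right_def by (intro L2_sum L2_scale translate_L2) (use reps_carrier in auto)

lemma sum_reps_invariant:
  fixes f :: "'k \<times> 'k set \<Rightarrow> complex"
  assumes q: "q \<in> carrier X" and f: "\<And>y. y \<in> reps N \<Longrightarrow> q \<in> uball N y \<Longrightarrow> f q = f y"
    and 0: "q \<notin> bounded_part N \<Longrightarrow> f q = 0"
  shows "(\<Sum>y\<in>reps N. f y * indicator (uball N y) q) = f q"
proof (cases "q \<in> bounded_part N")
  case True
  then obtain y where y: "y \<in> reps N" "q \<in> uball N y" using rep_exists[OF N] by blast
  show ?thesis using sum_reps_single[OF y, of f] f[OF y] by simp
next
  case False
  have "f y * indicator (uball N y) q = 0" if y: "y \<in> reps N" for y
    using uball_bounded[OF N, of q y] reps_bounded[OF N y] reps_carrier[OF y] False by (auto simp: indicator_def)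
  then show ?thesis unfolding 0[OF False] by (intro sum.neutral) blast
qed

lemma kappa_left_eq:
  assumes p: "p \<in> carrier X" and x: "x \<in> carrier X" and y: "y \<in> carrier X"
  shows "kappa_left N p y x = kappa N (p \<otimes>\<^bsub>X\<^esub> inv\<^bsub>X\<^esub> x) y"
proof -
  have "kappa_left N p y x = (\<Sum>z\<in>reps N. kappa N z y * indicator (uball N z) (p \<otimes>\<^bsub>X\<^esub> inv\<^bsub>X\<^esub> x))"
    unfolding kappa_left_def by (rule sum.cong) (auto simp: translate_eq[OF reps_carrier p x])
  also have "\<dots> = kappa N (p \<otimes>\<^bsub>X\<^esub> inv\<^bsub>X\<^esub> x) y"
  proof (rule sum_reps_invariant)
    show "kappa N (p \<otimes>\<^bsub>X\<^esub> inv\<^bsub>X\<^esub> x) y = kappa N z y"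
      if z: "z \<in> reps N" "p \<otimes>\<^bsub>X\<^esub> inv\<^bsub>X\<^esub> x \<in> uball N z" for z
      by (rule kappa_cong(2)[OF N y reps_carrier[OF z(1)] z(2)])
  qed (use p x in \<open>auto simp: kappa_def\<close>)
  finally show ?thesis .
qed

lemma kappa_right_eq:
  assumes p: "p \<in> carrier X" and x: "x \<in> carrier X" and y: "y \<in> carrier X"
  shows "kappa_right N p y x = kappa N y (p \<otimes>\<^bsub>X\<^esub> inv\<^bsub>X\<^esub> x)"
proof -
  have "kappa_right N p y x = (\<Sum>z\<in>reps N. kappa N y z * indicator (uball N z) (p \<otimes>\<^bsub>X\<^esub> inv\<^bsub>X\<^esub> x))"
    unfolding kappa_right_def by (rule sum.cong) (auto simp: translate_eq[OF reps_carrier p x])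
  also have "\<dots> = kappa N y (p \<otimes>\<^bsub>X\<^esub> inv\<^bsub>X\<^esub> x)"
  proof (rule sum_reps_invariant)
    show "kappa N y (p \<otimes>\<^bsub>X\<^esub> inv\<^bsub>X\<^esub> x) = kappa N y z"
      if z: "z \<in> reps N" "p \<otimes>\<^bsub>X\<^esub> inv\<^bsub>X\<^esub> x \<in> uball N z" for z
      by (rule kappa_cong(1)[OF N y reps_carrier[OF z(1)] z(2)])
  qed (use p x in \<open>auto simp: kappa_def\<close>)
  finally show ?thesis .
qed

text \<open>Expanding the second argument over balls writes the kernel as a finite sum of product
  functions, to which coefficient identities and tensor products of operators apply term by
  term.\<close>

lemma kappa_sum_left:
  assumes p: "p \<in> carrier X" "p' \<in> carrier X" and x: "x \<in> carrier X" "x' \<in> carrier X"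
  shows "kappa N (p \<otimes>\<^bsub>X\<^esub> inv\<^bsub>X\<^esub> x) (p' \<otimes>\<^bsub>X\<^esub> inv\<^bsub>X\<^esub> x') = (\<Sum>y\<in>reps N. kappa_left N p y x * translate N y p' x')"
proof -
  let ?q = "p \<otimes>\<^bsub>X\<^esub> inv\<^bsub>X\<^esub> x" and ?q' = "p' \<otimes>\<^bsub>X\<^esub> inv\<^bsub>X\<^esub> x'"
  have q: "?q \<in> carrier X" "?q' \<in> carrier X" using p x by auto
  have "kappa N ?q ?q' = kappa_right N p' ?q x'" by (simp add: kappa_right_eq p x q)
  also have "\<dots> = (\<Sum>y\<in>reps N. kappa_left N p y x * translate N y p' x')"
    unfolding kappa_right_def by (rule sum.cong) (auto simp: kappa_left_eq p x reps_carrier)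
  finally show ?thesis .
qed

lemma kappa_sum_right:
  assumes p: "p \<in> carrier X" "p' \<in> carrier X" and x: "x \<in> carrier X" "x' \<in> carrier X"
  shows "kappa N (p \<otimes>\<^bsub>X\<^esub> inv\<^bsub>X\<^esub> x) (p' \<otimes>\<^bsub>X\<^esub> inv\<^bsub>X\<^esub> x') = (\<Sum>y\<in>reps N. translate N y p x * kappa_right N p' y x')"
proof -
  let ?q = "p \<otimes>\<^bsub>X\<^esub> inv\<^bsub>X\<^esub> x" and ?q' = "p' \<otimes>\<^bsub>X\<^esub> inv\<^bsub>X\<^esub> x'"
  have q: "?q \<in> carrier X" "?q' \<in> carrier X" using p x by auto
  have "kappa N ?q ?q' = kappa_left N p ?q' x" by (simp add: kappa_left_eq p x q)
  also have "\<dots> = (\<Sum>y\<in>reps N. translate N y p x * kappa_right N p' y x')"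
    unfolding kappa_left_def by (rule sum.cong) (auto simp: kappa_right_eq p x reps_carrier mult.commute)
  finally show ?thesis .
qed

text \<open>Prepares the second application of F. For y in \<open>reps N\<close> the left translates
  are balls of the same level again, so \<open>twist_uball\<close> covers them.\<close>

lemma twist_translate:
  assumes F: "is_twist v \<pi> \<mu> \<Psi> n F" and Fb: "F \<in> bounded_ops (M \<Otimes>\<^sub>M M)"
    and p: "p \<in> carrier X" "p' \<in> carrier X" and y: "y \<in> reps N"
  shows "AE z in M \<Otimes>\<^sub>M M. F (tensor_fun (translate N y p) (translate N y p')) z =
    kappa N (inv\<^bsub>X\<^esub> y \<otimes>\<^bsub>X\<^esub> (p \<otimes>\<^bsub>X\<^esub> inv\<^bsub>X\<^esub> fst z)) (inv\<^bsub>X\<^esub> y \<otimes>\<^bsub>X\<^esub> (p' \<otimes>\<^bsub>X\<^esub> inv\<^bsub>X\<^esub> snd z))"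
proof -
  have yc: "y \<in> carrier X" by (rule reps_carrier[OF y])
  let ?r = "inv\<^bsub>X\<^esub> y \<otimes>\<^bsub>X\<^esub> p" and ?r' = "inv\<^bsub>X\<^esub> y \<otimes>\<^bsub>X\<^esub> p'"
  have r: "?r \<in> carrier X" "?r' \<in> carrier X" using yc p by auto
  have "AE z in M \<Otimes>\<^sub>M M. F (tensor_fun (translate N y p) (translate N y p')) z =
      F (\<lambda>(x, y). indicator (uball N ?r) x * indicator (uball N ?r') y) z"
  proof (rule bounded_ops_cong[OF Fb])
    show "tensor_fun (translate N y p) (translate N y p') \<in> L2 (M \<Otimes>\<^sub>M M)"
      by (rule L2_tensor(1)[OF sigma_finite_M]) (intro translate_L2 yc p)+
    show "(\<lambda>(x, y). indicator (uball N ?r) x * indicator (uball N ?r') y) \<in> L2 (M \<Otimes>\<^sub>M M)"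
      by (rule L2_tensor(1)[OF sigma_finite_M]) (intro uball_L2 r)+
    show "AE z in M \<Otimes>\<^sub>M M. tensor_fun (translate N y p) (translate N y p') z =
        (case z of (x, y) \<Rightarrow> indicator (uball N ?r) x * indicator (uball N ?r') y)"
      by (rule AE_I2) (auto simp: space_pair_measure space_M translate_eq_uball[OF N reps_bounded[OF N y]] p)
  qed
  moreover have "AE z in M \<Otimes>\<^sub>M M. F (\<lambda>(x, y). indicator (uball N ?r) x * indicator (uball N ?r') y) z =
      kappa N (?r \<otimes>\<^bsub>X\<^esub> inv\<^bsub>X\<^esub> fst z) (?r' \<otimes>\<^bsub>X\<^esub> inv\<^bsub>X\<^esub> snd z)"
    by (rule twist_uball[OF F N r])
  moreover have "AE z in M \<Otimes>\<^sub>M M. z \<in> space (M \<Otimes>\<^sub>M M)" by (rule AE_space)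
  ultimately show ?thesis
    by eventually_elim (use yc p in \<open>auto simp: space_pair_measure space_M G.m_assoc\<close>)
qed

end
end

section \<open>Coproducts of the twist\<close>

context twist_setting
begin

abbreviation "MM \<equiv> M \<Otimes>\<^sub>M M"
abbreviation "XX \<equiv> X \<times>\<times> X"
abbreviation "W \<equiv> group_vn X M"
abbreviation "WW \<equiv> vn_tensor M W M W"

lemmas generates_MM = generates_pair[OF generates_M generates_M]
lemmas generates_M_MM = generates_pair[OF generates_M generates_MM]
lemmas generates_MM_M = generates_pair[OF generates_MM generates_M]

section \<open>The algebras of X and of its square\<close>

lemma left_regular_bounded: "left_regular X g \<in> bounded_ops M" if "g \<in> carrier X"
  using group_vn_subset_closure(1)[OF group_X space_M left_mult_measure_preserving] that by blast

lemma von_neumann_algebra_W: "von_neumann_algebra M W"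
  unfolding group_vn_def
  by (rule von_neumann_algebra_vn_generated) (use left_regular_bounded in blast)

lemmas W_bounded = von_neumann_algebra_subset[OF von_neumann_algebra_W]

lemma left_regular_W: "left_regular X g \<in> W" if "g \<in> carrier X"
  unfolding group_vn_def by (rule subsetD[OF vn_generated_superset]) (use that in blast)

lemma von_neumann_algebra_WW: "von_neumann_algebra MM WW"
  by (rule von_neumann_algebra_vn_tensor[OF generates_M generates_M W_bounded W_bounded])

lemmas WW_bounded = von_neumann_algebra_subset[OF von_neumann_algebra_WW]

lemma carrier_XX: "carrier XX = carrier X \<times> carrier X"
  by (simp add: DirProd_def)

lemma space_MM: "space MM = carrier XX"
  by (simp add: space_pair_measure space_M carrier_XX)

lemma left_mult_measure_preserving_XX:
  assumes g: "g \<in> carrier XX"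
  shows "(\<lambda>x. g \<otimes>\<^bsub>XX\<^esub> x) \<in> measurable MM MM" "distr MM MM (\<lambda>x. g \<otimes>\<^bsub>XX\<^esub> x) = MM"
proof -
  obtain g1 g2 where gg: "g = (g1, g2)" "g1 \<in> carrier X" "g2 \<in> carrier X"
    using g by (cases g) (auto simp: carrier_XX)
  have eq: "(\<lambda>x. g \<otimes>\<^bsub>XX\<^esub> x) = (\<lambda>(x, y). (g1 \<otimes>\<^bsub>X\<^esub> x, g2 \<otimes>\<^bsub>X\<^esub> y))"
    by (auto simp: fun_eq_iff DirProd_def gg(1))
  note m = left_mult_measure_preserving[OF gg(2)] left_mult_measure_preserving[OF gg(3)]
  note [measurable] = m(1,3)
  show "(\<lambda>x. g \<otimes>\<^bsub>XX\<^esub> x) \<in> measurable MM MM" unfolding eq by measurable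
  have "distr M M (\<lambda>x. g1 \<otimes>\<^bsub>X\<^esub> x) \<Otimes>\<^sub>M distr M M (\<lambda>x. g2 \<otimes>\<^bsub>X\<^esub> x) = distr MM MM (\<lambda>(x, y). (g1 \<otimes>\<^bsub>X\<^esub> x, g2 \<otimes>\<^bsub>X\<^esub> y))"
    by (rule pair_measure_distr[OF m(1,3)]) (simp add: m sigma_finite_M)
  then show "distr MM MM (\<lambda>x. g \<otimes>\<^bsub>XX\<^esub> x) = MM" unfolding eq m(2,4) by simp
qed

lemmas group_vn_XX_closure =
  group_vn_subset_closure[OF DirProd_group[OF group_X group_X] space_MM left_mult_measure_preserving_XX]

lemma left_regular_XX:
  assumes "g \<in> carrier X" "h \<in> carrier X"
  shows "left_regular XX (g, h) (tensor_fun e f) = tensor_fun (left_regular X g e) (left_regular X h f)"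
  by (auto simp: fun_eq_iff left_regular_def inv_DirProd[OF group_X group_X assms] mult_DirProd)

text \<open>F is a limit of combinations of translations of the product group, whereas
  \<open>id_\<Delta>\<close> and \<open>\<Delta>_id\<close> are specified on operators
  \<open>op_tensor\<close>. This identification links the two.\<close>

lemma left_regular_XX_tensor:
  assumes g: "g \<in> carrier X" and h: "h \<in> carrier X"
  shows "op_eq MM (left_regular XX (g, h)) (op_tensor M M (left_regular X g) (left_regular X h))"
proof (rule op_eq_generates[OF generates_MM])
  note b = left_regular_bounded[OF g] left_regular_bounded[OF h]
  show "left_regular XX (g, h) \<in> bounded_ops MM" using group_vn_XX_closure(1) g h by (auto simp: carrier_XX)
  show "op_tensor M M (left_regular X g) (left_regular X h) \<in> bounded_ops MM"
    by (rule op_tensor_bounded[OF generates_M generates_M b])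
  fix C assume "C \<in> {A \<times> B |A B. A \<in> basic_sets \<and> B \<in> basic_sets}"
  then obtain A B where C: "C = A \<times> B" and AB: "A \<in> basic_sets" "B \<in> basic_sets"
    by (elim CollectE exE conjE)
  show "AE z in MM. left_regular XX (g, h) (\<lambda>x. indicator C x) z =
      op_tensor M M (left_regular X g) (left_regular X h) (\<lambda>x. indicator C x) z"
    unfolding C indicator_Times_eq left_regular_XX[OF g h]
    using op_tensor_apply[OF generates_M generates_M b generates_L2[OF generates_M AB(1)] generates_L2[OF generates_M AB(2)]]
    by eventually_elim (auto simp: case_prod_beta')
qed

lemma left_regular_XX_WW:
  assumes g: "g \<in> carrier X" and h: "h \<in> carrier X"
  shows "op_tensor M M (left_regular X g) (left_regular X h) \<in> WW" "left_regular XX (g, h) \<in> WW"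
proof -
  show 1: "op_tensor M M (left_regular X g) (left_regular X h) \<in> WW"
    by (rule vn_tensor_superset[OF left_regular_W[OF g] left_regular_W[OF h]])
  show "left_regular XX (g, h) \<in> WW"
    by (rule von_neumann_algebra_op_eq[OF von_neumann_algebra_WW 1 _ left_regular_XX_tensor[OF g h]])
      (use group_vn_XX_closure(1) g h in \<open>auto simp: carrier_XX\<close>)
qed

lemma left_regular_XX_image:
  assumes "T \<in> left_regular XX ` carrier XX"
  obtains g h where "g \<in> carrier X" "h \<in> carrier X" "T = left_regular XX (g, h)"
  using assms by (auto simp: carrier_XX)

lemma left_regular_XX_subset: "left_regular XX ` carrier XX \<subseteq> WW"
  by (rule subsetI, elim left_regular_XX_image) (simp add: left_regular_XX_WW)

lemma left_regular_translate: "left_regular X h (\<lambda>x. indicator (uball N p) x) = translate N (inv\<^bsub>X\<^esub> h) p"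
  by (simp add: left_regular_def translate_def)

end

locale cocycle_setting = twist_setting v \<pi> \<mu> n \<Psi>
  for v :: "'k::field \<Rightarrow> real" and \<pi> :: 'k and \<mu> :: "'k measure" and n :: nat and \<Psi> :: "'k \<Rightarrow> complex" +
  fixes F :: "(('k \<times> 'k set) \<times> ('k \<times> 'k set)) op"
    and \<Delta> :: "('k \<times> 'k set) op \<Rightarrow> (('k \<times> 'k set) \<times> ('k \<times> 'k set)) op"
    and id_\<Delta> :: "(('k \<times> 'k set) \<times> ('k \<times> 'k set)) op \<Rightarrow>
                  (('k \<times> 'k set) \<times> (('k \<times> 'k set) \<times> ('k \<times> 'k set))) op"
    and \<Delta>_id :: "(('k \<times> 'k set) \<times> ('k \<times> 'k set)) op \<Rightarrow>
                  ((('k \<times> 'k set) \<times> ('k \<times> 'k set)) \<times> ('k \<times> 'k set)) op"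
  assumes twist: "is_twist v \<pi> \<mu> \<Psi> n F"
    and coproduct: "is_coproduct X M \<Delta>"
    and id_coproduct: "is_hom_tensor M W M W id M W MM WW \<Delta> id_\<Delta>"
    and coproduct_id: "is_hom_tensor M W MM WW \<Delta> M W M W id \<Delta>_id"
begin

lemma twist_bounded: "F \<in> bounded_ops MM"
  using twist by (simp add: is_twist_def Let_def unitary_op_def)

lemma twist_closure: "F \<in> sigma_weak_topology MM closure_of op_span MM (left_regular XX ` carrier XX)"
  using twist group_vn_XX_closure(2) by (auto simp: is_twist_def Let_def)

lemma coproduct_bounded: "\<Delta> (left_regular X h) \<in> bounded_ops MM" "\<Delta> (left_regular X h) \<in> WW" if "h \<in> carrier X"
proof -
  show "\<Delta> (left_regular X h) \<in> WW"
    using coproduct left_regular_W[OF that] by (simp add: is_coproduct_def normal_star_hom_def)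
  then show "\<Delta> (left_regular X h) \<in> bounded_ops MM" using WW_bounded by blast
qed

lemma coproduct_apply:
  assumes h: "h \<in> carrier X" and p: "p \<in> carrier X" "p' \<in> carrier X"
  shows "AE z in MM. \<Delta> (left_regular X h) (tensor_fun (\<lambda>x. indicator (uball N p) x) (\<lambda>x. indicator (uball N p') x)) z
    = tensor_fun (translate N (inv\<^bsub>X\<^esub> h) p) (translate N (inv\<^bsub>X\<^esub> h) p') z"
proof -
  note b = left_regular_bounded[OF h] and e = uball_L2[OF p(1), of N] uball_L2[OF p(2), of N]
  have "op_eq MM (\<Delta> (left_regular X h)) (op_tensor M M (left_regular X h) (left_regular X h))"
    using coproduct h by (simp add: is_coproduct_def)
  from op_eqD[OF this L2_tensor(1)[OF sigma_finite_M e]]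
    op_tensor_apply[OF generates_M generates_M b b e]
  show ?thesis
    by eventually_elim (simp add: left_regular_translate case_prod_beta')
qed

lemma id_coproduct_facts:
  "normal_star_hom MM WW (M \<Otimes>\<^sub>M MM) (vn_tensor M W MM WW) id_\<Delta>"
  "vn_tensor M W MM WW \<subseteq> bounded_ops (M \<Otimes>\<^sub>M MM)"
  using id_coproduct
    von_neumann_algebra_subset[OF von_neumann_algebra_vn_tensor[OF generates_M generates_MM W_bounded WW_bounded]]
  by (auto simp: is_hom_tensor_def)

lemma coproduct_id_facts:
  "normal_star_hom MM WW (MM \<Otimes>\<^sub>M M) (vn_tensor MM WW M W) \<Delta>_id"
  "vn_tensor MM WW M W \<subseteq> bounded_ops (MM \<Otimes>\<^sub>M M)"
  using coproduct_id
    von_neumann_algebra_subset[OF von_neumann_algebra_vn_tensor[OF generates_MM generates_M WW_bounded W_bounded]]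
  by (auto simp: is_hom_tensor_def)

text \<open>The image of lambda_g (x) lambda_h is lambda_g (x) lambda_h (x) lambda_h. Each
  identification in this chain holds up to \<open>op_eq\<close>, so it is evaluated on product
  vectors.\<close>

lemma id_coproduct_apply:
  assumes g: "g \<in> carrier X" and h: "h \<in> carrier X"
    and p: "p1 \<in> carrier X" "p2 \<in> carrier X" "p3 \<in> carrier X"
  shows "AE z in M \<Otimes>\<^sub>M MM. id_\<Delta> (left_regular XX (g, h)) (tensor_fun (\<lambda>x. indicator (uball N p1) x)
      (tensor_fun (\<lambda>x. indicator (uball N p2) x) (\<lambda>x. indicator (uball N p3) x))) z
    = tensor_fun (translate N (inv\<^bsub>X\<^esub> g) p1)
        (tensor_fun (translate N (inv\<^bsub>X\<^esub> h) p2) (translate N (inv\<^bsub>X\<^esub> h) p3)) z"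
proof -
  let ?e = "\<lambda>p x. indicator (uball N p) x :: complex"
  have e: "?e p1 \<in> L2 M" "tensor_fun (?e p2) (?e p3) \<in> L2 MM"
    using p by (auto intro!: uball_L2 L2_tensor(1)[OF sigma_finite_M])
  have 1: "op_eq (M \<Otimes>\<^sub>M MM) (id_\<Delta> (left_regular XX (g, h)))
      (id_\<Delta> (op_tensor M M (left_regular X g) (left_regular X h)))"
    by (rule normal_star_hom_op_eq[OF id_coproduct_facts WW_bounded left_regular_XX_WW(2,1)[OF g h] left_regular_XX_tensor[OF g h]])
  have 2: "op_eq (M \<Otimes>\<^sub>M MM) (id_\<Delta> (op_tensor M M (left_regular X g) (left_regular X h)))
      (op_tensor M MM (id (left_regular X g)) (\<Delta> (left_regular X h)))"
    using id_coproduct left_regular_W[OF g] left_regular_W[OF h] by (simp add: is_hom_tensor_def)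
  have b: "id (left_regular X g) \<in> bounded_ops M" using left_regular_bounded[OF g] by simp
  show ?thesis
    using op_eqD[OF op_eq_trans[OF 1 2] L2_tensor(1)[OF sigma_finite_MM e]]
      op_tensor_apply[OF generates_M generates_MM b coproduct_bounded(1)[OF h] e]
      AE_pair_sndI[OF sigma_finite_MM coproduct_apply[OF h p(2,3), where N = N], where M = M]
    by eventually_elim (simp add: left_regular_translate case_prod_beta')
qed

lemma coproduct_id_apply:
  assumes g: "g \<in> carrier X" and h: "h \<in> carrier X"
    and p: "p1 \<in> carrier X" "p2 \<in> carrier X" "p3 \<in> carrier X"
  shows "AE z in MM \<Otimes>\<^sub>M M. \<Delta>_id (left_regular XX (g, h)) (tensor_fun
      (tensor_fun (\<lambda>x. indicator (uball N p1) x) (\<lambda>x. indicator (uball N p2) x)) (\<lambda>x. indicator (uball N p3) x)) z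
    = tensor_fun (tensor_fun (translate N (inv\<^bsub>X\<^esub> g) p1) (translate N (inv\<^bsub>X\<^esub> g) p2))
        (translate N (inv\<^bsub>X\<^esub> h) p3) z"
proof -
  let ?e = "\<lambda>p x. indicator (uball N p) x :: complex"
  have e: "tensor_fun (?e p1) (?e p2) \<in> L2 MM" "?e p3 \<in> L2 M"
    using p by (auto intro!: uball_L2 L2_tensor(1)[OF sigma_finite_M])
  have 1: "op_eq (MM \<Otimes>\<^sub>M M) (\<Delta>_id (left_regular XX (g, h)))
      (\<Delta>_id (op_tensor M M (left_regular X g) (left_regular X h)))"
    by (rule normal_star_hom_op_eq[OF coproduct_id_facts WW_bounded left_regular_XX_WW(2,1)[OF g h] left_regular_XX_tensor[OF g h]])
  have 2: "op_eq (MM \<Otimes>\<^sub>M M) (\<Delta>_id (op_tensor M M (left_regular X g) (left_regular X h)))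
      (op_tensor MM M (\<Delta> (left_regular X g)) (id (left_regular X h)))"
    using coproduct_id left_regular_W[OF g] left_regular_W[OF h] by (simp add: is_hom_tensor_def)
  have b: "id (left_regular X h) \<in> bounded_ops M" using left_regular_bounded[OF h] by simp
  show ?thesis
    using op_eqD[OF op_eq_trans[OF 1 2] L2_tensor(1)[OF sigma_finite_M e]]
      op_tensor_apply[OF generates_MM generates_M coproduct_bounded(1)[OF g] b e]
      AE_pair_fstI[OF sigma_finite_M coproduct_apply[OF g p(1,2), where N = N]]
    by eventually_elim (simp add: left_regular_translate case_prod_beta')
qed

end

lemma L2_inner_cong_AE_L2:
  assumes "f \<in> L2 M" "f' \<in> L2 M" "g \<in> L2 M" "AE x in M. f x = f' x"
  shows "L2_inner M f g = L2_inner M f' g"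
  by (rule L2_inner_cong_AE) (use assms L2_measurable in auto)

lemma sum_product_Times:
  fixes f :: "'a \<Rightarrow> 'c::semiring_0"
  shows "(\<Sum>x\<in>A. f x) * (\<Sum>y\<in>B. g y) = (\<Sum>w\<in>A \<times> B. f (fst w) * g (snd w))"
  by (simp add: sum_product sum.cartesian_product case_prod_beta')

context cocycle_setting
begin

text \<open>F is given in the algebra of the product group, while the homomorphisms live on the
  tensor product algebra. The latter is closed and contains all translations.\<close>

lemma twist_WW: "F \<in> WW"
proof -
  have "closedin (sigma_weak_topology MM) WW"
    using von_neumann_algebra_WW by (simp add: von_neumann_algebra_def)
  moreover have "op_span MM (left_regular XX ` carrier XX) \<subseteq> WW"
  proof
    fix T assume "T \<in> op_span MM (left_regular XX ` carrier XX)"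
    then show "T \<in> WW"
    proof induction
      case (eq S T)
      then show ?case using von_neumann_algebra_op_eq[OF von_neumann_algebra_WW] op_eq_sym by blast
    qed (use von_neumann_algebra_WW left_regular_XX_subset in \<open>auto simp: von_neumann_algebra_def\<close>)
  qed
  ultimately show ?thesis using closure_of_minimal twist_closure by blast
qed

lemma id_coproduct_bounded: "T \<in> WW \<Longrightarrow> id_\<Delta> T \<in> bounded_ops (M \<Otimes>\<^sub>M MM)"
  using id_coproduct_facts by (auto simp: normal_star_hom_def)

lemma coproduct_id_bounded: "T \<in> WW \<Longrightarrow> \<Delta>_id T \<in> bounded_ops (MM \<Otimes>\<^sub>M M)"
  using coproduct_id_facts by (auto simp: normal_star_hom_def)

lemmas id_coproduct_L2 = bounded_ops_L2[OF id_coproduct_bounded]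
lemmas coproduct_id_L2 = bounded_ops_L2[OF coproduct_id_bounded]

abbreviation "ball_fun N p \<equiv> (\<lambda>x. indicator (uball N p) x :: complex)"

context
  fixes N p1 p2 p3
  assumes N: "N \<ge> n" and p: "p1 \<in> carrier X" "p2 \<in> carrier X" "p3 \<in> carrier X"
begin

text \<open>Both sides are tested against boxes. For translations the resulting coefficient equals a
  coefficient on two factors; normality transfers this equality to F, where the explicit kernel
  applies. The expansion of the kernel then lifts back to three factors.\<close>

lemma id_coproduct_twist:
  "AE z in M \<Otimes>\<^sub>M MM. id_\<Delta> F (tensor_fun (ball_fun N p1) (tensor_fun (ball_fun N p2) (ball_fun N p3))) z =
    (\<Sum>y\<in>reps N. tensor_fun (kappa_left N p1 y) (tensor_fun (translate N y p2) (translate N y p3)) z)"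
proof (rule AE_eq_of_inner[OF generates_M_MM])
  \<comment> \<open>\<open>?\<xi>\<close> keeps only the first two balls. The third ball and its
    test set are stored in the weight \<open>?w\<close> introduced below.\<close>
  let ?\<Xi> = "tensor_fun (ball_fun N p1) (tensor_fun (ball_fun N p2) (ball_fun N p3))" and ?\<xi> = "tensor_fun (ball_fun N p1) (ball_fun N p2)"
  let ?G = "\<lambda>y. tensor_fun (kappa_left N p1 y) (tensor_fun (translate N y p2) (translate N y p3))"
  note sf = sigma_finite_M sigma_finite_MM
  note kl = kappa_left_L2[OF N p(1)] and tr = translate_L2
  have \<Xi>: "?\<Xi> \<in> L2 (M \<Otimes>\<^sub>M MM)" and \<xi>: "?\<xi> \<in> L2 MM"
    using p by (auto intro!: uball_L2 L2_tensor(1) sf)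
  have G: "?G y \<in> L2 (M \<Otimes>\<^sub>M MM)" if "y \<in> reps N" for y
    by (intro L2_tensor(1) sf kl tr p reps_carrier[OF N that])
  then show "(\<lambda>z. \<Sum>y\<in>reps N. ?G y z) \<in> L2 (M \<Otimes>\<^sub>M MM)" by (rule L2_sum)
  show F\<Xi>: "id_\<Delta> F ?\<Xi> \<in> L2 (M \<Otimes>\<^sub>M MM)"
    by (rule id_coproduct_L2[OF twist_WW \<Xi>])
  fix C assume "C \<in> {A \<times> B |A B. A \<in> basic_sets \<and> B \<in> {A \<times> B |A B. A \<in> basic_sets \<and> B \<in> basic_sets}}"
  then obtain A1 A2 A3 where C: "C = A1 \<times> (A2 \<times> A3)" and A: "A1 \<in> basic_sets" "A2 \<in> basic_sets" "A3 \<in> basic_sets"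
    by (elim CollectE exE conjE) (hypsubst, blast)
  let ?a = "\<lambda>A x. indicator A x :: complex"
  let ?H = "tensor_fun (?a A1) (tensor_fun (?a A2) (?a A3))" and ?w = "weight N p2 p3 A2 A3"
  let ?\<eta> = "tensor_fun (?a A1) ?w"
  have H_eq: "(\<lambda>z. indicator C z) = ?H" unfolding C by (auto simp: indicator_def fun_eq_iff)
  note a = generates_L2[OF generates_M A(1)] generates_L2[OF generates_M A(2)] generates_L2[OF generates_M A(3)]
  have w: "?w \<in> L2 M" by (rule weight_L2[OF p(2,3) A(2,3)])
  have H: "?H \<in> L2 (M \<Otimes>\<^sub>M MM)" and \<eta>: "?\<eta> \<in> L2 MM" by (intro L2_tensor(1) sf a w)+
  \<comment> \<open>Used twice: from three factors to two for translations, and in the opposite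
    direction for the terms in the expansion of F.\<close>
  have inner: "L2_inner (M \<Otimes>\<^sub>M MM) (tensor_fun f (tensor_fun (translate N q p2) (translate N q p3))) ?H =
      L2_inner MM (tensor_fun f (translate N q p2)) ?\<eta>" if f: "f \<in> L2 M" and q: "q \<in> carrier X" for f q
  proof -
    have "L2_inner (M \<Otimes>\<^sub>M MM) (tensor_fun f (tensor_fun (translate N q p2) (translate N q p3))) ?H =
        L2_inner M f (?a A1) * (L2_inner M (translate N q p2) (?a A2) * L2_inner M (translate N q p3) (?a A3))"
      unfolding L2_inner_tensor[OF sf f a(1) L2_tensor(1)[OF sf(1) tr[OF q p(2)] tr[OF q p(3)]] L2_tensor(1)[OF sf(1) a(2,3)]]
        L2_inner_tensor[OF sf(1,1) tr[OF q p(2)] a(2) tr[OF q p(3)] a(3)] ..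
    also have "\<dots> = L2_inner MM (tensor_fun f (translate N q p2)) ?\<eta>"
      unfolding L2_inner_tensor[OF sf(1,1) f a(1) tr[OF q p(2)] w] weight_inner[OF p(2,3) q] ..
    finally show ?thesis .
  qed
  have base: "L2_inner (M \<Otimes>\<^sub>M MM) (id_\<Delta> T ?\<Xi>) ?H = L2_inner MM (T ?\<xi>) ?\<eta>"
    if T: "T \<in> left_regular XX ` carrier XX" for T
  proof -
    obtain g h where gh: "g \<in> carrier X" "h \<in> carrier X" and T_eq: "T = left_regular XX (g, h)"
      using T by (rule left_regular_XX_image)
    have i: "inv\<^bsub>X\<^esub> g \<in> carrier X" "inv\<^bsub>X\<^esub> h \<in> carrier X" using gh by auto
    have "L2_inner (M \<Otimes>\<^sub>M MM) (id_\<Delta> T ?\<Xi>) ?H = L2_inner (M \<Otimes>\<^sub>M MM)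
        (tensor_fun (translate N (inv\<^bsub>X\<^esub> g) p1) (tensor_fun (translate N (inv\<^bsub>X\<^esub> h) p2) (translate N (inv\<^bsub>X\<^esub> h) p3))) ?H"
      unfolding T_eq
    proof (rule L2_inner_cong_AE_L2[OF _ _ H id_coproduct_apply[OF gh p]])
      show "id_\<Delta> (left_regular XX (g, h)) ?\<Xi> \<in> L2 (M \<Otimes>\<^sub>M MM)"
        by (rule id_coproduct_L2[OF left_regular_XX_WW(2)[OF gh] \<Xi>])
    qed (intro L2_tensor(1) sf tr i p)
    also have "\<dots> = L2_inner MM (T ?\<xi>) ?\<eta>"
      unfolding inner[OF tr[OF i(1) p(1)] i(2)] T_eq left_regular_XX[OF gh] left_regular_translate ..
    finally show ?thesis .
  qed
  have "L2_inner (M \<Otimes>\<^sub>M MM) (id_\<Delta> F ?\<Xi>) ?H = L2_inner MM (F ?\<xi>) ?\<eta>"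
    by (rule normal_star_hom_coefficient(2)[OF id_coproduct_facts von_neumann_algebra_WW left_regular_XX_subset
      twist_closure \<xi> \<eta> \<Xi> H base])
  also have "\<dots> = L2_inner MM (\<lambda>z. \<Sum>y\<in>reps N. tensor_fun (kappa_left N p1 y) (translate N y p2) z) ?\<eta>"
  proof (rule L2_inner_cong_AE_L2[OF bounded_ops_L2[OF twist_bounded \<xi>] _ \<eta>])
    show "(\<lambda>z. \<Sum>y\<in>reps N. tensor_fun (kappa_left N p1 y) (translate N y p2) z) \<in> L2 MM"
      by (intro L2_sum L2_tensor(1) sf kl tr p reps_carrier[OF N])
    show "AE z in MM. F ?\<xi> z = (\<Sum>y\<in>reps N. tensor_fun (kappa_left N p1 y) (translate N y p2) z)"
      using twist_uball[OF twist N p(1,2)] AE_space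
      by eventually_elim (auto simp: space_pair_measure space_M kappa_sum_left[OF N p(1,2)])
  qed
  also have "\<dots> = (\<Sum>y\<in>reps N. L2_inner MM (tensor_fun (kappa_left N p1 y) (translate N y p2)) ?\<eta>)"
    by (rule L2_inner_sum_left[OF _ \<eta>]) (intro L2_tensor(1) sf kl tr p reps_carrier[OF N])
  also have "\<dots> = (\<Sum>y\<in>reps N. L2_inner (M \<Otimes>\<^sub>M MM) (?G y) ?H)"
    by (rule sum.cong[OF refl]) (simp only: inner[OF kl reps_carrier[OF N]])
  also have "\<dots> = L2_inner (M \<Otimes>\<^sub>M MM) (\<lambda>z. \<Sum>y\<in>reps N. ?G y z) ?H"
    by (rule L2_inner_sum_left[OF G H, symmetric])
  finally show "L2_inner (M \<Otimes>\<^sub>M MM) (id_\<Delta> F ?\<Xi>) (\<lambda>x. indicator C x) =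
      L2_inner (M \<Otimes>\<^sub>M MM) (\<lambda>z. \<Sum>y\<in>reps N. ?G y z) (\<lambda>x. indicator C x)"
    unfolding H_eq .
qed

text \<open>The previous formula is a finite sum of product functions. F acts on the last two
  factors of each term, which are left translates of balls by the same y.\<close>

lemma twist_id_coproduct:
  "AE z in M \<Otimes>\<^sub>M MM. op_tensor M MM id F (id_\<Delta> F (tensor_fun (ball_fun N p1) (tensor_fun (ball_fun N p2) (ball_fun N p3)))) z =
    (\<Sum>y\<in>reps N. kappa N (p1 \<otimes>\<^bsub>X\<^esub> inv\<^bsub>X\<^esub> fst z) y *
      kappa N (inv\<^bsub>X\<^esub> y \<otimes>\<^bsub>X\<^esub> (p2 \<otimes>\<^bsub>X\<^esub> inv\<^bsub>X\<^esub> fst (snd z))) (inv\<^bsub>X\<^esub> y \<otimes>\<^bsub>X\<^esub> (p3 \<otimes>\<^bsub>X\<^esub> inv\<^bsub>X\<^esub> snd (snd z))))"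
proof -
  let ?\<Xi> = "tensor_fun (ball_fun N p1) (tensor_fun (ball_fun N p2) (ball_fun N p3))"
  let ?t = "\<lambda>y. tensor_fun (translate N y p2) (translate N y p3)"
  let ?G = "\<lambda>y. tensor_fun (kappa_left N p1 y) (?t y)"
  note sf = sigma_finite_M sigma_finite_MM
  note kl = kappa_left_L2[OF N p(1)] and rc = reps_carrier[OF N]
  note R = op_tensor_bounded[OF generates_M generates_MM bounded_ops_id twist_bounded]
  have t: "?t y \<in> L2 MM" if "y \<in> reps N" for y
    by (intro L2_tensor(1) sf translate_L2 p rc that)
  have G: "?G y \<in> L2 (M \<Otimes>\<^sub>M MM)" if "y \<in> reps N" for y
    by (intro L2_tensor(1) sf kl t that)
  have "AE z in M \<Otimes>\<^sub>M MM. op_tensor M MM id F (id_\<Delta> F ?\<Xi>) z = op_tensor M MM id F (\<lambda>z. \<Sum>y\<in>reps N. ?G y z) z"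
  proof (rule bounded_ops_cong[OF R _ L2_sum[OF G] id_coproduct_twist])
    have "?\<Xi> \<in> L2 (M \<Otimes>\<^sub>M MM)" using p by (auto intro!: uball_L2 L2_tensor(1) sf)
    then show "id_\<Delta> F ?\<Xi> \<in> L2 (M \<Otimes>\<^sub>M MM)"
      by (rule id_coproduct_L2[OF twist_WW])
  qed
  moreover have "AE z in M \<Otimes>\<^sub>M MM. op_tensor M MM id F (\<lambda>z. \<Sum>y\<in>reps N. ?G y z) z = (\<Sum>y\<in>reps N. op_tensor M MM id F (?G y) z)"
    by (rule bounded_ops_sum[OF R G])
  moreover have "AE z in M \<Otimes>\<^sub>M MM. \<forall>y\<in>reps N. op_tensor M MM id F (?G y) z = id (kappa_left N p1 y) (fst z) * F (?t y) (snd z)"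
    by (rule AE_finite_allI[OF finite_reps_X]) (rule op_tensor_apply[OF generates_M generates_MM bounded_ops_id twist_bounded kl t])
  moreover have "AE z in M \<Otimes>\<^sub>M MM. \<forall>y\<in>reps N. F (?t y) (snd z) = kappa N (inv\<^bsub>X\<^esub> y \<otimes>\<^bsub>X\<^esub> (p2 \<otimes>\<^bsub>X\<^esub> inv\<^bsub>X\<^esub> fst (snd z)))
      (inv\<^bsub>X\<^esub> y \<otimes>\<^bsub>X\<^esub> (p3 \<otimes>\<^bsub>X\<^esub> inv\<^bsub>X\<^esub> snd (snd z)))"
    by (rule AE_finite_allI[OF finite_reps_X])
      (rule AE_pair_sndI[OF sf(2) twist_translate[OF N twist twist_bounded p(2,3)]])
  moreover have "AE z in M \<Otimes>\<^sub>M MM. z \<in> space (M \<Otimes>\<^sub>M MM)" by (rule AE_space)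
  ultimately show ?thesis
  proof eventually_elim
    case (elim z)
    then have z: "fst z \<in> carrier X" by (auto simp: space_pair_measure space_M)
    show ?case unfolding elim(1,2)
      by (rule sum.cong[OF refl]) (use elim(3,4) z in \<open>simp add: kappa_left_eq[OF N p(1)] rc\<close>)
  qed
qed

text \<open>The mirror image: now the first leg of F is doubled, so the weight replaces the first
  two factors and the second ball is absent from \<open>?\<xi>\<close>.\<close>

lemma coproduct_id_twist:
  "AE z in MM \<Otimes>\<^sub>M M. \<Delta>_id F (tensor_fun (tensor_fun (ball_fun N p1) (ball_fun N p2)) (ball_fun N p3)) z =
    (\<Sum>y\<in>reps N. tensor_fun (tensor_fun (translate N y p1) (translate N y p2)) (kappa_right N p3 y) z)"
proof (rule AE_eq_of_inner[OF generates_MM_M])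
  let ?\<Xi> = "tensor_fun (tensor_fun (ball_fun N p1) (ball_fun N p2)) (ball_fun N p3)" and ?\<xi> = "tensor_fun (ball_fun N p1) (ball_fun N p3)"
  let ?G = "\<lambda>y. tensor_fun (tensor_fun (translate N y p1) (translate N y p2)) (kappa_right N p3 y)"
  note sf = sigma_finite_M sigma_finite_MM
  note kr = kappa_right_L2[OF N p(3)] and tr = translate_L2
  have \<Xi>: "?\<Xi> \<in> L2 (MM \<Otimes>\<^sub>M M)" and \<xi>: "?\<xi> \<in> L2 MM"
    using p by (auto intro!: uball_L2 L2_tensor(1) sf)
  have G: "?G y \<in> L2 (MM \<Otimes>\<^sub>M M)" if "y \<in> reps N" for y
    by (intro L2_tensor(1) sf kr tr p reps_carrier[OF N that])
  then show "(\<lambda>z. \<Sum>y\<in>reps N. ?G y z) \<in> L2 (MM \<Otimes>\<^sub>M M)" by (rule L2_sum)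
  show F\<Xi>: "\<Delta>_id F ?\<Xi> \<in> L2 (MM \<Otimes>\<^sub>M M)"
    by (rule coproduct_id_L2[OF twist_WW \<Xi>])
  fix C assume "C \<in> {A \<times> B |A B. A \<in> {A \<times> B |A B. A \<in> basic_sets \<and> B \<in> basic_sets} \<and> B \<in> basic_sets}"
  then obtain A1 A2 A3 where C: "C = (A1 \<times> A2) \<times> A3" and A: "A1 \<in> basic_sets" "A2 \<in> basic_sets" "A3 \<in> basic_sets"
    by (elim CollectE exE conjE) (hypsubst, blast)
  let ?a = "\<lambda>A x. indicator A x :: complex"
  let ?H = "tensor_fun (tensor_fun (?a A1) (?a A2)) (?a A3)" and ?w = "weight N p1 p2 A1 A2"
  let ?\<eta> = "tensor_fun ?w (?a A3)"
  have H_eq: "(\<lambda>z. indicator C z) = ?H" unfolding C by (auto simp: indicator_def fun_eq_iff)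
  note a = generates_L2[OF generates_M A(1)] generates_L2[OF generates_M A(2)] generates_L2[OF generates_M A(3)]
  have w: "?w \<in> L2 M" by (rule weight_L2[OF p(1,2) A(1,2)])
  have H: "?H \<in> L2 (MM \<Otimes>\<^sub>M M)" and \<eta>: "?\<eta> \<in> L2 MM" by (intro L2_tensor(1) sf a w)+
  have inner: "L2_inner (MM \<Otimes>\<^sub>M M) (tensor_fun (tensor_fun (translate N q p1) (translate N q p2)) f) ?H =
      L2_inner MM (tensor_fun (translate N q p1) f) ?\<eta>" if f: "f \<in> L2 M" and q: "q \<in> carrier X" for f q
  proof -
    have "L2_inner (MM \<Otimes>\<^sub>M M) (tensor_fun (tensor_fun (translate N q p1) (translate N q p2)) f) ?H =
        L2_inner M (translate N q p1) (?a A1) * L2_inner M (translate N q p2) (?a A2) * L2_inner M f (?a A3)"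
      unfolding L2_inner_tensor[OF sf(2,1) L2_tensor(1)[OF sf(1) tr[OF q p(1)] tr[OF q p(2)]] L2_tensor(1)[OF sf(1) a(1,2)] f a(3)]
        L2_inner_tensor[OF sf(1,1) tr[OF q p(1)] a(1) tr[OF q p(2)] a(2)] ..
    also have "\<dots> = L2_inner MM (tensor_fun (translate N q p1) f) ?\<eta>"
      unfolding L2_inner_tensor[OF sf(1,1) tr[OF q p(1)] w f a(3)] weight_inner[OF p(1,2) q] ..
    finally show ?thesis .
  qed
  have base: "L2_inner (MM \<Otimes>\<^sub>M M) (\<Delta>_id T ?\<Xi>) ?H = L2_inner MM (T ?\<xi>) ?\<eta>"
    if T: "T \<in> left_regular XX ` carrier XX" for T
  proof -
    obtain g h where gh: "g \<in> carrier X" "h \<in> carrier X" and T_eq: "T = left_regular XX (g, h)"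
      using T by (rule left_regular_XX_image)
    have i: "inv\<^bsub>X\<^esub> g \<in> carrier X" "inv\<^bsub>X\<^esub> h \<in> carrier X" using gh by auto
    have "L2_inner (MM \<Otimes>\<^sub>M M) (\<Delta>_id T ?\<Xi>) ?H = L2_inner (MM \<Otimes>\<^sub>M M)
        (tensor_fun (tensor_fun (translate N (inv\<^bsub>X\<^esub> g) p1) (translate N (inv\<^bsub>X\<^esub> g) p2)) (translate N (inv\<^bsub>X\<^esub> h) p3)) ?H"
      unfolding T_eq
    proof (rule L2_inner_cong_AE_L2[OF _ _ H coproduct_id_apply[OF gh p]])
      show "\<Delta>_id (left_regular XX (g, h)) ?\<Xi> \<in> L2 (MM \<Otimes>\<^sub>M M)"
        by (rule coproduct_id_L2[OF left_regular_XX_WW(2)[OF gh] \<Xi>])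
    qed (intro L2_tensor(1) sf tr i p)
    also have "\<dots> = L2_inner MM (T ?\<xi>) ?\<eta>"
      unfolding inner[OF tr[OF i(2) p(3)] i(1)] T_eq left_regular_XX[OF gh] left_regular_translate ..
    finally show ?thesis .
  qed
  have "L2_inner (MM \<Otimes>\<^sub>M M) (\<Delta>_id F ?\<Xi>) ?H = L2_inner MM (F ?\<xi>) ?\<eta>"
    by (rule normal_star_hom_coefficient(2)[OF coproduct_id_facts von_neumann_algebra_WW left_regular_XX_subset
      twist_closure \<xi> \<eta> \<Xi> H base])
  also have "\<dots> = L2_inner MM (\<lambda>z. \<Sum>y\<in>reps N. tensor_fun (translate N y p1) (kappa_right N p3 y) z) ?\<eta>"
  proof (rule L2_inner_cong_AE_L2[OF bounded_ops_L2[OF twist_bounded \<xi>] _ \<eta>])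
    show "(\<lambda>z. \<Sum>y\<in>reps N. tensor_fun (translate N y p1) (kappa_right N p3 y) z) \<in> L2 MM"
      by (intro L2_sum L2_tensor(1) sf kr tr p reps_carrier[OF N])
    show "AE z in MM. F ?\<xi> z = (\<Sum>y\<in>reps N. tensor_fun (translate N y p1) (kappa_right N p3 y) z)"
      using twist_uball[OF twist N p(1,3)] AE_space
      by eventually_elim (auto simp: space_pair_measure space_M kappa_sum_right[OF N p(1,3)])
  qed
  also have "\<dots> = (\<Sum>y\<in>reps N. L2_inner MM (tensor_fun (translate N y p1) (kappa_right N p3 y)) ?\<eta>)"
    by (rule L2_inner_sum_left[OF _ \<eta>]) (intro L2_tensor(1) sf kr tr p reps_carrier[OF N])
  also have "\<dots> = (\<Sum>y\<in>reps N. L2_inner (MM \<Otimes>\<^sub>M M) (?G y) ?H)"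
    by (rule sum.cong[OF refl]) (simp only: inner[OF kr reps_carrier[OF N]])
  also have "\<dots> = L2_inner (MM \<Otimes>\<^sub>M M) (\<lambda>z. \<Sum>y\<in>reps N. ?G y z) ?H"
    by (rule L2_inner_sum_left[OF G H, symmetric])
  finally show "L2_inner (MM \<Otimes>\<^sub>M M) (\<Delta>_id F ?\<Xi>) (\<lambda>x. indicator C x) =
      L2_inner (MM \<Otimes>\<^sub>M M) (\<lambda>z. \<Sum>y\<in>reps N. ?G y z) (\<lambda>x. indicator C x)"
    unfolding H_eq .
qed

lemma twist_coproduct_id:
  "AE z in MM \<Otimes>\<^sub>M M. op_tensor MM M F id (\<Delta>_id F (tensor_fun (tensor_fun (ball_fun N p1) (ball_fun N p2)) (ball_fun N p3))) z =
    (\<Sum>y\<in>reps N. kappa N y (p3 \<otimes>\<^bsub>X\<^esub> inv\<^bsub>X\<^esub> snd z) *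
      kappa N (inv\<^bsub>X\<^esub> y \<otimes>\<^bsub>X\<^esub> (p1 \<otimes>\<^bsub>X\<^esub> inv\<^bsub>X\<^esub> fst (fst z))) (inv\<^bsub>X\<^esub> y \<otimes>\<^bsub>X\<^esub> (p2 \<otimes>\<^bsub>X\<^esub> inv\<^bsub>X\<^esub> snd (fst z))))"
proof -
  let ?\<Xi> = "tensor_fun (tensor_fun (ball_fun N p1) (ball_fun N p2)) (ball_fun N p3)"
  let ?t = "\<lambda>y. tensor_fun (translate N y p1) (translate N y p2)"
  let ?G = "\<lambda>y. tensor_fun (?t y) (kappa_right N p3 y)"
  note sf = sigma_finite_M sigma_finite_MM
  note kr = kappa_right_L2[OF N p(3)] and rc = reps_carrier[OF N]
  note R = op_tensor_bounded[OF generates_MM generates_M twist_bounded bounded_ops_id]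
  have t: "?t y \<in> L2 MM" if "y \<in> reps N" for y
    by (intro L2_tensor(1) sf translate_L2 p rc that)
  have G: "?G y \<in> L2 (MM \<Otimes>\<^sub>M M)" if "y \<in> reps N" for y
    by (intro L2_tensor(1) sf kr t that)
  have "AE z in MM \<Otimes>\<^sub>M M. op_tensor MM M F id (\<Delta>_id F ?\<Xi>) z = op_tensor MM M F id (\<lambda>z. \<Sum>y\<in>reps N. ?G y z) z"
  proof (rule bounded_ops_cong[OF R _ L2_sum[OF G] coproduct_id_twist])
    have "?\<Xi> \<in> L2 (MM \<Otimes>\<^sub>M M)" using p by (auto intro!: uball_L2 L2_tensor(1) sf)
    then show "\<Delta>_id F ?\<Xi> \<in> L2 (MM \<Otimes>\<^sub>M M)"
      by (rule coproduct_id_L2[OF twist_WW])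
  qed
  moreover have "AE z in MM \<Otimes>\<^sub>M M. op_tensor MM M F id (\<lambda>z. \<Sum>y\<in>reps N. ?G y z) z = (\<Sum>y\<in>reps N. op_tensor MM M F id (?G y) z)"
    by (rule bounded_ops_sum[OF R G])
  moreover have "AE z in MM \<Otimes>\<^sub>M M. \<forall>y\<in>reps N. op_tensor MM M F id (?G y) z = F (?t y) (fst z) * id (kappa_right N p3 y) (snd z)"
    by (rule AE_finite_allI[OF finite_reps_X]) (rule op_tensor_apply[OF generates_MM generates_M twist_bounded bounded_ops_id t kr])
  moreover have "AE z in MM \<Otimes>\<^sub>M M. \<forall>y\<in>reps N. F (?t y) (fst z) = kappa N (inv\<^bsub>X\<^esub> y \<otimes>\<^bsub>X\<^esub> (p1 \<otimes>\<^bsub>X\<^esub> inv\<^bsub>X\<^esub> fst (fst z)))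
      (inv\<^bsub>X\<^esub> y \<otimes>\<^bsub>X\<^esub> (p2 \<otimes>\<^bsub>X\<^esub> inv\<^bsub>X\<^esub> snd (fst z)))"
    by (rule AE_finite_allI[OF finite_reps_X])
      (rule AE_pair_fstI[OF sf(1) twist_translate[OF N twist twist_bounded p(1,2)]])
  moreover have "AE z in MM \<Otimes>\<^sub>M M. z \<in> space (MM \<Otimes>\<^sub>M M)" by (rule AE_space)
  ultimately show ?thesis
  proof eventually_elim
    case (elim z)
    then have z: "snd z \<in> carrier X" by (auto simp: space_pair_measure space_M)
    show ?case unfolding elim(1,2)
      by (rule sum.cong[OF refl]) (use elim(3,4) z in \<open>simp add: kappa_right_eq[OF N p(3)] rc mult.commute\<close>)
  qed
qed

end
end

section \<open>The cocycle relation\<close>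

context cocycle_setting
begin

text \<open>On three balls of equal radius both sides are kernel sums, related by
  \<open>kappa_cocycle\<close> at the points p1 z1^(-1), p2 z2^(-1), p3 z3^(-1).\<close>

lemma cocycle_uball:
  assumes N: "N \<ge> n" and p: "p1 \<in> carrier X" "p2 \<in> carrier X" "p3 \<in> carrier X"
  defines "f \<equiv> tensor_fun (ball_fun N p1) (tensor_fun (ball_fun N p2) (ball_fun N p3))"
  shows "AE z in M \<Otimes>\<^sub>M MM. (op_tensor M MM id F \<circ> id_\<Delta> F) f z = op_assoc (op_tensor MM M F id \<circ> \<Delta>_id F) f z"
proof -
  let ?g = "tensor_fun (tensor_fun (ball_fun N p1) (ball_fun N p2)) (ball_fun N p3)"
  have fg: "(\<lambda>((x, y), z). f (x, y, z)) = ?g" by (auto simp: f_def fun_eq_iff mult.assoc)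
  have assoc: "op_assoc (op_tensor MM M F id \<circ> \<Delta>_id F) f z =
      op_tensor MM M F id (\<Delta>_id F ?g) ((fst z, fst (snd z)), snd (snd z))" for z
  proof -
    obtain x y w where z: "z = (x, y, w)" by (cases z) auto
    show ?thesis unfolding z op_assoc_def prod.case comp_apply fg by simp
  qed
  note 1 = AE_assoc[OF generates_M generates_M generates_M twist_coproduct_id[OF N p]]
  have 2: "AE z in M \<Otimes>\<^sub>M MM. z \<in> space (M \<Otimes>\<^sub>M MM)" by (rule AE_space)
  show ?thesis using twist_id_coproduct[OF N p] 1 2
  proof eventually_elim
    case (elim z)
    have z: "fst z \<in> carrier X" "fst (snd z) \<in> carrier X" "snd (snd z) \<in> carrier X"
      using elim(3) by (auto simp: space_pair_measure space_M)
    have "(op_tensor M MM id F \<circ> id_\<Delta> F) f z =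
        (\<Sum>y\<in>reps N. kappa N (p1 \<otimes>\<^bsub>X\<^esub> inv\<^bsub>X\<^esub> fst z) y *
          kappa N (inv\<^bsub>X\<^esub> y \<otimes>\<^bsub>X\<^esub> (p2 \<otimes>\<^bsub>X\<^esub> inv\<^bsub>X\<^esub> fst (snd z))) (inv\<^bsub>X\<^esub> y \<otimes>\<^bsub>X\<^esub> (p3 \<otimes>\<^bsub>X\<^esub> inv\<^bsub>X\<^esub> snd (snd z))))"
      using elim(1) by (simp only: f_def comp_apply)
    also have "\<dots> = (\<Sum>y\<in>reps N. kappa N y (p3 \<otimes>\<^bsub>X\<^esub> inv\<^bsub>X\<^esub> snd (snd z)) *
          kappa N (inv\<^bsub>X\<^esub> y \<otimes>\<^bsub>X\<^esub> (p1 \<otimes>\<^bsub>X\<^esub> inv\<^bsub>X\<^esub> fst z)) (inv\<^bsub>X\<^esub> y \<otimes>\<^bsub>X\<^esub> (p2 \<otimes>\<^bsub>X\<^esub> inv\<^bsub>X\<^esub> fst (snd z))))"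
      by (rule kappa_cocycle[OF N]) (use p z in auto)
    also have "\<dots> = op_assoc (op_tensor MM M F id \<circ> \<Delta>_id F) f z"
      using elim(2) by (simp only: assoc fst_conv snd_conv)
    finally show ?case .
  qed
qed

text \<open>Any point of a ball is a centre, so a nonempty intersection with the units can be
  recentred at a unit.\<close>

lemma basic_sets_cases:
  assumes "A \<in> basic_sets"
  obtains "A = {}" | m p where "p \<in> carrier X" "A = uball m p"
proof -
  obtain B D where A: "A = B \<times> D" "B \<in> unit_sets" "D \<in> insert {} {{C} |C. C \<in> \<Gamma>}"
    using assms unfolding basic_sets_def by (elim CollectE exE conjE)
  show thesis
  proof (cases "A = {}")
    case False
    then have "B \<noteq> {}" "D \<noteq> {}" by (simp_all add: A(1))
    then obtain b where b: "b \<in> B" by blast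
    obtain C where C: "C \<in> \<Gamma>" "D = {C}" using A(3) \<open>D \<noteq> {}\<close> by (elim insertE CollectE exE conjE) simp_all
    note bC = b C
    obtain m c where B: "B = U \<inter> vball m c"
      using A(2) \<open>B \<noteq> {}\<close> unfolding unit_sets_def by (elim imageE insertE CollectE exE conjE) simp_all
    obtain t where t: "C = cls t" using bC by (auto simp: Gamma_iff)
    have bU: "b \<in> U" "b \<in> vball m c" using bC(1) unfolding B by auto
    have "A = uball m (b, C)"
    proof (rule Set.set_eqI)
      fix x show "x \<in> A \<longleftrightarrow> x \<in> uball m (b, C)"
        unfolding A(1) B bC(3) vball_eq[OF bU(2)]
        using bC(2) by (cases x; simp add: uball_def carrier_X vball_def; blast)
    qed
    then show thesis using bU by (intro that(2)[of "(b, C)" m]) (simp_all add: t)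
  qed (use that in blast)
qed

lemma bounded_part_exhaust:
  assumes "p \<in> carrier X" shows "\<exists>k. \<forall>N\<ge>k. N \<ge> n \<longrightarrow> p \<in> bounded_part N"
proof -
  obtain a t where p: "a \<in> U" "p = (a, cls t)" using assms by (rule X_cases)
  obtain k where k: "v t * v \<pi> ^ k \<le> 1" using uniformizer_power_bounded by blast
  have "p \<in> bounded_part N" if N: "N \<ge> k" "N \<ge> n" for N
  proof -
    have "v t * v \<pi> ^ N \<le> v t * v \<pi> ^ k"
      by (intro mult_left_mono uniformizer_power_antimono N val_nonneg)
    then show ?thesis unfolding p(2) bounded_part_iff[OF N(2) p(1)] using k by simp
  qed
  then show ?thesis by blast
qed

text \<open>By density it suffices to treat a box of three balls with possibly different radii. At a
  sufficiently fine common level its indicator is a finite combination of the boxes in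
  \<open>cocycle_uball\<close>.\<close>

lemma cocycle:
  "op_eq (M \<Otimes>\<^sub>M MM) (op_tensor M MM id F \<circ> id_\<Delta> F) (op_assoc (op_tensor MM M F id \<circ> \<Delta>_id F))"
    (is "op_eq _ ?S ?T")
proof (rule op_eq_generates[OF generates_M_MM])
  show S: "?S \<in> bounded_ops (M \<Otimes>\<^sub>M MM)"
    by (rule bounded_ops_comp[OF op_tensor_bounded[OF generates_M generates_MM bounded_ops_id twist_bounded]
      id_coproduct_bounded[OF twist_WW]])
  show T: "?T \<in> bounded_ops (M \<Otimes>\<^sub>M MM)"
    by (rule op_assoc_bounded[OF generates_M generates_M generates_M
      bounded_ops_comp[OF op_tensor_bounded[OF generates_MM generates_M twist_bounded bounded_ops_id]
      coproduct_id_bounded[OF twist_WW]]])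
  fix C assume "C \<in> {A \<times> B |A B. A \<in> basic_sets \<and> B \<in> {A \<times> B |A B. A \<in> basic_sets \<and> B \<in> basic_sets}}"
  then obtain A1 A2 A3 where C: "C = A1 \<times> (A2 \<times> A3)" and A: "A1 \<in> basic_sets" "A2 \<in> basic_sets" "A3 \<in> basic_sets"
    by (elim CollectE exE conjE) (hypsubst, blast)
  let ?a = "\<lambda>A x. indicator A x :: complex"
  let ?f = "tensor_fun (?a A1) (tensor_fun (?a A2) (?a A3))"
  have f_eq: "(\<lambda>z. indicator C z) = ?f" unfolding C by (auto simp: indicator_def fun_eq_iff)
  show "AE z in M \<Otimes>\<^sub>M MM. ?S (\<lambda>z. indicator C z) z = ?T (\<lambda>z. indicator C z) z"
  proof (cases "C = {}")
    case True
    then have z: "(\<lambda>z. indicator C z) = (\<lambda>_. 0 :: complex)" by simp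
    show ?thesis unfolding z using bounded_ops_zero[OF S] bounded_ops_zero[OF T] by eventually_elim simp
  next
    case False
    then have ne: "A1 \<noteq> {}" "A2 \<noteq> {}" "A3 \<noteq> {}" by (auto simp: C)
    obtain m1 p1 where p1: "p1 \<in> carrier X" "A1 = uball m1 p1" using A(1) ne(1) by (metis basic_sets_cases)
    obtain m2 p2 where p2: "p2 \<in> carrier X" "A2 = uball m2 p2" using A(2) ne(2) by (metis basic_sets_cases)
    obtain m3 p3 where p3: "p3 \<in> carrier X" "A3 = uball m3 p3" using A(3) ne(3) by (metis basic_sets_cases)
    obtain k1 where k1: "\<forall>N\<ge>k1. N \<ge> n \<longrightarrow> p1 \<in> bounded_part N" using bounded_part_exhaust[OF p1(1)] by blast
    obtain k2 where k2: "\<forall>N\<ge>k2. N \<ge> n \<longrightarrow> p2 \<in> bounded_part N" using bounded_part_exhaust[OF p2(1)] by blast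
    obtain k3 where k3: "\<forall>N\<ge>k3. N \<ge> n \<longrightarrow> p3 \<in> bounded_part N" using bounded_part_exhaust[OF p3(1)] by blast
    \<comment> \<open>A level that exceeds n and all three radii, and beyond which the three centres
      are bounded.\<close>
    define N where "N = n + m1 + m2 + m3 + k1 + k2 + k3"
    have N: "N \<ge> n" "m1 \<le> N" "m2 \<le> N" "m3 \<le> N" by (auto simp: N_def)
    have b: "p1 \<in> bounded_part N" "p2 \<in> bounded_part N" "p3 \<in> bounded_part N"
      using k1 k2 k3 by (auto simp: N_def)
    \<comment> \<open>Triples of representatives; the coefficient \<open>?c\<close> is 1 exactly for
      the triples inside the box.\<close>
    let ?I = "reps N \<times> (reps N \<times> reps N)"
    let ?e = "\<lambda>i. tensor_fun (ball_fun N (fst i)) (tensor_fun (ball_fun N (fst (snd i))) (ball_fun N (snd (snd i))))"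
    let ?c = "\<lambda>i. ?a A1 (fst i) * (?a A2 (fst (snd i)) * ?a A3 (snd (snd i)))"
    have rc: "fst i \<in> carrier X" "fst (snd i) \<in> carrier X" "snd (snd i) \<in> carrier X" if "i \<in> ?I" for i
      using that reps_carrier[OF N(1)] by auto
    show ?thesis unfolding f_eq
    proof (rule bounded_ops_agree_sum[OF S T, where I = ?I and e = ?e and c = ?c])
      show "?e i \<in> L2 (M \<Otimes>\<^sub>M MM)" if "i \<in> ?I" for i
        by (intro L2_tensor(1) sigma_finite_M sigma_finite_MM uball_L2 rc[OF that])
      show "AE z in M \<Otimes>\<^sub>M MM. ?S (?e i) z = ?T (?e i) z" if "i \<in> ?I" for i
        by (rule cocycle_uball[OF N(1) rc[OF that]])
      show "finite ?I" using finite_reps_X by blast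
      show "?f \<in> L2 (M \<Otimes>\<^sub>M MM)"
        by (intro L2_tensor(1) sigma_finite_M sigma_finite_MM generates_L2[OF generates_M] A)
      have "?f z = (\<Sum>i\<in>?I. ?c i * ?e i z)" if "z \<in> space (M \<Otimes>\<^sub>M MM)" for z
      proof -
        obtain x y w where z: "z = (x, y, w)" by (cases z) auto
        have c: "x \<in> carrier X" "y \<in> carrier X" "w \<in> carrier X"
          using that by (auto simp: z space_pair_measure space_M)
        have "?f z = ?a A1 x * (?a A2 y * ?a A3 w)" by (simp add: z)
        also have "\<dots> = (\<Sum>i\<in>?I. ?a A1 (fst i) * ?a (uball N (fst i)) x *
            (?a A2 (fst (snd i)) * ?a (uball N (fst (snd i))) y * (?a A3 (snd (snd i)) * ?a (uball N (snd (snd i))) w)))"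
          unfolding p1(2) p2(2) p3(2) indicator_uball_expand[OF N(2,1) b(1) c(1)]
            indicator_uball_expand[OF N(3,1) b(2) c(2)] indicator_uball_expand[OF N(4,1) b(3) c(3)] sum_product_Times ..
        also have "\<dots> = (\<Sum>i\<in>?I. ?c i * ?e i z)"
          by (rule sum.cong[OF refl]) (simp add: z mult_ac)
        finally show ?thesis .
      qed
      then show "AE z in M \<Otimes>\<^sub>M MM. ?f z = (\<Sum>i\<in>?I. ?c i * ?e i z)" by (rule AE_I2)
    qed
  qed
qed

end

theorem mainTheorem2:
  fixes v :: "'k::field \<Rightarrow> real" and \<pi> :: 'k
    and \<mu> :: "'k measure" and \<Psi> :: "'k \<Rightarrow> complex" and n :: nat
    and F :: "(('k \<times> 'k set) \<times> ('k \<times> 'k set)) op"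
    and \<Delta> :: "('k \<times> 'k set) op \<Rightarrow> (('k \<times> 'k set) \<times> ('k \<times> 'k set)) op"
    and id_\<Delta> :: "(('k \<times> 'k set) \<times> ('k \<times> 'k set)) op \<Rightarrow>
                  (('k \<times> 'k set) \<times> (('k \<times> 'k set) \<times> ('k \<times> 'k set))) op"
    and \<Delta>_id :: "(('k \<times> 'k set) \<times> ('k \<times> 'k set)) op \<Rightarrow>
                  ((('k \<times> 'k set) \<times> ('k \<times> 'k set)) \<times> ('k \<times> 'k set)) op"
  defines "X \<equiv> X_group v \<pi> n" and "M \<equiv> X_measure v \<pi> \<mu> n"
  defines "W \<equiv> group_vn X M"
  assumes field: "nonarch_local_field v \<pi>"
    and char: "CHAR('k) \<noteq> 2"
    and not_Q2: "\<not> extension_of_Q2 v"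
    and n: "n \<ge> 1"
    and haar: "haar_measure v \<mu>"
    and character: "unitary_character v \<Psi>"
    and trivial: "\<forall>x\<in>integers_of v. \<Psi> x = 1"
    and nontrivial: "\<exists>x\<in>frac_ideal v \<pi> (- 1). \<Psi> x \<noteq> 1"
    and F: "is_twist v \<pi> \<mu> \<Psi> n F"
    and coproduct: "is_coproduct X M \<Delta>"
    and id_\<Delta>: "is_hom_tensor M W M W id M W (M \<Otimes>\<^sub>M M) (vn_tensor M W M W) \<Delta> id_\<Delta>"
    and \<Delta>_id: "is_hom_tensor M W (M \<Otimes>\<^sub>M M) (vn_tensor M W M W) \<Delta> M W M W id \<Delta>_id"
  shows "op_eq (M \<Otimes>\<^sub>M (M \<Otimes>\<^sub>M M))
           (op_tensor M (M \<Otimes>\<^sub>M M) id F \<circ> id_\<Delta> F)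
           (op_assoc (op_tensor (M \<Otimes>\<^sub>M M) M F id \<circ> \<Delta>_id F))"
proof -
  interpret nonarch_local_field v \<pi> by (rule field)
  interpret cocycle_setting v \<pi> \<mu> n \<Psi> F \<Delta> id_\<Delta> \<Delta>_id
    using haar n character trivial nontrivial val_two[OF char not_Q2] F coproduct id_\<Delta> \<Delta>_id
    unfolding X_def M_def W_def by unfold_locales
  show ?thesis unfolding M_def by (rule cocycle)
qed

end
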